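(* Let $d\ge1$ and let $\Omega\subset\mathbb{R}^d$ be an open bounded set with Lipschitz continuous boundary. Let $\{s_n\}_{n\in\mathbb{N}}\subset(0,1)$ be such that $s_n\to1^-$ as $n\to+\infty$. (i) (Compactness) Let $\{u^n\}_{n\in\mathbb{N}}\subset L^2(\Omega)$ be such that $$\sup_{n\in\mathbb{N}}\Big((1-s_n)F^{s_n}(u^n)+\|u^n\|_{L^2(\Omega)}^2\Big)\le M$$ for some constant $M$ independent of $n$. Then, up to a subsequence, $u^n\to u$ strongly in $L^2(\Omega)$ for some $u\in H^1_0(\Omega)$. (ii) ($\Gamma$-liminf inequality) For every $u\in L^2(\Omega)$ and for every $\{u^n\}_{n\in\mathbb{N}}\subset L^2(\Omega)$ with $u^n\to u$ in $L^2(\Omega)$, it holds $$F^1(u)\le\liminf_{n\to+\infty}(1-s_n)F^{s_n}(u^n).$$ (iii) ($\Gamma$-limsup inequality) For every $u\in L^2(\Omega)$ there exists $\{u^n\}_{n\in\mathbb{N}}\subset L^2(\Omega)$ with $u^n\to u$ in $L^2(\Omega)$ such that $$F^1(u)=\lim_{n\to+\infty}(1-s_n)F^{s_n}(u^n).$$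
   Context: For measurable $u:\Omega\to\mathbb{R}$, $\tilde u$ denotes its extension by $0$ to $\mathbb{R}^d$. For $s\in(0,1)$ and $u\in L^2(\Omega)$, $$F^s(u):=\frac12\int_{\mathbb{R}^d}\int_{\mathbb{R}^d}\frac{|\tilde u(x)-\tilde u(y)|^2}{|x-y|^{d+2s}}\,dy\,dx\in[0,+\infty].$$ $F^1:L^2(\Omega)\to\mathbb{R}\cup\{+\infty\}$ is defined by $F^1(u):=\frac{\omega_d}{4}\int_\Omega|\nabla u(x)|^2\,dx$ if $u\in H^1_0(\Omega)$ and $F^1(u):=+\infty$ elsewhere in $L^2(\Omega)$, where $\omega_d$ is the Lebesgue measure of the unit ball of $\mathbb{R}^d$. *)

theory Defs
  imports "HOL-Analysis.Analysis"
begin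

text \<open>
  \<open>\<real>\<^sup>d\<close> is a Euclidean space \<open>'a\<close> with \<open>d = DIM('a) \<ge> 1\<close>. A function on \<open>\<Omega>\<close> is a total
  function whose values outside \<open>\<Omega>\<close> never matter, and elements of \<open>L\<^sup>2(\<Omega>)\<close> are represented by
  functions rather than by classes modulo a.e. equality.
\<close>

text \<open>
  Near each boundary point, \<open>\<Omega>\<close> is the set of points lying above the graph of a Lipschitz function
  \<open>\<gamma>\<close> over the hyperplane orthogonal to some unit vector \<open>e\<close> (the new vertical axis);
  \<open>x - (x \<bullet> e) *\<^sub>R e\<close> is the orthogonal projection of \<open>x\<close> onto that hyperplane. For \<open>d = 1\<close>
  the hyperplane is \<open>{0}\<close>.
\<close>
definition lipschitz_boundary :: "'a::euclidean_space set \<Rightarrow> bool" where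
  "lipschitz_boundary \<Omega> \<longleftrightarrow>
     (\<forall>p\<in>frontier \<Omega>. \<exists>e r L \<gamma>. norm e = 1 \<and> 0 < r \<and> L-lipschitz_on {y. y \<bullet> e = 0} \<gamma> \<and>
        \<Omega> \<inter> ball p r = {x \<in> ball p r. \<gamma> (x - (x \<bullet> e) *\<^sub>R e) < x \<bullet> e})"

definition L2 :: "'a::euclidean_space set \<Rightarrow> ('a \<Rightarrow> 'b::euclidean_space) set" where
  "L2 \<Omega> = {u. u \<in> borel_measurable (lebesgue_on \<Omega>) \<and>
              integrable (lebesgue_on \<Omega>) (\<lambda>x. (norm (u x))\<^sup>2)}"

definition L2_norm :: "'a::euclidean_space set \<Rightarrow> ('a \<Rightarrow> 'b::euclidean_space) \<Rightarrow> real" where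
  "L2_norm \<Omega> u = sqrt (\<integral>x. (norm (u x))\<^sup>2 \<partial>lebesgue_on \<Omega>)"

fun Ck :: "nat \<Rightarrow> ('a::euclidean_space \<Rightarrow> real) \<Rightarrow> bool" where
  "Ck 0 f \<longleftrightarrow> continuous_on UNIV f"
| "Ck (Suc k) f \<longleftrightarrow>
     (\<forall>x. f differentiable (at x)) \<and> (\<forall>v. Ck k (\<lambda>x. frechet_derivative f (at x) v))"

text \<open>\<open>C\<^sub>c\<^sup>\<infinity>(\<Omega>)\<close>, each function being extended by \<open>0\<close> to the whole space.\<close>
definition test_functions :: "'a::euclidean_space set \<Rightarrow> ('a \<Rightarrow> real) set" where
  "test_functions \<Omega> = {\<phi>. (\<forall>k. Ck k \<phi>) \<and>
     compact (closure {x. \<phi> x \<noteq> 0}) \<and> closure {x. \<phi> x \<noteq> 0} \<subseteq> \<Omega>}"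

definition has_weak_gradient ::
    "'a::euclidean_space set \<Rightarrow> ('a \<Rightarrow> real) \<Rightarrow> ('a \<Rightarrow> 'a) \<Rightarrow> bool" where
  "has_weak_gradient \<Omega> u G \<longleftrightarrow> G \<in> L2 \<Omega> \<and>
     (\<forall>\<phi>\<in>test_functions \<Omega>. \<forall>b\<in>Basis.
        (\<integral>x. u x * frechet_derivative \<phi> (at x) b \<partial>lebesgue_on \<Omega>)
          = - (\<integral>x. (G x \<bullet> b) * \<phi> x \<partial>lebesgue_on \<Omega>))"

definition H1 :: "'a::euclidean_space set \<Rightarrow> ('a \<Rightarrow> real) set" where
  "H1 \<Omega> = {u \<in> L2 \<Omega>. \<exists>G. has_weak_gradient \<Omega> u G}"

text \<open>
  Only meaningful for \<open>u \<in> H\<^sup>1(\<Omega>)\<close>; the weak gradient is then unique up to a.e. equality in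
  \<open>\<Omega>\<close> (\<open>\<Omega>\<close> open), so the choice does not affect integrals over \<open>\<Omega>\<close>.
\<close>
definition weak_gradient :: "'a::euclidean_space set \<Rightarrow> ('a \<Rightarrow> real) \<Rightarrow> 'a \<Rightarrow> 'a" where
  "weak_gradient \<Omega> u = (SOME G. has_weak_gradient \<Omega> u G)"

definition H1_norm :: "'a::euclidean_space set \<Rightarrow> ('a \<Rightarrow> real) \<Rightarrow> real" where
  "H1_norm \<Omega> u = sqrt ((L2_norm \<Omega> u)\<^sup>2 + (L2_norm \<Omega> (weak_gradient \<Omega> u))\<^sup>2)"

text \<open>\<open>H\<^sup>1\<^sub>0(\<Omega>)\<close>, the closure of \<open>C\<^sub>c\<^sup>\<infinity>(\<Omega>)\<close> in \<open>H\<^sup>1(\<Omega>)\<close>.\<close>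
definition H10 :: "'a::euclidean_space set \<Rightarrow> ('a \<Rightarrow> real) set" where
  "H10 \<Omega> = {u \<in> H1 \<Omega>. \<forall>\<epsilon>>0. \<exists>\<phi>\<in>test_functions \<Omega>. H1_norm \<Omega> (\<lambda>x. u x - \<phi> x) < \<epsilon>}"

definition zero_ext :: "'a::euclidean_space set \<Rightarrow> ('a \<Rightarrow> real) \<Rightarrow> 'a \<Rightarrow> real" where
  "zero_ext \<Omega> u x = (if x \<in> \<Omega> then u x else 0)"

text \<open>On the diagonal \<open>x = y\<close>, a null set, the quotient is \<open>0 / 0 = 0\<close>.\<close>
definition Fs :: "'a::euclidean_space set \<Rightarrow> real \<Rightarrow> ('a \<Rightarrow> real) \<Rightarrow> ennreal" where
  "Fs \<Omega> s u = ennreal (1/2) *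
     (\<integral>\<^sup>+ x. (\<integral>\<^sup>+ y. ennreal (\<bar>zero_ext \<Omega> u x - zero_ext \<Omega> u y\<bar>\<^sup>2 /
         norm (x - y) powr (real DIM('a) + 2 * s)) \<partial>lebesgue) \<partial>lebesgue)"

text \<open>The value lies in \<open>\<real> \<union> {+\<infinity>}\<close> and is nonnegative, hence the type \<^typ>\<open>ennreal\<close>.\<close>
definition F1 :: "'a::euclidean_space set \<Rightarrow> ('a \<Rightarrow> real) \<Rightarrow> ennreal" where
  "F1 \<Omega> u = (if u \<in> H10 \<Omega>
     then ennreal (measure lebesgue (ball (0::'a) 1) / 4 *
            (\<integral>x. (norm (weak_gradient \<Omega> u x))\<^sup>2 \<partial>lebesgue_on \<Omega>))
     else \<infinity>)"

end

theory Submission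
  imports Defs "HOL-Complex_Analysis.Great_Picard"
begin

text \<open>
  Extend every function by zero to \<open>\<real>\<^sup>d\<close> and let \<open>\<Phi>\<^sub>u(h) = \<parallel>u(\<cdot> + h) - u\<parallel>\<^sup>2\<close>, so that
  \<open>F\<^sup>s(u)\<close> is one half of the integral of \<open>\<Phi>\<^sub>u(h) |h|\<^bsup>-d-2s\<^esup>\<close>. Everything rests on the two elementary inequalities
  \<open>\<Phi>\<^sub>u(2h) \<le> 4 \<Phi>\<^sub>u(h)\<close> and \<open>\<Phi>\<^sub>u(h + k) \<le> 2 \<Phi>\<^sub>u(h) + 2 \<Phi>\<^sub>u(k)\<close>. By the first one, the integral
  \<open>I(r)\<close> of \<open>\<Phi>\<^sub>u(h) |h|\<^bsup>-d-2\<^esup>\<close> over the shell \<open>r/2 < |h| \<le> r\<close> grows when \<open>r\<close> is halved, and summing a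
  geometric series over dyadic shells gives \<open>(1-s) F\<^sup>s(u) \<ge> c(s,r) I(r)\<close> with \<open>c(s,r)\<close> converging to
  \<open>1 / (2 ln 4)\<close>. By the second one, \<open>\<Phi>\<^sub>u(h) \<le> C |h|\<^sup>2 I(|h|/2)\<close>. Hence bounded energy gives
  \<open>\<Phi>\<^sub>u(h) \<le> C |h|\<^bsup>2s\<^esup>\<close> uniformly, which yields strong compactness (Frechet-Kolmogorov) and, in the
  limit, \<open>\<Phi>\<^sub>u(h) \<le> C |h|\<^sup>2\<close>.

  On a Lipschitz domain the latter bound forces \<open>u\<close> into \<open>H\<^sup>1\<^sub>0\<close>: localise with Lipschitz cutoffs,
  translate inwards and mollify to obtain test functions with bounded gradients. For \<open>u\<close> in \<open>H\<^sup>1\<^sub>0\<close>,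
  \<open>4\<^sup>k \<Phi>\<^sub>u(h/2\<^sup>k)\<close> converges to the integral of \<open>(\<nabla>u \<bullet> h)\<^sup>2\<close>, and integrating this over the shell
  \<open>1/2 < |h| \<le> 1\<close> produces \<open>\<omega>\<^sub>d ln 2\<close> times the Dirichlet integral, which gives the sharp constant in
  the liminf inequality. Summing the same shells from above shows that constant sequences are
  recovery sequences.
\<close>

section \<open>Squared norms and translations\<close>

text \<open>With the weight |h|^(-d-2) a quadratic \<open>Phi\<close> contributes equally to every
  dyadic shell. The energy multiplies the shell of radius r/2^k by about (r/2^k)^(2(1-s)); this
  series of ratio 4^(-(1-s)) has a sum of order 1/((1-s) ln 4). That explains the normalising factor
  1-s and the constant ln 4. On the gradient side, the mean of (g . z)^2 over directions is |g|^2/d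
  and the sphere has area d omega_d, whence omega_d ln 2. The constants meet in (1/2) (1/ln 4)
  omega_d ln 2 = omega_d/4.

  The obstacle in the liminf inequality is that s_n and u^n move together while u^n converges only
  in L2. Monotonicity of I under halving removes it: the radius r is frozen, Fatou's lemma is
  applied on that one shell, and r tends to 0 only afterwards, for the limit function alone. Since u
  is merely in L2, its membership in H^1_0 has to come out of the same shell bound; there the
  geometry of the boundary enters.\<close>

lemma ennreal_numeral_mult_finite: "x < \<infinity> \<Longrightarrow> numeral w * x < (\<infinity> :: ennreal)"
  by (simp add: ennreal_mult_less_top)

lemma nn_integral_lborel_shift:
  fixes f :: "'a::euclidean_space \<Rightarrow> ennreal"
  assumes [measurable]: "f \<in> borel_measurable borel"
  shows "(\<integral>\<^sup>+x. f (x + h) \<partial>lborel) = (\<integral>\<^sup>+x. f x \<partial>lborel)"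
proof -
  have "(\<integral>\<^sup>+x. f x \<partial>lborel) = (\<integral>\<^sup>+x. f x \<partial>(distr lborel borel ((+) h)))"
    by (simp add: lborel_distr_plus)
  also have "\<dots> = (\<integral>\<^sup>+x. f (h + x) \<partial>lborel)"
    by (subst nn_integral_distr) auto
  finally show ?thesis by (simp add: add.commute)
qed

lemma nn_integral_lborel_scale:
  fixes f :: "'a::euclidean_space \<Rightarrow> ennreal"
  assumes [measurable]: "f \<in> borel_measurable borel" and c: "c \<noteq> 0"
  shows "(\<integral>\<^sup>+x. f x \<partial>lborel) = ennreal (\<bar>c\<bar> ^ DIM('a)) * (\<integral>\<^sup>+x. f (c *\<^sub>R x) \<partial>lborel)"
proof -
  have "(\<integral>\<^sup>+x. f x \<partial>lborel)
      = (\<integral>\<^sup>+x. f x \<partial>(density (distr lborel borel (\<lambda>x. 0 + c *\<^sub>R x)) (\<lambda>_. ennreal (\<bar>c\<bar> ^ DIM('a)))))"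
    using lborel_affine[OF c, of "0::'a"] by simp
  also have "\<dots> = (\<integral>\<^sup>+x. ennreal (\<bar>c\<bar> ^ DIM('a)) * f (c *\<^sub>R x) \<partial>lborel)"
    by (subst nn_integral_density) (auto simp: nn_integral_distr)
  also have "\<dots> = ennreal (\<bar>c\<bar> ^ DIM('a)) * (\<integral>\<^sup>+x. f (c *\<^sub>R x) \<partial>lborel)"
    by (rule nn_integral_cmult) auto
  finally show ?thesis .
qed

lemma nn_integral_lborel_uminus:
  fixes f :: "'a::euclidean_space \<Rightarrow> ennreal"
  assumes [measurable]: "f \<in> borel_measurable borel"
  shows "(\<integral>\<^sup>+x. f (- x) \<partial>lborel) = (\<integral>\<^sup>+x. f x \<partial>lborel)"
  using nn_integral_lborel_scale[OF assms, of "-1"] by simp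

text \<open>The squared L2 norm over the whole space, with values in \<open>ennreal\<close>:
  estimates can be chained first and finiteness checked afterwards.\<close>

definition nsq :: "('a::euclidean_space \<Rightarrow> 'b::real_normed_vector) \<Rightarrow> ennreal" where
  "nsq f = (\<integral>\<^sup>+x. ennreal ((norm (f x))\<^sup>2) \<partial>lborel)"

lemma nsq_zero [simp]: "nsq (\<lambda>x. 0) = 0"
  by (simp add: nsq_def)

lemma nsq_cong_AE: "AE x in lborel. norm (f x) = norm (g x) \<Longrightarrow> nsq f = nsq g"
  unfolding nsq_def by (rule nn_integral_cong_AE) auto

lemma nsq_mono_AE: "AE x in lborel. norm (f x) \<le> norm (g x) \<Longrightarrow> nsq f \<le> nsq g"
  unfolding nsq_def by (rule nn_integral_mono_AE) (auto intro!: ennreal_leI power_mono)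

lemma nsq_mono: "(\<And>x. norm (f x) \<le> norm (g x)) \<Longrightarrow> nsq f \<le> nsq g"
  by (rule nsq_mono_AE) auto

lemma nsq_minus: "nsq (\<lambda>x. f x - g x) = nsq (\<lambda>x. g x - f x)"
  by (rule nsq_cong_AE) (auto simp: norm_minus_commute)

lemma nsq_scaleR:
  fixes f :: "'a::euclidean_space \<Rightarrow> 'b::euclidean_space"
  assumes [measurable]: "f \<in> borel_measurable borel"
  shows "nsq (\<lambda>x. c *\<^sub>R f x) = ennreal (c\<^sup>2) * nsq f"
  unfolding nsq_def by (subst nn_integral_cmult[symmetric])
    (auto simp: power_mult_distrib ennreal_mult intro!: nn_integral_cong)

lemma nsq_shift:
  fixes f :: "'a::euclidean_space \<Rightarrow> 'b::euclidean_space"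
  assumes [measurable]: "f \<in> borel_measurable borel"
  shows "nsq (\<lambda>x. f (x + h)) = nsq f"
  unfolding nsq_def by (rule nn_integral_lborel_shift[of "\<lambda>x. ennreal ((norm (f x))\<^sup>2)"]) auto

text \<open>Young's inequality 2ab <= e a^2 + b^2/e for the cross term. The weight e stays free so
  that it can be optimised later.\<close>

lemma norm_sq_add_le_eps:
  fixes a b :: "'b::real_normed_vector"
  assumes e: "e > 0"
  shows "(norm (a + b))\<^sup>2 \<le> (1 + e) * (norm a)\<^sup>2 + (1 + 1/e) * (norm b)\<^sup>2"
proof -
  have "(norm (a + b))\<^sup>2 \<le> (norm a + norm b)\<^sup>2"
    by (intro power_mono norm_triangle_ineq) auto
  also have "\<dots> = (norm a)\<^sup>2 + (norm b)\<^sup>2 + 2 * norm a * norm b"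
    by (simp add: power2_eq_square algebra_simps)
  also have "2 * norm a * norm b \<le> e * (norm a)\<^sup>2 + (1/e) * (norm b)\<^sup>2"
  proof -
    have "0 \<le> (e * norm a - norm b)\<^sup>2 / e" using e by simp
    also have "\<dots> = e * (norm a)\<^sup>2 + (1/e) * (norm b)\<^sup>2 - 2 * norm a * norm b"
      using e by (simp add: power2_eq_square field_simps)
    finally show ?thesis by simp
  qed
  finally show ?thesis by (simp add: algebra_simps)
qed

lemma nsq_add_eps:
  fixes f g :: "'a::euclidean_space \<Rightarrow> 'b::euclidean_space"
  assumes [measurable]: "f \<in> borel_measurable borel" "g \<in> borel_measurable borel" and e: "e > 0"
  shows "nsq (\<lambda>x. f x + g x) \<le> ennreal (1 + e) * nsq f + ennreal (1 + 1/e) * nsq g"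
proof -
  have "nsq (\<lambda>x. f x + g x)
     \<le> (\<integral>\<^sup>+x. ennreal (1 + e) * ennreal ((norm (f x))\<^sup>2) + ennreal (1 + 1/e) * ennreal ((norm (g x))\<^sup>2) \<partial>lborel)"
    unfolding nsq_def
  proof (rule nn_integral_mono)
    fix x
    have "ennreal ((norm (f x + g x))\<^sup>2) \<le> ennreal ((1 + e) * (norm (f x))\<^sup>2 + (1 + 1/e) * (norm (g x))\<^sup>2)"
      by (rule ennreal_leI, rule norm_sq_add_le_eps[OF e])
    also have "\<dots> = ennreal (1 + e) * ennreal ((norm (f x))\<^sup>2) + ennreal (1 + 1/e) * ennreal ((norm (g x))\<^sup>2)"
      using e by (subst ennreal_plus) (auto simp: ennreal_mult)
    finally show "ennreal ((norm (f x + g x))\<^sup>2) \<le> \<dots>" .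
  qed
  also have "\<dots> = ennreal (1 + e) * nsq f + ennreal (1 + 1/e) * nsq g"
    unfolding nsq_def by (simp add: nn_integral_add nn_integral_cmult)
  finally show ?thesis .
qed

lemma nsq_add:
  fixes f g :: "'a::euclidean_space \<Rightarrow> 'b::euclidean_space"
  assumes "f \<in> borel_measurable borel" "g \<in> borel_measurable borel"
  shows "nsq (\<lambda>x. f x + g x) \<le> 2 * nsq f + 2 * nsq g"
  using nsq_add_eps[OF assms, of 1] by simp

lemma nsq_diff_triangle:
  fixes f g :: "'a::euclidean_space \<Rightarrow> 'b::euclidean_space"
  assumes [measurable]: "f \<in> borel_measurable borel" "g \<in> borel_measurable borel" "h \<in> borel_measurable borel"
  shows "nsq (\<lambda>x. f x - h x) \<le> 2 * nsq (\<lambda>x. f x - g x) + 2 * nsq (\<lambda>x. g x - h x)"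
  using nsq_add[of "\<lambda>x. f x - g x" "\<lambda>x. g x - h x"] by simp

lemma nsq_diff:
  fixes f g :: "'a::euclidean_space \<Rightarrow> 'b::euclidean_space"
  assumes [measurable]: "f \<in> borel_measurable borel" "g \<in> borel_measurable borel"
  shows "nsq (\<lambda>x. f x - g x) \<le> 2 * nsq f + 2 * nsq g"
  using nsq_diff_triangle[of f "\<lambda>x. 0" g] nsq_minus[of "\<lambda>x. 0" g] by simp

lemma nsq_parallelogram:
  fixes f g :: "'a::euclidean_space \<Rightarrow> 'b::euclidean_space"
  assumes [measurable]: "f \<in> borel_measurable borel" "g \<in> borel_measurable borel"
  shows "nsq (\<lambda>x. f x - g x) + nsq (\<lambda>x. f x + g x) = 2 * nsq f + 2 * nsq g"
proof -
  have eq: "(norm (a - b))\<^sup>2 + (norm (a + b))\<^sup>2 = 2 * (norm a)\<^sup>2 + 2 * (norm b)\<^sup>2" for a b :: 'b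
    by (simp add: power2_norm_eq_inner inner_add_left inner_add_right inner_diff_left inner_diff_right inner_commute)
  have "nsq (\<lambda>x. f x - g x) + nsq (\<lambda>x. f x + g x)
     = (\<integral>\<^sup>+x. ennreal ((norm (f x - g x))\<^sup>2) + ennreal ((norm (f x + g x))\<^sup>2) \<partial>lborel)"
    unfolding nsq_def by (subst nn_integral_add) auto
  also have "\<dots> = (\<integral>\<^sup>+x. 2 * ennreal ((norm (f x))\<^sup>2) + 2 * ennreal ((norm (g x))\<^sup>2) \<partial>lborel)"
  proof (rule nn_integral_cong)
    fix x
    have "ennreal ((norm (f x - g x))\<^sup>2) + ennreal ((norm (f x + g x))\<^sup>2)
      = ennreal (2 * (norm (f x))\<^sup>2 + 2 * (norm (g x))\<^sup>2)"
      by (subst ennreal_plus[symmetric]) (auto simp: eq)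
    also have "\<dots> = 2 * ennreal ((norm (f x))\<^sup>2) + 2 * ennreal ((norm (g x))\<^sup>2)"
      by (subst ennreal_plus) (auto simp: ennreal_mult)
    finally show "ennreal ((norm (f x - g x))\<^sup>2) + ennreal ((norm (f x + g x))\<^sup>2) = \<dots>" .
  qed
  also have "\<dots> = 2 * nsq f + 2 * nsq g"
    unfolding nsq_def by (simp add: nn_integral_add nn_integral_cmult)
  finally show ?thesis .
qed

text \<open>Minimising (1 + e) B + (1 + 1/e) D over e gives (sqrt B + sqrt D)^2 at e = sqrt D / sqrt
  B. That choice makes no sense when B or D vanishes, so it is made for slightly larger b and d, and
  the excess is sent to 0.\<close>

lemma sqrt_le_of_eps:
  fixes A B D :: real
  assumes nn: "0 \<le> A" "0 \<le> B" "0 \<le> D"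
    and le: "\<And>e. e > 0 \<Longrightarrow> A \<le> (1 + e) * B + (1 + 1/e) * D"
  shows "sqrt A \<le> sqrt B + sqrt D"
proof -
  have *: "A \<le> (b + d)\<^sup>2" if bd: "b > 0" "d > 0" "B \<le> b\<^sup>2" "D \<le> d\<^sup>2" for b d
  proof -
    have "A \<le> (1 + d/b) * B + (1 + b/d) * D" using le[of "d/b"] bd by simp
    also have "\<dots> \<le> (1 + d/b) * b\<^sup>2 + (1 + b/d) * d\<^sup>2"
      using bd by (intro add_mono mult_left_mono) auto
    also have "\<dots> = (b + d)\<^sup>2" using bd by (simp add: field_simps power2_eq_square)
    finally show ?thesis .
  qed
  show ?thesis
  proof (rule field_le_epsilon)
    fix e :: real assume e: "e > 0"
    have "A \<le> ((sqrt B + e/2) + (sqrt D + e/2))\<^sup>2"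
    proof (rule *)
      show "B \<le> (sqrt B + e/2)\<^sup>2" "D \<le> (sqrt D + e/2)\<^sup>2"
        using e nn by (simp_all add: power2_sum)
      show "0 < sqrt B + e/2" "0 < sqrt D + e/2" using e nn by (simp_all add: add_nonneg_pos)
    qed
    then have "sqrt A \<le> \<bar>(sqrt B + e/2) + (sqrt D + e/2)\<bar>"
      by (metis real_sqrt_abs real_sqrt_le_iff)
    then show "sqrt A \<le> sqrt B + sqrt D + e" using e nn by simp
  qed
qed

lemma nsq_minkowski:
  fixes f g :: "'a::euclidean_space \<Rightarrow> 'b::euclidean_space"
  assumes [measurable]: "f \<in> borel_measurable borel" "g \<in> borel_measurable borel"
    and fin: "nsq f < \<infinity>" "nsq g < \<infinity>"
  shows "sqrt (enn2real (nsq (\<lambda>x. f x + g x))) \<le> sqrt (enn2real (nsq f)) + sqrt (enn2real (nsq g))"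
proof (rule sqrt_le_of_eps)
  obtain a where a: "nsq f = ennreal a" "a \<ge> 0" using fin(1) by (cases "nsq f") auto
  obtain b where b: "nsq g = ennreal b" "b \<ge> 0" using fin(2) by (cases "nsq g") auto
  fix e :: real assume e: "e > 0"
  have "nsq (\<lambda>x. f x + g x) \<le> ennreal (1 + e) * ennreal a + ennreal (1 + 1/e) * ennreal b"
    using nsq_add_eps[OF assms(1,2) e] a b by simp
  also have "\<dots> = ennreal ((1 + e) * a + (1 + 1/e) * b)"
    using e a b by (simp add: ennreal_mult ennreal_plus)
  finally have "enn2real (nsq (\<lambda>x. f x + g x)) \<le> (1 + e) * a + (1 + 1/e) * b"
    using e a b by (intro enn2real_leI) auto
  then show "enn2real (nsq (\<lambda>x. f x + g x)) \<le> (1 + e) * enn2real (nsq f) + (1 + 1/e) * enn2real (nsq g)"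
    using a b by simp
qed auto

text \<open>The reverse triangle inequality for the real norms. It needs finite values, and
  \<open>nsq (f n)\<close> is known to be finite only once \<open>f n\<close> is close to
  \<open>g\<close>, hence the eventual statements.\<close>

lemma nsq_tendsto:
  fixes f :: "nat \<Rightarrow> 'a::euclidean_space \<Rightarrow> 'b::euclidean_space"
  assumes [measurable]: "\<And>n. f n \<in> borel_measurable borel" "g \<in> borel_measurable borel"
    and fin: "nsq g < \<infinity>" and lim: "(\<lambda>n. nsq (\<lambda>x. f n x - g x)) \<longlonglongrightarrow> 0"
  shows "(\<lambda>n. nsq (f n)) \<longlonglongrightarrow> nsq g"
proof -
  let ?N = "\<lambda>f. sqrt (enn2real (nsq f))"
  have ev: "eventually (\<lambda>n. nsq (\<lambda>x. f n x - g x) < 1) sequentially"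
    using order_tendstoD(2)[OF lim, of 1] by simp
  have d0: "(\<lambda>n. ?N (\<lambda>x. f n x - g x)) \<longlonglongrightarrow> 0"
    using tendsto_real_sqrt[OF tendsto_enn2real[of _ 0], of "\<lambda>n. nsq (\<lambda>x. f n x - g x)" sequentially] lim
    by simp
  have fin2: "nsq (f n) < \<infinity> \<and> \<bar>?N (f n) - ?N g\<bar> \<le> ?N (\<lambda>x. f n x - g x)"
    if "nsq (\<lambda>x. f n x - g x) < 1" for n
  proof -
    have d: "nsq (\<lambda>x. f n x - g x) < \<infinity>" using that less_trans ennreal_one_less_top by (metis infinity_ennreal_def)
    have "nsq (f n) \<le> 2 * nsq (\<lambda>x. f n x - g x) + 2 * nsq g"
      using nsq_add[of "\<lambda>x. f n x - g x" g] by simp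
    also have "\<dots> < \<infinity>" using ennreal_numeral_mult_finite[OF d] ennreal_numeral_mult_finite[OF fin] by auto
    finally have fn: "nsq (f n) < \<infinity>" .
    have 1: "?N (f n) \<le> ?N (\<lambda>x. f n x - g x) + ?N g"
      using nsq_minkowski[of "\<lambda>x. f n x - g x" g] d fin by simp
    have d': "nsq (\<lambda>x. g x - f n x) < \<infinity>" using d by (subst nsq_minus) auto
    have 2: "?N g \<le> ?N (\<lambda>x. g x - f n x) + ?N (f n)"
      using nsq_minkowski[of "\<lambda>x. g x - f n x" "f n"] d' fn by simp
    have "?N (\<lambda>x. g x - f n x) = ?N (\<lambda>x. f n x - g x)" by (subst nsq_minus) auto
    then show ?thesis using 1 2 fn by auto
  qed
  have "(\<lambda>n. ?N (f n)) \<longlonglongrightarrow> ?N g"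
  proof (rule LIM_zero_cancel, rule Lim_null_comparison[OF _ d0])
    show "eventually (\<lambda>n. norm (?N (f n) - ?N g) \<le> ?N (\<lambda>x. f n x - g x)) sequentially"
      using ev by eventually_elim (use fin2 in auto)
  qed
  then have "(\<lambda>n. (?N (f n))\<^sup>2) \<longlonglongrightarrow> (?N g)\<^sup>2" by (rule tendsto_power)
  then have "(\<lambda>n. ennreal (enn2real (nsq (f n)))) \<longlonglongrightarrow> ennreal (enn2real (nsq g))"
    by (intro tendsto_ennrealI) simp
  moreover have "eventually (\<lambda>n. ennreal (enn2real (nsq (f n))) = nsq (f n)) sequentially"
    using ev by eventually_elim (use fin2 in auto)
  ultimately show ?thesis using fin
    by (simp add: tendsto_cong)
qed

text \<open>Riesz-Fischer: a fast subsequence converges almost everywhere, and Fatou's lemma turns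
  its pointwise limit into the L2 limit of the whole sequence.\<close>

lemma nsq_complete:
  fixes f :: "nat \<Rightarrow> 'a::euclidean_space \<Rightarrow> 'b::euclidean_space"
  assumes [measurable]: "\<And>n. f n \<in> borel_measurable borel"
    and cauchy: "\<And>e. e > 0 \<Longrightarrow> \<exists>N. \<forall>m\<ge>N. \<forall>n\<ge>N. nsq (\<lambda>x. f m x - f n x) \<le> ennreal e"
  shows "\<exists>g. g \<in> borel_measurable borel \<and> (\<lambda>n. nsq (\<lambda>x. f n x - g x)) \<longlonglongrightarrow> 0"
proof -
  obtain N where N: "\<And>k m n. m \<ge> N k \<Longrightarrow> n \<ge> N k \<Longrightarrow> nsq (\<lambda>x. f m x - f n x) \<le> ennreal ((1/4)^k)"
    using cauchy[of "(1/4)^k" for k] by (metis zero_less_divide_1_iff zero_less_numeral zero_less_power)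
  define r where "r k = (\<Sum>i\<le>k. N i) + k" for k
  have r_mono: "strict_mono r" unfolding strict_mono_Suc_iff r_def by auto
  have rN: "r k \<ge> N k" for k
  proof -
    have "N k \<le> (\<Sum>i\<le>k. N i)" by (rule member_le_sum) auto
    then show ?thesis unfolding r_def by simp
  qed
  \<comment> \<open>The squared increments integrate to at most 4^(-k). The weight 2^k keeps the sum
    integrable and still forces the increments, wherever \<open>S\<close> is finite, below a
    geometric sequence of ratio sqrt (1/2).\<close>
  define S where "S x = (\<Sum>k. ennreal (2^k) * ennreal ((norm (f (r (Suc k)) x - f (r k) x))\<^sup>2))" for x
  have [measurable]: "S \<in> borel_measurable borel" unfolding S_def by measurable
  have "(\<integral>\<^sup>+x. S x \<partial>lborel) = (\<Sum>k. ennreal (2^k) * nsq (\<lambda>x. f (r (Suc k)) x - f (r k) x))"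
    unfolding S_def nsq_def by (subst nn_integral_suminf) (auto simp: nn_integral_cmult)
  also have "\<dots> \<le> (\<Sum>k. ennreal ((1/2)^k))"
  proof (rule suminf_le)
    fix k
    have "r k \<le> r (Suc k)" using r_mono by (simp add: strict_mono_less_eq)
    then have "nsq (\<lambda>x. f (r (Suc k)) x - f (r k) x) \<le> ennreal ((1/4)^k)"
      using rN[of k] by (intro N) auto
    then have "ennreal (2^k) * nsq (\<lambda>x. f (r (Suc k)) x - f (r k) x) \<le> ennreal (2^k) * ennreal ((1/4)^k)"
      by (intro mult_left_mono) auto
    also have "\<dots> = ennreal ((1/2)^k)"
      by (subst ennreal_mult[symmetric]) (auto simp: power_mult_distrib[symmetric])
    finally show "ennreal (2^k) * nsq (\<lambda>x. f (r (Suc k)) x - f (r k) x) \<le> ennreal ((1/2)^k)" .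
  qed auto
  also have "\<dots> = ennreal (\<Sum>k. (1/2)^k)"
    by (rule suminf_ennreal2) (auto simp: summable_geometric)
  also have "\<dots> < \<infinity>" by simp
  finally have "AE x in lborel. S x \<noteq> \<infinity>"
    by (intro nn_integral_noteq_infinite) auto
  then have conv: "AE x in lborel. convergent (\<lambda>k. f (r k) x)"
  proof eventually_elim
    fix x assume Sx: "S x \<noteq> \<infinity>"
    then obtain C where C: "S x = ennreal C" "C \<ge> 0" by (cases "S x") auto
    have bd: "norm (f (r (Suc k)) x - f (r k) x) \<le> sqrt C * (sqrt (1/2))^k" for k
    proof -
      have "ennreal (2^k * (norm (f (r (Suc k)) x - f (r k) x))\<^sup>2) \<le> S x"
      proof -
        have "sum (\<lambda>k. ennreal (2^k) * ennreal ((norm (f (r (Suc k)) x - f (r k) x))\<^sup>2)) {k} \<le> S x"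
          unfolding S_def by (rule sum_le_suminf) auto
        then show ?thesis by (simp add: ennreal_mult)
      qed
      then have "2^k * (norm (f (r (Suc k)) x - f (r k) x))\<^sup>2 \<le> C"
        using C by (simp add: ennreal_le_iff)
      then have "(norm (f (r (Suc k)) x - f (r k) x))\<^sup>2 \<le> C * (1/2)^k"
        by (simp add: field_simps)
      then have "sqrt ((norm (f (r (Suc k)) x - f (r k) x))\<^sup>2) \<le> sqrt (C * (1/2)^k)"
        by (rule real_sqrt_le_mono)
      then show ?thesis by (simp add: real_sqrt_mult real_sqrt_power)
    qed
    have "summable (\<lambda>k. f (r (Suc k)) x - f (r k) x)"
    proof (rule summable_comparison_test')
      show "summable (\<lambda>k. sqrt C * (sqrt (1/2))^k)"
        by (intro summable_mult summable_geometric) (simp add: real_sqrt_divide)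
    qed (use bd in auto)
    then have "convergent (\<lambda>n. \<Sum>k<n. f (r (Suc k)) x - f (r k) x)"
      by (simp add: summable_iff_convergent)
    then have "convergent (\<lambda>n. f (r n) x - f (r 0) x)"
      by (simp add: sum_lessThan_telescope[of "\<lambda>k. f (r k) x"])
    then have "convergent (\<lambda>n. (f (r n) x - f (r 0) x) + f (r 0) x)"
      by (intro convergent_add convergent_const)
    then show "convergent (\<lambda>k. f (r k) x)" by simp
  qed
  define g where "g x = lim (\<lambda>k. f (r k) x)" for x
  have [measurable]: "g \<in> borel_measurable borel"
    unfolding g_def by (rule borel_measurable_lim_metric) auto
  have lim: "AE x in lborel. (\<lambda>k. f (r k) x) \<longlonglongrightarrow> g x"
    using conv by eventually_elim (auto simp: g_def convergent_LIMSEQ_iff)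
  have "(\<lambda>n. nsq (\<lambda>x. f n x - g x)) \<longlonglongrightarrow> 0"
  proof (rule tendsto_zero_ennreal)
    fix e :: real assume e: "e > 0"
    obtain M where M: "\<And>m n. m \<ge> M \<Longrightarrow> n \<ge> M \<Longrightarrow> nsq (\<lambda>x. f m x - f n x) \<le> ennreal (e/2)"
      using cauchy[of "e/2"] e by auto
    show "\<forall>\<^sub>F n in sequentially. nsq (\<lambda>x. f n x - g x) < ennreal e"
      unfolding eventually_sequentially
    proof (intro exI[of _ M] allI impI)
      fix n assume n: "n \<ge> M"
      have "nsq (\<lambda>x. f n x - g x) = (\<integral>\<^sup>+x. liminf (\<lambda>k. ennreal ((norm (f n x - f (r k) x))\<^sup>2)) \<partial>lborel)"
        unfolding nsq_def
      proof (rule nn_integral_cong_AE)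
        show "AE x in lborel. ennreal ((norm (f n x - g x))\<^sup>2) = liminf (\<lambda>k. ennreal ((norm (f n x - f (r k) x))\<^sup>2))"
          using lim
        proof eventually_elim
          fix x assume "(\<lambda>k. f (r k) x) \<longlonglongrightarrow> g x"
          then have "(\<lambda>k. ennreal ((norm (f n x - f (r k) x))\<^sup>2)) \<longlonglongrightarrow> ennreal ((norm (f n x - g x))\<^sup>2)"
            by (intro tendsto_ennrealI tendsto_intros)
          then show "ennreal ((norm (f n x - g x))\<^sup>2) = liminf (\<lambda>k. ennreal ((norm (f n x - f (r k) x))\<^sup>2))"
            by (metis lim_imp_Liminf sequentially_bot)
        qed
      qed
      also have "\<dots> \<le> liminf (\<lambda>k. nsq (\<lambda>x. f n x - f (r k) x))"
        unfolding nsq_def by (rule nn_integral_liminf) auto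
      also have "\<dots> \<le> ennreal (e/2)"
      proof (rule Liminf_le)
        show "\<forall>\<^sub>F k in sequentially. nsq (\<lambda>x. f n x - f (r k) x) \<le> ennreal (e/2)"
          unfolding eventually_sequentially
        proof (intro exI[of _ M] allI impI M n)
          fix k assume "M \<le> k"
          then show "M \<le> r k" using seq_suble[OF r_mono, of k] by simp
        qed
      qed simp
      also have "\<dots> < ennreal e" using e by (simp add: ennreal_less_iff)
      finally show "nsq (\<lambda>x. f n x - g x) < ennreal e" .
    qed
  qed
  then show ?thesis by (intro exI[of _ g]) auto
qed

lemma nsq_limit_finite:
  fixes f :: "nat \<Rightarrow> 'a::euclidean_space \<Rightarrow> 'b::euclidean_space"
  assumes [measurable]: "\<And>n. f n \<in> borel_measurable borel" "g \<in> borel_measurable borel"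
    and "\<And>n. nsq (f n) < \<infinity>" and lim: "(\<lambda>n. nsq (\<lambda>x. f n x - g x)) \<longlonglongrightarrow> 0"
  shows "nsq g < \<infinity>"
proof -
  have "eventually (\<lambda>n. nsq (\<lambda>x. f n x - g x) < 1) sequentially"
    using order_tendstoD(2)[OF lim, of 1] by simp
  then obtain n where n: "nsq (\<lambda>x. f n x - g x) < 1" by (auto simp: eventually_sequentially)
  have "nsq g = nsq (\<lambda>x. f n x - (f n x - g x))" by simp
  also have "\<dots> \<le> 2 * nsq (f n) + 2 * nsq (\<lambda>x. f n x - g x)" by (rule nsq_diff) auto
  also have "\<dots> < \<infinity>"
  proof -
    have "nsq (\<lambda>x. f n x - g x) < \<infinity>" using n by (rule less_trans) simp
    then show ?thesis using assms(3)[of n] ennreal_numeral_mult_finite by auto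
  qed
  finally show ?thesis .
qed

section \<open>Squared L2 moduli of translation\<close>

definition Phi :: "('a::euclidean_space \<Rightarrow> 'b::real_normed_vector) \<Rightarrow> 'a \<Rightarrow> ennreal" where
  "Phi f h = nsq (\<lambda>x. f (x + h) - f x)"

lemma measurable_Phi [measurable]:
  fixes f :: "'a::euclidean_space \<Rightarrow> 'b::euclidean_space"
  assumes [measurable]: "f \<in> borel_measurable borel"
  shows "Phi f \<in> borel_measurable borel"
  unfolding Phi_def nsq_def by measurable

lemma Phi_add:
  fixes f :: "'a::euclidean_space \<Rightarrow> 'b::euclidean_space"
  assumes [measurable]: "f \<in> borel_measurable borel"
  shows "Phi f (h + k) \<le> 2 * Phi f h + 2 * Phi f k"
proof -
  have "Phi f (h + k) = nsq (\<lambda>x. (f (x + (h + k)) - f (x + k)) + (f (x + k) - f x))"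
    by (simp add: Phi_def)
  also have "\<dots> \<le> 2 * nsq (\<lambda>x. f (x + (h + k)) - f (x + k)) + 2 * nsq (\<lambda>x. f (x + k) - f x)"
    by (rule nsq_add) auto
  also have "nsq (\<lambda>x. f (x + (h + k)) - f (x + k)) = nsq (\<lambda>x. (\<lambda>y. f (y + h) - f y) (x + k))"
    by (simp add: algebra_simps)
  also have "\<dots> = Phi f h" unfolding Phi_def by (rule nsq_shift) auto
  finally show ?thesis by (simp add: Phi_def)
qed

lemma Phi_double:
  fixes f :: "'a::euclidean_space \<Rightarrow> 'b::euclidean_space"
  assumes "f \<in> borel_measurable borel"
  shows "Phi f (2 *\<^sub>R h) \<le> 4 * Phi f h"
proof -
  have "2 * Phi f h + 2 * Phi f h = 4 * Phi f h"
    by (metis distrib_right numeral_Bit0)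
  then show ?thesis using Phi_add[OF assms, of h h] by (simp add: scaleR_2)
qed

text \<open>Doubling, iterated. As 4^k times \<open>Phi\<close> at h/2^k is the squared norm of a
  difference quotient, a directional derivative will bound \<open>Phi\<close> itself with constant
  1.\<close>

lemma Phi_dyadic:
  fixes f :: "'a::euclidean_space \<Rightarrow> 'b::euclidean_space"
  assumes "f \<in> borel_measurable borel"
  shows "Phi f h \<le> 4^k * Phi f ((1/2)^k *\<^sub>R h)"
proof (induction k)
  case (Suc k)
  have "Phi f ((1/2)^k *\<^sub>R h) \<le> 4 * Phi f ((1/2)^Suc k *\<^sub>R h)"
    using Phi_double[OF assms, of "(1/2)^Suc k *\<^sub>R h"] by simp
  then have "4^k * Phi f ((1/2)^k *\<^sub>R h) \<le> 4^k * (4 * Phi f ((1/2)^Suc k *\<^sub>R h))"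
    by (rule mult_left_mono) simp
  with Suc show ?case by (simp add: mult.assoc mult.left_commute)
qed simp

lemma Phi_le_nsq:
  fixes f :: "'a::euclidean_space \<Rightarrow> 'b::euclidean_space"
  assumes [measurable]: "f \<in> borel_measurable borel"
  shows "Phi f h \<le> 4 * nsq f"
proof -
  have "2 * nsq f + 2 * nsq f = 4 * nsq f" by (metis distrib_right numeral_Bit0)
  then show ?thesis
    using nsq_diff[of "\<lambda>x. f (x + h)" f] by (simp add: Phi_def nsq_shift)
qed

lemma Phi_diff_le:
  fixes f g :: "'a::euclidean_space \<Rightarrow> 'b::euclidean_space"
  assumes [measurable]: "f \<in> borel_measurable borel" "g \<in> borel_measurable borel"
  shows "nsq (\<lambda>x. (f (x + h) - f x) - (g (x + h) - g x)) \<le> 4 * nsq (\<lambda>x. f x - g x)"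
  using Phi_le_nsq[of "\<lambda>x. f x - g x" h] by (simp add: Phi_def algebra_simps)

text \<open>This limit at each single h is what Fatou's lemma is applied to on a shell, and it
  carries translation bounds over to the limit function.\<close>

lemma Phi_tendsto:
  fixes f :: "nat \<Rightarrow> 'a::euclidean_space \<Rightarrow> 'b::euclidean_space"
  assumes [measurable]: "\<And>n. f n \<in> borel_measurable borel" "g \<in> borel_measurable borel"
    and fin: "nsq g < \<infinity>" and lim: "(\<lambda>n. nsq (\<lambda>x. f n x - g x)) \<longlonglongrightarrow> 0"
  shows "(\<lambda>n. Phi (f n) h) \<longlonglongrightarrow> Phi g h"
  unfolding Phi_def
proof (rule nsq_tendsto)
  have "Phi g h < \<infinity>"
    by (rule le_less_trans[OF Phi_le_nsq ennreal_numeral_mult_finite[OF fin]]) auto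
  then show "nsq (\<lambda>x. g (x + h) - g x) < \<infinity>" by (simp add: Phi_def)
  have "(\<lambda>n. 4 * nsq (\<lambda>x. f n x - g x)) \<longlonglongrightarrow> 4 * 0"
    by (rule ennreal_tendsto_cmult[OF _ lim]) simp
  then have l4: "(\<lambda>n. 4 * nsq (\<lambda>x. f n x - g x)) \<longlonglongrightarrow> 0" by simp
  show "(\<lambda>n. nsq (\<lambda>x. f n (x + h) - f n x - (g (x + h) - g x))) \<longlonglongrightarrow> 0"
  proof (rule tendsto_sandwich[OF _ _ tendsto_const l4])
    show "\<forall>\<^sub>F n in sequentially. nsq (\<lambda>x. f n (x + h) - f n x - (g (x + h) - g x)) \<le> 4 * nsq (\<lambda>x. f n x - g x)"
      by (rule always_eventually, rule allI, rule Phi_diff_le[of "f n" g h for n]) auto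
  qed simp
qed auto

section \<open>Dyadic shells and radial integrals\<close>

lemma power_mult_powr: "x > 0 \<Longrightarrow> x ^ n * x powr q = x powr (real n + q)"
  for x :: real
  by (simp add: powr_add powr_realpow)

text \<open>Polar coordinates for radial integrands. A measure on the line is determined by
  half-lines; the norm pulls {..a} back to a ball of volume omega_d a^d, and differentiating in a
  gives the density.\<close>

lemma nn_integral_norm:
  fixes g :: "real \<Rightarrow> ennreal"
  assumes [measurable]: "g \<in> borel_measurable borel"
  shows "(\<integral>\<^sup>+x. g (norm (x::'a::euclidean_space)) \<partial>lborel)
    = (\<integral>\<^sup>+t. ennreal (DIM('a) * unit_ball_vol DIM('a) * t ^ (DIM('a) - 1)) * indicator {0..} t * g t \<partial>lborel)"
proof -
  let ?w = "\<lambda>t. ennreal (DIM('a) * unit_ball_vol DIM('a) * t ^ (DIM('a) - 1)) * indicator {0..} t"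
  have "distr lborel borel (norm :: 'a \<Rightarrow> real) = density lborel ?w"
  proof (rule measure_eqI_generator_eq[where E = "range atMost" and \<Omega> = UNIV and A = "\<lambda>i. {..real i}"])
    show "Int_stable (range atMost :: real set set)"
      by (auto simp: Int_stable_def)
    show "sets (distr lborel borel (norm :: 'a \<Rightarrow> real)) = sigma_sets UNIV (range atMost)"
      "sets (density lborel ?w) = sigma_sets UNIV (range atMost)"
      by (simp_all add: borel_eq_atMost)
    show "(\<Union>i. {..real i}) = UNIV" by (auto simp: real_arch_simple)
    have cb: "norm -` {..a} = cball (0::'a) a" for a by auto
    have em: "emeasure (distr lborel borel (norm :: 'a \<Rightarrow> real)) {..a} = emeasure lborel (cball (0::'a) a)" for a
      by (subst emeasure_distr) (auto simp: cb)
    show "emeasure (distr lborel borel (norm :: 'a \<Rightarrow> real)) {..real i} \<noteq> \<infinity>" for i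
      unfolding em by (simp add: emeasure_cball)
    fix X :: "real set" assume "X \<in> range atMost"
    then obtain a where X: "X = {..a}" by auto
    show "emeasure (distr lborel borel (norm :: 'a \<Rightarrow> real)) X = emeasure (density lborel ?w) X"
    proof (cases "a \<ge> 0")
      case False
      have "emeasure (density lborel ?w) X = (\<integral>\<^sup>+t. ?w t * indicator {..a} t \<partial>lborel)"
        unfolding X by (rule emeasure_density) auto
      also have "\<dots> = (\<integral>\<^sup>+t. 0 \<partial>(lborel :: real measure))"
        using False by (intro nn_integral_cong) (auto simp: indicator_def)
      finally show ?thesis using False unfolding X em by simp
    next
      case True
      have "emeasure (density lborel ?w) X = (\<integral>\<^sup>+t. ?w t * indicator {..a} t \<partial>lborel)"
        unfolding X by (rule emeasure_density) auto
      also have "\<dots> = (\<integral>\<^sup>+t. ennreal (DIM('a) * unit_ball_vol DIM('a) * t ^ (DIM('a) - 1)) * indicator {0..a} t \<partial>lborel)"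
        by (intro nn_integral_cong) (auto simp: indicator_def)
      also have "\<dots> = ennreal (unit_ball_vol DIM('a) * a ^ DIM('a) - unit_ball_vol DIM('a) * 0 ^ DIM('a))"
        by (rule nn_integral_FTC_Icc) (use True in \<open>auto intro!: derivative_eq_intros\<close>)
      finally show ?thesis using True unfolding X em by (simp add: emeasure_cball)
    qed
  qed auto
  then have "(\<integral>\<^sup>+t. g t \<partial>(distr lborel borel (norm :: 'a \<Rightarrow> real))) = (\<integral>\<^sup>+t. g t \<partial>(density lborel ?w))"
    by simp
  then show ?thesis
    by (simp add: nn_integral_distr nn_integral_density)
qed

text \<open>Half-open, so that the shells of outer radii r/2^k partition the punctured ball of
  radius r.\<close>

definition shell :: "real \<Rightarrow> 'a::euclidean_space set" where
  "shell r = {h. r / 2 < norm h \<and> norm h \<le> r}"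

lemma measurable_shell [measurable]: "shell r \<in> sets borel"
  unfolding shell_def by measurable

text \<open>Polar coordinates cancel all powers but 1/t, whose integral from 1/2 to 1 is ln
  2.\<close>

lemma shell_radial_integral:
  "(\<integral>\<^sup>+z. indicator (shell 1) z * ennreal (norm (z::'a::euclidean_space) powr - real DIM('a)) \<partial>lborel)
    = ennreal (DIM('a) * unit_ball_vol DIM('a) * ln 2)"
proof -
  let ?w = "DIM('a) * unit_ball_vol DIM('a)"
  have "(\<integral>\<^sup>+z. indicator (shell 1) z * ennreal (norm (z::'a) powr - real DIM('a)) \<partial>lborel)
    = (\<integral>\<^sup>+z. (indicator {1/2<..1} (norm (z::'a)) * ennreal (norm z powr - real DIM('a))) \<partial>lborel)"
    by (intro nn_integral_cong) (auto simp: shell_def indicator_def)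
  also have "\<dots> = (\<integral>\<^sup>+t. ennreal (?w * t ^ (DIM('a) - 1)) * indicator {0..} t *
      (indicator {1/2<..1} t * ennreal (t powr - real DIM('a))) \<partial>lborel)"
    by (rule nn_integral_norm) auto
  also have "\<dots> = (\<integral>\<^sup>+t. ennreal (?w * inverse t) * indicator {1/2..1} t \<partial>lborel)"
  proof (rule nn_integral_cong_AE)
    have "AE t in lborel. t \<noteq> (1/2::real)" by (rule AE_lborel_singleton)
    then show "AE t in lborel. ennreal (?w * t ^ (DIM('a) - 1)) * indicator {0..} t *
      (indicator {1/2<..1} t * ennreal (t powr - real DIM('a))) = ennreal (?w * inverse t) * indicator {1/2..1} t"
    proof eventually_elim
      fix t :: real assume t: "t \<noteq> 1/2"
      have "t ^ (DIM('a) - 1) * t powr - real DIM('a) = inverse t" if "t > 0"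
      proof -
        have "t ^ (DIM('a) - 1) = t powr (real DIM('a) - 1)"
          using that by (subst powr_realpow[symmetric]) (auto simp: of_nat_diff)
        then have "t ^ (DIM('a) - 1) * t powr - real DIM('a) = t powr (-1)"
          by (simp add: powr_add[symmetric])
        also have "\<dots> = inverse t" using that by (simp add: powr_minus)
        finally show ?thesis .
      qed
      then show "ennreal (?w * t ^ (DIM('a) - 1)) * indicator {0..} t *
      (indicator {1/2<..1} t * ennreal (t powr - real DIM('a))) = ennreal (?w * inverse t) * indicator {1/2..1} t"
        using t by (auto simp: indicator_def ennreal_mult[symmetric] mult.assoc)
    qed
  qed
  also have "\<dots> = ennreal (?w * ln 1 - ?w * ln (1/2))"
    by (rule nn_integral_FTC_Icc) (auto intro!: derivative_eq_intros simp: field_simps)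
  also have "?w * ln 1 - ?w * ln (1/2) = ?w * ln 2" by (simp add: ln_div)
  finally show ?thesis .
qed

text \<open>For s >= 1/2 the kernel |z|^(-d-2s) lies below this one outside the unit ball, so a
  single constant bounds the far part of the energy as s tends to 1.\<close>

lemma tail_radial_integral:
  "(\<integral>\<^sup>+z. indicator {z. norm z > 1} z * ennreal (norm (z::'a::euclidean_space) powr - (real DIM('a) + 1)) \<partial>lborel) < \<infinity>"
proof -
  let ?w = "DIM('a) * unit_ball_vol DIM('a)"
  have "(\<integral>\<^sup>+z. indicator {z. norm z > 1} z * ennreal (norm (z::'a) powr - (real DIM('a) + 1)) \<partial>lborel)
    = (\<integral>\<^sup>+z. (indicator {1<..} (norm (z::'a)) * ennreal (norm z powr - (real DIM('a) + 1))) \<partial>lborel)"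
    by (intro nn_integral_cong) (auto simp: indicator_def)
  also have "\<dots> = (\<integral>\<^sup>+t. ennreal (?w * t ^ (DIM('a) - 1)) * indicator {0..} t *
      (indicator {1<..} t * ennreal (t powr - (real DIM('a) + 1))) \<partial>lborel)"
    by (rule nn_integral_norm) auto
  also have "\<dots> \<le> (\<integral>\<^sup>+t. ennreal (?w * inverse (t\<^sup>2)) * indicator {1..} t \<partial>lborel)"
  proof (rule nn_integral_mono)
    fix t :: real
    have "t ^ (DIM('a) - 1) * t powr - (real DIM('a) + 1) = inverse (t\<^sup>2)" if "t > 0"
    proof -
      have "t ^ (DIM('a) - 1) = t powr (real DIM('a) - 1)"
        using that by (subst powr_realpow[symmetric]) (auto simp: of_nat_diff)
      then have "t ^ (DIM('a) - 1) * t powr - (real DIM('a) + 1) = t powr (-2)"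
        by (simp add: powr_add[symmetric])
      also have "\<dots> = inverse (t\<^sup>2)" using that by (simp add: powr_minus)
      finally show ?thesis .
    qed
    then show "ennreal (?w * t ^ (DIM('a) - 1)) * indicator {0..} t *
      (indicator {1<..} t * ennreal (t powr - (real DIM('a) + 1))) \<le> ennreal (?w * inverse (t\<^sup>2)) * indicator {1..} t"
      by (auto simp: indicator_def ennreal_mult[symmetric] mult.assoc)
  qed
  also have "\<dots> = ennreal (0 - (- ?w * inverse 1))"
  proof (rule nn_integral_FTC_atLeast)
    show "((\<lambda>t. - ?w * inverse t) \<longlongrightarrow> 0) at_top"
      by (rule tendsto_mult_right_zero) (rule tendsto_inverse_0_at_top, rule filterlim_ident)
    fix t :: real assume "1 \<le> t"
    then show "DERIV (\<lambda>t. - ?w * inverse t) t :> ?w * inverse (t\<^sup>2)"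
      by (auto intro!: derivative_eq_intros simp: power2_eq_square)
  qed auto
  finally show ?thesis by (simp add: le_less_trans)
qed

section \<open>Coordinate symmetries of Lebesgue measure and second moments of a shell\<close>

lemma lborel_reflect:
  fixes b :: "'a::euclidean_space"
  assumes b: "b \<in> Basis"
  shows "distr lborel borel (\<lambda>x::'a. x - (2 * (x \<bullet> b)) *\<^sub>R b) = lborel"
proof -
  let ?c = "\<lambda>j::'a. if j = b then -1 else 1 :: real"
  have T: "(0::'a) + (\<Sum>j\<in>Basis. (?c j * (x \<bullet> j)) *\<^sub>R j) = x - (2 * (x \<bullet> b)) *\<^sub>R b" for x :: 'a
  proof (rule euclidean_eqI)
    fix i :: 'a assume i: "i \<in> Basis"
    have "((0::'a) + (\<Sum>j\<in>Basis. (?c j * (x \<bullet> j)) *\<^sub>R j)) \<bullet> i = ?c i * (x \<bullet> i)"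
      using i by (simp add: inner_sum_left inner_Basis if_distrib sum.delta cong: if_cong)
    also have "\<dots> = (x - (2 * (x \<bullet> b)) *\<^sub>R b) \<bullet> i"
      using i b by (auto simp: inner_diff_left inner_Basis)
    finally show "((0::'a) + (\<Sum>j\<in>Basis. (?c j * (x \<bullet> j)) *\<^sub>R j)) \<bullet> i = (x - (2 * (x \<bullet> b)) *\<^sub>R b) \<bullet> i" .
  qed
  have p: "(\<Prod>j\<in>Basis. \<bar>?c j\<bar>) = 1" by (intro prod.neutral) auto
  have "lborel = density (distr lborel borel (\<lambda>x. (0::'a) + (\<Sum>j\<in>Basis. (?c j * (x \<bullet> j)) *\<^sub>R j))) (\<lambda>_. ennreal (\<Prod>j\<in>Basis. \<bar>?c j\<bar>))"
    by (rule lborel_affine_euclidean) auto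
  then show ?thesis unfolding T p by (simp add: density_1)
qed

lemma lborel_swap:
  fixes b c :: "'a::euclidean_space"
  assumes b: "b \<in> Basis" and c: "c \<in> Basis"
  defines "T \<equiv> \<lambda>x::'a. (\<Sum>j\<in>Basis. (x \<bullet> (Transposition.transpose b c j)) *\<^sub>R j)"
  shows "distr lborel borel T = lborel"
proof (rule lborel_eqI[symmetric])
  let ?s = "Transposition.transpose b c"
  have bij: "bij_betw ?s Basis Basis"
    using b c by (intro bij_betwI[where g = ?s]) (auto simp: Transposition.transpose_def)
  have sB: "?s j \<in> Basis" if "j \<in> Basis" for j using that b c by (auto simp: Transposition.transpose_def)
  have T: "T x \<bullet> i = x \<bullet> ?s i" if "i \<in> Basis" for x i
    unfolding T_def using that by (simp add: inner_sum_left inner_Basis if_distrib sum.delta cong: if_cong)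
  have [measurable]: "T \<in> borel_measurable borel" unfolding T_def by measurable
  fix l u :: 'a assume le: "\<And>b. b \<in> Basis \<Longrightarrow> l \<bullet> b \<le> u \<bullet> b"
  have pre: "T -` box l u = box (T l) (T u)"
  proof (rule set_eqI)
    fix x
    have "x \<in> T -` box l u \<longleftrightarrow> (\<forall>i\<in>Basis. l \<bullet> i < x \<bullet> ?s i \<and> x \<bullet> ?s i < u \<bullet> i)"
      by (auto simp: mem_box T)
    also have "\<dots> \<longleftrightarrow> (\<forall>i\<in>Basis. l \<bullet> ?s i < x \<bullet> i \<and> x \<bullet> i < u \<bullet> ?s i)"
      using sB by (metis transpose_involutory)
    also have "\<dots> \<longleftrightarrow> x \<in> box (T l) (T u)" by (auto simp: mem_box T)
    finally show "x \<in> T -` box l u \<longleftrightarrow> x \<in> box (T l) (T u)" .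
  qed
  have "emeasure (distr lborel borel T) (box l u) = emeasure lborel (box (T l) (T u))"
    by (subst emeasure_distr) (auto simp: pre)
  also have "\<dots> = (\<Prod>i\<in>Basis. (T u - T l) \<bullet> i)"
    using le sB by (subst emeasure_lborel_box) (auto simp: T)
  also have "(\<Prod>i\<in>Basis. (T u - T l) \<bullet> i) = (\<Prod>i\<in>Basis. (u - l) \<bullet> ?s i)"
    by (intro prod.cong) (auto simp: T inner_diff_left)
  also have "\<dots> = (\<Prod>i\<in>Basis. (u - l) \<bullet> i)"
    by (rule prod.reindex_bij_betw[OF bij])
  finally show "emeasure (distr lborel borel T) (box l u) = (\<Prod>b\<in>Basis. (u - l) \<bullet> b)" .
qed simp

text \<open>The second moments of a radial weight form a multiple of the identity: reflecting one
  coordinate kills the off-diagonal moments, exchanging two coordinates equates the diagonal ones,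
  and the trace is the radial integral d omega_d ln 2. Each diagonal moment is therefore omega_d ln
  2.\<close>

lemma shell_quadratic_integral:
  fixes g :: "'a::euclidean_space"
  shows "(\<integral>\<^sup>+z. indicator (shell 1) z * (ennreal ((g \<bullet> z)\<^sup>2) * ennreal (norm z powr - (real DIM('a) + 2))) \<partial>lborel)
    = ennreal (unit_ball_vol DIM('a) * ln 2 * (norm g)\<^sup>2)"
proof -
  define w where "w z = indicator (shell 1) z * norm z powr - (real DIM('a) + 2)" for z :: 'a
  have w0: "w z \<ge> 0" for z unfolding w_def by auto
  have [measurable]: "w \<in> borel_measurable borel" unfolding w_def by measurable
  have wn: "w x = w y" if "norm x = norm y" for x y using that by (simp add: w_def shell_def indicator_def)
  have wz: "ennreal ((norm z)\<^sup>2 * w z) = indicator (shell 1) z * ennreal (norm z powr - real DIM('a))" for z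
  proof (cases "z \<in> shell 1")
    case True
    then have "norm z > 0" by (auto simp: shell_def)
    then have "(norm z)\<^sup>2 * norm z powr - (real DIM('a) + 2) = norm z powr (real 2 + - (real DIM('a) + 2))"
      by (rule power_mult_powr)
    also have "\<dots> = norm z powr - real DIM('a)" by simp
    finally have "(norm z)\<^sup>2 * norm z powr - (real DIM('a) + 2) = norm z powr - real DIM('a)" .
    with True show ?thesis by (simp add: w_def)
  qed (simp add: w_def)
  have nint: "(\<integral>\<^sup>+z. ennreal ((norm z)\<^sup>2 * w z) \<partial>lborel) = ennreal (DIM('a) * unit_ball_vol DIM('a) * ln 2)"
    unfolding wz by (rule shell_radial_integral)
  have int: "integrable lborel (\<lambda>z. (norm z)\<^sup>2 * w z)"
    by (rule integrableI_nonneg) (auto simp: nint w0)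
  have val: "(\<integral>z. (norm z)\<^sup>2 * w z \<partial>lborel) = DIM('a) * unit_ball_vol DIM('a) * ln 2"
    by (subst integral_eq_nn_integral) (auto simp: nint w0)
  have intbc: "integrable lborel (\<lambda>z. ((z \<bullet> b) * (z \<bullet> c)) * w z)" if "b \<in> Basis" "c \<in> Basis" for b c
  proof (rule Bochner_Integration.integrable_bound[OF int])
    show "AE z in lborel. norm (((z \<bullet> b) * (z \<bullet> c)) * w z) \<le> norm ((norm z)\<^sup>2 * w z)"
    proof (rule AE_I2)
      fix z :: 'a
      have "\<bar>z \<bullet> b\<bar> * \<bar>z \<bullet> c\<bar> \<le> norm z * norm z"
        using that by (intro mult_mono Basis_le_norm) auto
      then have "\<bar>z \<bullet> b\<bar> * \<bar>z \<bullet> c\<bar> * w z \<le> norm z * norm z * w z"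
        by (rule mult_right_mono[OF _ w0])
      then show "norm (((z \<bullet> b) * (z \<bullet> c)) * w z) \<le> norm ((norm z)\<^sup>2 * w z)"
        using w0[of z] by (simp add: abs_mult power2_eq_square)
    qed
  qed auto
  define m where "m b c = (\<integral>z. ((z \<bullet> b) * (z \<bullet> c)) * w z \<partial>lborel)" for b c
  have off: "m b c = 0" if bc: "b \<in> Basis" "c \<in> Basis" "b \<noteq> c" for b c
  proof -
    let ?T = "\<lambda>x::'a. x - (2 * (x \<bullet> b)) *\<^sub>R b"
    have nT: "norm (?T z) = norm z" for z
    proof -
      have "(norm (?T z))\<^sup>2 = (norm z)\<^sup>2"
        using bc by (simp add: power2_norm_eq_inner inner_diff_left inner_diff_right inner_commute)
      then show ?thesis by simp
    qed
    have "m b c = (\<integral>z. ((z \<bullet> b) * (z \<bullet> c)) * w z \<partial>(distr lborel borel ?T))"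
      unfolding m_def by (subst lborel_reflect[OF bc(1)]) auto
    also have "\<dots> = (\<integral>z. ((?T z \<bullet> b) * (?T z \<bullet> c)) * w (?T z) \<partial>lborel)"
      by (subst integral_distr) auto
    also have "\<dots> = (\<integral>z. - (((z \<bullet> b) * (z \<bullet> c)) * w z) \<partial>lborel)"
      using bc by (intro Bochner_Integration.integral_cong refl)
        (auto simp: wn[OF nT] inner_diff_left inner_Basis)
    also have "\<dots> = - m b c" unfolding m_def by (rule Bochner_Integration.integral_minus)
    finally show ?thesis by simp
  qed
  have diag: "m b b = m c c" if bc: "b \<in> Basis" "c \<in> Basis" for b c
  proof -
    let ?s = "Transposition.transpose b c"
    let ?T = "\<lambda>x::'a. (\<Sum>j\<in>Basis. (x \<bullet> (?s j)) *\<^sub>R j)"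
    have bij: "bij_betw ?s Basis Basis"
      using bc by (intro bij_betwI[where g = ?s]) (auto simp: Transposition.transpose_def)
    have T: "?T x \<bullet> i = x \<bullet> ?s i" if "i \<in> Basis" for x i
      using that by (simp add: inner_sum_left inner_Basis if_distrib sum.delta cong: if_cong)
    have nT: "norm (?T z) = norm z" for z
    proof -
      have "?T z \<bullet> ?T z = (\<Sum>i\<in>Basis. (?T z \<bullet> i) * (?T z \<bullet> i))" by (rule euclidean_inner)
      also have "\<dots> = (\<Sum>i\<in>Basis. (z \<bullet> ?s i) * (z \<bullet> ?s i))"
        by (intro sum.cong refl) (simp add: T)
      also have "\<dots> = (\<Sum>i\<in>Basis. (z \<bullet> i) * (z \<bullet> i))"
        by (rule sum.reindex_bij_betw[OF bij])
      also have "\<dots> = z \<bullet> z" by (rule euclidean_inner[symmetric])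
      finally show ?thesis by (simp add: norm_eq_sqrt_inner)
    qed
    have "m b b = (\<integral>z. ((z \<bullet> b) * (z \<bullet> b)) * w z \<partial>(distr lborel borel ?T))"
      unfolding m_def by (subst lborel_swap[OF bc]) auto
    also have "\<dots> = (\<integral>z. ((?T z \<bullet> b) * (?T z \<bullet> b)) * w (?T z) \<partial>lborel)"
      by (subst integral_distr) auto
    also have "\<dots> = m c c"
      using bc unfolding m_def by (intro Bochner_Integration.integral_cong refl)
        (simp only: wn[OF nT] T transpose_apply_first)
    finally show ?thesis .
  qed
  have sumd: "(\<Sum>b\<in>Basis. m b b) = DIM('a) * unit_ball_vol DIM('a) * ln 2"
  proof -
    have "(\<Sum>b\<in>Basis. m b b) = (\<integral>z. (\<Sum>b\<in>Basis. ((z \<bullet> b) * (z \<bullet> b)) * w z) \<partial>lborel)"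
      unfolding m_def by (rule Bochner_Integration.integral_sum[symmetric]) (rule intbc)
    also have "\<dots> = (\<integral>z. (norm z)\<^sup>2 * w z \<partial>lborel)"
      by (simp add: sum_distrib_right[symmetric] euclidean_inner[symmetric] power2_norm_eq_inner)
    finally show ?thesis using val by simp
  qed
  have mb: "m b b = unit_ball_vol DIM('a) * ln 2" if "b \<in> Basis" for b :: 'a
  proof -
    have "(\<Sum>c\<in>(Basis::'a set). m c c) = (\<Sum>c\<in>(Basis::'a set). m b b)"
      using that by (intro sum.cong refl diag)
    then have "DIM('a) * m b b = DIM('a) * (unit_ball_vol DIM('a) * ln 2)" using sumd by simp
    then show ?thesis by simp
  qed
  have expand: "(g \<bullet> z)\<^sup>2 * w z = (\<Sum>b\<in>Basis. \<Sum>c\<in>Basis. ((g \<bullet> b) * (g \<bullet> c)) * (((z \<bullet> b) * (z \<bullet> c)) * w z))" for z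
  proof -
    have "(g \<bullet> z)\<^sup>2 = (\<Sum>b\<in>Basis. (g \<bullet> b) * (z \<bullet> b)) * (\<Sum>c\<in>Basis. (g \<bullet> c) * (z \<bullet> c))"
      by (simp add: euclidean_inner[of g z] power2_eq_square)
    also have "\<dots> = (\<Sum>b\<in>Basis. \<Sum>c\<in>Basis. ((g \<bullet> b) * (z \<bullet> b)) * ((g \<bullet> c) * (z \<bullet> c)))"
      by (rule sum_product)
    finally have "(g \<bullet> z)\<^sup>2 * w z = (\<Sum>b\<in>Basis. \<Sum>c\<in>Basis. ((g \<bullet> b) * (z \<bullet> b)) * ((g \<bullet> c) * (z \<bullet> c)) * w z)"
      by (simp add: sum_distrib_right)
    also have "\<dots> = (\<Sum>b\<in>Basis. \<Sum>c\<in>Basis. ((g \<bullet> b) * (g \<bullet> c)) * (((z \<bullet> b) * (z \<bullet> c)) * w z))"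
      by (intro sum.cong refl) (simp add: mult_ac)
    finally show ?thesis .
  qed
  have intg: "integrable lborel (\<lambda>z. (g \<bullet> z)\<^sup>2 * w z)"
    unfolding expand by (intro Bochner_Integration.integrable_sum integrable_mult_right intbc)
  have "(\<integral>z. (g \<bullet> z)\<^sup>2 * w z \<partial>lborel) = (\<Sum>b\<in>Basis. \<Sum>c\<in>Basis. ((g \<bullet> b) * (g \<bullet> c)) * m b c)"
    unfolding expand m_def
    by (subst Bochner_Integration.integral_sum, intro Bochner_Integration.integrable_sum integrable_mult_right intbc, assumption+,
        intro sum.cong refl, subst Bochner_Integration.integral_sum, intro integrable_mult_right intbc, assumption+,
        intro sum.cong refl integral_mult_right_zero)
  also have "\<dots> = (\<Sum>b\<in>Basis. \<Sum>c\<in>Basis. if c = b then (g \<bullet> b)\<^sup>2 * (unit_ball_vol DIM('a) * ln 2) else 0)"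
    by (intro sum.cong refl) (auto simp: off mb power2_eq_square)
  also have "\<dots> = (\<Sum>b\<in>Basis. (g \<bullet> b)\<^sup>2 * (unit_ball_vol DIM('a) * ln 2))"
    by (simp add: sum.delta)
  also have "\<dots> = unit_ball_vol DIM('a) * ln 2 * (norm g)\<^sup>2"
    unfolding sum_distrib_right[symmetric] power2_norm_eq_inner euclidean_inner[of g g]
    by (simp add: power2_eq_square)
  finally have v: "(\<integral>z. (g \<bullet> z)\<^sup>2 * w z \<partial>lborel) = unit_ball_vol DIM('a) * ln 2 * (norm g)\<^sup>2" .
  have "(\<integral>\<^sup>+z. indicator (shell 1) z * (ennreal ((g \<bullet> z)\<^sup>2) * ennreal (norm z powr - (real DIM('a) + 2))) \<partial>lborel)
    = (\<integral>\<^sup>+z. ennreal ((g \<bullet> z)\<^sup>2 * w z) \<partial>lborel)"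
    by (intro nn_integral_cong) (auto simp: w_def indicator_def ennreal_mult)
  also have "\<dots> = ennreal (\<integral>z. (g \<bullet> z)\<^sup>2 * w z \<partial>lborel)"
    by (rule nn_integral_eq_integral[OF intg]) (auto simp: w0)
  finally show ?thesis unfolding v .
qed

text \<open>For \<open>Q = Phi u\<close> this is the I(r) of the overview. \<open>Q\<close> stays
  arbitrary because the same integral is needed for the quadratic form h ->
  \<open>nsq (\<lambda>x. G x \<bullet> h)\<close> and for rescaled moduli.\<close>

definition shell_int :: "('a::euclidean_space \<Rightarrow> ennreal) \<Rightarrow> real \<Rightarrow> ennreal" where
  "shell_int Q r = (\<integral>\<^sup>+h. indicator (shell r) h * (Q h * ennreal (norm h powr - (real DIM('a) + 2))) \<partial>lborel)"

text \<open>The Jacobian c^d and the weight c^(-d-2) leave 1/c^2, which compensates quadratic growth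
  of \<open>Q\<close>. This is the reason for the exponent d + 2.\<close>

lemma shell_int_scale:
  fixes Q :: "'a::euclidean_space \<Rightarrow> ennreal"
  assumes [measurable]: "Q \<in> borel_measurable borel" and c: "c > 0"
  shows "shell_int Q (c * r) = shell_int (\<lambda>h. ennreal (1 / c\<^sup>2) * Q (c *\<^sub>R h)) r"
proof -
  have "shell_int Q (c * r) = ennreal (\<bar>c\<bar> ^ DIM('a)) * (\<integral>\<^sup>+h. indicator (shell (c * r)) (c *\<^sub>R h)
      * (Q (c *\<^sub>R h) * ennreal (norm (c *\<^sub>R h) powr - (real DIM('a) + 2))) \<partial>lborel)"
    unfolding shell_int_def by (rule nn_integral_lborel_scale) (use c in auto)
  also have "\<dots> = (\<integral>\<^sup>+h. ennreal (\<bar>c\<bar> ^ DIM('a)) * (indicator (shell (c * r)) (c *\<^sub>R h)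
      * (Q (c *\<^sub>R h) * ennreal (norm (c *\<^sub>R h) powr - (real DIM('a) + 2)))) \<partial>lborel)"
    by (rule nn_integral_cmult[symmetric]) auto
  also have "\<dots> = shell_int (\<lambda>h. ennreal (1 / c\<^sup>2) * Q (c *\<^sub>R h)) r"
    unfolding shell_int_def
  proof (rule nn_integral_cong)
    fix h :: 'a
    have i: "indicator (shell (c * r)) (c *\<^sub>R h) = (indicator (shell r) h :: ennreal)"
    proof -
      have "c *\<^sub>R h \<in> shell (c * r) \<longleftrightarrow> c * (r / 2) < c * norm h \<and> c * norm h \<le> c * r"
        using c by (simp add: shell_def)
      also have "\<dots> \<longleftrightarrow> h \<in> shell r" using c by (simp add: shell_def)
      finally show ?thesis by (simp add: indicator_def)
    qed
    have p: "\<bar>c\<bar> ^ DIM('a) * norm (c *\<^sub>R h) powr - (real DIM('a) + 2) = 1 / c\<^sup>2 * norm h powr - (real DIM('a) + 2)"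
    proof -
      have "norm (c *\<^sub>R h) powr - (real DIM('a) + 2) = c powr - (real DIM('a) + 2) * norm h powr - (real DIM('a) + 2)"
        using c by (simp add: powr_mult)
      moreover have "c ^ DIM('a) * c powr - (real DIM('a) + 2) = 1 / c\<^sup>2"
      proof -
        have "c ^ DIM('a) * c powr - (real DIM('a) + 2) = c powr (-2)"
          using c by (simp add: power_mult_powr)
        also have "\<dots> = 1 / c\<^sup>2" using c by (simp add: powr_minus_divide)
        finally show ?thesis .
      qed
      ultimately show ?thesis by (simp only: mult.assoc[symmetric] abs_of_pos[OF c])
    qed
    have "ennreal (\<bar>c\<bar> ^ DIM('a)) * (indicator (shell (c * r)) (c *\<^sub>R h)
      * (Q (c *\<^sub>R h) * ennreal (norm (c *\<^sub>R h) powr - (real DIM('a) + 2))))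
      = indicator (shell r) h * (Q (c *\<^sub>R h) * (ennreal (\<bar>c\<bar> ^ DIM('a)) * ennreal (norm (c *\<^sub>R h) powr - (real DIM('a) + 2))))"
      unfolding i by (simp add: mult_ac)
    also have "ennreal (\<bar>c\<bar> ^ DIM('a)) * ennreal (norm (c *\<^sub>R h) powr - (real DIM('a) + 2))
      = ennreal (1 / c\<^sup>2) * ennreal (norm h powr - (real DIM('a) + 2))"
      by (simp only: ennreal_mult''[OF powr_ge_zero, symmetric] p)
    finally show "ennreal (\<bar>c\<bar> ^ DIM('a)) * (indicator (shell (c * r)) (c *\<^sub>R h)
      * (Q (c *\<^sub>R h) * ennreal (norm (c *\<^sub>R h) powr - (real DIM('a) + 2))))
      = indicator (shell r) h * (ennreal (1 / c\<^sup>2) * Q (c *\<^sub>R h) * ennreal (norm h powr - (real DIM('a) + 2)))"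
      by (simp add: mult_ac)
  qed
  finally show ?thesis .
qed

lemma shell_int_mono:
  "(\<And>h. h \<in> shell r \<Longrightarrow> Q h \<le> Q' h) \<Longrightarrow> shell_int Q r \<le> shell_int Q' r"
  unfolding shell_int_def by (intro nn_integral_mono) (auto simp: indicator_def intro!: mult_right_mono)

lemma shell_int_half:
  fixes Q :: "'a::euclidean_space \<Rightarrow> ennreal"
  assumes [measurable]: "Q \<in> borel_measurable borel"
    and dbl: "\<And>h. Q (2 *\<^sub>R h) \<le> 4 * Q h"
  shows "shell_int Q r \<le> shell_int Q (r / 2)"
proof -
  have "shell_int Q (1/2 * r) = shell_int (\<lambda>h. ennreal (1 / (1/2)\<^sup>2) * Q ((1/2) *\<^sub>R h)) r"
    by (rule shell_int_scale) auto
  also have "\<dots> \<ge> shell_int Q r"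
  proof (rule shell_int_mono)
    fix h show "Q h \<le> ennreal (1 / (1/2)\<^sup>2) * Q ((1/2) *\<^sub>R h)"
      using dbl[of "(1/2) *\<^sub>R h"] by (simp add: power2_eq_square)
  qed
  finally show ?thesis by simp
qed

lemma shell_int_dyadic:
  fixes Q :: "'a::euclidean_space \<Rightarrow> ennreal"
  assumes "Q \<in> borel_measurable borel" and "\<And>h. Q (2 *\<^sub>R h) \<le> 4 * Q h"
  shows "shell_int Q r \<le> shell_int Q (r / 2^k)"
proof (induction k)
  case (Suc k)
  also have "shell_int Q (r / 2^k) \<le> shell_int Q (r / 2^k / 2)" by (rule shell_int_half[OF assms])
  finally show ?case by (simp add: field_simps)
qed simp

lemma nn_integral_ball_shells:
  fixes F :: "'a::euclidean_space \<Rightarrow> ennreal"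
  assumes [measurable]: "F \<in> borel_measurable borel" and r: "r > 0"
  shows "(\<integral>\<^sup>+h. indicator {h. 0 < norm h \<and> norm h \<le> r} h * F h \<partial>lborel)
     = (\<Sum>k. \<integral>\<^sup>+h. indicator (shell (r / 2^k)) h * F h \<partial>lborel)"
proof -
  have disj: "disjoint_family (\<lambda>k. shell (r / 2^k) :: 'a set)"
  proof -
    have "shell (r / 2^m) \<inter> shell (r / 2^n) = ({} :: 'a set)" if "m < n" for m n
    proof -
      have "r / 2^n \<le> r / 2^(Suc m)"
        using that r by (intro divide_left_mono power_increasing) auto
      then have le: "r / 2^n \<le> r / 2^m / 2" by (simp add: field_simps)
      have False if "r / 2^m / 2 < norm x" "norm x \<le> r / 2^n" for x :: 'a
        using le that by linarith
      then show ?thesis by (auto simp: shell_def)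
    qed
    then show ?thesis unfolding disjoint_family_on_def by (metis Int_commute linorder_neq_iff)
  qed
  have un: "(\<Union>k. shell (r / 2^k)) = {h::'a. 0 < norm h \<and> norm h \<le> r}"
  proof (intro set_eqI iffI)
    fix h :: 'a assume "h \<in> (\<Union>k. shell (r / 2^k))"
    then obtain k where k: "r / 2^k / 2 < norm h" "norm h \<le> r / 2^k" by (auto simp: shell_def)
    have "r / 2^k \<le> r / 1" using r by (intro divide_left_mono) auto
    moreover have "0 < r / 2^k / 2" using r by simp
    ultimately have "0 < norm h" "norm h \<le> r" using k by linarith+
    then show "h \<in> {h. 0 < norm h \<and> norm h \<le> r}" by blast
  next
    fix h :: 'a assume "h \<in> {h. 0 < norm h \<and> norm h \<le> r}"
    then have h: "0 < norm h" "norm h \<le> r" by auto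
    \<comment> \<open>The first k at which r/2^k drops below |h| is not 0, and its predecessor
      indexes the shell containing h.\<close>
    define P where "P k \<longleftrightarrow> r / 2^k < norm h" for k :: nat
    obtain n where "(1/2)^n < norm h / r" using real_arch_pow_inv[of "norm h / r" "1/2"] h r by auto
    then have "P n" unfolding P_def using r by (simp add: field_simps power_divide)
    then have L: "P (LEAST k. P k)" by (rule LeastI)
    have "\<not> P 0" using h by (simp add: P_def)
    then obtain k where k: "(LEAST k. P k) = Suc k" using L by (cases "LEAST k. P k") auto
    then have "\<not> P k" using not_less_Least[of k P] by simp
    moreover have "P (Suc k)" using L k by simp
    ultimately have "h \<in> shell (r / 2^k)" by (simp add: shell_def P_def field_simps)
    then show "h \<in> (\<Union>k. shell (r / 2^k))" by blast
  qed
  have "(\<integral>\<^sup>+h. indicator {h. 0 < norm h \<and> norm h \<le> r} h * F h \<partial>lborel)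
      = (\<integral>\<^sup>+h. (\<Sum>k. indicator (shell (r / 2^k)) h * F h) \<partial>lborel)"
    by (intro nn_integral_cong) (simp add: suminf_indicator[OF disj] un ennreal_suminf_multc[symmetric])
  also have "\<dots> = (\<Sum>k. \<integral>\<^sup>+h. indicator (shell (r / 2^k)) h * F h \<partial>lborel)"
    by (rule nn_integral_suminf) auto
  finally show ?thesis .
qed

section \<open>Summing the fractional energy over dyadic shells\<close>

lemma suminf_quarter_powr:
  assumes a: "a > (0::real)"
  shows "(\<Sum>k. ennreal ((1/2^k) powr (2 * a))) = ennreal (4 powr a / (4 powr a - 1))"
proof -
  have p: "(1/2^k) powr (2 * a) = (4 powr (- a))^k" for k :: nat
  proof -
    have "(1/2^k::real) = 2 powr (- real k)" by (simp add: powr_minus_divide powr_realpow)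
    then have "(1/2^k) powr (2 * a) = 2 powr (2 * (- a * real k))" by (simp add: powr_powr mult_ac)
    also have "\<dots> = (2 powr 2) powr (- a * real k)" by (simp only: powr_powr)
    also have "\<dots> = (4 powr (- a)) powr real k" by (simp add: powr_powr)
    also have "\<dots> = (4 powr (- a))^k" by (simp add: powr_realpow)
    finally show ?thesis .
  qed
  have lt: "4 powr (- a) < 1" using a by (simp add: powr_less_one)
  have "(\<Sum>k. ennreal ((1/2^k) powr (2 * a))) = ennreal (\<Sum>k. (4 powr (- a))^k)"
    unfolding p using lt by (intro suminf_ennreal2) (auto intro: summable_geometric)
  also have "(\<Sum>k. (4 powr (- a))^k) = 1 / (1 - 4 powr (-a))"
    by (rule suminf_geometric) (use lt in auto)
  also have "\<dots> = 4 powr a / (4 powr a - 1)"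
  proof -
    have "4 powr a > 1" using a by simp
    then show ?thesis by (simp add: powr_minus field_simps)
  qed
  finally show ?thesis .
qed

text \<open>For \<open>Q = Phi U\<close> this is twice the fractional energy, see
  \<open>Fs_eq_frac_energy\<close>.\<close>

definition frac_energy :: "real \<Rightarrow> ('a::euclidean_space \<Rightarrow> ennreal) \<Rightarrow> ennreal" where
  "frac_energy s Q = (\<integral>\<^sup>+h. Q h * ennreal (norm h powr - (real DIM('a) + 2 * s)) \<partial>lborel)"

text \<open>With a = 1 - s the kernel is |h|^(2a) times the weight of \<open>shell_int\<close>, and
  on the k-th shell |h|^(2a) is at least its value at the inner radius r/2^(k+1). Replacing every
  I(r/2^k) by the smaller I(r) leaves a geometric series of ratio 4^(-a); the factor 4^a in its sum
  cancels against (r/2)^(2a) = r^(2a) / 4^a.\<close>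

lemma shell_energy_lower:
  fixes Q :: "'a::euclidean_space \<Rightarrow> ennreal"
  assumes [measurable]: "Q \<in> borel_measurable borel" and dbl: "\<And>h. Q (2 *\<^sub>R h) \<le> 4 * Q h"
    and s: "s < 1" and r: "r > 0"
  shows "ennreal (r powr (2 - 2 * s) / (4 powr (1 - s) - 1)) * shell_int Q r \<le> frac_energy s Q"
proof -
  define a where "a = 1 - s"
  have a: "a > 0" using s by (simp add: a_def)
  have "4 powr a > 1" using a by simp
  let ?F = "\<lambda>h::'a. Q h * ennreal (norm h powr - (real DIM('a) + 2 * s))"
  have step: "ennreal ((r / 2 * (1/2^k)) powr (2 * a)) * shell_int Q r \<le> (\<integral>\<^sup>+h. indicator (shell (r / 2^k)) h * ?F h \<partial>lborel)" for k
  proof -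
    have "ennreal ((r / 2 * (1/2^k)) powr (2 * a)) * shell_int Q r
      \<le> ennreal ((r / 2 * (1/2^k)) powr (2 * a)) * shell_int Q (r / 2^k)"
      by (intro mult_left_mono shell_int_dyadic dbl) auto
    also have "\<dots> = (\<integral>\<^sup>+h. ennreal ((r / 2 * (1/2^k)) powr (2 * a)) *
        (indicator (shell (r / 2^k)) h * (Q h * ennreal (norm h powr - (real DIM('a) + 2)))) \<partial>lborel)"
      unfolding shell_int_def by (rule nn_integral_cmult[symmetric]) auto
    also have "\<dots> \<le> (\<integral>\<^sup>+h. indicator (shell (r / 2^k)) h * ?F h \<partial>lborel)"
    proof (rule nn_integral_mono)
      fix h :: 'a
      show "ennreal ((r / 2 * (1/2^k)) powr (2 * a)) *
        (indicator (shell (r / 2^k)) h * (Q h * ennreal (norm h powr - (real DIM('a) + 2))))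
        \<le> indicator (shell (r / 2^k)) h * ?F h"
      proof (cases "h \<in> shell (r / 2^k)")
        case True
        then have h: "r / 2 * (1/2^k) \<le> norm h" by (simp add: shell_def)
        have "(r / 2 * (1/2^k)) powr (2 * a) * norm h powr - (real DIM('a) + 2)
          \<le> norm h powr (2 * a) * norm h powr - (real DIM('a) + 2)"
          using h r a by (intro mult_right_mono powr_mono2) auto
        also have "\<dots> = norm h powr - (real DIM('a) + 2 * s)"
          unfolding powr_add[symmetric] by (simp add: a_def algebra_simps)
        finally have "ennreal ((r / 2 * (1/2^k)) powr (2 * a)) * ennreal (norm h powr - (real DIM('a) + 2))
          \<le> ennreal (norm h powr - (real DIM('a) + 2 * s))"
          by (subst ennreal_mult[symmetric]) (auto intro: ennreal_leI)
        then have "Q h * (ennreal ((r / 2 * (1/2^k)) powr (2 * a)) * ennreal (norm h powr - (real DIM('a) + 2)))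
          \<le> Q h * ennreal (norm h powr - (real DIM('a) + 2 * s))" by (rule mult_left_mono) simp
        then show ?thesis using True by (simp add: mult_ac)
      qed simp
    qed
    finally show ?thesis .
  qed
  have c: "r powr (2 - 2 * s) / (4 powr (1 - s) - 1) = (r/2) powr (2 * a) * (4 powr a / (4 powr a - 1))"
  proof -
    have "(2::real) powr (2 * a) = 4 powr a" by (simp add: powr_powr[symmetric])
    then have "(r/2) powr (2 * a) = r powr (2 * a) / 4 powr a" using r by (simp add: powr_divide)
    moreover have "2 - 2 * s = 2 * a" by (simp add: a_def)
    ultimately show ?thesis by (simp add: a_def[symmetric])
  qed
  have "ennreal (r powr (2 - 2 * s) / (4 powr (1 - s) - 1)) * shell_int Q r
     = ennreal ((r/2) powr (2 * a)) * (\<Sum>k. ennreal ((1/2^k) powr (2 * a))) * shell_int Q r"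
    unfolding c suminf_quarter_powr[OF a] using \<open>4 powr a > 1\<close> by (subst ennreal_mult) auto
  also have "\<dots> = (\<Sum>k. ennreal ((r/2) powr (2 * a)) * ennreal ((1/2^k) powr (2 * a)) * shell_int Q r)"
    by (simp add: ennreal_suminf_cmult ennreal_suminf_multc)
  also have "\<dots> = (\<Sum>k. ennreal ((r / 2 * (1/2^k)) powr (2 * a)) * shell_int Q r)"
  proof (rule suminf_cong)
    fix k
    have "(r / 2 * (1/2^k)) powr (2 * a) = (r/2) powr (2 * a) * (1/2^k) powr (2 * a)"
      using r by (intro powr_mult)
    then show "ennreal ((r/2) powr (2 * a)) * ennreal ((1/2^k) powr (2 * a)) * shell_int Q r
      = ennreal ((r / 2 * (1/2^k)) powr (2 * a)) * shell_int Q r"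
      by (simp add: ennreal_mult)
  qed
  also have "\<dots> \<le> (\<Sum>k. \<integral>\<^sup>+h. indicator (shell (r / 2^k)) h * ?F h \<partial>lborel)"
    by (intro suminf_le step) auto
  also have "\<dots> = (\<integral>\<^sup>+h. indicator {h. 0 < norm h \<and> norm h \<le> r} h * ?F h \<partial>lborel)"
    by (rule nn_integral_ball_shells[symmetric]) (use r in auto)
  also have "\<dots> \<le> frac_energy s Q"
    unfolding frac_energy_def by (intro nn_integral_mono) (auto simp: indicator_def)
  finally show ?thesis .
qed

text \<open>For a 2-homogeneous \<open>Q\<close> all dyadic shells have the same
  \<open>shell_int\<close>, so the lower estimate can be reversed by using the outer radius of each
  shell. At r = 1 the two bounds differ by the factor 4^(1-s), which tends to 1.\<close>

lemma shell_energy_upper: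
  fixes Q :: "'a::euclidean_space \<Rightarrow> ennreal"
  assumes [measurable]: "Q \<in> borel_measurable borel"
    and hom: "\<And>c h. c > 0 \<Longrightarrow> Q (c *\<^sub>R h) = ennreal (c\<^sup>2) * Q h"
    and s: "s < 1"
  shows "(\<integral>\<^sup>+h. indicator {h. 0 < norm h \<and> norm h \<le> 1} h * (Q h * ennreal (norm h powr - (real DIM('a) + 2 * s))) \<partial>lborel)
    \<le> ennreal (4 powr (1 - s) / (4 powr (1 - s) - 1)) * shell_int Q 1"
proof -
  define a where "a = 1 - s"
  have a: "a > 0" using s by (simp add: a_def)
  let ?F = "\<lambda>h::'a. Q h * ennreal (norm h powr - (real DIM('a) + 2 * s))"
  have inv: "shell_int Q (1 / 2^k) = shell_int Q 1" for k
  proof -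
    have "shell_int Q (1 / 2^k * 1) = shell_int (\<lambda>h. ennreal (1 / (1 / 2^k)\<^sup>2) * Q ((1 / 2^k) *\<^sub>R h)) 1"
      by (rule shell_int_scale) auto
    also have "(\<lambda>h. ennreal (1 / (1 / 2^k)\<^sup>2) * Q ((1 / 2^k) *\<^sub>R h)) = Q"
    proof
      fix h
      have "ennreal (1 / (1 / 2^k)\<^sup>2) * Q ((1 / 2^k) *\<^sub>R h) = (ennreal (1 / (1 / 2^k)\<^sup>2) * ennreal ((1/2^k)\<^sup>2)) * Q h"
        by (subst hom) (auto simp: mult.assoc)
      also have "ennreal (1 / (1 / 2^k)\<^sup>2) * ennreal ((1/2^k)\<^sup>2) = 1"
        by (subst ennreal_mult[symmetric]) auto
      finally show "ennreal (1 / (1 / 2^k)\<^sup>2) * Q ((1 / 2^k) *\<^sub>R h) = Q h" by simp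
    qed
    finally show ?thesis by simp
  qed
  have step: "(\<integral>\<^sup>+h. indicator (shell (1 / 2^k)) h * ?F h \<partial>lborel) \<le> ennreal ((1/2^k) powr (2 * a)) * shell_int Q 1" for k
  proof -
    have "(\<integral>\<^sup>+h. indicator (shell (1 / 2^k)) h * ?F h \<partial>lborel) \<le> (\<integral>\<^sup>+h. ennreal ((1/2^k) powr (2 * a)) *
        (indicator (shell (1 / 2^k)) h * (Q h * ennreal (norm h powr - (real DIM('a) + 2)))) \<partial>lborel)"
    proof (rule nn_integral_mono)
      fix h :: 'a
      show "indicator (shell (1 / 2^k)) h * ?F h \<le> ennreal ((1/2^k) powr (2 * a)) *
        (indicator (shell (1 / 2^k)) h * (Q h * ennreal (norm h powr - (real DIM('a) + 2))))"
      proof (cases "h \<in> shell (1 / 2^k)")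
        case True
        then have h: "norm h \<le> 1/2^k" by (simp add: shell_def)
        have "norm h powr - (real DIM('a) + 2 * s) = norm h powr (2 * a) * norm h powr - (real DIM('a) + 2)"
          unfolding powr_add[symmetric] by (simp add: a_def algebra_simps)
        also have "\<dots> \<le> (1/2^k) powr (2 * a) * norm h powr - (real DIM('a) + 2)"
          using h a by (intro mult_right_mono powr_mono2) auto
        finally have "ennreal (norm h powr - (real DIM('a) + 2 * s))
          \<le> ennreal ((1/2^k) powr (2 * a)) * ennreal (norm h powr - (real DIM('a) + 2))"
          by (subst ennreal_mult[symmetric]) (auto intro: ennreal_leI)
        then have "Q h * ennreal (norm h powr - (real DIM('a) + 2 * s)) \<le> Q h * (ennreal ((1/2^k) powr (2 * a)) * ennreal (norm h powr - (real DIM('a) + 2)))"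
          by (rule mult_left_mono) simp
        then show ?thesis using True by (simp add: mult_ac)
      qed simp
    qed
    also have "\<dots> = ennreal ((1/2^k) powr (2 * a)) * shell_int Q (1 / 2^k)"
      unfolding shell_int_def by (rule nn_integral_cmult) auto
    finally show ?thesis unfolding inv .
  qed
  have "(\<integral>\<^sup>+h. indicator {h. 0 < norm h \<and> norm h \<le> 1} h * ?F h \<partial>lborel)
     = (\<Sum>k. \<integral>\<^sup>+h. indicator (shell (1 / 2^k)) h * ?F h \<partial>lborel)"
    by (rule nn_integral_ball_shells) auto
  also have "\<dots> \<le> (\<Sum>k. ennreal ((1/2^k) powr (2 * a)) * shell_int Q 1)"
    by (intro suminf_le step) auto
  also have "\<dots> = ennreal (4 powr (1 - s) / (4 powr (1 - s) - 1)) * shell_int Q 1"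
    by (simp only: ennreal_suminf_multc suminf_quarter_powr[OF a]) (simp only: a_def)
  finally show ?thesis .
qed

text \<open>
  The ball of radius \<open>|h|/4\<close> around \<open>h/2\<close> is invariant under \<open>z \<mapsto> h - z\<close>, so averaging
  \<open>Q h \<le> 2 Q z + 2 Q (h - z)\<close> over it bounds \<open>Q h\<close> by its mean there.
\<close>
lemma pointwise_le_shell_int:
  fixes Q :: "'a::euclidean_space \<Rightarrow> ennreal"
  assumes [measurable]: "Q \<in> borel_measurable borel"
    and sub: "\<And>h k. Q (h + k) \<le> 2 * Q h + 2 * Q k" and h: "h \<noteq> 0"
  shows "Q h \<le> ennreal (8 * 4 ^ DIM('a) / unit_ball_vol DIM('a) * (norm h)\<^sup>2) * shell_int Q (norm h / 2)"
proof -
  \<comment> \<open>The radius |h|/4 keeps |z| strictly above |h|/4, so this ball is covered by the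
    two shells of outer radii |h| and |h|/2.\<close>
  define E where "E = ball ((1/2) *\<^sub>R h) (norm h / 4)"
  have [measurable]: "E \<in> sets borel" by (simp add: E_def)
  let ?V = "unit_ball_vol DIM('a) * (norm h / 4) ^ DIM('a)"
  have V: "?V > 0" using h by simp
  have dbl: "Q (2 *\<^sub>R k) \<le> 4 * Q k" for k
  proof -
    have "2 * Q k + 2 * Q k = 4 * Q k" by (metis distrib_right numeral_Bit0)
    then show ?thesis using sub[of k k] by (simp add: scaleR_2)
  qed
  have Eb: "norm h / 4 < norm z \<and> norm z \<le> norm h" if "z \<in> E" for z
  proof -
    have "norm (z - (1/2) *\<^sub>R h) < norm h / 4" using that by (simp add: E_def dist_norm norm_minus_commute)
    moreover have "norm h / 2 = norm ((1/2) *\<^sub>R h)" by simp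
    moreover have "norm ((1/2) *\<^sub>R h) \<le> norm z + norm ((1/2) *\<^sub>R h - z)" "norm z \<le> norm ((1/2) *\<^sub>R h) + norm (z - (1/2) *\<^sub>R h)"
      by (metis add.commute diff_add_cancel norm_triangle_ineq)+
    ultimately show ?thesis by (auto simp: norm_minus_commute)
  qed
  have Esym: "h - z \<in> E \<longleftrightarrow> z \<in> E" for z
  proof -
    have "(1/2) *\<^sub>R h + (1/2) *\<^sub>R h = h" by (simp add: scaleR_left_distrib[symmetric])
    then have "(1/2) *\<^sub>R h - (h - z) = - ((1/2) *\<^sub>R h - z)" by (simp add: algebra_simps)
    then show ?thesis by (simp only: E_def mem_ball dist_norm norm_minus_cancel)
  qed
  have "ennreal ?V * Q h = (\<integral>\<^sup>+z. indicator E z * Q h \<partial>lborel)"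
  proof (subst nn_integral_multc)
    have "emeasure lborel E = ennreal ?V" unfolding E_def by (rule emeasure_ball) simp
    then show "ennreal ?V * Q h = (\<integral>\<^sup>+z. indicator E z \<partial>lborel) * Q h" by simp
  qed auto
  also have "\<dots> \<le> (\<integral>\<^sup>+z. 2 * (indicator E z * Q z) + 2 * (indicator E (h - z) * Q (h - z)) \<partial>lborel)"
  proof (rule nn_integral_mono)
    fix z
    show "indicator E z * Q h \<le> 2 * (indicator E z * Q z) + 2 * (indicator E (h - z) * Q (h - z))"
      using sub[of z "h - z"] Esym[of z] by (auto simp: indicator_def)
  qed
  also have "\<dots> = 2 * (\<integral>\<^sup>+z. indicator E z * Q z \<partial>lborel) + 2 * (\<integral>\<^sup>+z. indicator E (h - z) * Q (h - z) \<partial>lborel)"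
    by (simp add: nn_integral_add nn_integral_cmult)
  also have "(\<integral>\<^sup>+z. indicator E (h - z) * Q (h - z) \<partial>lborel) = (\<integral>\<^sup>+z. indicator E z * Q z \<partial>lborel)"
  proof -
    have "(\<integral>\<^sup>+z. indicator E (h - z) * Q (h - z) \<partial>lborel) = (\<integral>\<^sup>+z. indicator E (h + z) * Q (h + z) \<partial>lborel)"
      using nn_integral_lborel_uminus[of "\<lambda>z. indicator E (h + z) * Q (h + z)"] by simp
    also have "\<dots> = (\<integral>\<^sup>+z. indicator E z * Q z \<partial>lborel)"
      using nn_integral_lborel_shift[of "\<lambda>z. indicator E z * Q z" h] by (simp add: add.commute)
    finally show ?thesis .
  qed
  also have "2 * (\<integral>\<^sup>+z. indicator E z * Q z \<partial>lborel) + 2 * (\<integral>\<^sup>+z. indicator E z * Q z \<partial>lborel)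
     = 4 * (\<integral>\<^sup>+z. indicator E z * Q z \<partial>lborel)"
    by (metis distrib_right numeral_Bit0)
  also have "(\<integral>\<^sup>+z. indicator E z * Q z \<partial>lborel)
     \<le> ennreal (norm h ^ (DIM('a) + 2)) * (shell_int Q (norm h) + shell_int Q (norm h / 2))"
  proof -
    have "(\<integral>\<^sup>+z. indicator E z * Q z \<partial>lborel) \<le> (\<integral>\<^sup>+z. ennreal (norm h ^ (DIM('a) + 2)) *
        (indicator (shell (norm h)) z * (Q z * ennreal (norm z powr - (real DIM('a) + 2)))
         + indicator (shell (norm h / 2)) z * (Q z * ennreal (norm z powr - (real DIM('a) + 2)))) \<partial>lborel)"
    proof (rule nn_integral_mono)
      fix z
      show "indicator E z * Q z \<le> ennreal (norm h ^ (DIM('a) + 2)) *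
        (indicator (shell (norm h)) z * (Q z * ennreal (norm z powr - (real DIM('a) + 2)))
         + indicator (shell (norm h / 2)) z * (Q z * ennreal (norm z powr - (real DIM('a) + 2))))"
      proof (cases "z \<in> E")
        case True
        note z = Eb[OF True]
        have "norm z > 0" using z h by (smt (verit) zero_less_norm_iff divide_pos_pos)
        then have "1 = norm z ^ (DIM('a) + 2) * norm z powr - (real DIM('a) + 2)"
          by (subst powr_realpow[symmetric]) (auto simp: powr_add[symmetric])
        also have "\<dots> \<le> norm h ^ (DIM('a) + 2) * norm z powr - (real DIM('a) + 2)"
          using z by (intro mult_right_mono power_mono) auto
        finally have "1 \<le> ennreal (norm h ^ (DIM('a) + 2)) * ennreal (norm z powr - (real DIM('a) + 2))"
          by (subst ennreal_mult[symmetric]) (auto simp del: ennreal_1 simp: ennreal_1[symmetric] intro: ennreal_leI)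
        then have "Q z * 1 \<le> Q z * (ennreal (norm h ^ (DIM('a) + 2)) * ennreal (norm z powr - (real DIM('a) + 2)))"
          by (rule mult_left_mono) simp
        moreover have "z \<in> shell (norm h) \<or> z \<in> shell (norm h / 2)" using z by (auto simp: shell_def)
        moreover have "\<not> (z \<in> shell (norm h) \<and> z \<in> shell (norm h / 2))" by (auto simp: shell_def)
        ultimately show ?thesis using True by (auto simp: mult_ac)
      qed simp
    qed
    also have "\<dots> = ennreal (norm h ^ (DIM('a) + 2)) * (shell_int Q (norm h) + shell_int Q (norm h / 2))"
      unfolding shell_int_def by (simp add: nn_integral_cmult nn_integral_add)
    finally show ?thesis .
  qed
  \<comment> \<open>The outer shell is dominated by the inner one, so only I(|h|/2) remains. This 2
    and the 4 from the averaging make the constant 8; the power 4^d comes from the volume of a ball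
    of radius |h|/4.\<close>
  also have "shell_int Q (norm h) + shell_int Q (norm h / 2) \<le> 2 * shell_int Q (norm h / 2)"
    using shell_int_half[of Q "norm h", OF _ dbl] by (simp add: mult_2 add_right_mono)
  finally have main: "ennreal ?V * Q h \<le> 4 * (ennreal (norm h ^ (DIM('a) + 2)) * (2 * shell_int Q (norm h / 2)))"
    by (simp add: mult_left_mono)
  have "Q h = ennreal (1 / ?V) * (ennreal ?V * Q h)"
  proof -
    have "ennreal (1 / ?V) * ennreal ?V = ennreal (1 / ?V * ?V)"
      by (rule ennreal_mult''[symmetric]) (use V in linarith)
    also have "1 / ?V * ?V = 1" using V by (metis less_numeral_extra(3) nonzero_eq_divide_eq)
    finally show ?thesis by (simp only: mult.assoc[symmetric] ennreal_1 mult_1)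
  qed
  also have "\<dots> \<le> ennreal (1 / ?V) * (4 * (ennreal (norm h ^ (DIM('a) + 2)) * (2 * shell_int Q (norm h / 2))))"
    by (rule mult_left_mono[OF main]) simp
  also have "\<dots> = (ennreal (1 / ?V) * ennreal 4 * ennreal (norm h ^ (DIM('a) + 2)) * ennreal 2) * shell_int Q (norm h / 2)"
    by (simp add: mult_ac)
  also have "ennreal (1 / ?V) * ennreal 4 * ennreal (norm h ^ (DIM('a) + 2)) * ennreal 2
     = ennreal (1 / ?V * 4 * norm h ^ (DIM('a) + 2) * 2)"
    by (simp only: ennreal_mult''[OF zero_le_numeral] ennreal_mult''[OF zero_le_power[OF norm_ge_zero]])
  also have "1 / ?V * 4 * norm h ^ (DIM('a) + 2) * 2 = 8 * 4 ^ DIM('a) / unit_ball_vol DIM('a) * (norm h)\<^sup>2"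
    using h by (simp add: power_add power_divide power2_eq_square field_simps)
  finally show ?thesis .
qed

section \<open>Smooth functions and mollification\<close>

abbreviation ddir :: "('a::euclidean_space \<Rightarrow> real) \<Rightarrow> 'a \<Rightarrow> 'a \<Rightarrow> real" where
  "ddir f v \<equiv> (\<lambda>x. frechet_derivative f (at x) v)"

definition smooth :: "('a::euclidean_space \<Rightarrow> real) \<Rightarrow> bool" where
  "smooth f \<longleftrightarrow> (\<forall>k. Ck k f)"

text \<open>Induction on the order over a class closed under directional derivatives: smoothness of
  a whole family is reduced to one differentiation. It serves for linear forms, bumps and
  convolutions.\<close>

lemma smooth_family:
  assumes A: "\<And>f. f \<in> A \<Longrightarrow> (\<forall>x. f differentiable (at x)) \<and> (\<forall>v. ddir f v \<in> A)"
    and f: "f \<in> A"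
  shows "smooth f"
  unfolding smooth_def
proof
  fix k show "Ck k f" using f
  proof (induction k arbitrary: f)
    case 0
    then show ?case using A[of f]
      by (auto intro!: continuous_at_imp_continuous_on differentiable_imp_continuous_within)
  next
    case (Suc k)
    then show ?case using A[of f] by auto
  qed
qed

lemma smooth_differentiable: "smooth f \<Longrightarrow> f differentiable (at x)"
  unfolding smooth_def by (metis Ck.simps(2))

lemma smooth_ddir: "smooth f \<Longrightarrow> smooth (ddir f v)"
  unfolding smooth_def by (metis Ck.simps(2))

lemma smooth_continuous: "smooth f \<Longrightarrow> continuous_on S f"
  unfolding smooth_def by (metis Ck.simps(1) continuous_on_subset subset_UNIV)

lemma smooth_measurable: "smooth f \<Longrightarrow> f \<in> borel_measurable borel"
  using smooth_continuous by (rule borel_measurable_continuous_onI)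

lemma smooth_has_derivative: "smooth f \<Longrightarrow> (f has_derivative (\<lambda>v. ddir f v x)) (at x)"
  using smooth_differentiable frechet_derivative_works by blast

lemma ddir_eqI: "(f has_derivative D) (at x) \<Longrightarrow> ddir f v x = D v"
  using frechet_derivative_at by metis

lemma smooth_const: "smooth (\<lambda>x. c)"
proof (rule smooth_family[of "{\<lambda>x. c | c. True}"])
  fix f :: "'a \<Rightarrow> real" assume "f \<in> {\<lambda>x. c | c. True}"
  then obtain c where f: "f = (\<lambda>x. c)" by auto
  show "(\<forall>x. f differentiable (at x)) \<and> (\<forall>v. ddir f v \<in> {\<lambda>x. c | c. True})"
    unfolding f by auto
qed auto

lemma smooth_inner: "smooth (\<lambda>x. x \<bullet> w)"
proof (rule smooth_family[of "insert (\<lambda>x. x \<bullet> w) {f. smooth f}"])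
  fix f :: "'a \<Rightarrow> real" assume "f \<in> insert (\<lambda>x. x \<bullet> w) {f. smooth f}"
  then consider "f = (\<lambda>x. x \<bullet> w)" | "smooth f" by auto
  then show "(\<forall>x. f differentiable (at x)) \<and> (\<forall>v. ddir f v \<in> insert (\<lambda>x. x \<bullet> w) {f. smooth f})"
  proof cases
    case 1
    have d: "(f has_derivative (\<lambda>v. v \<bullet> w)) (at x)" for x
      unfolding 1 by (auto intro!: derivative_eq_intros)
    have "ddir f v = (\<lambda>x. v \<bullet> w)" for v by (rule ext) (rule ddir_eqI[OF d])
    then show ?thesis using d smooth_const by (auto simp: differentiable_def)
  next
    case 2
    then show ?thesis using smooth_differentiable smooth_ddir by blast
  qed
qed auto

lemma Ck_Suc_imp: "Ck (Suc k) f \<Longrightarrow> Ck k f"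
proof (induction k arbitrary: f)
  case 0
  then show ?case
    by (auto intro!: continuous_at_imp_continuous_on differentiable_imp_continuous_within)
next
  case (Suc k)
  then show ?case by (metis Ck.simps(2))
qed

lemma Ck_add: "Ck k f \<Longrightarrow> Ck k g \<Longrightarrow> Ck k (\<lambda>x. f x + g x)"
proof (induction k arbitrary: f g)
  case (Suc k)
  have d: "((\<lambda>x. f x + g x) has_derivative (\<lambda>v. ddir f v x + ddir g v x)) (at x)" for x
    using Suc.prems by (intro has_derivative_add) (auto simp: frechet_derivative_works[symmetric])
  have "ddir (\<lambda>x. f x + g x) v = (\<lambda>x. ddir f v x + ddir g v x)" for v
    by (rule ext) (rule ddir_eqI[OF d])
  moreover have "Ck k (\<lambda>x. ddir f v x + ddir g v x)" for v
    using Suc.prems by (intro Suc.IH) auto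
  ultimately show ?case using d by (auto simp: differentiable_def)
qed (auto intro: continuous_on_add)

lemma Ck_mult: "Ck k f \<Longrightarrow> Ck k g \<Longrightarrow> Ck k (\<lambda>x. f x * g x)"
proof (induction k arbitrary: f g)
  case (Suc k)
  have d: "((\<lambda>x. f x * g x) has_derivative (\<lambda>v. f x * ddir g v x + ddir f v x * g x)) (at x)" for x
    using Suc.prems by (intro has_derivative_mult) (auto simp: frechet_derivative_works[symmetric])
  have "ddir (\<lambda>x. f x * g x) v = (\<lambda>x. f x * ddir g v x + ddir f v x * g x)" for v
    by (rule ext) (rule ddir_eqI[OF d])
  moreover have "Ck k (\<lambda>x. f x * ddir g v x + ddir f v x * g x)" for v
    using Suc.prems Ck_Suc_imp[OF Suc.prems(1)] Ck_Suc_imp[OF Suc.prems(2)]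
    by (intro Ck_add Suc.IH) auto
  ultimately show ?case using d by (auto simp: differentiable_def)
qed (auto intro: continuous_on_mult)

lemma smooth_add: "smooth f \<Longrightarrow> smooth g \<Longrightarrow> smooth (\<lambda>x. f x + g x)"
  unfolding smooth_def using Ck_add by blast

lemma smooth_mult: "smooth f \<Longrightarrow> smooth g \<Longrightarrow> smooth (\<lambda>x. f x * g x)"
  unfolding smooth_def using Ck_mult by blast

lemma smooth_cmult: "smooth f \<Longrightarrow> smooth (\<lambda>x. c * f x)"
  using smooth_mult[OF smooth_const] by blast

lemma smooth_diff: "smooth f \<Longrightarrow> smooth g \<Longrightarrow> smooth (\<lambda>x. f x - g x)"
  using smooth_add[of f "\<lambda>x. (-1) * g x"] smooth_cmult[of g "-1"] by simp

lemma smooth_sum: "(\<And>i. i \<in> I \<Longrightarrow> smooth (f i)) \<Longrightarrow> smooth (\<lambda>x. \<Sum>i\<in>I. f i x)"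
  by (induction I rule: infinite_finite_induct) (auto intro: smooth_add smooth_const)

lemma smooth_inner_self: "smooth (\<lambda>x. x \<bullet> x)"
proof -
  have "(\<lambda>x::'a. x \<bullet> x) = (\<lambda>x. \<Sum>b\<in>Basis. (x \<bullet> b) * (x \<bullet> b))"
    by (rule ext) (rule euclidean_inner)
  then show ?thesis by (simp only:) (intro smooth_sum smooth_mult smooth_inner)
qed

text \<open>A quadratic error is o(|y - x|). Bumps at the edge of their support and convolutions are
  differentiated this way.\<close>

lemma has_derivative_of_quadratic_bound:
  fixes f :: "'a::real_normed_vector \<Rightarrow> real"
  assumes L: "bounded_linear L" and bd: "\<And>y. \<bar>f y - f x - L (y - x)\<bar> \<le> C * (norm (y - x))\<^sup>2"
  shows "(f has_derivative L) (at x)"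
  unfolding has_derivative_iff_norm
proof (intro conjI L)
  have "((\<lambda>y. C * norm (y - x)) \<longlongrightarrow> C * norm (x - x)) (at x)" by (intro tendsto_intros)
  then have lim: "((\<lambda>y. C * norm (y - x)) \<longlongrightarrow> 0) (at x)" by simp
  show "((\<lambda>y. norm (f y - f x - L (y - x)) / norm (y - x)) \<longlongrightarrow> 0) (at x)"
  proof (rule Lim_null_comparison[OF _ lim])
    show "\<forall>\<^sub>F y in at x. norm (norm (f y - f x - L (y - x)) / norm (y - x)) \<le> C * norm (y - x)"
      unfolding eventually_at_filter
    proof (intro always_eventually allI impI)
      fix y assume "y \<noteq> x"
      then have "norm (y - x) > 0" by simp
      then show "norm (norm (f y - f x - L (y - x)) / norm (y - x)) \<le> C * norm (y - x)"
        using bd[of y] by (simp add: divide_le_eq power2_eq_square mult.assoc)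
    qed
  qed
qed

text \<open>A single term of the exponential series, t^(m+2)/(m+2)! <= exp t. The two spare powers
  of t make the bump vanish to second order.\<close>

lemma power_exp_bound:
  fixes t :: real assumes "t > 0"
  shows "t ^ m * exp (- t) \<le> fact (m + 2) / t\<^sup>2"
proof -
  define F :: real where "F = fact (m + 2)"
  have F: "F > 0" by (simp only: F_def fact_gt_zero)
  have "t ^ (m + 2) / F \<le> exp t"
  proof -
    have "sum (\<lambda>n. t ^ n /\<^sub>R fact n) {m + 2} \<le> (\<Sum>n. t ^ n /\<^sub>R fact n)"
      using assms by (intro sum_le_suminf[OF summable_exp_generic]) auto
    then show ?thesis by (simp only: exp_def F_def sum.insert_remove sum.empty finite.emptyI Diff_empty add_0_right divide_inverse mult.commute real_scaleR_def empty_Diff)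
  qed
  then have "t ^ (m + 2) * exp (- t) \<le> F"
    using F by (simp add: exp_minus field_simps)
  then have "t ^ m * exp (- t) \<le> F / t\<^sup>2" using assms by (simp add: field_simps power_add power2_eq_square)
  then show ?thesis by (simp only: F_def)
qed

text \<open>
  The weights \<open>p\<close> and \<open>m\<close> make the family closed under directional derivatives; the standard bump is
  \<open>p = 1\<close>, \<open>m = 0\<close>.
\<close>
definition bump :: "real \<Rightarrow> ('a::euclidean_space \<Rightarrow> real) \<Rightarrow> nat \<Rightarrow> 'a \<Rightarrow> real" where
  "bump \<epsilon> p m x = (if norm x < \<epsilon> then p x * (1 / (\<epsilon>\<^sup>2 - x \<bullet> x)) ^ m * exp (- (1 / (\<epsilon>\<^sup>2 - x \<bullet> x))) else 0)"

lemma norm_lt_inner: "norm x < \<epsilon> \<Longrightarrow> x \<bullet> x < \<epsilon>\<^sup>2"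
  by (metis norm_ge_zero power2_norm_eq_inner power2_less_imp_less power_strict_mono zero_less_numeral)

text \<open>With t = 1/(\<epsilon>^2 - |y|^2), the bump at y is at most a constant times t^(-2) =
  (\<epsilon>^2 - |y|^2)^2, and \<epsilon>^2 - |y|^2 <= 2 \<epsilon> |y - x| because |x| >=
  \<epsilon>. So it is quadratically small at x, on the sphere and beyond alike.\<close>

lemma bump_has_derivative_outside:
  fixes p :: "'a::euclidean_space \<Rightarrow> real"
  assumes e: "\<epsilon> > 0" and p: "smooth p" and x: "norm x \<ge> \<epsilon>"
  shows "(bump \<epsilon> p m has_derivative (\<lambda>v. 0)) (at x)"
proof -
  have "compact (p ` cball 0 \<epsilon>)" by (intro compact_continuous_image smooth_continuous p compact_cball)
  then obtain B where B: "B > 0" "\<And>y. norm y \<le> \<epsilon> \<Longrightarrow> \<bar>p y\<bar> \<le> B"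
    using compact_imp_bounded[of "p ` cball 0 \<epsilon>"] unfolding bounded_pos by auto
  define F :: real where "F = fact (m + 2)"
  have F: "F > 0" by (simp only: F_def fact_gt_zero)
  have x0: "bump \<epsilon> p m x = 0" using x by (simp add: bump_def)
  show ?thesis
  proof (rule has_derivative_of_quadratic_bound)
    fix y
    show "\<bar>bump \<epsilon> p m y - bump \<epsilon> p m x - 0\<bar> \<le> (B * (F * 4 * \<epsilon>\<^sup>2)) * (norm (y - x))\<^sup>2"
    proof (cases "norm y < \<epsilon>")
      case True
      let ?t = "1 / (\<epsilon>\<^sup>2 - y \<bullet> y)"
      have pos: "\<epsilon>\<^sup>2 - y \<bullet> y > 0" using norm_lt_inner[OF True] by simp
      have "\<bar>bump \<epsilon> p m y\<bar> = \<bar>p y\<bar> * (?t ^ m * exp (- ?t))"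
        using True pos by (simp add: bump_def abs_mult)
      also have "\<dots> \<le> B * (F / ?t\<^sup>2)" unfolding F_def
        using B True pos by (intro mult_mono power_exp_bound) auto
      also have "F / ?t\<^sup>2 = F * (\<epsilon>\<^sup>2 - y \<bullet> y)\<^sup>2"
        by (simp add: power_divide)
      also have "(\<epsilon>\<^sup>2 - y \<bullet> y)\<^sup>2 \<le> (2 * \<epsilon> * norm (y - x))\<^sup>2"
      proof (rule power_mono)
        have "\<epsilon>\<^sup>2 - y \<bullet> y = (\<epsilon> + norm y) * (\<epsilon> - norm y)"
          by (simp add: power2_norm_eq_inner[symmetric] power2_eq_square algebra_simps)
        also have "\<dots> \<le> (2 * \<epsilon>) * norm (y - x)"
        proof (rule mult_mono)
          have "norm x - norm y \<le> norm (x - y)" by (rule norm_triangle_ineq2)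
          then show "\<epsilon> - norm y \<le> norm (y - x)" using x by (simp add: norm_minus_commute)
        qed (use True e in auto)
        finally show "\<epsilon>\<^sup>2 - y \<bullet> y \<le> 2 * \<epsilon> * norm (y - x)" .
      qed (use pos in auto)
      finally show ?thesis using B F by (simp add: x0 mult_ac power_mult_distrib)
    next
      case False
      then show ?thesis using x0 B F by (simp add: bump_def)
    qed
  qed simp
qed

text \<open>The product rule produces the powers m, m + 1 and m + 2 of t = 1/(\<epsilon>^2 - |x|^2).
  The factors (\<epsilon>^2 - |x|^2)^2 and \<epsilon>^2 - |x|^2 raise the first two to m + 2, so the
  derivative is again a \<open>bump\<close> with a smooth weight.\<close>

lemma bump_has_derivative_inside:
  fixes p :: "'a::euclidean_space \<Rightarrow> real"
  assumes p: "smooth p" and x: "norm x < \<epsilon>"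
  shows "(bump \<epsilon> p m has_derivative (\<lambda>v. bump \<epsilon> (\<lambda>x. ddir p v x * (\<epsilon>\<^sup>2 - x \<bullet> x)\<^sup>2
        + (real m * 2 * (\<epsilon>\<^sup>2 - x \<bullet> x) - 2) * (p x * (x \<bullet> v))) (m + 2) x)) (at x)"
proof -
  let ?T = "\<lambda>x::'a. 1 / (\<epsilon>\<^sup>2 - x \<bullet> x)"
  have pos: "\<epsilon>\<^sup>2 - x \<bullet> x > 0" using norm_lt_inner[OF x] by simp
  have T: "(?T has_derivative (\<lambda>v. (?T x)\<^sup>2 * (2 * (x \<bullet> v)))) (at x)"
    using pos by (auto intro!: derivative_eq_intros simp: inner_commute power2_eq_square field_simps)
  have TM: "((\<lambda>x. ?T x ^ m) has_derivative (\<lambda>v. (real m * ?T x ^ (m + 1)) * (2 * (x \<bullet> v)))) (at x)"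
  proof (cases m)
    case (Suc k)
    show ?thesis unfolding Suc
      by (rule has_derivative_eq_rhs[OF has_derivative_power[OF T]])
        (auto simp: power2_eq_square mult_ac)
  qed simp
  have TE: "((\<lambda>x. exp (- ?T x)) has_derivative (\<lambda>v. exp (- ?T x) * (- ((?T x)\<^sup>2 * (2 * (x \<bullet> v)))))) (at x)"
    by (rule has_derivative_eq_rhs[OF has_derivative_exp[OF has_derivative_minus[OF T]]]) (simp add: mult.commute)
  have D: "((\<lambda>x. p x * ?T x ^ m * exp (- ?T x)) has_derivative
     (\<lambda>v. (p x * ?T x ^ m) * (exp (- ?T x) * (- ((?T x)\<^sup>2 * (2 * (x \<bullet> v)))))
        + (p x * ((real m * ?T x ^ (m + 1)) * (2 * (x \<bullet> v))) + ddir p v x * ?T x ^ m) * exp (- ?T x))) (at x)"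
    by (intro has_derivative_mult TM TE smooth_has_derivative p)
  have "(bump \<epsilon> p m has_derivative
     (\<lambda>v. (p x * ?T x ^ m) * (exp (- ?T x) * (- ((?T x)\<^sup>2 * (2 * (x \<bullet> v)))))
        + (p x * ((real m * ?T x ^ (m + 1)) * (2 * (x \<bullet> v))) + ddir p v x * ?T x ^ m) * exp (- ?T x))) (at x)"
    by (rule has_derivative_transform_within_open[OF D open_ball[of 0 \<epsilon>]])
      (use x in \<open>auto simp: bump_def\<close>)
  then show ?thesis
  proof (rule has_derivative_eq_rhs)
    show "(\<lambda>v. (p x * ?T x ^ m) * (exp (- ?T x) * (- ((?T x)\<^sup>2 * (2 * (x \<bullet> v)))))
        + (p x * ((real m * ?T x ^ (m + 1)) * (2 * (x \<bullet> v))) + ddir p v x * ?T x ^ m) * exp (- ?T x))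
      = (\<lambda>v. bump \<epsilon> (\<lambda>x. ddir p v x * (\<epsilon>\<^sup>2 - x \<bullet> x)\<^sup>2
        + (real m * 2 * (\<epsilon>\<^sup>2 - x \<bullet> x) - 2) * (p x * (x \<bullet> v))) (m + 2) x)"
    proof
      fix v
      define t where "t = ?T x"
      have tt: "(\<epsilon>\<^sup>2 - x \<bullet> x) * t = 1" using pos by (simp add: t_def)
      define q where "q = \<epsilon>\<^sup>2 - x \<bullet> x"
      have qt: "q * t = 1" using tt by (simp add: q_def)
      have "(ddir p v x * q\<^sup>2 + (real m * 2 * q - 2) * (p x * (x \<bullet> v))) * t ^ (m + 2)
        = ddir p v x * t ^ m * (q * t)\<^sup>2 + real m * 2 * (p x * (x \<bullet> v)) * t ^ (m + 1) * (q * t) - 2 * (p x * (x \<bullet> v)) * t ^ (m + 2)"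
        by (simp add: algebra_simps power2_eq_square power_add)
      also have "\<dots> = ddir p v x * t ^ m + real m * 2 * (p x * (x \<bullet> v)) * t ^ (m + 1) - 2 * (p x * (x \<bullet> v)) * t ^ (m + 2)"
        by (simp add: qt)
      finally have calc: "(ddir p v x * q\<^sup>2 + (real m * 2 * q - 2) * (p x * (x \<bullet> v))) * t ^ (m + 2)
        = ddir p v x * t ^ m + real m * 2 * (p x * (x \<bullet> v)) * t ^ (m + 1) - 2 * (p x * (x \<bullet> v)) * t ^ (m + 2)" .
      have R: "bump \<epsilon> (\<lambda>x. ddir p v x * (\<epsilon>\<^sup>2 - x \<bullet> x)\<^sup>2
        + (real m * 2 * (\<epsilon>\<^sup>2 - x \<bullet> x) - 2) * (p x * (x \<bullet> v))) (m + 2) x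
        = (ddir p v x * q\<^sup>2 + (real m * 2 * q - 2) * (p x * (x \<bullet> v))) * t ^ (m + 2) * exp (- t)"
        using x by (simp only: bump_def if_True t_def q_def)
      show "(p x * ?T x ^ m) * (exp (- ?T x) * (- ((?T x)\<^sup>2 * (2 * (x \<bullet> v)))))
        + (p x * ((real m * ?T x ^ (m + 1)) * (2 * (x \<bullet> v))) + ddir p v x * ?T x ^ m) * exp (- ?T x)
        = bump \<epsilon> (\<lambda>x. ddir p v x * (\<epsilon>\<^sup>2 - x \<bullet> x)\<^sup>2
        + (real m * 2 * (\<epsilon>\<^sup>2 - x \<bullet> x) - 2) * (p x * (x \<bullet> v))) (m + 2) x"
        unfolding R calc unfolding t_def[symmetric]
        by (simp add: algebra_simps power2_eq_square power_add)
    qed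
  qed
qed

lemma smooth_bump:
  assumes e: "\<epsilon> > 0" and p: "smooth p"
  shows "smooth (bump \<epsilon> p m)"
proof (rule smooth_family[of "{bump \<epsilon> p m | p m. smooth p}"])
  fix f assume "f \<in> {bump \<epsilon> p m | p m. smooth p}"
  then obtain p m where f: "f = bump \<epsilon> p m" and p: "smooth p" by auto
  let ?q = "\<lambda>v x. ddir p v x * (\<epsilon>\<^sup>2 - x \<bullet> x)\<^sup>2 + (real m * 2 * (\<epsilon>\<^sup>2 - x \<bullet> x) - 2) * (p x * (x \<bullet> v))"
  have d: "(f has_derivative (\<lambda>v. bump \<epsilon> (?q v) (m + 2) x)) (at x)" for x
  proof (cases "norm x < \<epsilon>")
    case True
    then show ?thesis unfolding f by (rule bump_has_derivative_inside[OF p])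
  next
    case False
    then have "(\<lambda>v. bump \<epsilon> (?q v) (m + 2) x) = (\<lambda>v. 0)" by (auto simp: bump_def)
    then show ?thesis using bump_has_derivative_outside[OF e p, of x m] False unfolding f by simp
  qed
  have q: "smooth (?q v)" for v
    unfolding power2_eq_square
    by (intro smooth_add smooth_mult smooth_diff smooth_const smooth_ddir smooth_inner_self smooth_inner p)
  have "ddir f v = bump \<epsilon> (?q v) (m + 2)" for v by (rule ext) (rule ddir_eqI[OF d])
  then show "(\<forall>x. f differentiable (at x)) \<and> (\<forall>v. ddir f v \<in> {bump \<epsilon> p m | p m. smooth p})"
    using d q by (auto simp: differentiable_def)
qed (use p in auto)

section \<open>Compactly supported smooth functions: bounds, gradients, Taylor expansion\<close>

definition smooth_compact :: "('a::euclidean_space \<Rightarrow> real) \<Rightarrow> bool" where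
  "smooth_compact f \<longleftrightarrow> smooth f \<and> bounded {x. f x \<noteq> 0}"

lemma ddir_zero_outside:
  assumes "x \<notin> closure {x. f x \<noteq> 0}"
  shows "ddir f v x = 0"
proof -
  have "((\<lambda>x. 0) has_derivative (\<lambda>v. 0)) (at x)" by simp
  then have "(f has_derivative (\<lambda>v. 0)) (at x)"
    by (rule has_derivative_transform_within_open[of _ _ _ _ "- closure {x. f x \<noteq> 0}"])
      (use assms closure_subset[of "{x. f x \<noteq> 0}"] in auto)
  then show ?thesis by (rule ddir_eqI)
qed

lemma smooth_compact_ddir: "smooth_compact f \<Longrightarrow> smooth_compact (ddir f v)"
  unfolding smooth_compact_def
  using bounded_subset[of "closure {x. f x \<noteq> 0}" "{x. ddir f v x \<noteq> 0}"] ddir_zero_outside[of _ f v]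
  by (auto intro: smooth_ddir)

lemma smooth_compact_bounded:
  assumes "smooth_compact f"
  shows "\<exists>C\<ge>0. \<forall>x. \<bar>f x\<bar> \<le> C"
proof -
  have "compact (closure {x. f x \<noteq> 0})" using assms by (simp add: smooth_compact_def)
  then have "compact (f ` closure {x. f x \<noteq> 0})"
    using assms by (intro compact_continuous_image smooth_continuous) (auto simp: smooth_compact_def)
  then obtain C where C: "\<And>x. x \<in> closure {x. f x \<noteq> 0} \<Longrightarrow> \<bar>f x\<bar> \<le> C" and "C > 0"
    using compact_imp_bounded[of "f ` closure {x. f x \<noteq> 0}"] unfolding bounded_pos by auto
  have "\<bar>f x\<bar> \<le> C" for x
    using C[of x] closure_subset[of "{x. f x \<noteq> 0}"] \<open>C > 0\<close> by (cases "f x = 0") auto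
  then show ?thesis using \<open>C > 0\<close> by (intro exI[of _ C]) auto
qed

definition grad :: "('a::euclidean_space \<Rightarrow> real) \<Rightarrow> 'a \<Rightarrow> 'a" where
  "grad f x = (\<Sum>b\<in>Basis. ddir f b x *\<^sub>R b)"

lemma grad_inner_Basis: "b \<in> Basis \<Longrightarrow> grad f x \<bullet> b = ddir f b x"
  by (simp add: grad_def)

lemma ddir_eq_grad:
  assumes "f differentiable (at x)"
  shows "ddir f v x = grad f x \<bullet> v"
proof -
  have lin: "linear (\<lambda>v. ddir f v x)" by (rule linear_frechet_derivative[OF assms])
  have "ddir f v x = ddir f (\<Sum>b\<in>Basis. (v \<bullet> b) *\<^sub>R b) x" by (simp add: euclidean_representation)
  also have "\<dots> = (\<Sum>b\<in>Basis. (v \<bullet> b) * ddir f b x)"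
    using linear_sum[OF lin, of "\<lambda>b. (v \<bullet> b) *\<^sub>R b" Basis] linear_scale[OF lin] by simp
  also have "\<dots> = grad f x \<bullet> v"
    by (simp add: grad_def inner_sum_left inner_commute[of v] mult.commute)
  finally show ?thesis .
qed

lemma has_derivative_grad:
  assumes "f differentiable (at x)"
  shows "(f has_derivative (\<lambda>v. grad f x \<bullet> v)) (at x)"
proof -
  have "(f has_derivative (\<lambda>v. ddir f v x)) (at x)" using assms frechet_derivative_works by blast
  then show ?thesis by (simp add: ddir_eq_grad[OF assms])
qed

lemma lipschitz_of_grad_bound:
  fixes f :: "'a::euclidean_space \<Rightarrow> real"
  assumes S: "convex S" and d: "\<And>x. x \<in> S \<Longrightarrow> (f has_derivative (\<lambda>v. g x \<bullet> v)) (at x)"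
    and bd: "\<And>x. x \<in> S \<Longrightarrow> norm (g x) \<le> K" and x: "x \<in> S" and y: "y \<in> S"
  shows "\<bar>f y - f x\<bar> \<le> K * norm (y - x)"
proof -
  have "norm (f y - f x) \<le> K * norm (y - x)"
  proof (rule differentiable_bound[OF S])
    fix z assume z: "z \<in> S"
    show "(f has_derivative (\<lambda>v. g z \<bullet> v)) (at z within S)"
      by (rule has_derivative_at_withinI[OF d[OF z]])
    show "onorm (\<lambda>v. g z \<bullet> v) \<le> K"
    proof (rule onorm_le)
      fix v
      have "\<bar>g z \<bullet> v\<bar> \<le> norm (g z) * norm v" by (rule Cauchy_Schwarz_ineq2)
      also have "\<dots> \<le> K * norm v" by (rule mult_right_mono[OF bd[OF z]]) simp
      finally show "norm (g z \<bullet> v) \<le> K * norm v" by simp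
    qed
  qed (use x y in auto)
  then show ?thesis by simp
qed

lemma grad_bounded:
  assumes "smooth_compact f"
  shows "\<exists>K\<ge>0. \<forall>x. norm (grad f x) \<le> K"
proof -
  have "\<forall>b. \<exists>C\<ge>0. \<forall>x. \<bar>ddir f b x\<bar> \<le> C"
    using smooth_compact_bounded[OF smooth_compact_ddir[OF assms]] by blast
  then obtain C where C: "\<And>b. C b \<ge> 0" "\<And>b x. \<bar>ddir f b x\<bar> \<le> C b" by metis
  have "norm (grad f x) \<le> (\<Sum>b\<in>Basis. C b)" for x
    unfolding grad_def by (rule sum_norm_le) (simp add: C)
  then show ?thesis using C by (intro exI[of _ "\<Sum>b\<in>Basis. C b"]) (auto intro: sum_nonneg)
qed

lemma smooth_compact_lipschitz:
  assumes "smooth_compact f"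
  shows "\<exists>K\<ge>0. \<forall>x y. \<bar>f y - f x\<bar> \<le> K * norm (y - x)"
proof -
  obtain K where K: "K \<ge> 0" "\<And>x. norm (grad f x) \<le> K" using grad_bounded[OF assms] by auto
  have "\<bar>f y - f x\<bar> \<le> K * norm (y - x)" for x y
    by (rule lipschitz_of_grad_bound[of UNIV f "grad f"])
      (use K assms in \<open>auto intro!: has_derivative_grad smooth_differentiable simp: smooth_compact_def\<close>)
  then show ?thesis using K by blast
qed

text \<open>The mean value inequality for z -> f z - grad f x . z on the ball of radius |y - x|
  about x, where the gradient of this function is at most a Lipschitz constant times |y -
  x|.\<close>

lemma smooth_compact_taylor:
  assumes f: "smooth_compact f"
  shows "\<exists>C\<ge>0. \<forall>x y. \<bar>f y - f x - grad f x \<bullet> (y - x)\<bar> \<le> C * (norm (y - x))\<^sup>2"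
proof -
  have "\<forall>b. \<exists>K\<ge>0. \<forall>x y. \<bar>ddir f b y - ddir f b x\<bar> \<le> K * norm (y - x)"
    using smooth_compact_lipschitz[OF smooth_compact_ddir[OF f]] by blast
  then obtain K where K: "\<And>b. K b \<ge> 0" "\<And>b x y. \<bar>ddir f b y - ddir f b x\<bar> \<le> K b * norm (y - x)" by metis
  let ?C = "\<Sum>b\<in>Basis. K b"
  have g: "norm (grad f y - grad f x) \<le> ?C * norm (y - x)" for x y
  proof -
    have "grad f y - grad f x = (\<Sum>b\<in>Basis. (ddir f b y - ddir f b x) *\<^sub>R b)"
      by (simp add: grad_def sum_subtractf scaleR_diff_left)
    also have "norm \<dots> \<le> (\<Sum>b\<in>Basis. K b * norm (y - x))"
      by (rule sum_norm_le) (simp add: K)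
    finally show ?thesis by (simp add: sum_distrib_right)
  qed
  have C0: "?C \<ge> 0" using K by (auto intro: sum_nonneg)
  have "\<bar>f y - f x - grad f x \<bullet> (y - x)\<bar> \<le> ?C * (norm (y - x))\<^sup>2" for x y
  proof -
    let ?h = "\<lambda>z. f z - grad f x \<bullet> z"
    have "\<bar>?h y - ?h x\<bar> \<le> (?C * norm (y - x)) * norm (y - x)"
    proof (rule lipschitz_of_grad_bound[of "cball x (norm (y - x))" ?h "\<lambda>z. grad f z - grad f x"])
      fix z assume "z \<in> cball x (norm (y - x))"
      then have "norm (z - x) \<le> norm (y - x)" by (simp add: dist_norm norm_minus_commute)
      then show "norm (grad f z - grad f x) \<le> ?C * norm (y - x)"
        using g[of z x] C0 by (meson mult_left_mono order_trans)
      have "f differentiable (at z)" using f by (auto simp: smooth_compact_def intro: smooth_differentiable)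
      then show "(?h has_derivative (\<lambda>v. (grad f z - grad f x) \<bullet> v)) (at z)"
        by (auto intro!: derivative_eq_intros has_derivative_grad simp: inner_diff_left)
    qed (auto simp: dist_norm norm_minus_commute)
    then show ?thesis by (simp add: inner_diff_right power2_eq_square algebra_simps)
  qed
  then show ?thesis using C0 by blast
qed

section \<open>Convolution with a smooth kernel\<close>

definition conv :: "('a::euclidean_space \<Rightarrow> real) \<Rightarrow> ('a \<Rightarrow> real) \<Rightarrow> 'a \<Rightarrow> real" where
  "conv \<rho> f x = (\<integral>y. \<rho> (x - y) * f y \<partial>lborel)"

lemma conv_integrable:
  assumes r: "smooth_compact \<rho>" and f: "integrable lborel f"
  shows "integrable lborel (\<lambda>y. \<rho> (x - y) * f y)"
proof -
  obtain C where C: "\<And>x. \<bar>\<rho> x\<bar> \<le> C" "C \<ge> 0" using smooth_compact_bounded[OF r] by auto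
  have [measurable]: "\<rho> \<in> borel_measurable borel" using r by (auto simp: smooth_compact_def intro: smooth_measurable)
  have [measurable]: "f \<in> borel_measurable borel" using borel_measurable_integrable[OF f] by simp
  show ?thesis
  proof (rule Bochner_Integration.integrable_bound[of _ "\<lambda>y. C * f y"])
    show "integrable lborel (\<lambda>y. C * f y)" using f by simp
    show "AE y in lborel. norm (\<rho> (x - y) * f y) \<le> norm (C * f y)"
      using C by (intro AE_I2) (auto simp: abs_mult intro!: mult_right_mono)
  qed simp
qed

text \<open>The Taylor bound for the kernel is uniform in its argument; integrated against |f| it
  becomes a quadratic remainder for the convolution.\<close>

lemma conv_has_derivative:
  assumes r: "smooth_compact \<rho>" and f: "integrable lborel f"
  shows "(conv \<rho> f has_derivative (\<lambda>v. conv (ddir \<rho> v) f x)) (at x)"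
proof -
  have rd: "\<rho> differentiable (at z)" for z using r by (auto simp: smooth_compact_def intro: smooth_differentiable)
  obtain C where C: "\<And>x y. \<bar>\<rho> y - \<rho> x - grad \<rho> x \<bullet> (y - x)\<bar> \<le> C * (norm (y - x))\<^sup>2" "C \<ge> 0"
    using smooth_compact_taylor[OF r] by auto
  have i: "integrable lborel (\<lambda>y. ddir \<rho> v (x - y) * f y)" for v
    by (rule conv_integrable[OF smooth_compact_ddir[OF r] f])
  have eq: "conv (ddir \<rho> v) f x = (\<Sum>b\<in>Basis. conv (ddir \<rho> b) f x *\<^sub>R b) \<bullet> v" for v
  proof -
    have "conv (ddir \<rho> v) f x = (\<integral>y. (\<Sum>b\<in>Basis. (v \<bullet> b) * (ddir \<rho> b (x - y) * f y)) \<partial>lborel)"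
      unfolding conv_def
    proof (rule Bochner_Integration.integral_cong[OF refl])
      fix y
      have "ddir \<rho> v (x - y) = (\<Sum>b\<in>Basis. (v \<bullet> b) * ddir \<rho> b (x - y))"
      proof -
        have "ddir \<rho> v (x - y) = grad \<rho> (x - y) \<bullet> v" by (rule ddir_eq_grad[OF rd])
        also have "\<dots> = (\<Sum>b\<in>Basis. (v \<bullet> b) * ddir \<rho> b (x - y))"
          by (simp add: grad_def inner_sum_left inner_commute[of v] mult.commute)
        finally show ?thesis .
      qed
      then show "ddir \<rho> v (x - y) * f y = (\<Sum>b\<in>Basis. (v \<bullet> b) * (ddir \<rho> b (x - y) * f y))"
        by (simp add: sum_distrib_right mult.assoc)
    qed
    also have "\<dots> = (\<Sum>b\<in>Basis. (v \<bullet> b) * conv (ddir \<rho> b) f x)"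
      unfolding conv_def by (subst Bochner_Integration.integral_sum) (auto intro: i)
    finally show ?thesis by (simp add: inner_sum_left inner_commute[of v] mult.commute)
  qed
  show ?thesis
  proof (rule has_derivative_of_quadratic_bound)
    show "bounded_linear (\<lambda>v. conv (ddir \<rho> v) f x)"
      by (subst ext[OF eq]) (rule bounded_linear_inner_right)
    fix y
    have "conv \<rho> f y - conv \<rho> f x - conv (ddir \<rho> (y - x)) f x
       = (\<integral>z. (\<rho> (y - z) - \<rho> (x - z) - ddir \<rho> (y - x) (x - z)) * f z \<partial>lborel)"
      unfolding conv_def
      by (simp add: left_diff_distrib Bochner_Integration.integral_diff conv_integrable[OF r f] i)
    also have "\<bar>\<dots>\<bar> \<le> (\<integral>z. (C * (norm (y - x))\<^sup>2) * norm (f z) \<partial>lborel)"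
    proof -
      have "norm (\<integral>z. (\<rho> (y - z) - \<rho> (x - z) - ddir \<rho> (y - x) (x - z)) * f z \<partial>lborel)
        \<le> (\<integral>z. (C * (norm (y - x))\<^sup>2) * norm (f z) \<partial>lborel)"
      proof (rule order_trans[OF integral_norm_bound], rule integral_mono)
        show "integrable lborel (\<lambda>z. norm ((\<rho> (y - z) - \<rho> (x - z) - ddir \<rho> (y - x) (x - z)) * f z))"
          by (intro integrable_norm) (simp add: left_diff_distrib conv_integrable[OF r f] i)
        show "integrable lborel (\<lambda>z. (C * (norm (y - x))\<^sup>2) * norm (f z))"
          by (intro integrable_mult_right integrable_norm f)
        fix z
        have "\<bar>\<rho> (y - z) - \<rho> (x - z) - ddir \<rho> (y - x) (x - z)\<bar> \<le> C * (norm (y - x))\<^sup>2"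
          using C(1)[of "y - z" "x - z"] by (simp add: ddir_eq_grad[OF rd])
        then show "norm ((\<rho> (y - z) - \<rho> (x - z) - ddir \<rho> (y - x) (x - z)) * f z) \<le> (C * (norm (y - x))\<^sup>2) * norm (f z)"
          by (simp add: abs_mult mult_right_mono)
      qed
      then show ?thesis by simp
    qed
    also have "\<dots> = (C * (\<integral>z. norm (f z) \<partial>lborel)) * (norm (y - x))\<^sup>2" by simp
    finally show "\<bar>conv \<rho> f y - conv \<rho> f x - conv (ddir \<rho> (y - x)) f x\<bar> \<le> (C * (\<integral>z. norm (f z) \<partial>lborel)) * (norm (y - x))\<^sup>2" .
  qed
qed

lemma smooth_conv:
  assumes "smooth_compact \<rho>" and f: "integrable lborel f"
  shows "smooth (conv \<rho> f)"
proof (rule smooth_family[of "{conv \<rho> f | \<rho>. smooth_compact \<rho>}"])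
  fix g assume "g \<in> {conv \<rho> f | \<rho>. smooth_compact \<rho>}"
  then obtain \<rho> where g: "g = conv \<rho> f" and r: "smooth_compact \<rho>" by auto
  have "ddir g v = conv (ddir \<rho> v) f" for v
    unfolding g by (rule ext) (rule ddir_eqI[OF conv_has_derivative[OF r f]])
  then show "(\<forall>x. g differentiable (at x)) \<and> (\<forall>v. ddir g v \<in> {conv \<rho> f | \<rho>. smooth_compact \<rho>})"
    using conv_has_derivative[OF r f] smooth_compact_ddir[OF r] unfolding g differentiable_def by blast
qed (use assms in auto)

text \<open>An average of translates of f: the form to which Jensen's inequality applies.\<close>

lemma conv_eq_average:
  assumes [measurable]: "\<rho> \<in> borel_measurable borel" "f \<in> borel_measurable borel"
  shows "conv \<rho> f x = (\<integral>y. \<rho> y * f (x - y) \<partial>lborel)"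
proof -
  have d: "distr lborel borel (\<lambda>y. x - y) = (lborel :: 'a measure)"
    using lborel_affine[of "-1" x] by (simp add: density_1)
  have "(\<integral>y. \<rho> (x - y) * f y \<partial>lborel) = (\<integral>y. \<rho> (x - y) * f y \<partial>(distr lborel borel (\<lambda>y. x - y)))"
    by (simp only: d)
  also have "\<dots> = (\<integral>y. \<rho> y * f (x - y) \<partial>lborel)"
    by (subst integral_distr) auto
  finally show ?thesis by (simp add: conv_def)
qed

lemma average_integrable:
  assumes r: "smooth_compact \<rho>" and f: "integrable lborel f"
  shows "integrable lborel (\<lambda>y. \<rho> y * f (x - y))"
proof -
  have [measurable]: "\<rho> \<in> borel_measurable borel" using r by (auto simp: smooth_compact_def intro: smooth_measurable)
  have [measurable]: "f \<in> borel_measurable borel" using borel_measurable_integrable[OF f] by simp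
  have d: "distr lborel borel (\<lambda>y. x - y) = (lborel :: 'a measure)"
    using lborel_affine[of "-1" x] by (simp add: density_1)
  have "integrable (distr lborel borel (\<lambda>y. x - y)) (\<lambda>y. \<rho> (x - y) * f y)"
    using conv_integrable[OF r f] by (simp only: d)
  then show ?thesis by (subst (asm) integrable_distr_eq) auto
qed

text \<open>
  Jensen's inequality; integrability of the inner integrand is not required, since a divergent Bochner integral is \<open>0\<close>.
\<close>
lemma nsq_average:
  fixes \<rho> :: "'a::euclidean_space \<Rightarrow> real" and g :: "'a \<Rightarrow> 'a \<Rightarrow> real"
  assumes [measurable]: "\<rho> \<in> borel_measurable borel" "(\<lambda>(x, y). g x y) \<in> borel_measurable (borel \<Otimes>\<^sub>M borel)"
    and nn: "\<And>y. \<rho> y \<ge> 0" and int: "integrable lborel \<rho>" and one: "(\<integral>y. \<rho> y \<partial>lborel) = 1"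
  shows "nsq (\<lambda>x. \<integral>y. \<rho> y * g x y \<partial>lborel) \<le> (\<integral>\<^sup>+y. ennreal (\<rho> y) * nsq (\<lambda>x. g x y) \<partial>lborel)"
proof -
  have J: "ennreal ((norm (\<integral>y. \<rho> y * g x y \<partial>lborel))\<^sup>2) \<le> (\<integral>\<^sup>+y. ennreal (\<rho> y) * ennreal ((norm (g x y))\<^sup>2) \<partial>lborel)" for x
  proof -
    let ?m = "\<integral>y. \<rho> y * g x y \<partial>lborel"
    have [measurable]: "g x \<in> borel_measurable borel" by measurable
    have eq: "(\<integral>\<^sup>+y. ennreal (\<rho> y) * ennreal ((norm (g x y))\<^sup>2) \<partial>lborel) = (\<integral>\<^sup>+y. ennreal (\<rho> y * (g x y)\<^sup>2) \<partial>lborel)"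
      by (intro nn_integral_cong) (simp add: ennreal_mult nn)
    show ?thesis
    proof (cases "(\<integral>\<^sup>+y. ennreal (\<rho> y * (g x y)\<^sup>2) \<partial>lborel) = \<infinity> \<or> \<not> integrable lborel (\<lambda>y. \<rho> y * g x y)")
      case True
      then show ?thesis unfolding eq by (auto simp: not_integrable_integral_eq)
    next
      case False
      then have i2: "integrable lborel (\<lambda>y. \<rho> y * (g x y)\<^sup>2)"
        by (intro integrableI_nonneg) (auto simp: nn less_top)
      from False have i1: "integrable lborel (\<lambda>y. \<rho> y * g x y)" by simp
      \<comment> \<open>Expanding the variance about the mean m; its nonnegativity is the
        inequality.\<close>
      have e: "\<rho> y * (g x y - ?m)\<^sup>2 = \<rho> y * (g x y)\<^sup>2 - (2 * ?m) * (\<rho> y * g x y) + ?m\<^sup>2 * \<rho> y" for y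
        by (simp add: power2_eq_square algebra_simps)
      have "0 \<le> (\<integral>y. \<rho> y * (g x y - ?m)\<^sup>2 \<partial>lborel)" by (intro integral_nonneg_AE) (auto simp: nn)
      also have "\<dots> = (\<integral>y. \<rho> y * (g x y)\<^sup>2 \<partial>lborel) - (2 * ?m) * ?m + ?m\<^sup>2 * 1"
        unfolding e using i1 i2 int one by (simp add: Bochner_Integration.integral_add Bochner_Integration.integral_diff)
      finally have "?m\<^sup>2 \<le> (\<integral>y. \<rho> y * (g x y)\<^sup>2 \<partial>lborel)" by (simp add: power2_eq_square)
      then have "ennreal (?m\<^sup>2) \<le> ennreal (\<integral>y. \<rho> y * (g x y)\<^sup>2 \<partial>lborel)" by (rule ennreal_leI)
      also have "\<dots> = (\<integral>\<^sup>+y. ennreal (\<rho> y * (g x y)\<^sup>2) \<partial>lborel)"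
        by (rule nn_integral_eq_integral[symmetric, OF i2]) (auto simp: nn)
      finally show ?thesis unfolding eq by simp
    qed
  qed
  have "nsq (\<lambda>x. \<integral>y. \<rho> y * g x y \<partial>lborel) \<le> (\<integral>\<^sup>+x. \<integral>\<^sup>+y. ennreal (\<rho> y) * ennreal ((norm (g x y))\<^sup>2) \<partial>lborel \<partial>lborel)"
    unfolding nsq_def by (rule nn_integral_mono) (rule J)
  also have "\<dots> = (\<integral>\<^sup>+y. \<integral>\<^sup>+x. ennreal (\<rho> y) * ennreal ((norm (g x y))\<^sup>2) \<partial>lborel \<partial>lborel)"
    by (rule lborel_pair.Fubini'[symmetric]) measurable
  also have "\<dots> = (\<integral>\<^sup>+y. ennreal (\<rho> y) * nsq (\<lambda>x. g x y) \<partial>lborel)"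
    unfolding nsq_def by (intro nn_integral_cong nn_integral_cmult) measurable
  finally show ?thesis .
qed

section \<open>Mollifiers and translation moduli\<close>

definition mollifier :: "real \<Rightarrow> ('a::euclidean_space \<Rightarrow> real) \<Rightarrow> bool" where
  "mollifier \<epsilon> \<rho> \<longleftrightarrow> smooth_compact \<rho> \<and> (\<forall>x. \<rho> x \<ge> 0) \<and> (\<forall>x. norm x \<ge> \<epsilon> \<longrightarrow> \<rho> x = 0) \<and>
     integrable lborel \<rho> \<and> (\<integral>x. \<rho> x \<partial>lborel) = 1"

lemma smooth_compact_integrable:
  assumes f: "smooth_compact f"
  shows "integrable lborel f"
proof -
  let ?K = "closure {x. f x \<noteq> 0}"
  have "compact ?K" using f by (simp add: smooth_compact_def)
  moreover have "continuous_on ?K f" using f by (auto simp: smooth_compact_def intro: smooth_continuous)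
  ultimately have "set_integrable lborel ?K f" by (rule borel_integrable_compact[unfolded set_integrable_def[symmetric]])
  moreover have "(\<lambda>x. indicator ?K x *\<^sub>R f x) = f"
    using closure_subset[of "{x. f x \<noteq> 0}"] by (auto simp: indicator_def fun_eq_iff)
  ultimately show ?thesis by (simp add: set_integrable_def)
qed

lemma mollifier_exists:
  assumes e: "\<epsilon> > 0"
  shows "\<exists>\<rho> :: 'a::euclidean_space \<Rightarrow> real. mollifier \<epsilon> \<rho>"
proof -
  let ?b = "bump \<epsilon> (\<lambda>x::'a. 1) 0"
  have sm: "smooth ?b" by (rule smooth_bump[OF e smooth_const])
  have "bounded {x. ?b x \<noteq> 0}" by (rule bounded_subset[of "ball 0 \<epsilon>"]) (auto simp: bump_def)
  then have sc: "smooth_compact ?b" using sm by (simp add: smooth_compact_def)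
  have nn: "?b x \<ge> 0" for x by (simp add: bump_def)
  have int: "integrable lborel ?b" by (rule smooth_compact_integrable[OF sc])
  have [measurable]: "?b \<in> borel_measurable borel" using sm by (rule smooth_measurable)
  have "(\<integral>x. ?b x \<partial>lborel) \<noteq> 0"
  proof
    assume "(\<integral>x. ?b x \<partial>lborel) = 0"
    then have "AE x in lborel. ?b x = 0" using integral_nonneg_eq_0_iff_AE[OF int] nn by simp
    then have "AE x in lborel. x \<notin> ball (0::'a) \<epsilon>"
      by eventually_elim (auto simp: bump_def)
    then have "ball (0::'a) \<epsilon> \<in> null_sets lborel"
      by (subst (asm) AE_iff_null_sets[symmetric]) auto
    then have "emeasure lborel (ball (0::'a) \<epsilon>) = 0" by auto
    then show False using e unit_ball_vol_pos[of "real DIM('a)"] by (simp add: emeasure_ball)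
  qed
  moreover have "(\<integral>x. ?b x \<partial>lborel) \<ge> 0" using nn by (intro integral_nonneg_AE) auto
  ultimately have I: "(\<integral>x. ?b x \<partial>lborel) > 0" by simp
  let ?c = "1 / (\<integral>x. ?b x \<partial>lborel)"
  have "smooth_compact (\<lambda>x. ?c * ?b x)"
    using sc smooth_cmult[OF sm, of ?c] by (auto simp: smooth_compact_def intro: bounded_subset)
  moreover have "norm x \<ge> \<epsilon> \<longrightarrow> ?b x = 0" for x by (simp add: bump_def)
  ultimately have "mollifier \<epsilon> (\<lambda>x. ?c * ?b x)"
    unfolding mollifier_def using int nn I by auto
  then show ?thesis by blast
qed

lemma mollifier_measurable: "mollifier \<epsilon> \<rho> \<Longrightarrow> \<rho> \<in> borel_measurable borel"
  by (auto simp: mollifier_def smooth_compact_def intro: smooth_measurable)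

text \<open>The error is a weighted average of differences f(x - y) - f x with |y| < \<epsilon>, so
  Jensen's inequality reads it off the translation modulus.\<close>

lemma mollify_error:
  assumes m: "mollifier \<epsilon> \<rho>" and f: "integrable lborel f"
    and K: "\<And>y. norm y < \<epsilon> \<Longrightarrow> Phi f y \<le> K"
  shows "nsq (\<lambda>x. conv \<rho> f x - f x) \<le> K"
proof -
  have [measurable]: "\<rho> \<in> borel_measurable borel" by (rule mollifier_measurable[OF m])
  have [measurable]: "f \<in> borel_measurable borel" using borel_measurable_integrable[OF f] by simp
  have sc: "smooth_compact \<rho>" and nn: "\<And>x. \<rho> x \<ge> 0" and int: "integrable lborel \<rho>"
    and one: "(\<integral>x. \<rho> x \<partial>lborel) = 1" and supp: "\<And>x. norm x \<ge> \<epsilon> \<Longrightarrow> \<rho> x = 0"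
    using m by (auto simp: mollifier_def)
  have "conv \<rho> f x - f x = (\<integral>y. \<rho> y * (f (x - y) - f x) \<partial>lborel)" for x
  proof -
    have "(\<integral>y. \<rho> y * (f (x - y) - f x) \<partial>lborel) = (\<integral>y. \<rho> y * f (x - y) - \<rho> y * f x \<partial>lborel)"
      by (simp add: right_diff_distrib)
    also have "\<dots> = conv \<rho> f x - f x"
      using average_integrable[OF sc f, of x] int one by (simp add: Bochner_Integration.integral_diff conv_eq_average)
    finally show ?thesis by simp
  qed
  then have "nsq (\<lambda>x. conv \<rho> f x - f x) \<le> (\<integral>\<^sup>+y. ennreal (\<rho> y) * nsq (\<lambda>x. f (x - y) - f x) \<partial>lborel)"
    by (simp only:) (rule nsq_average; (use nn int one in \<open>auto simp: split_beta'\<close>))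
  also have "\<dots> \<le> (\<integral>\<^sup>+y. ennreal (\<rho> y) * K \<partial>lborel)"
  proof (rule nn_integral_mono)
    fix y :: 'a
    show "ennreal (\<rho> y) * nsq (\<lambda>x. f (x - y) - f x) \<le> ennreal (\<rho> y) * K"
    proof (cases "norm y < \<epsilon>")
      case True
      then have "Phi f (- y) \<le> K" by (intro K) simp
      then show ?thesis by (intro mult_left_mono) (auto simp: Phi_def)
    qed (use supp in auto)
  qed
  also have "\<dots> = (\<integral>\<^sup>+y. ennreal (\<rho> y) \<partial>lborel) * K" by (rule nn_integral_multc) auto
  also have "(\<integral>\<^sup>+y. ennreal (\<rho> y) \<partial>lborel) = 1"
    using nn_integral_eq_integral[OF int] nn one by simp
  finally show ?thesis by simp
qed

text \<open>Mollification averages translates, \<open>Phi\<close> is unchanged by translating the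
  function, and Jensen's inequality does the rest.\<close>

lemma mollify_Phi:
  assumes m: "mollifier \<epsilon> \<rho>" and f: "integrable lborel f"
  shows "Phi (conv \<rho> f) h \<le> Phi f h"
proof -
  have [measurable]: "\<rho> \<in> borel_measurable borel" by (rule mollifier_measurable[OF m])
  have [measurable]: "f \<in> borel_measurable borel" using borel_measurable_integrable[OF f] by simp
  have sc: "smooth_compact \<rho>" and nn: "\<And>x. \<rho> x \<ge> 0" and int: "integrable lborel \<rho>"
    and one: "(\<integral>x. \<rho> x \<partial>lborel) = 1"
    using m by (auto simp: mollifier_def)
  have "conv \<rho> f (x + h) - conv \<rho> f x = (\<integral>y. \<rho> y * (f (x + h - y) - f (x - y)) \<partial>lborel)" for x
    using average_integrable[OF sc f] by (simp add: right_diff_distrib Bochner_Integration.integral_diff conv_eq_average)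
  then have "Phi (conv \<rho> f) h \<le> (\<integral>\<^sup>+y. ennreal (\<rho> y) * nsq (\<lambda>x. f (x + h - y) - f (x - y)) \<partial>lborel)"
    unfolding Phi_def by (simp only:) (rule nsq_average; (use nn int one in \<open>auto simp: split_beta'\<close>))
  also have "\<dots> = (\<integral>\<^sup>+y. ennreal (\<rho> y) * Phi f h \<partial>lborel)"
  proof (rule nn_integral_cong)
    fix y
    have "nsq (\<lambda>x. f (x + h - y) - f (x - y)) = nsq (\<lambda>x. (\<lambda>z. f (z + h) - f z) (x + (- y)))"
      by (simp add: algebra_simps)
    also have "\<dots> = Phi f h" unfolding Phi_def by (rule nsq_shift) auto
    finally show "ennreal (\<rho> y) * nsq (\<lambda>x. f (x + h - y) - f (x - y)) = ennreal (\<rho> y) * Phi f h" by simp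
  qed
  also have "\<dots> = (\<integral>\<^sup>+y. ennreal (\<rho> y) \<partial>lborel) * Phi f h" by (rule nn_integral_multc) auto
  also have "(\<integral>\<^sup>+y. ennreal (\<rho> y) \<partial>lborel) = 1"
    using nn_integral_eq_integral[OF int] nn one by simp
  finally show ?thesis by simp
qed

lemma test_functions_conv:
  assumes m: "mollifier \<epsilon> \<rho>" and f: "integrable lborel f" and K: "compact K"
    and f0: "\<And>x. x \<notin> K \<Longrightarrow> f x = 0" and sub: "\<And>x y. x \<in> K \<Longrightarrow> norm y \<le> \<epsilon> \<Longrightarrow> x + y \<in> \<Omega>"
  shows "conv \<rho> f \<in> test_functions \<Omega>"
proof -
  let ?S = "{x + y | x y. x \<in> K \<and> y \<in> cball 0 \<epsilon>}"
  have cS: "compact ?S" by (rule compact_sums[OF K compact_cball])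
  have S0: "{x. conv \<rho> f x \<noteq> 0} \<subseteq> ?S"
  proof
    fix x assume "x \<in> {x. conv \<rho> f x \<noteq> 0}"
    then have ne: "conv \<rho> f x \<noteq> 0" by simp
    have "\<not> (\<forall>y. \<rho> (x - y) * f y = 0)"
    proof
      assume "\<forall>y. \<rho> (x - y) * f y = 0"
      then have "conv \<rho> f x = 0" unfolding conv_def by (simp only: integral_zero)
      then show False using ne by simp
    qed
    then obtain y where y: "\<rho> (x - y) \<noteq> 0" "f y \<noteq> 0" by auto
    then have "y \<in> K" "norm (x - y) \<le> \<epsilon>" using f0 m unfolding mollifier_def by (blast, meson linear)
    then show "x \<in> ?S" by (intro CollectI exI[of _ y] exI[of _ "x - y"]) auto
  qed
  then have cl: "closure {x. conv \<rho> f x \<noteq> 0} \<subseteq> ?S"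
    using cS by (simp add: closure_minimal compact_imp_closed)
  moreover have "?S \<subseteq> \<Omega>" using sub by auto
  moreover have "compact (closure {x. conv \<rho> f x \<noteq> 0})"
    unfolding compact_closure by (rule bounded_subset[OF compact_imp_bounded[OF cS] S0])
  moreover have "\<forall>k. Ck k (conv \<rho> f)" using smooth_conv[OF _ f] m by (auto simp: mollifier_def smooth_def)
  ultimately show ?thesis by (auto simp: test_functions_def)
qed

section \<open>Representatives, test functions and weak gradients\<close>

text \<open>
  \<open>U\<close> is a Borel version of \<open>u\<close> on \<open>\<Omega>\<close>, extended by zero. Working with Borel functions makes Tonelli's
  theorem applicable, as \<open>lebesgue\<close> is not compatible with products.
\<close>
definition rep :: "'a::euclidean_space set \<Rightarrow> ('a \<Rightarrow> 'b::euclidean_space) \<Rightarrow> ('a \<Rightarrow> 'b) \<Rightarrow> bool" where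
  "rep \<Omega> u U \<longleftrightarrow> U \<in> borel_measurable borel \<and> (\<forall>x. x \<notin> \<Omega> \<longrightarrow> U x = 0) \<and>
     (AE x in lborel. x \<in> \<Omega> \<longrightarrow> U x = u x)"

lemma rep_measurable: "rep \<Omega> u U \<Longrightarrow> U \<in> borel_measurable borel"
  by (simp add: rep_def)

lemma rep_outside: "rep \<Omega> u U \<Longrightarrow> x \<notin> \<Omega> \<Longrightarrow> U x = 0"
  by (simp add: rep_def)

lemma rep_self: "U \<in> borel_measurable borel \<Longrightarrow> (\<And>x. x \<notin> \<Omega> \<Longrightarrow> U x = 0) \<Longrightarrow> rep \<Omega> U U"
  by (simp add: rep_def)

lemma rep_exists:
  fixes u :: "'a::euclidean_space \<Rightarrow> 'b::euclidean_space"
  assumes O: "open \<Omega>" and u: "u \<in> borel_measurable (lebesgue_on \<Omega>)"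
  shows "\<exists>U. rep \<Omega> u U"
proof -
  have OL: "\<Omega> \<in> sets lebesgue" using O by auto
  have [measurable]: "\<Omega> \<in> sets borel" using O by auto
  let ?u = "\<lambda>x. if x \<in> \<Omega> then u x else 0"
  have "?u \<in> borel_measurable lebesgue" using u OL by (simp add: borel_measurable_if)
  then have "(\<lambda>x. ?u x \<bullet> b) \<in> borel_measurable (completion lborel)" for b by measurable
  then have "\<forall>b. \<exists>g. g \<in> borel_measurable lborel \<and> (AE x in lborel. ?u x \<bullet> b = g x)"
    using completion_ex_borel_measurable_real by blast
  then obtain g where g: "\<And>b. g b \<in> borel_measurable lborel" "\<And>b. AE x in lborel. ?u x \<bullet> b = g b x" by metis
  have [measurable]: "g b \<in> borel_measurable borel" for b using g(1)[of b] by simp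
  let ?U = "\<lambda>x. indicator \<Omega> x *\<^sub>R (\<Sum>b\<in>Basis. g b x *\<^sub>R b)"
  have "AE x in lborel. \<forall>b\<in>Basis. ?u x \<bullet> b = g b x"
    using g(2) by (intro AE_finite_allI) auto
  then have "AE x in lborel. x \<in> \<Omega> \<longrightarrow> ?U x = u x"
  proof eventually_elim
    fix x assume *: "\<forall>b\<in>Basis. ?u x \<bullet> b = g b x"
    show "x \<in> \<Omega> \<longrightarrow> ?U x = u x"
    proof
      assume x: "x \<in> \<Omega>"
      have "(\<Sum>b\<in>Basis. g b x *\<^sub>R b) = (\<Sum>b\<in>Basis. (u x \<bullet> b) *\<^sub>R b)"
        using * x by (intro sum.cong refl) auto
      then show "?U x = u x" using x by (simp add: euclidean_representation)
    qed
  qed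
  then have "rep \<Omega> u ?U" by (auto simp: rep_def)
  then show ?thesis by blast
qed

lemma rep_lebesgue_measurable:
  assumes O: "open \<Omega>" and r: "rep \<Omega> u U"
  shows "u \<in> borel_measurable (lebesgue_on \<Omega>)"
proof -
  have OL: "\<Omega> \<in> sets lebesgue" using O by auto
  have U: "U \<in> borel_measurable lebesgue" using rep_measurable[OF r] by (auto intro: measurable_completion)
  have "AE x in lborel. x \<in> \<Omega> \<longrightarrow> U x = u x" using r by (simp add: rep_def)
  then have "AE x in lborel. U x = (if x \<in> \<Omega> then u x else 0)"
    by eventually_elim (use r in \<open>auto simp: rep_def\<close>)
  then have "AE x in lebesgue. U x = (if x \<in> \<Omega> then u x else 0)" by (rule AE_completion)
  from borel_measurable_AE[OF U this] show ?thesis using OL by (simp add: borel_measurable_if)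
qed

text \<open>The bridge from \<open>lebesgue_on\<close> to \<open>lborel\<close>: statements about
  functions on \<Omega> become statements about Borel functions on the whole space.\<close>

lemma integral_lebesgue_on_rep:
  fixes f :: "'a::euclidean_space \<Rightarrow> real"
  assumes O: "open \<Omega>" and r: "rep \<Omega> f F"
  shows "(\<integral>x. f x \<partial>lebesgue_on \<Omega>) = (\<integral>x. F x \<partial>lborel)"
    and "integrable (lebesgue_on \<Omega>) f \<longleftrightarrow> integrable lborel F"
proof -
  have OL: "\<Omega> \<in> sets lebesgue" using O by auto
  have F: "F \<in> borel_measurable borel" by (rule rep_measurable[OF r])
  have FL: "F \<in> borel_measurable lebesgue" using F by (auto intro: measurable_completion)
  have "(\<lambda>x. if x \<in> \<Omega> then f x else 0) \<in> borel_measurable lebesgue"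
    using rep_lebesgue_measurable[OF O r] OL by (simp add: borel_measurable_if)
  moreover have ie: "(\<lambda>x. if x \<in> \<Omega> then f x else 0) = (\<lambda>x. indicator \<Omega> x *\<^sub>R f x)"
    by (auto simp: fun_eq_iff)
  ultimately have iL: "(\<lambda>x. indicator \<Omega> x *\<^sub>R f x) \<in> borel_measurable lebesgue" by simp
  have "AE x in lborel. x \<in> \<Omega> \<longrightarrow> F x = f x" using r by (simp add: rep_def)
  then have "AE x in lborel. indicator \<Omega> x *\<^sub>R f x = F x"
    by eventually_elim (use r in \<open>auto simp: rep_def indicator_def\<close>)
  then have ae: "AE x in lebesgue. indicator \<Omega> x *\<^sub>R f x = F x" by (rule AE_completion)
  have "(\<integral>x. f x \<partial>lebesgue_on \<Omega>) = (\<integral>x. indicator \<Omega> x *\<^sub>R f x \<partial>lebesgue)"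
    using OL by (simp add: integral_restrict_space)
  also have "\<dots> = (\<integral>x. F x \<partial>lebesgue)" by (rule integral_cong_AE[OF iL FL ae])
  also have "\<dots> = (\<integral>x. F x \<partial>lborel)" using F by (simp add: integral_completion)
  finally show "(\<integral>x. f x \<partial>lebesgue_on \<Omega>) = (\<integral>x. F x \<partial>lborel)" .
  have "integrable (lebesgue_on \<Omega>) f \<longleftrightarrow> integrable lebesgue (\<lambda>x. indicator \<Omega> x *\<^sub>R f x)"
    using OL by (simp add: integrable_restrict_space)
  also have "\<dots> \<longleftrightarrow> integrable lebesgue F" by (rule integrable_cong_AE[OF iL FL ae])
  also have "\<dots> \<longleftrightarrow> integrable lborel F" using F by (simp add: integrable_completion)
  finally show "integrable (lebesgue_on \<Omega>) f \<longleftrightarrow> integrable lborel F" .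
qed

lemma rep_norm_sq: "rep \<Omega> u U \<Longrightarrow> rep \<Omega> (\<lambda>x. (norm (u x))\<^sup>2) (\<lambda>x. (norm (U x))\<^sup>2)"
  unfolding rep_def by (auto elim!: eventually_mono)

lemma rep_diff: "rep \<Omega> u U \<Longrightarrow> rep \<Omega> v V \<Longrightarrow> rep \<Omega> (\<lambda>x. u x - v x) (\<lambda>x. U x - V x)"
  unfolding rep_def by (auto elim: eventually_elim2)

lemma integrable_iff_nsq:
  fixes U :: "'a::euclidean_space \<Rightarrow> 'b::euclidean_space"
  assumes [measurable]: "U \<in> borel_measurable borel"
  shows "integrable lborel (\<lambda>x. (norm (U x))\<^sup>2) \<longleftrightarrow> nsq U < \<infinity>"
  unfolding nsq_def by (subst integrable_iff_bounded) auto

lemma rep_L2_iff: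
  assumes O: "open \<Omega>" and r: "rep \<Omega> u U"
  shows "u \<in> L2 \<Omega> \<longleftrightarrow> nsq U < \<infinity>"
  using rep_lebesgue_measurable[OF O r] integral_lebesgue_on_rep(2)[OF O rep_norm_sq[OF r]]
    integrable_iff_nsq[OF rep_measurable[OF r]] by (simp add: L2_def)

lemma rep_integral_eq_nsq:
  assumes O: "open \<Omega>" and r: "rep \<Omega> u U" and fin: "nsq U < \<infinity>"
  shows "ennreal (\<integral>x. (norm (u x))\<^sup>2 \<partial>lebesgue_on \<Omega>) = nsq U"
proof -
  have "integrable lborel (\<lambda>x. (norm (U x))\<^sup>2)" using fin integrable_iff_nsq[OF rep_measurable[OF r]] by simp
  then have "nsq U = ennreal (\<integral>x. (norm (U x))\<^sup>2 \<partial>lborel)"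
    unfolding nsq_def by (rule nn_integral_eq_integral) auto
  then show ?thesis using integral_lebesgue_on_rep(1)[OF O rep_norm_sq[OF r]] by simp
qed

lemma rep_L2_norm:
  assumes O: "open \<Omega>" and r: "rep \<Omega> u U" and fin: "nsq U < \<infinity>"
  shows "ennreal ((L2_norm \<Omega> u)\<^sup>2) = nsq U"
proof -
  have "0 \<le> (\<integral>x. (norm (u x))\<^sup>2 \<partial>lebesgue_on \<Omega>)" by (rule integral_nonneg_AE) auto
  then show ?thesis using rep_integral_eq_nsq[OF assms] by (simp add: L2_norm_def)
qed

lemma rep_L2_norm_tendsto:
  assumes O: "open \<Omega>" and r: "\<And>n. rep \<Omega> (u n) (U n)" and fin: "\<And>n. nsq (U n) < \<infinity>"
  shows "(\<lambda>n. L2_norm \<Omega> (u n)) \<longlonglongrightarrow> 0 \<longleftrightarrow> (\<lambda>n. nsq (U n)) \<longlonglongrightarrow> 0"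
proof
  assume "(\<lambda>n. L2_norm \<Omega> (u n)) \<longlonglongrightarrow> 0"
  then have "(\<lambda>n. ennreal ((L2_norm \<Omega> (u n))\<^sup>2)) \<longlonglongrightarrow> ennreal (0\<^sup>2)" by (intro tendsto_ennrealI tendsto_power)
  then show "(\<lambda>n. nsq (U n)) \<longlonglongrightarrow> 0" using rep_L2_norm[OF O r fin] by simp
next
  assume "(\<lambda>n. nsq (U n)) \<longlonglongrightarrow> 0"
  then have "(\<lambda>n. enn2real (ennreal ((L2_norm \<Omega> (u n))\<^sup>2))) \<longlonglongrightarrow> 0"
    using tendsto_enn2real[of "\<lambda>n. nsq (U n)" 0 sequentially] rep_L2_norm[OF O r fin] by simp
  then have "(\<lambda>n. sqrt ((L2_norm \<Omega> (u n))\<^sup>2)) \<longlonglongrightarrow> sqrt 0" by (intro tendsto_real_sqrt) simp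
  then show "(\<lambda>n. L2_norm \<Omega> (u n)) \<longlonglongrightarrow> 0" by (simp add: L2_norm_def integral_nonneg_AE)
qed

text \<open>Substitute y = x + h and exchange the integrals; the inner integral in x is then
  \<open>Phi U h\<close> times the kernel.\<close>

lemma Fs_eq_frac_energy:
  fixes u :: "'a::euclidean_space \<Rightarrow> real"
  assumes r: "rep \<Omega> u U"
  shows "Fs \<Omega> s u = ennreal (1/2) * frac_energy s (Phi U)"
proof -
  have [measurable]: "U \<in> borel_measurable borel" by (rule rep_measurable[OF r])
  let ?p = "real DIM('a) + 2 * s"
  have "AE x in lborel. x \<in> \<Omega> \<longrightarrow> U x = u x" using r by (simp add: rep_def)
  then have ae: "AE x in lborel. zero_ext \<Omega> u x = U x"
    by eventually_elim (use r in \<open>auto simp: rep_def zero_ext_def\<close>)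
  have "(\<integral>\<^sup>+ x. (\<integral>\<^sup>+ y. ennreal (\<bar>zero_ext \<Omega> u x - zero_ext \<Omega> u y\<bar>\<^sup>2 / norm (x - y) powr ?p) \<partial>lebesgue) \<partial>lebesgue)
    = (\<integral>\<^sup>+ x. (\<integral>\<^sup>+ y. ennreal (\<bar>zero_ext \<Omega> u x - zero_ext \<Omega> u y\<bar>\<^sup>2 / norm (x - y) powr ?p) \<partial>lborel) \<partial>lborel)"
    by (simp only: nn_integral_completion)
  also have "\<dots> = (\<integral>\<^sup>+ x. (\<integral>\<^sup>+ y. ennreal (\<bar>U x - U y\<bar>\<^sup>2 / norm (x - y) powr ?p) \<partial>lborel) \<partial>lborel)"
  proof (rule nn_integral_cong_AE)
    show "AE x in lborel. (\<integral>\<^sup>+ y. ennreal (\<bar>zero_ext \<Omega> u x - zero_ext \<Omega> u y\<bar>\<^sup>2 / norm (x - y) powr ?p) \<partial>lborel)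
       = (\<integral>\<^sup>+ y. ennreal (\<bar>U x - U y\<bar>\<^sup>2 / norm (x - y) powr ?p) \<partial>lborel)"
      using ae
    proof eventually_elim
      fix x assume x: "zero_ext \<Omega> u x = U x"
      show "(\<integral>\<^sup>+ y. ennreal (\<bar>zero_ext \<Omega> u x - zero_ext \<Omega> u y\<bar>\<^sup>2 / norm (x - y) powr ?p) \<partial>lborel)
       = (\<integral>\<^sup>+ y. ennreal (\<bar>U x - U y\<bar>\<^sup>2 / norm (x - y) powr ?p) \<partial>lborel)"
        by (rule nn_integral_cong_AE) (use ae x in \<open>auto elim!: eventually_mono\<close>)
    qed
  qed
  also have "\<dots> = (\<integral>\<^sup>+ x. (\<integral>\<^sup>+ h. ennreal ((norm (U (x + h) - U x))\<^sup>2) * ennreal (norm h powr - ?p) \<partial>lborel) \<partial>lborel)"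
  proof (rule nn_integral_cong)
    fix x
    have "(\<integral>\<^sup>+ y. ennreal (\<bar>U x - U y\<bar>\<^sup>2 / norm (x - y) powr ?p) \<partial>lborel)
       = (\<integral>\<^sup>+ h. ennreal (\<bar>U x - U (h + x)\<bar>\<^sup>2 / norm (x - (h + x)) powr ?p) \<partial>lborel)"
      by (rule nn_integral_lborel_shift[symmetric]) measurable
    also have "\<dots> = (\<integral>\<^sup>+ h. ennreal ((norm (U (x + h) - U x))\<^sup>2) * ennreal (norm h powr - ?p) \<partial>lborel)"
    proof (rule nn_integral_cong)
      fix h
      have "ennreal (\<bar>U x - U (h + x)\<bar>\<^sup>2 / norm (x - (h + x)) powr ?p) = ennreal ((norm (U (x + h) - U x))\<^sup>2 * norm h powr - ?p)"
        unfolding powr_minus_divide by (simp add: add.commute abs_minus_commute power2_commute)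
      then show "ennreal (\<bar>U x - U (h + x)\<bar>\<^sup>2 / norm (x - (h + x)) powr ?p) = ennreal ((norm (U (x + h) - U x))\<^sup>2) * ennreal (norm h powr - ?p)"
        by (simp add: ennreal_mult)
    qed
    finally show "(\<integral>\<^sup>+ y. ennreal (\<bar>U x - U y\<bar>\<^sup>2 / norm (x - y) powr ?p) \<partial>lborel)
       = (\<integral>\<^sup>+ h. ennreal ((norm (U (x + h) - U x))\<^sup>2) * ennreal (norm h powr - ?p) \<partial>lborel)" .
  qed
  also have "\<dots> = (\<integral>\<^sup>+ h. (\<integral>\<^sup>+ x. ennreal ((norm (U (x + h) - U x))\<^sup>2) * ennreal (norm h powr - ?p) \<partial>lborel) \<partial>lborel)"
    by (rule lborel_pair.Fubini'[symmetric]) measurable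
  also have "\<dots> = frac_energy s (Phi U)"
    unfolding frac_energy_def Phi_def nsq_def
    by (intro nn_integral_cong nn_integral_multc) measurable
  finally show ?thesis unfolding Fs_def by simp
qed

section \<open>Test functions, difference quotients and integration by parts\<close>

lemma test_functions_iff:
  "\<phi> \<in> test_functions \<Omega> \<longleftrightarrow> smooth_compact \<phi> \<and> closure {x. \<phi> x \<noteq> 0} \<subseteq> \<Omega>"
  by (auto simp: test_functions_def smooth_compact_def smooth_def)

lemma test_smooth_compact: "\<phi> \<in> test_functions \<Omega> \<Longrightarrow> smooth_compact \<phi>"
  by (simp add: test_functions_iff)

lemma smooth_compact_differentiable: "smooth_compact \<phi> \<Longrightarrow> \<phi> differentiable (at x)"
  by (auto simp: smooth_compact_def intro: smooth_differentiable)

lemma smooth_compact_measurable: "smooth_compact \<phi> \<Longrightarrow> \<phi> \<in> borel_measurable borel"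
  by (auto simp: smooth_compact_def intro: smooth_measurable)

lemma grad_measurable: "smooth_compact \<phi> \<Longrightarrow> grad \<phi> \<in> borel_measurable borel"
  unfolding grad_def[abs_def]
  by (intro borel_measurable_sum borel_measurable_scaleR smooth_compact_measurable smooth_compact_ddir) auto

lemma test_zero_outside: "\<phi> \<in> test_functions \<Omega> \<Longrightarrow> x \<notin> \<Omega> \<Longrightarrow> \<phi> x = 0"
  using closure_subset[of "{x. \<phi> x \<noteq> 0}"] by (auto simp: test_functions_iff)

lemma ddir_zero_outside_test: "\<phi> \<in> test_functions \<Omega> \<Longrightarrow> x \<notin> \<Omega> \<Longrightarrow> ddir \<phi> v x = 0"
  by (rule ddir_zero_outside) (auto simp: test_functions_iff)

lemma grad_zero_outside_test: "\<phi> \<in> test_functions \<Omega> \<Longrightarrow> x \<notin> \<Omega> \<Longrightarrow> grad \<phi> x = 0"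
  by (simp add: grad_def ddir_zero_outside_test)

lemma rep_test: "\<phi> \<in> test_functions \<Omega> \<Longrightarrow> rep \<Omega> \<phi> \<phi>"
  by (rule rep_self) (auto intro: smooth_compact_measurable test_smooth_compact test_zero_outside)

lemma rep_grad_test: "\<phi> \<in> test_functions \<Omega> \<Longrightarrow> rep \<Omega> (grad \<phi>) (grad \<phi>)"
  by (rule rep_self) (auto intro: grad_measurable test_smooth_compact grad_zero_outside_test)

lemma test_lincomb:
  assumes "\<phi> \<in> test_functions \<Omega>" "\<psi> \<in> test_functions \<Omega>"
  shows "(\<lambda>x. a * \<phi> x + b * \<psi> x) \<in> test_functions \<Omega>"
proof -
  let ?f = "\<lambda>x. a * \<phi> x + b * \<psi> x"
  have sub: "{x. ?f x \<noteq> 0} \<subseteq> {x. \<phi> x \<noteq> 0} \<union> {x. \<psi> x \<noteq> 0}" by auto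
  have "smooth ?f" using assms by (intro smooth_add smooth_cmult) (auto simp: test_functions_iff smooth_compact_def)
  moreover have "bounded {x. ?f x \<noteq> 0}"
    by (rule bounded_subset[OF _ sub]) (use assms in \<open>auto simp: test_functions_iff smooth_compact_def\<close>)
  moreover have "closure {x. ?f x \<noteq> 0} \<subseteq> \<Omega>"
    using closure_mono[OF sub] assms by (auto simp: test_functions_iff)
  ultimately show ?thesis by (simp add: test_functions_iff smooth_compact_def)
qed

lemma grad_lincomb:
  assumes "smooth_compact \<phi>" "smooth_compact \<psi>"
  shows "grad (\<lambda>x. a * \<phi> x + b * \<psi> x) x = a *\<^sub>R grad \<phi> x + b *\<^sub>R grad \<psi> x"
proof -
  have "((\<lambda>x. a * \<phi> x + b * \<psi> x) has_derivative (\<lambda>v. a * ddir \<phi> v x + b * ddir \<psi> v x)) (at x)"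
    using assms by (intro has_derivative_add has_derivative_mult_right smooth_has_derivative) (auto simp: smooth_compact_def)
  from ddir_eqI[OF this] show ?thesis
    by (simp add: grad_def scaleR_sum_right sum.distrib[symmetric] scaleR_add_left)
qed

lemma nsq_bounded_support:
  fixes f :: "'a::euclidean_space \<Rightarrow> 'b::euclidean_space"
  assumes bd: "\<And>x. norm (f x) \<le> C" and supp: "\<And>x. norm x > R \<Longrightarrow> f x = 0"
  shows "nsq f \<le> ennreal (C\<^sup>2) * emeasure lborel (cball (0::'a) R)"
proof -
  have "nsq f \<le> (\<integral>\<^sup>+x. ennreal (C\<^sup>2) * indicator (cball (0::'a) R) x \<partial>lborel)"
    unfolding nsq_def
  proof (rule nn_integral_mono)
    fix x
    show "ennreal ((norm (f x))\<^sup>2) \<le> ennreal (C\<^sup>2) * indicator (cball 0 R) x"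
    proof (cases "norm x \<le> R")
      case True
      then show ?thesis using bd[of x] by (auto intro!: ennreal_leI power_mono)
    next
      case False
      then show ?thesis using supp[of x] by simp
    qed
  qed
  also have "\<dots> = ennreal (C\<^sup>2) * emeasure lborel (cball (0::'a) R)"
    by (simp add: nn_integral_cmult_indicator)
  finally show ?thesis .
qed

text \<open>The two facts behind L2 estimates of the Taylor remainder: it is uniformly of second
  order in h, and its support lies in a ball that grows only by |h|.\<close>

lemma smooth_compact_difference_bound:
  assumes f: "smooth_compact f"
  shows "\<exists>C\<ge>0. \<exists>R\<ge>0. (\<forall>x h. \<bar>f (x + h) - f x - grad f x \<bullet> h\<bar> \<le> C * (norm h)\<^sup>2) \<and>
     (\<forall>x h. norm x > R + norm h \<longrightarrow> f (x + h) - f x - grad f x \<bullet> h = 0) \<and> (\<forall>x. norm x > R \<longrightarrow> f x = 0)"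
proof -
  obtain C where C: "C \<ge> 0" "\<And>x y. \<bar>f y - f x - grad f x \<bullet> (y - x)\<bar> \<le> C * (norm (y - x))\<^sup>2"
    using smooth_compact_taylor[OF f] by auto
  have "bounded (closure {x. f x \<noteq> 0})" using f by (simp add: smooth_compact_def bounded_closure)
  then obtain R where R: "R > 0" "\<And>x. x \<in> closure {x. f x \<noteq> 0} \<Longrightarrow> norm x \<le> R"
    unfolding bounded_pos by auto
  have f0: "f x = 0" if "norm x > R" for x using R(2)[of x] closure_subset[of "{x. f x \<noteq> 0}"] that by force
  have g0: "grad f x = 0" if "norm x > R" for x
    unfolding grad_def using ddir_zero_outside[of x f] R(2)[of x] that by force
  have "f (x + h) - f x - grad f x \<bullet> h = 0" if "norm x > R + norm h" for x h
  proof -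
    have "norm (x + h) \<ge> norm x - norm h" by (metis norm_diff_ineq)
    then have "norm (x + h) > R" "norm x > R" using that norm_ge_zero[of h] by linarith+
    then show ?thesis by (simp add: f0 g0)
  qed
  then show ?thesis using C(1) C(2)[of "x + h" x for x h] R(1) f0
    by (intro exI[of _ C] conjI exI[of _ R]) auto
qed

text \<open>The error is 2^k times a Taylor remainder for the increment h/2^k, hence at most C |h|^2
  / 2^k, and it vanishes outside one ball common to all k.\<close>

lemma nsq_difference_quotient_tendsto:
  assumes f: "smooth_compact f"
  shows "(\<lambda>k. nsq (\<lambda>x. 2^k * (f (x + (1/2)^k *\<^sub>R h) - f x) - grad f x \<bullet> h)) \<longlonglongrightarrow> 0"
proof -
  obtain C R where C: "C \<ge> 0" "\<And>x h. \<bar>f (x + h) - f x - grad f x \<bullet> h\<bar> \<le> C * (norm h)\<^sup>2"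
    and R: "\<And>x h. norm x > R + norm h \<Longrightarrow> f (x + h) - f x - grad f x \<bullet> h = 0"
    using smooth_compact_difference_bound[OF f] by blast
  let ?e = "\<lambda>k x. 2^k * (f (x + (1/2)^k *\<^sub>R h) - f x) - grad f x \<bullet> h"
  let ?V = "emeasure lborel (cball (0::'a) (R + norm h))"
  have e: "?e k x = 2^k * (f (x + (1/2)^k *\<^sub>R h) - f x - grad f x \<bullet> ((1/2)^k *\<^sub>R h))" for k x
    by (simp add: power_one_over field_simps)
  have le: "nsq (?e k) \<le> ennreal ((C * (norm h)\<^sup>2 * (1/2)^k)\<^sup>2) * ?V" for k
  proof (rule nsq_bounded_support)
    fix x
    have "\<bar>?e k x\<bar> \<le> 2^k * (C * (norm ((1/2)^k *\<^sub>R h))\<^sup>2)"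
      unfolding e abs_mult using C(2)[of x "(1/2)^k *\<^sub>R h"] by (simp del: inner_scaleR_right)
    also have "\<dots> = C * (norm h)\<^sup>2 * (1/2)^k" by (simp add: power_mult_distrib power_one_over field_simps power2_eq_square)
    finally show "norm (?e k x) \<le> C * (norm h)\<^sup>2 * (1/2)^k" by simp
  next
    fix x :: 'a assume x: "norm x > R + norm h"
    have "(1/2)^k * norm h \<le> 1 * norm h" by (intro mult_right_mono) (auto simp: power_le_one)
    then have "norm ((1/2)^k *\<^sub>R h) \<le> norm h" by simp
    then show "?e k x = 0" unfolding e using x R by simp
  qed
  have "(\<lambda>k. (C * (norm h)\<^sup>2 * (1/2)^k)\<^sup>2) \<longlonglongrightarrow> (C * (norm h)\<^sup>2 * 0)\<^sup>2"
    by (intro tendsto_intros LIMSEQ_power_zero) auto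
  then have "(\<lambda>k. ennreal ((C * (norm h)\<^sup>2 * (1/2)^k)\<^sup>2)) \<longlonglongrightarrow> 0"
    using tendsto_ennrealI by fastforce
  then have "(\<lambda>k. ?V * ennreal ((C * (norm h)\<^sup>2 * (1/2)^k)\<^sup>2)) \<longlonglongrightarrow> ?V * 0"
    by (intro ennreal_tendsto_cmult) (use emeasure_lborel_cball_finite[of "0::'a" "R + norm h"] in auto)
  then have l: "(\<lambda>k. ennreal ((C * (norm h)\<^sup>2 * (1/2)^k)\<^sup>2) * ?V) \<longlonglongrightarrow> 0" by (simp add: mult.commute)
  show ?thesis
    by (rule tendsto_sandwich[OF _ _ tendsto_const l]; rule always_eventually; rule allI) (simp, rule le)
qed

lemma nsq_difference_quotient:
  fixes f :: "'a::euclidean_space \<Rightarrow> real"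
  assumes [measurable]: "f \<in> borel_measurable borel"
  shows "nsq (\<lambda>x. 2^k * (f (x + (1/2)^k *\<^sub>R h) - f x)) = 4^k * Phi f ((1/2)^k *\<^sub>R h)"
proof -
  have "nsq (\<lambda>x. 2^k *\<^sub>R (f (x + (1/2)^k *\<^sub>R h) - f x)) = ennreal ((2^k)\<^sup>2) * nsq (\<lambda>x. f (x + (1/2)^k *\<^sub>R h) - f x)"
    by (rule nsq_scaleR) measurable
  moreover have "ennreal ((2^k)\<^sup>2) = 4^k"
    by (simp add: power2_eq_square power_mult_distrib[symmetric] ennreal_power[symmetric])
  ultimately show ?thesis by (simp add: Phi_def)
qed

lemma smooth_compact_nsq_finite: "smooth_compact f \<Longrightarrow> nsq f < \<infinity>"
proof -
  assume f: "smooth_compact f"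
  obtain C where C: "\<And>x. \<bar>f x\<bar> \<le> C" using smooth_compact_bounded[OF f] by auto
  obtain R where "\<And>x. norm x > R \<Longrightarrow> f x = 0" using smooth_compact_difference_bound[OF f] by blast
  then have "nsq f \<le> ennreal (C\<^sup>2) * emeasure lborel (cball (0::'a) R)"
    using C by (intro nsq_bounded_support) auto
  also have "\<dots> < \<infinity>" using emeasure_lborel_cball_finite[of "0::'a" R] by (simp add: ennreal_mult_less_top)
  finally show ?thesis .
qed

lemma smooth_compact_grad_nsq_finite: "smooth_compact f \<Longrightarrow> nsq (grad f) < \<infinity>"
proof -
  assume f: "smooth_compact f"
  obtain C where C: "\<And>x. norm (grad f x) \<le> C" using grad_bounded[OF f] by auto
  have "bounded (closure {x. f x \<noteq> 0})" using f by (simp add: smooth_compact_def bounded_closure)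
  then obtain R where R: "\<And>x. x \<in> closure {x. f x \<noteq> 0} \<Longrightarrow> norm x \<le> R"
    unfolding bounded_pos by auto
  have "grad f x = 0" if "norm x > R" for x
    unfolding grad_def using ddir_zero_outside[of x f] R[of x] that by force
  then have "nsq (grad f) \<le> ennreal (C\<^sup>2) * emeasure lborel (cball (0::'a) R)"
    using C by (intro nsq_bounded_support) auto
  also have "\<dots> < \<infinity>" using emeasure_lborel_cball_finite[of "0::'a" R] by (simp add: ennreal_mult_less_top)
  finally show ?thesis .
qed

lemma nsq_inner_le:
  fixes G :: "'a::euclidean_space \<Rightarrow> 'a"
  assumes [measurable]: "G \<in> borel_measurable borel"
  shows "nsq (\<lambda>x. G x \<bullet> h) \<le> ennreal ((norm h)\<^sup>2) * nsq G"
proof -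
  have "nsq (\<lambda>x. G x \<bullet> h) \<le> nsq (\<lambda>x. norm h *\<^sub>R G x)"
    using Cauchy_Schwarz_ineq2[of "G x" h for x] by (intro nsq_mono) (simp add: mult.commute)
  also have "\<dots> = ennreal ((norm h)\<^sup>2) * nsq G" by (rule nsq_scaleR) auto
  finally show ?thesis .
qed

text \<open>For the product F the integral of F(x + t v) - F x vanishes by translation invariance,
  so t times the integral of the derivative is, up to sign, a Taylor remainder of order t^2.
  Dividing by t and letting t tend to 0 shows that the derivative of F integrates to 0; the product
  rule does the rest.\<close>

lemma integral_by_parts:
  assumes f: "smooth_compact f" and g: "smooth_compact g"
  shows "(\<integral>x. f x * ddir g v x \<partial>lborel) = - (\<integral>x. ddir f v x * g x \<partial>lborel)"
proof -
  define F where "F x = f x * g x" for x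
  have sF: "smooth_compact F" unfolding F_def using f g
    by (auto simp: smooth_compact_def intro: smooth_mult bounded_subset)
  have dF: "ddir F v x = f x * ddir g v x + ddir f v x * g x" for x
  proof -
    have "(F has_derivative (\<lambda>v. f x * ddir g v x + ddir f v x * g x)) (at x)"
      unfolding F_def using f g by (intro has_derivative_mult smooth_has_derivative) (auto simp: smooth_compact_def)
    from ddir_eqI[OF this] show ?thesis .
  qed
  have smul: "smooth_compact (\<lambda>x. p x * q x)" if "smooth_compact p" "smooth_compact q" for p q :: "'a \<Rightarrow> real"
    using that by (auto simp: smooth_compact_def intro: smooth_mult bounded_subset)
  have iF: "integrable lborel F" by (rule smooth_compact_integrable[OF sF])
  have [measurable]: "F \<in> borel_measurable borel" by (rule smooth_compact_measurable[OF sF])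
  have idF: "integrable lborel (ddir F v)" by (rule smooth_compact_integrable[OF smooth_compact_ddir[OF sF]])
  have shift: "(\<integral>x. F (x + h) \<partial>lborel) = (\<integral>x. F x \<partial>lborel)" "integrable lborel (\<lambda>x. F (x + h))" for h
  proof -
    have d: "distr lborel borel ((+) h) = (lborel :: 'a measure)" by (rule lborel_distr_plus)
    have "(\<integral>x. F x \<partial>lborel) = (\<integral>x. F x \<partial>(distr lborel borel ((+) h)))" by (simp only: d)
    then show "(\<integral>x. F (x + h) \<partial>lborel) = (\<integral>x. F x \<partial>lborel)" by (subst (asm) integral_distr) (auto simp: add.commute)
    have "integrable (distr lborel borel ((+) h)) F" using iF by (simp only: d)
    then show "integrable lborel (\<lambda>x. F (x + h))" by (subst (asm) integrable_distr_eq) (auto simp: add.commute)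
  qed
  obtain C R where C: "C \<ge> 0" "\<And>x h. \<bar>F (x + h) - F x - grad F x \<bullet> h\<bar> \<le> C * (norm h)\<^sup>2"
    and R: "\<And>x h. norm x > R + norm h \<Longrightarrow> F (x + h) - F x - grad F x \<bullet> h = 0"
    using smooth_compact_difference_bound[OF sF] by blast
  let ?V = "measure lborel (cball (0::'a) (R + norm v))"
  have bd: "\<bar>\<integral>x. ddir F v x \<partial>lborel\<bar> \<le> t * (C * (norm v)\<^sup>2 * ?V)" if t: "0 < t" "t \<le> 1" for t
  proof -
    have d: "ddir F (t *\<^sub>R v) x = t * ddir F v x" for x
      by (simp add: ddir_eq_grad[OF smooth_compact_differentiable[OF sF]])
    have i3: "integrable lborel (\<lambda>x. F (x + t *\<^sub>R v) - F x - t * ddir F v x)"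
      by (intro Bochner_Integration.integrable_diff shift iF integrable_mult_right idF)
    have tI: "t * (\<integral>x. ddir F v x \<partial>lborel) = - (\<integral>x. F (x + t *\<^sub>R v) - F x - t * ddir F v x \<partial>lborel)"
      using shift(2)[of "t *\<^sub>R v"] iF idF by (simp add: Bochner_Integration.integral_diff shift(1))
    have "t * \<bar>\<integral>x. ddir F v x \<partial>lborel\<bar> = \<bar>\<integral>x. F (x + t *\<^sub>R v) - F x - t * ddir F v x \<partial>lborel\<bar>"
      using arg_cong[OF tI, of abs] t by (simp only: abs_mult abs_minus_cancel abs_of_pos)
    also have "\<dots> \<le> (\<integral>x. norm (F (x + t *\<^sub>R v) - F x - t * ddir F v x) \<partial>lborel)"
      using integral_norm_bound[of lborel "\<lambda>x. F (x + t *\<^sub>R v) - F x - t * ddir F v x"] by simp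
    also have "\<dots> \<le> (\<integral>x. (C * (t\<^sup>2 * (norm v)\<^sup>2)) * indicator (cball (0::'a) (R + norm v)) x \<partial>lborel)"
    proof (rule integral_mono)
      show "integrable lborel (\<lambda>x. norm (F (x + t *\<^sub>R v) - F x - t * ddir F v x))" by (rule integrable_norm[OF i3])
      show "integrable lborel (\<lambda>x::'a. (C * (t\<^sup>2 * (norm v)\<^sup>2)) * indicator (cball 0 (R + norm v)) x)"
        using emeasure_lborel_cball_finite[of "0::'a" "R + norm v"]
        by (intro integrable_mult_right integrable_real_indicator) auto
      fix x
      have eq: "F (x + t *\<^sub>R v) - F x - t * ddir F v x = F (x + t *\<^sub>R v) - F x - grad F x \<bullet> (t *\<^sub>R v)"
        by (simp add: ddir_eq_grad[OF smooth_compact_differentiable[OF sF]])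
      show "norm (F (x + t *\<^sub>R v) - F x - t * ddir F v x) \<le> (C * (t\<^sup>2 * (norm v)\<^sup>2)) * indicator (cball 0 (R + norm v)) x"
      proof (cases "norm x \<le> R + norm v")
        case True
        then show ?thesis using C(2)[of x "t *\<^sub>R v"] unfolding eq by (simp add: power_mult_distrib)
      next
        case False
        have "t * norm v \<le> 1 * norm v" using t by (intro mult_right_mono) auto
        then have "norm x > R + norm (t *\<^sub>R v)" using False t by simp
        then show ?thesis unfolding eq using R[of "t *\<^sub>R v" x] C(1) by simp
      qed
    qed
    also have "\<dots> = (C * (t\<^sup>2 * (norm v)\<^sup>2)) * ?V" by simp
    finally have "t * \<bar>\<integral>x. ddir F v x \<partial>lborel\<bar> \<le> t * (t * (C * (norm v)\<^sup>2 * ?V))"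
      by (simp add: power2_eq_square mult_ac)
    then show ?thesis using t by (simp add: mult_le_cancel_left_pos)
  qed
  have "(\<lambda>n. inverse (real (Suc n)) * (C * (norm v)\<^sup>2 * ?V)) \<longlonglongrightarrow> 0 * (C * (norm v)\<^sup>2 * ?V)"
    by (intro tendsto_mult LIMSEQ_inverse_real_of_nat tendsto_const)
  then have "\<bar>\<integral>x. ddir F v x \<partial>lborel\<bar> \<le> 0 * (C * (norm v)\<^sup>2 * ?V)"
    by (rule LIMSEQ_le_const) (intro exI[of _ 0] allI impI bd, auto simp: inverse_le_1_iff)
  then have "(\<integral>x. f x * ddir g v x + ddir f v x * g x \<partial>lborel) = 0" by (simp add: dF)
  moreover have "integrable lborel (\<lambda>x. f x * ddir g v x)" "integrable lborel (\<lambda>x. ddir f v x * g x)"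
    by (auto intro!: smooth_compact_integrable smul smooth_compact_ddir f g)
  ultimately show ?thesis by (simp add: Bochner_Integration.integral_add)
qed

section \<open>Pairings in L2, the fundamental lemma, uniqueness of weak gradients\<close>

lemma integrable_mult_L2:
  fixes f g :: "'a::euclidean_space \<Rightarrow> real"
  assumes [measurable]: "f \<in> borel_measurable borel" "g \<in> borel_measurable borel"
    and fin: "nsq f < \<infinity>" "nsq g < \<infinity>"
  shows "integrable lborel (\<lambda>x. f x * g x)"
proof (rule Bochner_Integration.integrable_bound)
  show "integrable lborel (\<lambda>x. (norm (f x))\<^sup>2 + (norm (g x))\<^sup>2)"
    using fin by (intro Bochner_Integration.integrable_add) (auto simp only: integrable_iff_nsq[OF assms(1)] integrable_iff_nsq[OF assms(2)])
  have "\<bar>a * b\<bar> \<le> a\<^sup>2 + b\<^sup>2" for a b :: real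
  proof -
    have "0 \<le> (\<bar>a\<bar> - \<bar>b\<bar>)\<^sup>2" by simp
    also have "\<dots> = a\<^sup>2 + b\<^sup>2 - 2 * (\<bar>a\<bar> * \<bar>b\<bar>)" by (simp add: power2_eq_square algebra_simps)
    finally have "2 * (\<bar>a\<bar> * \<bar>b\<bar>) \<le> a\<^sup>2 + b\<^sup>2" by linarith
    moreover have "0 \<le> \<bar>a\<bar> * \<bar>b\<bar>" by simp
    ultimately show ?thesis unfolding abs_mult by linarith
  qed
  then show "AE x in lborel. norm (f x * g x) \<le> norm ((norm (f x))\<^sup>2 + (norm (g x))\<^sup>2)" by simp
qed measurable

text \<open>Young's inequality splits the error into e |g|^2 and |F - f n|^2 / e. First e is fixed
  to make one part small, then n is taken large.\<close>

lemma integral_mult_tendsto: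
  fixes f :: "nat \<Rightarrow> 'a::euclidean_space \<Rightarrow> real"
  assumes [measurable]: "\<And>n. f n \<in> borel_measurable borel" "F \<in> borel_measurable borel" "g \<in> borel_measurable borel"
    and fin: "\<And>n. nsq (f n) < \<infinity>" "nsq F < \<infinity>" "nsq g < \<infinity>"
    and lim: "(\<lambda>n. nsq (\<lambda>x. F x - f n x)) \<longlonglongrightarrow> 0"
  shows "(\<lambda>n. \<integral>x. f n x * g x \<partial>lborel) \<longlonglongrightarrow> (\<integral>x. F x * g x \<partial>lborel)"
proof -
  let ?a = "\<lambda>n. enn2real (nsq (\<lambda>x. F x - f n x))"
  let ?b = "enn2real (nsq g)"
  have bd: "\<bar>(\<integral>x. f n x * g x \<partial>lborel) - (\<integral>x. F x * g x \<partial>lborel)\<bar> \<le> e * ?b + ?a n / e" if e: "e > 0" for e n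
  proof -
    have dfin: "nsq (\<lambda>x. F x - f n x) < \<infinity>"
      by (rule le_less_trans[OF nsq_diff]) (use fin ennreal_numeral_mult_finite in auto)
    have i: "integrable lborel (\<lambda>x. (norm (F x - f n x))\<^sup>2)" "integrable lborel (\<lambda>x. (norm (g x))\<^sup>2)"
      using dfin fin integrable_iff_nsq[of "\<lambda>x. F x - f n x"] integrable_iff_nsq[of g] by auto
    have val: "(\<integral>x. (norm (F x - f n x))\<^sup>2 \<partial>lborel) = ?a n" "(\<integral>x. (norm (g x))\<^sup>2 \<partial>lborel) = ?b"
      by (subst integral_eq_nn_integral; simp add: nsq_def)+
    have "(\<integral>x. f n x * g x \<partial>lborel) - (\<integral>x. F x * g x \<partial>lborel) = (\<integral>x. f n x * g x - F x * g x \<partial>lborel)"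
      by (intro Bochner_Integration.integral_diff[symmetric] integrable_mult_L2 fin) measurable
    also have "\<bar>\<dots>\<bar> \<le> (\<integral>x. norm (f n x * g x - F x * g x) \<partial>lborel)"
      using integral_norm_bound[of lborel "\<lambda>x. f n x * g x - F x * g x"] by simp
    also have "\<dots> \<le> (\<integral>x. e * (norm (g x))\<^sup>2 + (norm (F x - f n x))\<^sup>2 / e \<partial>lborel)"
    proof (rule integral_mono)
      show "integrable lborel (\<lambda>x. norm (f n x * g x - F x * g x))"
        by (intro integrable_norm Bochner_Integration.integrable_diff integrable_mult_L2 fin) measurable
      show "integrable lborel (\<lambda>x. e * (norm (g x))\<^sup>2 + (norm (F x - f n x))\<^sup>2 / e)"
        using i by auto
      fix x
      let ?p = "\<bar>F x - f n x\<bar>" and ?q = "\<bar>g x\<bar>"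
      have "0 \<le> (e * ?q - ?p)\<^sup>2 / e" using e by simp
      also have "\<dots> = e * ?q\<^sup>2 + ?p\<^sup>2 / e - 2 * (?p * ?q)" using e by (simp add: power2_eq_square field_simps)
      finally have "2 * (?p * ?q) \<le> e * ?q\<^sup>2 + ?p\<^sup>2 / e" by simp
      moreover have "0 \<le> ?p * ?q" by simp
      moreover have "norm (f n x * g x - F x * g x) = ?p * ?q"
        by (simp add: left_diff_distrib[symmetric] abs_mult abs_minus_commute)
      ultimately show "norm (f n x * g x - F x * g x) \<le> e * (norm (g x))\<^sup>2 + (norm (F x - f n x))\<^sup>2 / e" by simp
    qed
    also have "\<dots> = e * ?b + ?a n / e" using i val by simp
    finally show ?thesis .
  qed
  have a0: "?a \<longlonglongrightarrow> 0" using tendsto_enn2real[of _ 0, OF _ order_refl] lim by simp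
  have b0: "?b \<ge> 0" by simp
  show ?thesis
  proof (rule LIMSEQ_I)
    fix r :: real assume r: "r > 0"
    \<comment> \<open>The + 1 keeps the denominator positive when g vanishes.\<close>
    define e where "e = r / (2 * (?b + 1))"
    have e: "e > 0" using r b0 by (simp add: e_def add_nonneg_pos)
    have eb: "e * ?b < r / 2"
    proof -
      have "e * ?b < e * (?b + 1)" using e by simp
      also have "\<dots> = r / 2"
      proof -
        have "r / (2 * c) * c = r / 2" if "c \<noteq> 0" for c :: real using that by simp
        moreover have "?b + 1 \<noteq> 0" using b0 by linarith
        ultimately show ?thesis unfolding e_def by blast
      qed
      finally show ?thesis .
    qed
    obtain M where M: "\<And>n. n \<ge> M \<Longrightarrow> \<bar>?a n\<bar> < e * (r / 2)"
      using LIMSEQ_D[OF a0, of "e * (r/2)"] e r by auto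
    show "\<exists>no. \<forall>n\<ge>no. norm ((\<integral>x. f n x * g x \<partial>lborel) - (\<integral>x. F x * g x \<partial>lborel)) < r"
    proof (intro exI[of _ M] allI impI)
      fix n assume n: "n \<ge> M"
      have "?a n / e < r / 2" using M[OF n] e by (simp add: divide_less_eq mult.commute)
      then have "\<bar>(\<integral>x. f n x * g x \<partial>lborel) - (\<integral>x. F x * g x \<partial>lborel)\<bar> < r"
        using bd[OF e, of n] eb by linarith
      then show "norm ((\<integral>x. f n x * g x \<partial>lborel) - (\<integral>x. F x * g x \<partial>lborel)) < r" by simp
    qed
  qed
qed

text \<open>The indicator of a ball containing \<open>B\<close> supplies the second L2
  factor.\<close>

lemma integrable_of_L2_bounded_support:
  fixes f :: "'a::euclidean_space \<Rightarrow> real"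
  assumes [measurable]: "f \<in> borel_measurable borel" and fin: "nsq f < \<infinity>"
    and B: "bounded B" and supp: "\<And>x. x \<notin> B \<Longrightarrow> f x = 0"
  shows "integrable lborel f"
proof -
  obtain R where R: "\<And>x. x \<in> B \<Longrightarrow> norm x \<le> R" using B unfolding bounded_iff by auto
  have "integrable lborel (\<lambda>x. f x * indicator (cball 0 R) x)"
  proof (rule integrable_mult_L2[OF assms(1) _ fin])
    have "nsq (indicator (cball 0 R) :: 'a \<Rightarrow> real) \<le> ennreal (1\<^sup>2) * emeasure lborel (cball (0::'a) R)"
      by (rule nsq_bounded_support) (auto simp: indicator_def)
    also have "\<dots> < \<infinity>" using emeasure_lborel_cball_finite[of "0::'a" R] by simp
    finally show "nsq (indicator (cball 0 R) :: 'a \<Rightarrow> real) < \<infinity>" .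
  qed (auto intro: borel_measurable_indicator)
  moreover have "(\<lambda>x. f x * indicator (cball 0 R) x) = f"
    using R supp by (auto simp: fun_eq_iff indicator_def)
  ultimately show ?thesis by simp
qed

text \<open>The indicator of an open set is a bounded pointwise limit of test functions: take the
  points at distance at least 2 \<open>e n\<close> from the complement and smooth their indicator at
  scale \<open>e n\<close>. Dominated convergence applies with majorant |g|.\<close>

lemma integral_open_zero:
  fixes g :: "'a::euclidean_space \<Rightarrow> real"
  assumes bO: "bounded \<Omega>" and g: "integrable lborel g"
    and z: "\<And>\<psi>. \<psi> \<in> test_functions \<Omega> \<Longrightarrow> (\<integral>x. g x * \<psi> x \<partial>lborel) = 0"
    and W: "open W" "W \<subseteq> \<Omega>"
  shows "(\<integral>x. g x * indicator W x \<partial>lborel) = 0"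
proof -
  have [measurable]: "g \<in> borel_measurable borel" using borel_measurable_integrable[OF g] by simp
  have [measurable]: "W \<in> sets borel" using W by auto
  have Wn: "- W \<noteq> {}"
  proof
    assume "- W = {}"
    then have "W = UNIV" by auto
    then show False using bounded_subset[OF bO W(2)] not_bounded_UNIV by auto
  qed
  have cW: "closed (- W)" using W by auto
  have pos: "infdist x (- W) > 0" if "x \<in> W" for x
  proof -
    have "infdist x (- W) \<noteq> 0" using in_closed_iff_infdist_zero[OF cW Wn, of x] that by auto
    then show ?thesis using infdist_nonneg[of x "- W"] by linarith
  qed
  define e where "e n = inverse (real (Suc n))" for n
  have e0: "e n > 0" for n by (simp add: e_def)
  have elim: "e \<longlonglongrightarrow> 0" unfolding e_def[abs_def] by (rule LIMSEQ_inverse_real_of_nat)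
  \<comment> \<open>Twice the smoothing scale, so that the mollified indicator is still supported at
    a positive distance from the complement of W.\<close>
  define K where "K n = {x. 2 * e n \<le> infdist x (- W)}" for n
  have KW: "K n \<subseteq> W" for n
  proof
    fix x assume x: "x \<in> K n"
    then have "infdist x (- W) > 0" using e0[of n] by (simp add: K_def)
    then show "x \<in> W" using infdist_zero[of x "- W"] by (cases "x \<in> W") auto
  qed
  have Kc: "compact (K n)" for n
  proof -
    have "closed (K n)" unfolding K_def by (intro closed_Collect_le continuous_intros)
    moreover have "bounded (K n)" by (rule bounded_subset[OF bO]) (use KW W in blast)
    ultimately show ?thesis by (simp add: compact_eq_bounded_closed)
  qed
  have [measurable]: "K n \<in> sets borel" for n using Kc[of n] by (rule borel_compact)
  have "\<exists>\<rho> :: 'a \<Rightarrow> real. mollifier (e n) \<rho>" for n by (rule mollifier_exists[OF e0])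
  then obtain \<rho> :: "nat \<Rightarrow> 'a \<Rightarrow> real" where rho: "\<And>n. mollifier (e n) (\<rho> n)" by metis
  let ?f = "\<lambda>n. indicator (K n) :: 'a \<Rightarrow> real"
  define \<psi> where "\<psi> n = conv (\<rho> n) (?f n)" for n
  have fi: "integrable lborel (?f n)" for n
    using emeasure_compact_finite[OF Kc[of n]] by (intro integrable_real_indicator) auto
  have stay: "x + y \<in> W" if "x \<in> K n" "norm y \<le> e n" for x y n
  proof -
    have "infdist x (- W) \<le> infdist (x + y) (- W) + dist x (x + y)" by (rule infdist_triangle)
    then have "infdist (x + y) (- W) > 0" using that e0[of n] by (simp add: K_def dist_norm)
    then show ?thesis using infdist_zero[of "x + y" "- W"] by (cases "x + y \<in> W") auto
  qed
  have tW: "\<psi> n \<in> test_functions W" for n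
    unfolding \<psi>_def by (rule test_functions_conv[OF rho fi Kc]) (auto intro: stay)
  then have t: "\<psi> n \<in> test_functions \<Omega>" for n using W by (auto simp: test_functions_iff)
  have rm: "\<rho> n \<in> borel_measurable borel" for n by (rule mollifier_measurable[OF rho])
  have avg: "\<psi> n x = (\<integral>y. \<rho> n y * ?f n (x - y) \<partial>lborel)" for n x
    unfolding \<psi>_def by (rule conv_eq_average[OF rm]) auto
  have b1: "\<bar>\<psi> n x\<bar> \<le> 1" for n x
  proof -
    have nn: "\<And>y. \<rho> n y \<ge> 0" and int: "integrable lborel (\<rho> n)" and one: "(\<integral>y. \<rho> n y \<partial>lborel) = 1"
      using rho[of n] by (auto simp: mollifier_def)
    have "\<psi> n x \<le> (\<integral>y. \<rho> n y \<partial>lborel)" unfolding avg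
    proof (rule integral_mono)
      show "integrable lborel (\<lambda>y. \<rho> n y * ?f n (x - y))"
        using rho[of n] by (intro average_integrable fi) (auto simp: mollifier_def)
    qed (use nn int in \<open>auto simp: indicator_def\<close>)
    moreover have "0 \<le> \<psi> n x" unfolding avg using nn by (intro integral_nonneg_AE) auto
    ultimately show ?thesis using one by simp
  qed
  have lim: "(\<lambda>n. \<psi> n x) \<longlonglongrightarrow> indicator W x" for x
  proof (cases "x \<in> W")
    case False
    then have "\<psi> n x = 0" for n using test_zero_outside[OF tW] by blast
    then show ?thesis using False by simp
  next
    case True
    \<comment> \<open>Once 3 \<open>e n\<close> is below the distance of x to the complement, the
      averaging ball about x lies in \<open>K n\<close> and the average is exactly 1.\<close>
    have "eventually (\<lambda>n. e n < infdist x (- W) / 3) sequentially"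
      using order_tendstoD(2)[OF elim, of "infdist x (- W) / 3"] pos[OF True] by simp
    then have "eventually (\<lambda>n. \<psi> n x = indicator W x) sequentially"
    proof eventually_elim
      case (elim n)
      have "\<rho> n y * ?f n (x - y) = \<rho> n y" for y
      proof (cases "norm y < e n")
        case True
        have "infdist x (- W) \<le> infdist (x - y) (- W) + dist x (x - y)" by (rule infdist_triangle)
        then have "x - y \<in> K n" using True elim by (simp add: K_def dist_norm)
        then show ?thesis by simp
      next
        case False
        then show ?thesis using rho[of n] by (simp add: mollifier_def)
      qed
      then have "\<psi> n x = (\<integral>y. \<rho> n y \<partial>lborel)" unfolding avg by (simp only:)
      also have "\<dots> = 1" using rho[of n] by (simp add: mollifier_def)
      finally show ?case using True by simp
    qed
    then show ?thesis by (rule tendsto_eventually)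
  qed
  have "(\<lambda>n. \<integral>x. g x * \<psi> n x \<partial>lborel) \<longlonglongrightarrow> (\<integral>x. g x * indicator W x \<partial>lborel)"
  proof (rule integral_dominated_convergence[where w = "\<lambda>x. norm (g x)"])
    show "AE x in lborel. (\<lambda>n. g x * \<psi> n x) \<longlonglongrightarrow> g x * indicator W x"
      by (intro AE_I2 tendsto_mult tendsto_const lim)
    show "AE x in lborel. norm (g x * \<psi> n x) \<le> norm (g x)" for n
      using b1 by (intro AE_I2) (auto simp: abs_mult intro!: mult_left_le)
    show "(\<lambda>x. g x * \<psi> n x) \<in> borel_measurable lborel" for n
      using smooth_compact_measurable[OF test_smooth_compact[OF t[of n]]] by measurable
    show "integrable lborel (\<lambda>x. norm (g x))" using g by simp
  qed measurable
  then show ?thesis using z[OF t] by (simp add: LIMSEQ_const_iff)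
qed

text \<open>The positive and the negative part of g are densities of two finite measures that agree
  on open sets. Open sets are stable under intersection and generate the Borel sets, so the
  measures, and then the densities, coincide; the two parts of g can agree only where g = 0.\<close>

lemma fundamental_lemma:
  fixes g :: "'a::euclidean_space \<Rightarrow> real"
  assumes O: "open \<Omega>" "bounded \<Omega>" and g: "integrable lborel g" and supp: "\<And>x. x \<notin> \<Omega> \<Longrightarrow> g x = 0"
    and z: "\<And>\<psi>. \<psi> \<in> test_functions \<Omega> \<Longrightarrow> (\<integral>x. g x * \<psi> x \<partial>lborel) = 0"
  shows "AE x in lborel. g x = 0"
proof -
  have [measurable]: "g \<in> borel_measurable borel" using borel_measurable_integrable[OF g] by simp
  \<comment> \<open>\<open>ennreal\<close> sends negative reals to 0, so these are the positive and
    the negative part of g.\<close>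
  let ?p = "\<lambda>x. ennreal (g x)" and ?m = "\<lambda>x. ennreal (- g x)"
  have ip: "integrable lborel (\<lambda>x. max 0 (g x))" "integrable lborel (\<lambda>x. max 0 (- g x))" using g by auto
  have eq: "emeasure (density lborel ?p) X = emeasure (density lborel ?m) X" if X: "open X" for X
  proof -
    have [measurable]: "X \<in> sets borel" using X by auto
    have i2: "integrable lborel (\<lambda>x. max 0 (g x) * indicator X x)" "integrable lborel (\<lambda>x. max 0 (- g x) * indicator X x)"
      using integrable_real_mult_indicator[OF _ ip(1), of X] integrable_real_mult_indicator[OF _ ip(2), of X] by (simp_all add: mult.commute)
    have "(\<integral>x. max 0 (g x) * indicator X x \<partial>lborel) - (\<integral>x. max 0 (- g x) * indicator X x \<partial>lborel)
       = (\<integral>x. g x * indicator (X \<inter> \<Omega>) x \<partial>lborel)"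
    proof -
      have pt: "max 0 (g x) * indicator X x - max 0 (- g x) * indicator X x = g x * indicator (X \<inter> \<Omega>) x" for x
        using supp[of x] by (cases "x \<in> \<Omega>") (auto simp: indicator_def max_def)
      show ?thesis
        by (subst Bochner_Integration.integral_diff[OF i2, symmetric]) (simp only: pt)
    qed
    also have "\<dots> = 0" by (rule integral_open_zero[OF O(2) g z]) (use X O in auto)
    finally have e: "(\<integral>x. max 0 (g x) * indicator X x \<partial>lborel) = (\<integral>x. max 0 (- g x) * indicator X x \<partial>lborel)" by simp
    have "emeasure (density lborel ?p) X = (\<integral>\<^sup>+x. ennreal (max 0 (g x) * indicator X x) \<partial>lborel)"
      by (subst emeasure_density) (auto intro!: nn_integral_cong simp: indicator_def max_def ennreal_neg)
    also have "\<dots> = ennreal (\<integral>x. max 0 (g x) * indicator X x \<partial>lborel)"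
      by (rule nn_integral_eq_integral[OF i2(1)]) (auto simp: indicator_def)
    also have "\<dots> = (\<integral>\<^sup>+x. ennreal (max 0 (- g x) * indicator X x) \<partial>lborel)"
      unfolding e by (rule nn_integral_eq_integral[OF i2(2), symmetric]) (auto simp: indicator_def)
    also have "\<dots> = emeasure (density lborel ?m) X"
      by (subst emeasure_density) (auto intro!: nn_integral_cong simp: indicator_def max_def ennreal_neg)
    finally show ?thesis .
  qed
  have "density lborel ?p = density lborel ?m"
  proof (rule measure_eqI_generator_eq[where E = "{X. open X}" and \<Omega> = UNIV and A = "\<lambda>i. UNIV"])
    show "emeasure (density lborel ?p) UNIV \<noteq> \<infinity>"
    proof -
      have "emeasure (density lborel ?p) UNIV = (\<integral>\<^sup>+x. ennreal (max 0 (g x)) \<partial>lborel)"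
        by (subst emeasure_density) (auto intro!: nn_integral_cong simp: max_def ennreal_neg)
      also have "\<dots> = ennreal (\<integral>x. max 0 (g x) \<partial>lborel)"
        by (rule nn_integral_eq_integral[OF ip(1)]) auto
      finally show ?thesis by simp
    qed
  qed (auto simp: Int_stable_def eq borel_def)
  then have "AE x in lborel. ?p x = ?m x" by (intro sigma_finite_measure.density_unique[OF sigma_finite_lborel]) auto
  then show ?thesis
  proof eventually_elim
    fix x assume "ennreal (g x) = ennreal (- g x)"
    then show "g x = 0" by (cases "g x \<ge> 0") (auto simp: ennreal_neg ennreal_eq_0_iff)
  qed
qed

lemma has_weak_gradient_rep:
  assumes O: "open \<Omega>" and u: "rep \<Omega> u U" and G: "rep \<Omega> G G'" "nsq G' < \<infinity>"
  shows "has_weak_gradient \<Omega> u G \<longleftrightarrow> (\<forall>\<psi>\<in>test_functions \<Omega>. \<forall>b\<in>Basis.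
     (\<integral>x. U x * ddir \<psi> b x \<partial>lborel) = - (\<integral>x. (G' x \<bullet> b) * \<psi> x \<partial>lborel))"
proof -
  have L: "G \<in> L2 \<Omega>" using rep_L2_iff[OF O G(1)] G(2) by simp
  have 1: "(\<integral>x. u x * ddir \<psi> b x \<partial>lebesgue_on \<Omega>) = (\<integral>x. U x * ddir \<psi> b x \<partial>lborel)"
    if psi: "\<psi> \<in> test_functions \<Omega>" for \<psi> b
  proof (rule integral_lebesgue_on_rep(1)[OF O])
    have [measurable]: "ddir \<psi> b \<in> borel_measurable borel"
      by (rule smooth_compact_measurable[OF smooth_compact_ddir[OF test_smooth_compact[OF psi]]])
    have [measurable]: "U \<in> borel_measurable borel" by (rule rep_measurable[OF u])
    have "AE x in lborel. x \<in> \<Omega> \<longrightarrow> U x = u x" using u by (simp add: rep_def)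
    then have "AE x in lborel. x \<in> \<Omega> \<longrightarrow> U x * ddir \<psi> b x = u x * ddir \<psi> b x" by eventually_elim simp
    then show "rep \<Omega> (\<lambda>x. u x * ddir \<psi> b x) (\<lambda>x. U x * ddir \<psi> b x)"
      using rep_outside[OF u] by (auto simp: rep_def)
  qed
  have 2: "(\<integral>x. (G x \<bullet> b) * \<psi> x \<partial>lebesgue_on \<Omega>) = (\<integral>x. (G' x \<bullet> b) * \<psi> x \<partial>lborel)"
    if psi: "\<psi> \<in> test_functions \<Omega>" for \<psi> b
  proof (rule integral_lebesgue_on_rep(1)[OF O])
    have [measurable]: "\<psi> \<in> borel_measurable borel"
      by (rule smooth_compact_measurable[OF test_smooth_compact[OF psi]])
    have [measurable]: "G' \<in> borel_measurable borel" by (rule rep_measurable[OF G(1)])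
    have "AE x in lborel. x \<in> \<Omega> \<longrightarrow> G' x = G x" using G(1) by (simp add: rep_def)
    then have "AE x in lborel. x \<in> \<Omega> \<longrightarrow> (G' x \<bullet> b) * \<psi> x = (G x \<bullet> b) * \<psi> x" by eventually_elim simp
    then show "rep \<Omega> (\<lambda>x. (G x \<bullet> b) * \<psi> x) (\<lambda>x. (G' x \<bullet> b) * \<psi> x)"
      using rep_outside[OF G(1)] by (auto simp: rep_def)
  qed
  show ?thesis unfolding has_weak_gradient_def using L 1 2 by simp
qed

text \<open>\<open>weak_gradient\<close> is picked by \<open>SOME\<close>, so uniqueness is what
  makes it computable. Each component of the difference of two candidates integrates to 0 against
  every test function.\<close>

lemma weak_gradient_unique:
  assumes O: "open \<Omega>" "bounded \<Omega>" and u: "rep \<Omega> u U"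
    and G: "has_weak_gradient \<Omega> u G" "rep \<Omega> G G'" and H: "has_weak_gradient \<Omega> u H" "rep \<Omega> H H'"
  shows "AE x in lborel. G' x = H' x"
proof -
  have [measurable]: "G' \<in> borel_measurable borel" "H' \<in> borel_measurable borel"
    using rep_measurable[OF G(2)] rep_measurable[OF H(2)] by auto
  have fin: "nsq G' < \<infinity>" "nsq H' < \<infinity>"
    using G H rep_L2_iff[OF O(1)] by (auto simp: has_weak_gradient_def)
  have "AE x in lborel. (G' x - H' x) \<bullet> b = 0" if b: "b \<in> Basis" for b
  proof (rule fundamental_lemma[OF O])
    have fc: "nsq (\<lambda>x. G' x \<bullet> b) < \<infinity>" "nsq (\<lambda>x. H' x \<bullet> b) < \<infinity>"
      using nsq_inner_le[of G' b] nsq_inner_le[of H' b] fin b by (auto intro: le_less_trans)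
    then have "nsq (\<lambda>x. G' x \<bullet> b - H' x \<bullet> b) < \<infinity>"
      by (intro le_less_trans[OF nsq_diff]) (use ennreal_numeral_mult_finite fc in auto)
    then have "nsq (\<lambda>x. (G' x - H' x) \<bullet> b) < \<infinity>" by (simp add: inner_diff_left)
    then show "integrable lborel (\<lambda>x. (G' x - H' x) \<bullet> b)"
      by (rule integrable_of_L2_bounded_support[rotated, OF _ O(2)]) (use rep_outside[OF G(2)] rep_outside[OF H(2)] in auto)
    show "(G' x - H' x) \<bullet> b = 0" if "x \<notin> \<Omega>" for x
      using that rep_outside[OF G(2)] rep_outside[OF H(2)] by simp
    fix \<psi> assume psi: "\<psi> \<in> test_functions \<Omega>"
    have m: "\<psi> \<in> borel_measurable borel" "nsq \<psi> < \<infinity>"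
      using smooth_compact_measurable[OF test_smooth_compact[OF psi]] smooth_compact_nsq_finite[OF test_smooth_compact[OF psi]] by auto
    have "(\<integral>x. U x * ddir \<psi> b x \<partial>lborel) = - (\<integral>x. (G' x \<bullet> b) * \<psi> x \<partial>lborel)"
      "(\<integral>x. U x * ddir \<psi> b x \<partial>lborel) = - (\<integral>x. (H' x \<bullet> b) * \<psi> x \<partial>lborel)"
      using G(1) H(1) b psi has_weak_gradient_rep[OF O(1) u G(2) fin(1)] has_weak_gradient_rep[OF O(1) u H(2) fin(2)] by auto
    moreover have "integrable lborel (\<lambda>x. (G' x \<bullet> b) * \<psi> x)" "integrable lborel (\<lambda>x. (H' x \<bullet> b) * \<psi> x)"
      using m fc by (auto intro!: integrable_mult_L2)
    ultimately show "(\<integral>x. ((G' x - H' x) \<bullet> b) * \<psi> x \<partial>lborel) = 0"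
      by (simp add: inner_diff_left left_diff_distrib Bochner_Integration.integral_diff)
  qed
  then have "AE x in lborel. \<forall>b\<in>Basis. (G' x - H' x) \<bullet> b = 0" by (intro AE_finite_allI) auto
  then show ?thesis
  proof eventually_elim
    fix x assume "\<forall>b\<in>Basis. (G' x - H' x) \<bullet> b = 0"
    then have "G' x - H' x = 0" using euclidean_all_zero_iff by blast
    then show "G' x = H' x" by simp
  qed
qed

section \<open>Characterisation of the zero-trace Sobolev space\<close>

lemma has_weak_gradient_weak_gradient:
  "has_weak_gradient \<Omega> u G \<Longrightarrow> has_weak_gradient \<Omega> u (weak_gradient \<Omega> u)"
  unfolding weak_gradient_def by (rule someI[where P = "has_weak_gradient \<Omega> u"])

lemma has_weak_gradient_diff_test:
  assumes O: "open \<Omega>" and u: "rep \<Omega> u U" "nsq U < \<infinity>" and G: "has_weak_gradient \<Omega> u G" "rep \<Omega> G G'"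
    and \<phi>: "\<phi> \<in> test_functions \<Omega>"
  shows "has_weak_gradient \<Omega> (\<lambda>x. u x - \<phi> x) (\<lambda>x. G x - grad \<phi> x)"
proof -
  have sc: "smooth_compact \<phi>" by (rule test_smooth_compact[OF \<phi>])
  have [measurable]: "U \<in> borel_measurable borel" "G' \<in> borel_measurable borel" "\<phi> \<in> borel_measurable borel"
      "grad \<phi> \<in> borel_measurable borel"
    using rep_measurable[OF u(1)] rep_measurable[OF G(2)] smooth_compact_measurable[OF sc] grad_measurable[OF sc] by auto
  have finG: "nsq G' < \<infinity>" using G rep_L2_iff[OF O] by (auto simp: has_weak_gradient_def)
  have fin: "nsq (\<lambda>x. G' x - grad \<phi> x) < \<infinity>"
    by (rule le_less_trans[OF nsq_diff]) (use finG smooth_compact_grad_nsq_finite[OF sc] ennreal_numeral_mult_finite in auto)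
  have "(\<integral>x. (U x - \<phi> x) * ddir \<psi> b x \<partial>lborel) = - (\<integral>x. ((G' x - grad \<phi> x) \<bullet> b) * \<psi> x \<partial>lborel)"
    if psi: "\<psi> \<in> test_functions \<Omega>" and b: "b \<in> Basis" for \<psi> b
  proof -
    have sp: "smooth_compact \<psi>" by (rule test_smooth_compact[OF psi])
    have m [measurable]: "\<psi> \<in> borel_measurable borel" "ddir \<psi> b \<in> borel_measurable borel"
      using smooth_compact_measurable[OF sp] smooth_compact_measurable[OF smooth_compact_ddir[OF sp]] by auto
    have "nsq (\<lambda>x. G' x \<bullet> b) < \<infinity>" "nsq (\<lambda>x. grad \<phi> x \<bullet> b) < \<infinity>"
      using nsq_inner_le[of G' b] nsq_inner_le[of "grad \<phi>" b] finG smooth_compact_grad_nsq_finite[OF sc] b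
      by (auto intro: le_less_trans)
    then have i: "integrable lborel (\<lambda>x. (G' x \<bullet> b) * \<psi> x)" "integrable lborel (\<lambda>x. (grad \<phi> x \<bullet> b) * \<psi> x)"
      "integrable lborel (\<lambda>x. U x * ddir \<psi> b x)" "integrable lborel (\<lambda>x. \<phi> x * ddir \<psi> b x)"
      using u(2) smooth_compact_nsq_finite[OF sp] smooth_compact_nsq_finite[OF sc] smooth_compact_nsq_finite[OF smooth_compact_ddir[OF sp]]
      by (auto intro!: integrable_mult_L2)
    have "(\<integral>x. U x * ddir \<psi> b x \<partial>lborel) = - (\<integral>x. (G' x \<bullet> b) * \<psi> x \<partial>lborel)"
      using G(1) psi b has_weak_gradient_rep[OF O u(1) G(2) finG] by auto
    moreover have "(\<integral>x. \<phi> x * ddir \<psi> b x \<partial>lborel) = - (\<integral>x. (grad \<phi> x \<bullet> b) * \<psi> x \<partial>lborel)"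
      using integral_by_parts[OF sc sp, of b] b by (simp add: grad_inner_Basis)
    ultimately show ?thesis
      using i by (simp add: inner_diff_left left_diff_distrib Bochner_Integration.integral_diff)
  qed
  then show ?thesis
    using has_weak_gradient_rep[OF O rep_diff[OF u(1) rep_test[OF \<phi>]] rep_diff[OF G(2) rep_grad_test[OF \<phi>]] fin] by simp
qed

text \<open>\<open>H1_norm\<close> of u - \<phi> refers to a freshly chosen gradient of u - \<phi>,
  which need not be the difference of the chosen gradients pointwise. Uniqueness identifies them
  almost everywhere, so closeness in \<open>H1_norm\<close> becomes L2 convergence of
  gradients.\<close>

lemma H10_approximation:
  assumes O: "open \<Omega>" "bounded \<Omega>" and u: "u \<in> H10 \<Omega>" "rep \<Omega> u U"
  shows "\<exists>G \<phi>. rep \<Omega> (weak_gradient \<Omega> u) G \<and> nsq G < \<infinity> \<and> (\<forall>n. \<phi> n \<in> test_functions \<Omega>) \<and>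
    (\<lambda>n. nsq (\<lambda>x. U x - \<phi> n x)) \<longlonglongrightarrow> 0 \<and> (\<lambda>n. nsq (\<lambda>x. G x - grad (\<phi> n) x)) \<longlonglongrightarrow> 0"
proof -
  have hw: "has_weak_gradient \<Omega> u (weak_gradient \<Omega> u)"
    using u(1) has_weak_gradient_weak_gradient by (auto simp: H10_def H1_def)
  have L: "weak_gradient \<Omega> u \<in> L2 \<Omega>" using hw by (simp add: has_weak_gradient_def)
  obtain G where G: "rep \<Omega> (weak_gradient \<Omega> u) G" using rep_exists[OF O(1)] L by (auto simp: L2_def)
  have finG: "nsq G < \<infinity>" using rep_L2_iff[OF O(1) G] L by simp
  have finU: "nsq U < \<infinity>" using rep_L2_iff[OF O(1) u(2)] u(1) by (simp add: H10_def H1_def)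
  have [measurable]: "U \<in> borel_measurable borel" "G \<in> borel_measurable borel"
    using rep_measurable[OF u(2)] rep_measurable[OF G] by auto
  have ex: "\<exists>\<phi>. \<phi> \<in> test_functions \<Omega> \<and> nsq (\<lambda>x. U x - \<phi> x) \<le> ennreal (e\<^sup>2) \<and> nsq (\<lambda>x. G x - grad \<phi> x) \<le> ennreal (e\<^sup>2)"
    if e: "e > 0" for e
  proof -
    obtain \<phi> where phi: "\<phi> \<in> test_functions \<Omega>" "H1_norm \<Omega> (\<lambda>x. u x - \<phi> x) < e" using u(1) e by (auto simp: H10_def)
    have sc: "smooth_compact \<phi>" by (rule test_smooth_compact[OF phi(1)])
    have [measurable]: "\<phi> \<in> borel_measurable borel" "grad \<phi> \<in> borel_measurable borel"
      using smooth_compact_measurable[OF sc] grad_measurable[OF sc] by auto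
    let ?w = "\<lambda>x. u x - \<phi> x"
    have rw: "rep \<Omega> ?w (\<lambda>x. U x - \<phi> x)" by (rule rep_diff[OF u(2) rep_test[OF phi(1)]])
    have hwd: "has_weak_gradient \<Omega> ?w (\<lambda>x. weak_gradient \<Omega> u x - grad \<phi> x)"
      by (rule has_weak_gradient_diff_test[OF O(1) u(2) finU hw G phi(1)])
    have rd: "rep \<Omega> (\<lambda>x. weak_gradient \<Omega> u x - grad \<phi> x) (\<lambda>x. G x - grad \<phi> x)"
      by (rule rep_diff[OF G rep_grad_test[OF phi(1)]])
    have hww: "has_weak_gradient \<Omega> ?w (weak_gradient \<Omega> ?w)"
      by (rule has_weak_gradient_weak_gradient[OF hwd])
    then have Lw: "weak_gradient \<Omega> ?w \<in> L2 \<Omega>" by (simp add: has_weak_gradient_def)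
    obtain W where W: "rep \<Omega> (weak_gradient \<Omega> ?w) W" using rep_exists[OF O(1)] Lw by (auto simp: L2_def)
    have finW: "nsq W < \<infinity>" using rep_L2_iff[OF O(1) W] Lw by simp
    have "AE x in lborel. W x = G x - grad \<phi> x"
      by (rule weak_gradient_unique[OF O rw hww W hwd rd])
    then have eqW: "nsq (\<lambda>x. G x - grad \<phi> x) = nsq W" by (intro nsq_cong_AE) (auto elim: eventually_mono)
    have "(\<lambda>x. u x - \<phi> x) \<in> L2 \<Omega>"
    proof -
      have "nsq (\<lambda>x. U x - \<phi> x) < \<infinity>"
        by (rule le_less_trans[OF nsq_diff]) (use finU smooth_compact_nsq_finite[OF sc] ennreal_numeral_mult_finite in auto)
      then show ?thesis using rep_L2_iff[OF O(1) rw] by simp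
    qed
    then have finw: "nsq (\<lambda>x. U x - \<phi> x) < \<infinity>" using rep_L2_iff[OF O(1) rw] by simp
    let ?a = "L2_norm \<Omega> ?w" and ?b = "L2_norm \<Omega> (weak_gradient \<Omega> ?w)"
    have "?a\<^sup>2 + ?b\<^sup>2 < e\<^sup>2"
      using phi(2) e unfolding H1_norm_def by (metis abs_of_pos real_sqrt_abs real_sqrt_less_iff)
    then have ab: "?a\<^sup>2 \<le> e\<^sup>2" "?b\<^sup>2 \<le> e\<^sup>2" using zero_le_power2[of ?a] zero_le_power2[of ?b] by linarith+
    have "nsq (\<lambda>x. U x - \<phi> x) \<le> ennreal (e\<^sup>2)"
      unfolding rep_L2_norm[OF O(1) rw finw, symmetric] by (rule ennreal_leI[OF ab(1)])
    moreover have "nsq (\<lambda>x. G x - grad \<phi> x) \<le> ennreal (e\<^sup>2)"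
      unfolding eqW rep_L2_norm[OF O(1) W finW, symmetric] by (rule ennreal_leI[OF ab(2)])
    ultimately show ?thesis using phi(1) by blast
  qed
  have "\<forall>n. \<exists>\<phi>. \<phi> \<in> test_functions \<Omega> \<and> nsq (\<lambda>x. U x - \<phi> x) \<le> ennreal ((inverse (real (Suc n)))\<^sup>2)
      \<and> nsq (\<lambda>x. G x - grad \<phi> x) \<le> ennreal ((inverse (real (Suc n)))\<^sup>2)"
    by (intro allI ex) simp
  then obtain \<phi> where phi: "\<And>n. \<phi> n \<in> test_functions \<Omega>"
     "\<And>n. nsq (\<lambda>x. U x - \<phi> n x) \<le> ennreal ((inverse (real (Suc n)))\<^sup>2)"
     "\<And>n. nsq (\<lambda>x. G x - grad (\<phi> n) x) \<le> ennreal ((inverse (real (Suc n)))\<^sup>2)" by metis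
  have "(\<lambda>n. ennreal ((inverse (real (Suc n)))\<^sup>2)) \<longlonglongrightarrow> ennreal (0\<^sup>2)"
    by (intro tendsto_ennrealI tendsto_power LIMSEQ_inverse_real_of_nat)
  then have l: "(\<lambda>n. ennreal ((inverse (real (Suc n)))\<^sup>2)) \<longlonglongrightarrow> 0" by simp
  have "(\<lambda>n. nsq (\<lambda>x. U x - \<phi> n x)) \<longlonglongrightarrow> 0"
    by (rule tendsto_sandwich[OF _ _ tendsto_const l]; rule always_eventually; rule allI) (simp, rule phi)
  moreover have "(\<lambda>n. nsq (\<lambda>x. G x - grad (\<phi> n) x)) \<longlonglongrightarrow> 0"
    by (rule tendsto_sandwich[OF _ _ tendsto_const l]; rule always_eventually; rule allI) (simp, rule phi)
  ultimately show ?thesis using G finG phi(1) by blast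
qed

lemma nsq_diff_comm_tendsto:
  "(\<lambda>n. nsq (\<lambda>x. U x - f n x)) \<longlonglongrightarrow> 0 \<longleftrightarrow> (\<lambda>n. nsq (\<lambda>x. f n x - U x)) \<longlonglongrightarrow> 0"
  by (subst nsq_minus) (rule refl)

lemma nsq_component_le:
  fixes G :: "'a::euclidean_space \<Rightarrow> 'a"
  assumes "b \<in> Basis"
  shows "nsq (\<lambda>x. G x \<bullet> b) \<le> nsq G"
  using assms by (intro nsq_mono) (simp add: Basis_le_norm)

text \<open>Integration by parts survives L2 limits, so G is a weak gradient of u, and the \<phi> n
  then approach u in \<open>H1_norm\<close>. This is the converse of
  \<open>H10_approximation\<close>.\<close>

lemma H10_of_approximation:
  assumes O: "open \<Omega>" "bounded \<Omega>" and u: "rep \<Omega> u U" "nsq U < \<infinity>"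
    and G: "G \<in> borel_measurable borel" "\<And>x. x \<notin> \<Omega> \<Longrightarrow> G x = 0" "nsq G < \<infinity>"
    and phi: "\<And>n. \<phi> n \<in> test_functions \<Omega>" and lU: "(\<lambda>n. nsq (\<lambda>x. U x - \<phi> n x)) \<longlonglongrightarrow> 0"
    and lG: "(\<lambda>n. nsq (\<lambda>x. G x - grad (\<phi> n) x)) \<longlonglongrightarrow> 0"
  shows "u \<in> H10 \<Omega>"
proof -
  have sc: "smooth_compact (\<phi> n)" for n by (rule test_smooth_compact[OF phi])
  have [measurable]: "U \<in> borel_measurable borel" "\<phi> n \<in> borel_measurable borel" "grad (\<phi> n) \<in> borel_measurable borel" for n
    using rep_measurable[OF u(1)] smooth_compact_measurable[OF sc] grad_measurable[OF sc] by auto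
  note [measurable] = G(1)
  have rG: "rep \<Omega> G G" by (rule rep_self[OF G(1,2)])
  have "(\<integral>x. U x * ddir \<psi> b x \<partial>lborel) = - (\<integral>x. (G x \<bullet> b) * \<psi> x \<partial>lborel)"
    if psi: "\<psi> \<in> test_functions \<Omega>" and b: "b \<in> Basis" for \<psi> b
  proof -
    have sp: "smooth_compact \<psi>" by (rule test_smooth_compact[OF psi])
    have m [measurable]: "\<psi> \<in> borel_measurable borel" "ddir \<psi> b \<in> borel_measurable borel"
      using smooth_compact_measurable[OF sp] smooth_compact_measurable[OF smooth_compact_ddir[OF sp]] by auto
    have f: "nsq (\<phi> n) < \<infinity>" "nsq \<psi> < \<infinity>" "nsq (ddir \<psi> b) < \<infinity>" for n
      using smooth_compact_nsq_finite sc sp smooth_compact_ddir by blast+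
    have fb: "nsq (\<lambda>x. grad (\<phi> n) x \<bullet> b) < \<infinity>" "nsq (\<lambda>x. G x \<bullet> b) < \<infinity>" for n
      using nsq_component_le[OF b] smooth_compact_grad_nsq_finite[OF sc] G(3) by (blast intro: le_less_trans)+
    have 1: "(\<lambda>n. \<integral>x. \<phi> n x * ddir \<psi> b x \<partial>lborel) \<longlonglongrightarrow> (\<integral>x. U x * ddir \<psi> b x \<partial>lborel)"
      by (rule integral_mult_tendsto) (use f u(2) lU in auto)
    have lb: "(\<lambda>n. nsq (\<lambda>x. G x \<bullet> b - grad (\<phi> n) x \<bullet> b)) \<longlonglongrightarrow> 0"
    proof (rule tendsto_sandwich[OF _ _ tendsto_const lG]; rule always_eventually; rule allI)
      show "nsq (\<lambda>x. G x \<bullet> b - grad (\<phi> n) x \<bullet> b) \<le> nsq (\<lambda>x. G x - grad (\<phi> n) x)" for n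
        using nsq_component_le[OF b, of "\<lambda>x. G x - grad (\<phi> n) x"] by (simp add: inner_diff_left)
    qed simp
    have 2: "(\<lambda>n. \<integral>x. (grad (\<phi> n) x \<bullet> b) * \<psi> x \<partial>lborel) \<longlonglongrightarrow> (\<integral>x. (G x \<bullet> b) * \<psi> x \<partial>lborel)"
      by (rule integral_mult_tendsto) (use f fb lb in auto)
    have "(\<integral>x. \<phi> n x * ddir \<psi> b x \<partial>lborel) = - (\<integral>x. (grad (\<phi> n) x \<bullet> b) * \<psi> x \<partial>lborel)" for n
      using integral_by_parts[OF sc sp, of n b] b by (simp add: grad_inner_Basis)
    then have "(\<lambda>n. - (\<integral>x. (grad (\<phi> n) x \<bullet> b) * \<psi> x \<partial>lborel)) \<longlonglongrightarrow> (\<integral>x. U x * ddir \<psi> b x \<partial>lborel)"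
      using 1 by simp
    then show ?thesis using tendsto_minus[OF 2] LIMSEQ_unique by blast
  qed
  then have hw: "has_weak_gradient \<Omega> u G" using has_weak_gradient_rep[OF O(1) u(1) rG G(3)] by simp
  have uL: "u \<in> L2 \<Omega>" using rep_L2_iff[OF O(1) u(1)] u(2) by simp
  have "\<exists>\<psi>\<in>test_functions \<Omega>. H1_norm \<Omega> (\<lambda>x. u x - \<psi> x) < e" if e: "e > 0" for e
  proof -
    have "eventually (\<lambda>n. nsq (\<lambda>x. U x - \<phi> n x) < ennreal (e\<^sup>2 / 2)) sequentially"
      "eventually (\<lambda>n. nsq (\<lambda>x. G x - grad (\<phi> n) x) < ennreal (e\<^sup>2 / 2)) sequentially"
      using order_tendstoD(2)[OF lU, of "ennreal (e\<^sup>2/2)"] order_tendstoD(2)[OF lG, of "ennreal (e\<^sup>2/2)"] e by auto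
    then have "eventually (\<lambda>n. nsq (\<lambda>x. U x - \<phi> n x) < ennreal (e\<^sup>2 / 2) \<and> nsq (\<lambda>x. G x - grad (\<phi> n) x) < ennreal (e\<^sup>2 / 2)) sequentially"
      by (rule eventually_conj)
    then obtain n where n: "nsq (\<lambda>x. U x - \<phi> n x) < ennreal (e\<^sup>2 / 2)" "nsq (\<lambda>x. G x - grad (\<phi> n) x) < ennreal (e\<^sup>2 / 2)"
      by (auto simp: eventually_sequentially)
    let ?w = "\<lambda>x. u x - \<phi> n x"
    have rw: "rep \<Omega> ?w (\<lambda>x. U x - \<phi> n x)" by (rule rep_diff[OF u(1) rep_test[OF phi]])
    have hwd: "has_weak_gradient \<Omega> ?w (\<lambda>x. G x - grad (\<phi> n) x)"
      by (rule has_weak_gradient_diff_test[OF O(1) u hw rG phi])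
    have rd: "rep \<Omega> (\<lambda>x. G x - grad (\<phi> n) x) (\<lambda>x. G x - grad (\<phi> n) x)"
      by (rule rep_diff[OF rG rep_grad_test[OF phi]])
    have hww: "has_weak_gradient \<Omega> ?w (weak_gradient \<Omega> ?w)"
      by (rule has_weak_gradient_weak_gradient[OF hwd])
    then have Lw: "weak_gradient \<Omega> ?w \<in> L2 \<Omega>" by (simp add: has_weak_gradient_def)
    obtain W where W: "rep \<Omega> (weak_gradient \<Omega> ?w) W" using rep_exists[OF O(1)] Lw by (auto simp: L2_def)
    have finW: "nsq W < \<infinity>" using rep_L2_iff[OF O(1) W] Lw by simp
    have "AE x in lborel. W x = G x - grad (\<phi> n) x"
      by (rule weak_gradient_unique[OF O rw hww W hwd rd])
    then have eqW: "nsq W = nsq (\<lambda>x. G x - grad (\<phi> n) x)" by (intro nsq_cong_AE) (auto elim: eventually_mono)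
    have finw: "nsq (\<lambda>x. U x - \<phi> n x) < \<infinity>" using n(1) by (rule less_trans) simp
    let ?a = "L2_norm \<Omega> ?w" and ?b = "L2_norm \<Omega> (weak_gradient \<Omega> ?w)"
    have "ennreal (?a\<^sup>2) < ennreal (e\<^sup>2/2)" using rep_L2_norm[OF O(1) rw finw] n(1) by simp
    then have a: "?a\<^sup>2 < e\<^sup>2/2" using e by (simp add: ennreal_less_iff)
    have "ennreal (?b\<^sup>2) < ennreal (e\<^sup>2/2)" using rep_L2_norm[OF O(1) W finW] n(2) eqW by simp
    then have b: "?b\<^sup>2 < e\<^sup>2/2" using e by (simp add: ennreal_less_iff)
    have "sqrt (?a\<^sup>2 + ?b\<^sup>2) < sqrt (e\<^sup>2)" by (rule real_sqrt_less_mono) (use a b in linarith)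
    then show ?thesis using phi e by (intro bexI[of _ "\<phi> n"]) (auto simp: H1_norm_def)
  qed
  then show ?thesis using uL hw by (auto simp: H10_def H1_def)
qed

text \<open>
  Instead of weak compactness: among the test functions at \<open>L\<^sup>2\<close>-distance at most \<open>1/(n+1)\<close> from
  \<open>U\<close> (a convex set) take an almost minimiser of the Dirichlet integral. By the parallelogram
  identity the gradients of these almost minimisers form a Cauchy sequence.
\<close>
lemma H10_of_bounded_gradients:
  assumes O: "open \<Omega>" "bounded \<Omega>" and u: "rep \<Omega> u U" "nsq U < \<infinity>"
    and phi: "\<And>n. \<phi> n \<in> test_functions \<Omega>" and lU: "(\<lambda>n. nsq (\<lambda>x. U x - \<phi> n x)) \<longlonglongrightarrow> 0"
    and bd: "\<And>n. nsq (grad (\<phi> n)) \<le> ennreal C"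
  shows "u \<in> H10 \<Omega>"
proof -
  define e where "e n = inverse (real (Suc n))" for n
  have e0: "e n > 0" for n by (simp add: e_def)
  have el: "e \<longlonglongrightarrow> 0" unfolding e_def[abs_def] by (rule LIMSEQ_inverse_real_of_nat)
  have em: "e n \<le> e m" if "m \<le> n" for m n unfolding e_def using that by (intro le_imp_inverse_le) auto
  define K where "K n = {\<psi> \<in> test_functions \<Omega>. nsq (\<lambda>x. U x - \<psi> x) \<le> ennreal (e n)}" for n
  define I where "I n = (INF \<psi>\<in>K n. nsq (grad \<psi>))" for n
  have Um [measurable]: "U \<in> borel_measurable borel" using rep_measurable[OF u(1)] .
  have Kne: "\<exists>\<psi>\<in>K n. nsq (grad \<psi>) \<le> ennreal C" for n
  proof -
    have "eventually (\<lambda>k. nsq (\<lambda>x. U x - \<phi> k x) < ennreal (e n)) sequentially"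
      using order_tendstoD(2)[OF lU, of "ennreal (e n)"] e0[of n] by auto
    then obtain k where "nsq (\<lambda>x. U x - \<phi> k x) < ennreal (e n)" by (auto simp: eventually_sequentially)
    then have "\<phi> k \<in> K n" using phi by (simp add: K_def)
    then show ?thesis using bd by blast
  qed
  have IC: "I n \<le> ennreal C" for n
  proof -
    obtain \<psi> where "\<psi> \<in> K n" "nsq (grad \<psi>) \<le> ennreal C" using Kne by blast
    then show ?thesis unfolding I_def by (meson INF_lower order_trans)
  qed
  have Imono: "I m \<le> I n" if "m \<le> n" for m n
    unfolding I_def
  proof (rule INF_superset_mono)
    have "ennreal (e n) \<le> ennreal (e m)" by (rule ennreal_leI[OF em[OF that]])
    then show "K n \<subseteq> K m" by (auto simp: K_def)
  qed simp
  have "\<exists>\<psi>\<in>K n. nsq (grad \<psi>) < I n + ennreal (e n)" for n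
  proof -
    have "I n < \<infinity>" using le_less_trans[OF IC[of n]] by simp
    then obtain j where j: "I n = ennreal j" "j \<ge> 0" by (cases "I n") auto
    have "I n < I n + ennreal (e n)"
      using e0[of n] j by (simp add: ennreal_plus[symmetric] ennreal_less_iff del: ennreal_plus)
    then show ?thesis unfolding I_def by (subst (asm) INF_less_iff) auto
  qed
  then obtain f where fK: "\<And>n. f n \<in> K n" and fI: "\<And>n. nsq (grad (f n)) < I n + ennreal (e n)" by metis
  have ft: "f n \<in> test_functions \<Omega>" for n using fK by (simp add: K_def)
  have sc: "smooth_compact (f n)" for n by (rule test_smooth_compact[OF ft])
  have [measurable]: "f n \<in> borel_measurable borel" "grad (f n) \<in> borel_measurable borel" for n
    using smooth_compact_measurable[OF sc] grad_measurable[OF sc] by auto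
  define i where "i n = enn2real (I n)" for n
  have Ii: "I n = ennreal (i n)" for n
    using IC[of n] unfolding i_def by (metis ennreal_enn2real ennreal_less_top le_less_trans)
  have i0: "i n \<ge> 0" for n by (simp add: i_def)
  have imono: "i m \<le> i n" if "m \<le> n" for m n
    using Imono[OF that] i0 by (simp add: Ii ennreal_le_iff)
  have iC: "i n \<le> max 0 C" for n
  proof -
    have "ennreal (i n) \<le> ennreal (max 0 C)" using IC[of n] order_trans[OF _ ennreal_leI[of C "max 0 C"]] by (simp add: Ii)
    then show ?thesis by (subst (asm) ennreal_le_iff) auto
  qed
  \<comment> \<open>Parallelogram identity with the midpoint of \<open>f n\<close> and
    \<open>f m\<close>. The midpoint lies in \<open>K n\<close>, so its Dirichlet integral is at
    least \<open>i n\<close>, and the bound is 2 (i n + e n) + 2 (i m + e n) - 4 i n.\<close>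
  have main: "nsq (\<lambda>x. grad (f n) x - grad (f m) x) \<le> ennreal (2 * (i m - i n) + 4 * e n)" if nm: "n \<le> m" for n m
  proof -
    let ?g = "\<lambda>x. (1/2) * f n x + (1/2) * f m x"
    have gt: "?g \<in> test_functions \<Omega>" by (rule test_lincomb[OF ft ft])
    have "nsq (\<lambda>x. U x - ?g x) \<le> ennreal (e n)"
    proof -
      have "nsq (\<lambda>x. U x - ?g x) = nsq (\<lambda>x. (1/2) *\<^sub>R (U x - f n x) + (1/2) *\<^sub>R (U x - f m x))"
        by (rule arg_cong[of _ _ nsq]) (auto simp: fun_eq_iff field_simps)
      also have "\<dots> \<le> 2 * nsq (\<lambda>x. (1/2) *\<^sub>R (U x - f n x)) + 2 * nsq (\<lambda>x. (1/2) *\<^sub>R (U x - f m x))"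
        by (rule nsq_add) measurable
      also have "\<dots> = 2 * (ennreal ((1/2)\<^sup>2) * nsq (\<lambda>x. U x - f n x)) + 2 * (ennreal ((1/2)\<^sup>2) * nsq (\<lambda>x. U x - f m x))"
        by (subst (1 2) nsq_scaleR) measurable
      also have "\<dots> \<le> 2 * (ennreal ((1/2)\<^sup>2) * ennreal (e n)) + 2 * (ennreal ((1/2)\<^sup>2) * ennreal (e n))"
      proof -
        have "nsq (\<lambda>x. U x - f n x) \<le> ennreal (e n)" using fK[of n] by (simp add: K_def)
        moreover have "nsq (\<lambda>x. U x - f m x) \<le> ennreal (e n)"
          using fK[of m] ennreal_leI[OF em[OF nm]] by (auto simp: K_def)
        ultimately show ?thesis by (intro add_mono mult_left_mono) auto
      qed
      also have "\<dots> = ennreal (e n)"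
      proof -
        have "ennreal ((1/2)\<^sup>2) * ennreal (e n) = ennreal (e n / 4)"
          by (subst ennreal_mult[symmetric]) (use e0[of n] in \<open>auto simp: power2_eq_square\<close>)
        then have "2 * (ennreal ((1/2)\<^sup>2) * ennreal (e n)) = ennreal (e n / 2)"
          using e0[of n] by (simp add: numeral_mult_ennreal)
        then show ?thesis using e0[of n] by (simp add: ennreal_plus[symmetric] del: ennreal_plus)
      qed
      finally show ?thesis .
    qed
    then have "?g \<in> K n" using gt by (simp add: K_def)
    then have g: "I n \<le> nsq (grad ?g)" unfolding I_def by (rule INF_lower)
    have gg: "grad (f n) x + grad (f m) x = 2 *\<^sub>R grad ?g x" for x
      by (simp only: grad_lincomb[where a = "1/2" and b = "1/2", OF sc[of n] sc[of m]]) (simp add: scaleR_add_right)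
    have gm: "grad ?g \<in> borel_measurable borel" by (rule grad_measurable[OF test_smooth_compact[OF gt]])
    have "nsq (\<lambda>x. grad (f n) x + grad (f m) x) = ennreal (2\<^sup>2) * nsq (grad ?g)"
      unfolding gg by (rule nsq_scaleR[OF gm])
    then have par: "nsq (\<lambda>x. grad (f n) x - grad (f m) x) + ennreal 4 * nsq (grad ?g) = 2 * nsq (grad (f n)) + 2 * nsq (grad (f m))"
      using nsq_parallelogram[of "grad (f n)" "grad (f m)"] by simp
    have "nsq (\<lambda>x. grad (f n) x - grad (f m) x) + ennreal 4 * I n
        \<le> nsq (\<lambda>x. grad (f n) x - grad (f m) x) + ennreal 4 * nsq (grad ?g)"
      by (intro add_left_mono mult_left_mono g) simp
    also have "\<dots> = 2 * nsq (grad (f n)) + 2 * nsq (grad (f m))" by (rule par)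
    also have "\<dots> \<le> 2 * (ennreal (i n) + ennreal (e n)) + 2 * (ennreal (i m) + ennreal (e n))"
    proof (intro add_mono mult_left_mono)
      show "nsq (grad (f n)) \<le> ennreal (i n) + ennreal (e n)" using fI[of n] by (simp add: Ii)
      have "nsq (grad (f m)) \<le> ennreal (i m) + ennreal (e m)" using fI[of m] by (simp add: Ii)
      also have "\<dots> \<le> ennreal (i m) + ennreal (e n)" by (intro add_left_mono ennreal_leI em[OF nm])
      finally show "nsq (grad (f m)) \<le> ennreal (i m) + ennreal (e n)" .
    qed auto
    also have "\<dots> = ennreal (2 * (i n + e n) + 2 * (i m + e n))"
      using e0[of n] i0 by (simp add: numeral_mult_ennreal ennreal_plus[symmetric] add_nonneg_nonneg less_imp_le del: ennreal_plus)
    finally have le: "nsq (\<lambda>x. grad (f n) x - grad (f m) x) + ennreal (4 * i n) \<le> ennreal (2 * (i n + e n) + 2 * (i m + e n))"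
      by (simp add: Ii ennreal_mult i0)
    have "nsq (\<lambda>x. grad (f n) x - grad (f m) x) < \<infinity>"
      using le by (metis ennreal_less_top infinity_ennreal_def add_increasing2 le_less_trans zero_le order_refl)
    then obtain a where a: "nsq (\<lambda>x. grad (f n) x - grad (f m) x) = ennreal a" "a \<ge> 0"
      by (cases "nsq (\<lambda>x. grad (f n) x - grad (f m) x)") auto
    have "ennreal (a + 4 * i n) \<le> ennreal (2 * (i n + e n) + 2 * (i m + e n))"
      using le a i0 by (simp add: ennreal_plus)
    then have "a + 4 * i n \<le> 2 * (i n + e n) + 2 * (i m + e n)"
      using e0[of n] i0[of n] i0[of m] by (subst (asm) ennreal_le_iff) (auto simp: less_imp_le)
    then show ?thesis unfolding a by (intro ennreal_leI) simp
  qed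
  \<comment> \<open>The sets \<open>K n\<close> shrink, so their infima increase; being bounded by C
    they converge, which makes the right-hand side of \<open>main\<close> small.\<close>
  have "incseq i" using imono by (simp add: incseq_def)
  then obtain l where "i \<longlonglongrightarrow> l" using incseq_convergent[of i "max 0 C"] iC by blast
  then have "convergent i" by (auto simp: convergent_def)
  then have ci: "Cauchy i" by (rule convergent_Cauchy)
  have "\<exists>G. G \<in> borel_measurable borel \<and> (\<lambda>n. nsq (\<lambda>x. grad (f n) x - G x)) \<longlonglongrightarrow> 0"
  proof (rule nsq_complete)
    fix r :: real assume r: "r > 0"
    obtain M1 where M1: "\<And>m n. m \<ge> M1 \<Longrightarrow> n \<ge> M1 \<Longrightarrow> \<bar>i m - i n\<bar> < r / 4"
      using CauchyD[OF ci, of "r/4"] r by auto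
    obtain M2 where M2: "\<And>n. n \<ge> M2 \<Longrightarrow> e n < r / 8"
      using order_tendstoD(2)[OF el, of "r/8"] r by (auto simp: eventually_sequentially)
    have *: "nsq (\<lambda>x. grad (f n) x - grad (f m) x) \<le> ennreal r" if "n \<ge> max M1 M2" "n \<le> m" for n m
    proof -
      have ab: "\<bar>i m - i n\<bar> < r / 4" and en: "e n < r / 8" using M1[of m n] M2[of n] that by auto
      have "i m - i n < r / 4" by (rule le_less_trans[OF abs_ge_self ab])
      then have "2 * (i m - i n) < r / 2" by simp
      moreover have "4 * e n < r / 2" using en by simp
      ultimately have "2 * (i m - i n) + 4 * e n \<le> r" by linarith
      then show ?thesis using main[OF that(2)] ennreal_leI order_trans by blast
    qed
    show "\<exists>N. \<forall>m\<ge>N. \<forall>n\<ge>N. nsq (\<lambda>x. grad (f m) x - grad (f n) x) \<le> ennreal r"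
    proof (intro exI[of _ "max M1 M2"] allI impI)
      fix m n assume "max M1 M2 \<le> m" "max M1 M2 \<le> n"
      then show "nsq (\<lambda>x. grad (f m) x - grad (f n) x) \<le> ennreal r"
        using *[of m n] *[of n m] nsq_minus[of "grad (f m)" "grad (f n)"] by (cases "m \<le> n") auto
    qed
  qed measurable
  then obtain G where G [measurable]: "G \<in> borel_measurable borel" and lG: "(\<lambda>n. nsq (\<lambda>x. grad (f n) x - G x)) \<longlonglongrightarrow> 0"
    by blast
  have [measurable]: "\<Omega> \<in> sets borel" using O by auto
  \<comment> \<open>Truncation outside \<Omega>, where all approximating gradients vanish, can only
    improve the convergence.\<close>
  define G' where "G' x = indicator \<Omega> x *\<^sub>R G x" for x
  have G'm [measurable]: "G' \<in> borel_measurable borel" unfolding G'_def by measurable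
  have lG': "(\<lambda>n. nsq (\<lambda>x. grad (f n) x - G' x)) \<longlonglongrightarrow> 0"
  proof (rule tendsto_sandwich[OF _ _ tendsto_const lG]; rule always_eventually; rule allI)
    show "nsq (\<lambda>x. grad (f n) x - G' x) \<le> nsq (\<lambda>x. grad (f n) x - G x)" for n
      by (rule nsq_mono) (auto simp: G'_def indicator_def grad_zero_outside_test[OF ft])
  qed simp
  have fG': "nsq G' < \<infinity>"
    by (rule nsq_limit_finite[OF _ G'm smooth_compact_grad_nsq_finite[OF sc] lG']) measurable
  have elE: "(\<lambda>n. ennreal (e n)) \<longlonglongrightarrow> 0" using tendsto_ennrealI[OF el] by simp
  have lf: "(\<lambda>n. nsq (\<lambda>x. U x - f n x)) \<longlonglongrightarrow> 0"
  proof (rule tendsto_sandwich[OF _ _ tendsto_const elE]; rule always_eventually; rule allI)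
    show "nsq (\<lambda>x. U x - f n x) \<le> ennreal (e n)" for n using fK[of n] by (simp add: K_def)
  qed simp
  show ?thesis
  proof (rule H10_of_approximation[OF O u G'm _ fG' ft lf])
    show "(\<lambda>n. nsq (\<lambda>x. G' x - grad (f n) x)) \<longlonglongrightarrow> 0"
      using lG' by (rule iffD2[OF nsq_diff_comm_tendsto])
  qed (simp add: G'_def)
qed

text \<open>The data required by \<open>H10_of_bounded_gradients\<close>, isolated because they add
  up: the pieces of a localised function can be approximated independently of one another.\<close>

definition approximable :: "'a::euclidean_space set \<Rightarrow> ('a \<Rightarrow> real) \<Rightarrow> bool" where
  "approximable \<Omega> U \<longleftrightarrow> (\<exists>\<phi> C. C \<ge> 0 \<and> (\<forall>n. \<phi> n \<in> test_functions \<Omega>) \<and> (\<lambda>n. nsq (\<lambda>x. U x - \<phi> n x)) \<longlonglongrightarrow> 0 \<and>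
     (\<forall>n. nsq (grad (\<phi> n)) \<le> ennreal C))"

lemma approximable_zero: "approximable \<Omega> (\<lambda>x. 0)"
proof -
  have "(\<lambda>x. 0) \<in> test_functions \<Omega>" by (simp add: test_functions_iff smooth_compact_def smooth_const)
  moreover have "grad (\<lambda>x::'a. 0) x = 0" for x by (simp add: grad_def)
  then have "nsq (grad (\<lambda>x::'a. 0)) = 0" by (simp add: nsq_def)
  ultimately show ?thesis unfolding approximable_def
    by (intro exI[of _ "\<lambda>n x. 0"] exI[of _ 0]) auto
qed

lemma approximable_add:
  assumes [measurable]: "U \<in> borel_measurable borel" "V \<in> borel_measurable borel"
    and "approximable \<Omega> U" "approximable \<Omega> V"
  shows "approximable \<Omega> (\<lambda>x. U x + V x)"
proof -
  obtain \<phi> C where phi: "C \<ge> 0" "\<And>n. \<phi> n \<in> test_functions \<Omega>" "(\<lambda>n. nsq (\<lambda>x. U x - \<phi> n x)) \<longlonglongrightarrow> 0" "\<And>n. nsq (grad (\<phi> n)) \<le> ennreal C"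
    using assms(3) unfolding approximable_def by blast
  obtain \<psi> D where psi: "D \<ge> 0" "\<And>n. \<psi> n \<in> test_functions \<Omega>" "(\<lambda>n. nsq (\<lambda>x. V x - \<psi> n x)) \<longlonglongrightarrow> 0" "\<And>n. nsq (grad (\<psi> n)) \<le> ennreal D"
    using assms(4) unfolding approximable_def by blast
  have sc: "smooth_compact (\<phi> n)" "smooth_compact (\<psi> n)" for n using phi psi test_smooth_compact by blast+
  have [measurable]: "\<phi> n \<in> borel_measurable borel" "\<psi> n \<in> borel_measurable borel"
    "grad (\<phi> n) \<in> borel_measurable borel" "grad (\<psi> n) \<in> borel_measurable borel" for n
    using sc smooth_compact_measurable grad_measurable by blast+
  let ?f = "\<lambda>n x. 1 * \<phi> n x + 1 * \<psi> n x"
  have "(\<lambda>n. 2 * nsq (\<lambda>x. U x - \<phi> n x) + 2 * nsq (\<lambda>x. V x - \<psi> n x)) \<longlonglongrightarrow> 2 * 0 + 2 * 0"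
    by (intro tendsto_add ennreal_tendsto_cmult phi psi) auto
  then have l: "(\<lambda>n. 2 * nsq (\<lambda>x. U x - \<phi> n x) + 2 * nsq (\<lambda>x. V x - \<psi> n x)) \<longlonglongrightarrow> 0" by simp
  have "(\<lambda>n. nsq (\<lambda>x. (U x + V x) - ?f n x)) \<longlonglongrightarrow> 0"
  proof (rule tendsto_sandwich[OF _ _ tendsto_const l]; rule always_eventually; rule allI)
    fix n
    have "(\<lambda>x. (U x + V x) - ?f n x) = (\<lambda>x. (U x - \<phi> n x) + (V x - \<psi> n x))" by auto
    then show "nsq (\<lambda>x. (U x + V x) - ?f n x) \<le> 2 * nsq (\<lambda>x. U x - \<phi> n x) + 2 * nsq (\<lambda>x. V x - \<psi> n x)"
      by (simp only:) (rule nsq_add; measurable)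
  qed simp
  moreover have "nsq (grad (?f n)) \<le> ennreal (2 * C + 2 * D)" for n
  proof -
    have "nsq (grad (?f n)) = nsq (\<lambda>x. grad (\<phi> n) x + grad (\<psi> n) x)"
      by (rule arg_cong[of _ _ nsq]) (auto simp: fun_eq_iff grad_lincomb[OF sc(1) sc(2), of 1 _ 1, simplified])
    also have "\<dots> \<le> 2 * nsq (grad (\<phi> n)) + 2 * nsq (grad (\<psi> n))" by (rule nsq_add) measurable
    also have "\<dots> \<le> 2 * ennreal C + 2 * ennreal D" by (intro add_mono mult_left_mono phi psi) auto
    also have "\<dots> = ennreal (2 * C + 2 * D)" using phi(1) psi(1) by (simp add: ennreal_mult ennreal_plus)
    finally show ?thesis .
  qed
  moreover have "?f n \<in> test_functions \<Omega>" for n by (rule test_lincomb[OF phi(2) psi(2)])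
  ultimately show ?thesis unfolding approximable_def
    using phi(1) psi(1) by (intro exI[of _ ?f] exI[of _ "2 * C + 2 * D"]) auto
qed

text \<open>In each basis direction b the squared difference quotients 4^k Phi(b/2^k) are at most C,
  hence so is their limit; the d directions sum to d C.\<close>

lemma nsq_grad_le_of_Phi:
  fixes \<phi> :: "'a::euclidean_space \<Rightarrow> real"
  assumes sc: "smooth_compact \<phi>" and C: "C \<ge> 0" and bd: "\<And>h. Phi \<phi> h \<le> ennreal (C * (norm h)\<^sup>2)"
  shows "nsq (grad \<phi>) \<le> ennreal (real DIM('a) * C)"
proof -
  have [measurable]: "\<phi> \<in> borel_measurable borel" "grad \<phi> \<in> borel_measurable borel"
    using smooth_compact_measurable[OF sc] grad_measurable[OF sc] by auto
  have dir: "nsq (\<lambda>x. grad \<phi> x \<bullet> b) \<le> ennreal C" if b: "b \<in> Basis" for b :: 'a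
  proof -
    have "nsq (\<lambda>x. grad \<phi> x \<bullet> b) < \<infinity>"
      using nsq_component_le[OF b] smooth_compact_grad_nsq_finite[OF sc] by (blast intro: le_less_trans)
    then have lim: "(\<lambda>k. nsq (\<lambda>x. 2^k * (\<phi> (x + (1/2)^k *\<^sub>R b) - \<phi> x))) \<longlonglongrightarrow> nsq (\<lambda>x. grad \<phi> x \<bullet> b)"
      by (intro nsq_tendsto nsq_difference_quotient_tendsto[OF sc]) measurable
    have "nsq (\<lambda>x. 2^k * (\<phi> (x + (1/2)^k *\<^sub>R b) - \<phi> x)) \<le> ennreal C" for k
    proof -
      have "nsq (\<lambda>x. 2^k * (\<phi> (x + (1/2)^k *\<^sub>R b) - \<phi> x)) = 4^k * Phi \<phi> ((1/2)^k *\<^sub>R b)"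
        by (rule nsq_difference_quotient) measurable
      also have "\<dots> \<le> 4^k * ennreal (C * (norm ((1/2)^k *\<^sub>R b))\<^sup>2)" by (rule mult_left_mono[OF bd]) simp
      also have "\<dots> = ennreal (4^k) * ennreal (C * ((1/2)^k)\<^sup>2)" using b by (simp add: ennreal_power[symmetric])
      also have "\<dots> = ennreal (4^k * (C * ((1/2)^k)\<^sup>2))" by (rule ennreal_mult[symmetric]) (use C in auto)
      also have "4^k * (C * ((1/2)^k)\<^sup>2) = C"
        by (simp add: power2_eq_square power_mult_distrib[symmetric])
      finally show ?thesis .
    qed
    then show ?thesis by (intro LIMSEQ_le_const2[OF lim]) auto
  qed
  have "nsq (grad \<phi>) = (\<integral>\<^sup>+x. (\<Sum>b\<in>Basis. ennreal ((norm (grad \<phi> x \<bullet> b))\<^sup>2)) \<partial>lborel)"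
    unfolding nsq_def
  proof (rule nn_integral_cong)
    fix x
    have "(norm (grad \<phi> x))\<^sup>2 = (\<Sum>b\<in>Basis. (norm (grad \<phi> x \<bullet> b))\<^sup>2)"
      unfolding power2_norm_eq_inner[of "grad \<phi> x"] euclidean_inner[of "grad \<phi> x" "grad \<phi> x"] by (simp add: power2_eq_square)
    then show "ennreal ((norm (grad \<phi> x))\<^sup>2) = (\<Sum>b\<in>Basis. ennreal ((norm (grad \<phi> x \<bullet> b))\<^sup>2))"
      by (simp add: sum_ennreal)
  qed
  also have "\<dots> = (\<Sum>b\<in>(Basis :: 'a set). nsq (\<lambda>x. grad \<phi> x \<bullet> b))"
    unfolding nsq_def by (rule nn_integral_sum) measurable
  also have "\<dots> \<le> (\<Sum>b\<in>(Basis :: 'a set). ennreal C)" by (rule sum_mono) (rule dir)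
  also have "\<dots> = ennreal (real DIM('a) * C)" using C by (simp add: ennreal_mult ennreal_of_nat_eq_real_of_nat)
  finally show ?thesis .
qed

text \<open>Shifting by a small multiple of v moves the compact support strictly inside \<Omega>,
  which leaves room to mollify. Neither operation increases \<open>Phi\<close>, so the gradients
  stay bounded by \<open>nsq_grad_le_of_Phi\<close>, while the quadratic bound on
  \<open>Phi W\<close> makes both errors tend to 0.\<close>

lemma approximable_shift:
  fixes W :: "'a::euclidean_space \<Rightarrow> real"
  assumes Wm [measurable]: "W \<in> borel_measurable borel" and fin: "nsq W < \<infinity>" and C: "C \<ge> 0"
    and bd: "\<And>h. Phi W h \<le> ennreal (C * (norm h)\<^sup>2)" and O: "open \<Omega>" and K: "compact K"
    and supp: "\<And>x. x \<notin> K \<Longrightarrow> W x = 0" and t0: "t0 > 0"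
    and inside: "\<And>t x. 0 < t \<Longrightarrow> t < t0 \<Longrightarrow> x \<in> K \<Longrightarrow> x + t *\<^sub>R v \<in> \<Omega>"
  shows "approximable \<Omega> W"
proof -
  \<comment> \<open>n + 2 rather than n + 1 keeps the first shift strictly below
    \<open>t0\<close>.\<close>
  define t where "t n = t0 / real (n + 2)" for n
  have t: "0 < t n" "t n < t0" for n
  proof -
    show "0 < t n" using t0 by (simp add: t_def)
    have "t0 * 1 < t0 * real (n + 2)" using t0 by (intro mult_strict_left_mono) auto
    then show "t n < t0" by (simp add: t_def divide_less_eq)
  qed
  have tl: "t \<longlonglongrightarrow> 0"
  proof -
    have "(\<lambda>n. t0 / real n) \<longlonglongrightarrow> 0" by (rule lim_const_over_n)
    then show ?thesis unfolding t_def by (rule LIMSEQ_ignore_initial_segment)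
  qed
  define Kn where "Kn n = (\<lambda>x. x + t n *\<^sub>R v) ` K" for n
  have Knc: "compact (Kn n)" for n unfolding Kn_def by (intro compact_continuous_image continuous_intros K)
  have KnO: "Kn n \<subseteq> \<Omega>" for n unfolding Kn_def using inside t by auto
  have "\<exists>e. 0 < e \<and> e \<le> inverse (real (Suc n)) \<and> (\<forall>x y. x \<in> Kn n \<longrightarrow> norm y \<le> e \<longrightarrow> x + y \<in> \<Omega>)" for n
  proof -
    obtain e where e: "e > 0" "(\<Union>x\<in>Kn n. cball x e) \<subseteq> \<Omega>"
      using compact_subset_open_imp_cball_epsilon_subset[OF Knc O KnO] by blast
    have "x + y \<in> \<Omega>" if "x \<in> Kn n" "norm y \<le> min e (inverse (real (Suc n)))" for x y
    proof -
      have "x + y \<in> cball x e" using that by (simp add: dist_norm)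
      then show ?thesis using e(2) that by blast
    qed
    then show ?thesis using e(1) by (intro exI[of _ "min e (inverse (real (Suc n)))"]) auto
  qed
  then obtain e where e: "\<And>n. 0 < e n" "\<And>n. e n \<le> inverse (real (Suc n))"
    "\<And>n x y. x \<in> Kn n \<Longrightarrow> norm y \<le> e n \<Longrightarrow> x + y \<in> \<Omega>" by metis
  have el: "e \<longlonglongrightarrow> 0"
    by (rule tendsto_sandwich[OF _ _ tendsto_const LIMSEQ_inverse_real_of_nat]) (use e in \<open>auto intro!: always_eventually less_imp_le\<close>)
  have "\<exists>\<rho> :: 'a \<Rightarrow> real. mollifier (e n) \<rho>" for n by (rule mollifier_exists[OF e(1)])
  then obtain \<rho> :: "nat \<Rightarrow> 'a \<Rightarrow> real" where rho: "\<And>n. mollifier (e n) (\<rho> n)" by metis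
  define Wn where "Wn n x = W (x + (- (t n *\<^sub>R v)))" for n x
  have Wnm [measurable]: "Wn n \<in> borel_measurable borel" for n unfolding Wn_def by measurable
  have Wns: "nsq (Wn n) = nsq W" for n unfolding Wn_def by (rule nsq_shift) measurable
  have WnK: "Wn n x = 0" if "x \<notin> Kn n" for n x
  proof -
    have "x = (x + (- (t n *\<^sub>R v))) + t n *\<^sub>R v" by simp
    then have "x + (- (t n *\<^sub>R v)) \<notin> K" using that unfolding Kn_def by blast
    then show ?thesis using supp by (simp add: Wn_def)
  qed
  have Wni: "integrable lborel (Wn n)" for n
    by (rule integrable_of_L2_bounded_support[OF Wnm _ compact_imp_bounded[OF Knc] WnK]) (use Wns fin in auto)
  have WnPhi: "Phi (Wn n) h = Phi W h" for n h
  proof -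
    have "Phi (Wn n) h = nsq (\<lambda>x. (\<lambda>y. W (y + h) - W y) (x + (- (t n *\<^sub>R v))))"
      unfolding Phi_def Wn_def by (simp add: algebra_simps)
    also have "\<dots> = Phi W h" unfolding Phi_def by (rule nsq_shift) measurable
    finally show ?thesis .
  qed
  define \<phi> where "\<phi> n = conv (\<rho> n) (Wn n)" for n
  have phit: "\<phi> n \<in> test_functions \<Omega>" for n
    unfolding \<phi>_def by (rule test_functions_conv[OF rho Wni Knc WnK]) (use e in auto)
  have sc: "smooth_compact (\<phi> n)" for n by (rule test_smooth_compact[OF phit])
  have [measurable]: "\<phi> n \<in> borel_measurable borel" for n by (rule smooth_compact_measurable[OF sc])
  have "Phi (\<phi> n) h \<le> ennreal (C * (norm h)\<^sup>2)" for n h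
    unfolding \<phi>_def using mollify_Phi[OF rho Wni] bd by (metis WnPhi order_trans)
  then have g: "nsq (grad (\<phi> n)) \<le> ennreal (real DIM('a) * C)" for n
    by (rule nsq_grad_le_of_Phi[OF sc C])
  have err: "nsq (\<lambda>x. W x - \<phi> n x) \<le> ennreal (2 * (C * (norm (t n *\<^sub>R v))\<^sup>2) + 2 * (C * (e n)\<^sup>2))" for n
  proof -
    have a1: "nsq (\<lambda>x. \<phi> n x - Wn n x) \<le> ennreal (C * (e n)\<^sup>2)"
      unfolding \<phi>_def
    proof (rule mollify_error[OF rho Wni])
      fix y :: 'a assume "norm y < e n"
      then have "C * (norm y)\<^sup>2 \<le> C * (e n)\<^sup>2" using C by (intro mult_left_mono power_mono) auto
      then show "Phi (Wn n) y \<le> ennreal (C * (e n)\<^sup>2)" unfolding WnPhi using bd ennreal_leI order_trans by blast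
    qed
    have a2: "nsq (\<lambda>x. Wn n x - W x) \<le> ennreal (C * (norm (t n *\<^sub>R v))\<^sup>2)"
      using bd[of "- (t n *\<^sub>R v)"] by (simp add: Phi_def Wn_def)
    have "nsq (\<lambda>x. W x - \<phi> n x) = nsq (\<lambda>x. \<phi> n x - W x)" by (rule nsq_minus)
    also have "\<dots> \<le> 2 * nsq (\<lambda>x. \<phi> n x - Wn n x) + 2 * nsq (\<lambda>x. Wn n x - W x)"
      by (rule nsq_diff_triangle) measurable
    also have "\<dots> \<le> 2 * ennreal (C * (e n)\<^sup>2) + 2 * ennreal (C * (norm (t n *\<^sub>R v))\<^sup>2)"
      by (intro add_mono mult_left_mono a1 a2) auto
    also have "\<dots> = 2 * ennreal (C * (norm (t n *\<^sub>R v))\<^sup>2) + 2 * ennreal (C * (e n)\<^sup>2)"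
      by (rule add.commute)
    also have "\<dots> = ennreal (2 * (C * (norm (t n *\<^sub>R v))\<^sup>2) + 2 * (C * (e n)\<^sup>2))"
      using C by (simp add: ennreal_mult ennreal_plus)
    finally show ?thesis .
  qed
  have "(\<lambda>n. 2 * (C * (norm (t n *\<^sub>R v))\<^sup>2) + 2 * (C * (e n)\<^sup>2)) \<longlonglongrightarrow> 2 * (C * (norm (0 *\<^sub>R v))\<^sup>2) + 2 * (C * 0\<^sup>2)"
    by (intro tendsto_intros tl el)
  then have l: "(\<lambda>n. ennreal (2 * (C * (norm (t n *\<^sub>R v))\<^sup>2) + 2 * (C * (e n)\<^sup>2))) \<longlonglongrightarrow> 0"
    using tendsto_ennrealI by fastforce
  have "(\<lambda>n. nsq (\<lambda>x. W x - \<phi> n x)) \<longlonglongrightarrow> 0"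
    by (rule tendsto_sandwich[OF _ _ tendsto_const l]; rule always_eventually; rule allI) (simp, rule err)
  then show ?thesis unfolding approximable_def
    using phit g C by (intro exI[of _ \<phi>] exI[of _ "real DIM('a) * C"]) auto
qed

text \<open>The discrete product rule: the increment of \<eta> U is \<eta>(x+h) (U(x+h) - U x) +
  (\<eta>(x+h) - \<eta> x) U x, and the second term is at most L |h| |U x|. A Lipschitz factor thus
  preserves a quadratic bound, with a larger constant.\<close>

lemma Phi_cutoff:
  fixes \<eta> U :: "'a::euclidean_space \<Rightarrow> real"
  assumes [measurable]: "U \<in> borel_measurable borel" "\<eta> \<in> borel_measurable borel"
    and fin: "nsq U < \<infinity>" and C: "C \<ge> 0" "\<And>h. Phi U h \<le> ennreal (C * (norm h)\<^sup>2)"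
    and c1: "\<And>x. \<bar>\<eta> x\<bar> \<le> 1" and lip: "L \<ge> 0" "\<And>x y. \<bar>\<eta> x - \<eta> y\<bar> \<le> L * norm (x - y)"
  shows "\<exists>D\<ge>0. \<forall>h. Phi (\<lambda>x. \<eta> x * U x) h \<le> ennreal (D * (norm h)\<^sup>2)"
proof -
  obtain N where N: "nsq U = ennreal N" "N \<ge> 0" using fin by (cases "nsq U") auto
  let ?D = "2 * C + 2 * (L\<^sup>2 * N)"
  have "Phi (\<lambda>x. \<eta> x * U x) h \<le> ennreal (?D * (norm h)\<^sup>2)" for h
  proof -
    have "Phi (\<lambda>x. \<eta> x * U x) h = nsq (\<lambda>x. \<eta> (x + h) * (U (x + h) - U x) + (\<eta> (x + h) - \<eta> x) * U x)"
      unfolding Phi_def by (simp add: algebra_simps)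
    also have "\<dots> \<le> 2 * nsq (\<lambda>x. \<eta> (x + h) * (U (x + h) - U x)) + 2 * nsq (\<lambda>x. (\<eta> (x + h) - \<eta> x) * U x)"
      by (rule nsq_add) measurable
    also have "\<dots> \<le> 2 * ennreal (C * (norm h)\<^sup>2) + 2 * ennreal ((L * norm h)\<^sup>2 * N)"
    proof (intro add_mono mult_left_mono)
      have "nsq (\<lambda>x. \<eta> (x + h) * (U (x + h) - U x)) \<le> Phi U h"
        unfolding Phi_def
        by (rule nsq_mono) (use c1 in \<open>auto simp: abs_mult intro: mult_left_le_one_le\<close>)
      then show "nsq (\<lambda>x. \<eta> (x + h) * (U (x + h) - U x)) \<le> ennreal (C * (norm h)\<^sup>2)" using C(2) order_trans by blast
      have "nsq (\<lambda>x. (\<eta> (x + h) - \<eta> x) * U x) \<le> nsq (\<lambda>x. (L * norm h) *\<^sub>R U x)"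
      proof (rule nsq_mono)
        fix x
        have "\<bar>\<eta> (x + h) - \<eta> x\<bar> \<le> L * norm h" using lip(2)[of "x + h" x] by simp
        then show "norm ((\<eta> (x + h) - \<eta> x) * U x) \<le> norm ((L * norm h) *\<^sub>R U x)"
          using lip(1) by (simp add: abs_mult mult_right_mono)
      qed
      also have "\<dots> = ennreal ((L * norm h)\<^sup>2) * nsq U" by (rule nsq_scaleR) measurable
      also have "\<dots> = ennreal ((L * norm h)\<^sup>2 * N)" using N by (simp add: ennreal_mult)
      finally show "nsq (\<lambda>x. (\<eta> (x + h) - \<eta> x) * U x) \<le> ennreal ((L * norm h)\<^sup>2 * N)" .
    qed auto
    also have "\<dots> = ennreal (2 * (C * (norm h)\<^sup>2) + 2 * ((L * norm h)\<^sup>2 * N))"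
      using C(1) N(2) by (simp add: ennreal_mult ennreal_plus)
    also have "2 * (C * (norm h)\<^sup>2) + 2 * ((L * norm h)\<^sup>2 * N) = ?D * (norm h)\<^sup>2"
      by (simp add: power_mult_distrib algebra_simps)
    finally show ?thesis .
  qed
  then show ?thesis using C(1) N(2) by (intro exI[of _ ?D]) auto
qed

section \<open>Localisation and pushing inwards at the boundary\<close>

definition cutoff :: "'a::euclidean_space \<Rightarrow> real \<Rightarrow> 'a \<Rightarrow> real" where
  "cutoff p r x = max 0 (min 1 (2 - 3 * norm (x - p) / r))"

lemma cutoff_props:
  assumes r: "r > 0"
  shows "0 \<le> cutoff p r x" "cutoff p r x \<le> 1"
    and "norm (x - p) \<le> r / 3 \<Longrightarrow> cutoff p r x = 1"
    and "norm (x - p) \<ge> 2 * r / 3 \<Longrightarrow> cutoff p r x = 0"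
    and "\<bar>cutoff p r x - cutoff p r y\<bar> \<le> (3 / r) * norm (x - y)"
    and "cutoff p r \<in> borel_measurable borel"
proof -
  show "0 \<le> cutoff p r x" "cutoff p r x \<le> 1" by (auto simp: cutoff_def)
  show "cutoff p r x = 1" if "norm (x - p) \<le> r / 3"
    using that r by (simp add: cutoff_def field_simps)
  show "cutoff p r x = 0" if "norm (x - p) \<ge> 2 * r / 3"
    using that r by (simp add: cutoff_def field_simps)
  show "cutoff p r \<in> borel_measurable borel" unfolding cutoff_def[abs_def] by measurable
  have "\<bar>cutoff p r x - cutoff p r y\<bar> \<le> \<bar>(2 - 3 * norm (x - p) / r) - (2 - 3 * norm (y - p) / r)\<bar>"
    unfolding cutoff_def by (auto simp: max_def min_def abs_if)
  also have "\<dots> = (3 / r) * \<bar>norm (x - p) - norm (y - p)\<bar>"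
  proof -
    have "(2 - 3 * norm (x - p) / r) - (2 - 3 * norm (y - p) / r) = - ((3 / r) * (norm (x - p) - norm (y - p)))"
      by (simp add: right_diff_distrib)
    then show ?thesis using r by (simp only: abs_minus_cancel abs_mult) simp
  qed
  also have "\<dots> \<le> (3 / r) * norm (x - y)"
    using norm_triangle_ineq3[of "x - p" "y - p"] r by (intro mult_left_mono) auto
  finally show "\<bar>cutoff p r x - cutoff p r y\<bar> \<le> (3 / r) * norm (x - y)" .
qed

text \<open>Supports are confined to radius 2 r/3, the range of \<open>cutoff p r\<close>; the
  remaining r/3 is the margin for translations inside the ball of radius r.\<close>

definition locally_approximable :: "'a::euclidean_space set \<Rightarrow> 'a \<Rightarrow> real \<Rightarrow> bool" where
  "locally_approximable \<Omega> p r \<longleftrightarrow> r > 0 \<and> (\<forall>W C. W \<in> borel_measurable borel \<and> nsq W < \<infinity> \<and> C \<ge> 0 \<and>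
     (\<forall>h. Phi W h \<le> ennreal (C * (norm h)\<^sup>2)) \<and> (\<forall>x. x \<notin> \<Omega> \<or> norm (x - p) > 2 * r / 3 \<longrightarrow> W x = 0)
     \<longrightarrow> approximable \<Omega> W)"

text \<open>Instead of a partition of unity, one centre is split off at a time: U = c U + (1 - c) U
  with c the cutoff at p. The first piece is local at p; the second vanishes within r p / 3 of p and
  is therefore covered by the other centres. The constant C grows at each step, so the induction
  generalises over it.\<close>

lemma approximable_finite_cover:
  assumes "finite F" and "\<And>p. p \<in> F \<Longrightarrow> locally_approximable \<Omega> p (r p)"
    and "U \<in> borel_measurable borel" "nsq U < \<infinity>" "C \<ge> 0" "\<And>h. Phi U h \<le> ennreal (C * (norm h)\<^sup>2)"
    and "\<And>x. x \<notin> \<Omega> \<Longrightarrow> U x = 0" "\<And>x. U x \<noteq> 0 \<Longrightarrow> \<exists>p\<in>F. norm (x - p) \<le> r p / 3"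
  shows "approximable \<Omega> U"
  using assms
proof (induction F arbitrary: U C rule: finite_induct)
  case empty
  then have "U = (\<lambda>x. 0)" by auto
  then show ?case using approximable_zero by simp
next
  case (insert p F)
  have la: "locally_approximable \<Omega> p (r p)" using insert.prems(1) by simp
  then have rp: "r p > 0" by (simp add: locally_approximable_def)
  note Um [measurable] = insert.prems(2)
  note c = cutoff_props[where p = p, OF rp]
  note [measurable] = c(6)
  let ?V = "\<lambda>x. cutoff p (r p) x * U x" and ?W = "\<lambda>x. (1 - cutoff p (r p) x) * U x"
  have fin: "nsq ?V < \<infinity>" "nsq ?W < \<infinity>"
  proof -
    have "nsq ?V \<le> nsq U" by (rule nsq_mono) (use c(1,2) in \<open>auto simp: abs_mult intro: mult_left_le_one_le\<close>)
    moreover have "nsq ?W \<le> nsq U" by (rule nsq_mono) (use c(1,2) in \<open>auto simp: abs_mult intro: mult_left_le_one_le\<close>)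
    ultimately show "nsq ?V < \<infinity>" "nsq ?W < \<infinity>" using insert.prems(3) by (auto intro: le_less_trans)
  qed
  have "\<exists>D\<ge>0. \<forall>h. Phi ?V h \<le> ennreal (D * (norm h)\<^sup>2)"
    by (rule Phi_cutoff[OF Um c(6) insert.prems(3,4,5), of "3 / r p"]) (use c rp in auto)
  then obtain D where D: "D \<ge> 0" "\<And>h. Phi ?V h \<le> ennreal (D * (norm h)\<^sup>2)" by blast
  have c5: "\<bar>cutoff p (r p) y - cutoff p (r p) x\<bar> \<le> (3 / r p) * norm (x - y)" for x y
    using c(5)[of x y] by (simp only: abs_minus_commute)
  have "\<exists>E\<ge>0. \<forall>h. Phi ?W h \<le> ennreal (E * (norm h)\<^sup>2)"
    by (rule Phi_cutoff[OF Um _ insert.prems(3,4,5), of _ "3 / r p"])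
      (use c(1,2) c5 rp in auto)
  then obtain E where E: "E \<ge> 0" "\<And>h. Phi ?W h \<le> ennreal (E * (norm h)\<^sup>2)" by blast
  have "approximable \<Omega> ?V"
  proof -
    have "\<forall>x. x \<notin> \<Omega> \<or> norm (x - p) > 2 * r p / 3 \<longrightarrow> ?V x = 0" using c(4) insert.prems(6) by auto
    then show ?thesis using la fin(1) D unfolding locally_approximable_def by (intro la[unfolded locally_approximable_def, THEN conjunct2, rule_format, of _ D]) auto
  qed
  moreover have "approximable \<Omega> ?W"
  proof (rule insert.IH[of ?W E])
    fix x assume x: "?W x \<noteq> 0"
    then have "U x \<noteq> 0" "cutoff p (r p) x \<noteq> 1" by auto
    then have "norm (x - p) > r p / 3" using c(3)[of x] by force
    then show "\<exists>p\<in>F. norm (x - p) \<le> r p / 3" using insert.prems(7)[OF \<open>U x \<noteq> 0\<close>] by auto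
  qed (use insert.prems fin E in auto)
  ultimately have "approximable \<Omega> (\<lambda>x. ?V x + ?W x)" by (intro approximable_add) measurable
  moreover have "(\<lambda>x. ?V x + ?W x) = U" by (auto simp: fun_eq_iff algebra_simps)
  ultimately show ?case by simp
qed

lemma locally_approximable_interior:
  assumes O: "open \<Omega>" and p: "p \<in> \<Omega>"
  shows "\<exists>r. locally_approximable \<Omega> p r"
proof -
  obtain r where r: "r > 0" "ball p r \<subseteq> \<Omega>" using O p openE by blast
  have "locally_approximable \<Omega> p r"
    unfolding locally_approximable_def
  proof (intro conjI r allI impI, elim conjE)
    fix W :: "'a \<Rightarrow> real" and C
    assume W: "W \<in> borel_measurable borel" "nsq W < \<infinity>" "0 \<le> C" "\<forall>h. Phi W h \<le> ennreal (C * (norm h)\<^sup>2)"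
      "\<forall>x. x \<notin> \<Omega> \<or> 2 * r / 3 < norm (x - p) \<longrightarrow> W x = 0"
    have sub: "cball p (2 * r / 3) \<subseteq> \<Omega>" using r by (intro order_trans[OF _ r(2)]) (auto simp: dist_norm)
    show "approximable \<Omega> W"
      by (rule approximable_shift[OF W(1-3) _ O compact_cball[of p "2 * r / 3"], of 1 0])
        (use W sub in \<open>auto simp: dist_norm norm_minus_commute\<close>)
  qed
  then show ?thesis by blast
qed

text \<open>Moving in direction e keeps the projection orthogonal to e and raises the height. Points
  of the closure lie weakly above the graph, so every positive shift puts them strictly above it,
  that is into \<Omega>.\<close>

lemma locally_approximable_boundary:
  assumes O: "open \<Omega>" and bO: "bounded \<Omega>" and lip: "lipschitz_boundary \<Omega>" and p: "p \<in> frontier \<Omega>"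
  shows "\<exists>r. locally_approximable \<Omega> p r"
proof -
  obtain e r L \<gamma> where e: "norm e = 1" and r: "0 < r" and g: "L-lipschitz_on {y. y \<bullet> e = 0} \<gamma>"
    and eq: "\<Omega> \<inter> ball p r = {x \<in> ball p r. \<gamma> (x - (x \<bullet> e) *\<^sub>R e) < x \<bullet> e}"
    using lip p unfolding lipschitz_boundary_def by blast
  have ee: "e \<bullet> e = 1" using e by (simp add: power2_norm_eq_inner[symmetric])
  have cont: "continuous_on UNIV (\<lambda>x. x \<bullet> e - \<gamma> (x - (x \<bullet> e) *\<^sub>R e))"
  proof (intro continuous_intros)
    show "continuous_on UNIV (\<lambda>x. \<gamma> (x - (x \<bullet> e) *\<^sub>R e))"
      by (rule continuous_on_compose2[OF lipschitz_on_continuous_on[OF g]])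
        (auto intro!: continuous_intros simp: inner_diff_left ee)
  qed
  \<comment> \<open>A point strictly below the graph has, by continuity, a neighbourhood below the
    graph, and such a neighbourhood misses \<Omega>.\<close>
  have cl: "\<gamma> (x - (x \<bullet> e) *\<^sub>R e) \<le> x \<bullet> e" if x: "x \<in> closure \<Omega>" "x \<in> ball p r" for x
  proof (rule ccontr)
    let ?f = "\<lambda>x. x \<bullet> e - \<gamma> (x - (x \<bullet> e) *\<^sub>R e)"
    assume "\<not> \<gamma> (x - (x \<bullet> e) *\<^sub>R e) \<le> x \<bullet> e"
    then have "x \<in> ball p r \<inter> {x. ?f x < 0}" using x by auto
    moreover have "open (ball p r \<inter> {x. ?f x < 0})"
      by (intro open_Int open_ball open_Collect_less cont continuous_intros)
    ultimately have "ball p r \<inter> {x. ?f x < 0} \<inter> \<Omega> \<noteq> {}"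
      using x(1) open_Int_closure_eq_empty by blast
    then obtain y where "y \<in> ball p r" "?f y < 0" "y \<in> \<Omega>" by auto
    moreover from this have "y \<in> {x \<in> ball p r. \<gamma> (x - (x \<bullet> e) *\<^sub>R e) < x \<bullet> e}" using eq by blast
    ultimately show False by simp
  qed
  have "locally_approximable \<Omega> p r"
    unfolding locally_approximable_def
  proof (intro conjI r allI impI, elim conjE)
    fix W :: "'a \<Rightarrow> real" and C
    assume W: "W \<in> borel_measurable borel" "nsq W < \<infinity>" "0 \<le> C" "\<forall>h. Phi W h \<le> ennreal (C * (norm h)\<^sup>2)"
      "\<forall>x. x \<notin> \<Omega> \<or> 2 * r / 3 < norm (x - p) \<longrightarrow> W x = 0"
    let ?K = "closure \<Omega> \<inter> cball p (2 * r / 3)"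
    have K: "compact ?K" by (intro closed_Int_compact closed_closure compact_cball)
    show "approximable \<Omega> W"
    \<comment> \<open>Shifts shorter than r/3 keep the ball of radius 2 r/3 inside the chart ball of
      radius r.\<close>
    proof (rule approximable_shift[OF W(1-3) _ O K, of "r / 3" e])
      fix x assume "x \<notin> ?K"
      then show "W x = 0" using W(5) closure_subset[of \<Omega>] by (auto simp: dist_norm norm_minus_commute)
    next
      fix t x assume t: "0 < t" "t < r / 3" and x: "x \<in> ?K"
      let ?y = "x + t *\<^sub>R e"
      have "norm (x - p) \<le> 2 * r / 3" using x by (simp add: dist_norm norm_minus_commute)
      moreover have "norm (?y - p) \<le> norm (x - p) + norm (t *\<^sub>R e)"
        using norm_triangle_ineq[of "x - p" "t *\<^sub>R e"] by (simp add: algebra_simps)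
      ultimately have y: "?y \<in> ball p r" using t e by (simp add: dist_norm norm_minus_commute)
      have xb: "x \<in> ball p r" using \<open>norm (x - p) \<le> 2 * r / 3\<close> r by (simp add: dist_norm norm_minus_commute)
      have yx: "?y - (?y \<bullet> e) *\<^sub>R e = x - (x \<bullet> e) *\<^sub>R e"
        by (simp add: inner_add_left ee scaleR_add_left)
      have "\<gamma> (?y - (?y \<bullet> e) *\<^sub>R e) \<le> x \<bullet> e" unfolding yx using cl[OF _ xb] x by simp
      also have "x \<bullet> e < ?y \<bullet> e" using t by (simp add: inner_add_left ee)
      finally have "?y \<in> {x \<in> ball p r. \<gamma> (x - (x \<bullet> e) *\<^sub>R e) < x \<bullet> e}" using y by blast
      then show "?y \<in> \<Omega>" using eq by blast
    qed (use W r in auto)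
  qed
  then show ?thesis by blast
qed

lemma H10_of_Phi_bound:
  assumes O: "open \<Omega>" "bounded \<Omega>" "lipschitz_boundary \<Omega>" and u: "rep \<Omega> u U" "nsq U < \<infinity>"
    and C: "C \<ge> 0" "\<And>h. Phi U h \<le> ennreal (C * (norm h)\<^sup>2)"
  shows "u \<in> H10 \<Omega>"
proof -
  have "\<exists>r. locally_approximable \<Omega> p r" if "p \<in> closure \<Omega>" for p
    using that locally_approximable_interior[OF O(1), of p] locally_approximable_boundary[OF O, of p]
    by (cases "p \<in> \<Omega>") (auto simp: frontier_def interior_open O(1))
  then obtain r where r: "\<And>p. p \<in> closure \<Omega> \<Longrightarrow> locally_approximable \<Omega> p (r p)" by metis
  have comp: "compact (closure \<Omega>)" using O(2) by simp
  have "closure \<Omega> \<subseteq> (\<Union>p\<in>closure \<Omega>. ball p (r p / 3))"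
    using r by (force simp: locally_approximable_def)
  then obtain F where F: "F \<subseteq> closure \<Omega>" "finite F" "closure \<Omega> \<subseteq> (\<Union>p\<in>F. ball p (r p / 3))"
    using compactE_image[OF comp, of "closure \<Omega>" "\<lambda>p. ball p (r p / 3)"] by (metis open_ball)
  have "approximable \<Omega> U"
  proof (rule approximable_finite_cover[OF F(2) _ rep_measurable[OF u(1)] u(2) C])
    fix x assume "U x \<noteq> 0"
    then have "x \<in> \<Omega>" using rep_outside[OF u(1)] by blast
    then obtain p where "p \<in> F" "x \<in> ball p (r p / 3)" using F(3) closure_subset by blast
    then show "\<exists>p\<in>F. norm (x - p) \<le> r p / 3" by (intro bexI[of _ p]) (auto simp: dist_norm norm_minus_commute)
  qed (use r F rep_outside[OF u(1)] in auto)
  then show ?thesis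
    unfolding approximable_def using H10_of_bounded_gradients[OF O(1,2) u] by blast
qed

section \<open>Compactness\<close>

text \<open>Convexity of exp: 4^a lies below its chord between a = 0 and a = 1. This replaces the
  asymptotics at 0 by a bound uniform in s.\<close>

lemma four_powr_le:
  assumes "0 \<le> a" "a \<le> (1::real)"
  shows "4 powr a - 1 \<le> 3 * a"
proof -
  have "exp ((1 - a) *\<^sub>R 0 + a *\<^sub>R ln 4) \<le> (1 - a) * exp 0 + a * exp (ln (4::real))"
    by (rule convex_onD[OF exp_convex]) (use assms in auto)
  then show ?thesis by (simp add: powr_def mult.commute)
qed

text \<open>The pointwise bound by I(|h|/2), with I estimated by \<open>shell_energy_lower\<close>
  at r = |h|/2. The factor 1 - s comes from 4^(1-s) - 1 <= 3 (1 - s), and |h|^2 / r^(2-2s) <= 4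
  |h|^(2s); hence 96 = 8 * 3 * 4, independently of s.\<close>

lemma Phi_le_frac_energy:
  fixes U :: "'a::euclidean_space \<Rightarrow> real"
  assumes [measurable]: "U \<in> borel_measurable borel" and s: "0 < s" "s < 1"
  shows "Phi U h \<le> ennreal (96 * 4 ^ DIM('a) / unit_ball_vol DIM('a) * norm h powr (2 * s)) * (ennreal (1 - s) * frac_energy s (Phi U))"
proof (cases "h = 0")
  case True
  then show ?thesis by (simp add: Phi_def)
next
  case False
  define a where "a = 1 - s"
  have a: "0 < a" "a < 1" using s by (auto simp: a_def)
  define r where "r = norm h / 2"
  have r: "r > 0" using False by (simp add: r_def)
  have den: "4 powr a - 1 > 0" using a by simp
  let ?I = "shell_int (Phi U) r" and ?E = "frac_energy s (Phi U)"
  define c where "c = 8 * 4 ^ DIM('a) / unit_ball_vol DIM('a)"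
  have c: "c > 0" by (simp add: c_def)
  have up: "Phi U h \<le> ennreal (c * (norm h)\<^sup>2) * ?I"
    unfolding r_def c_def by (rule pointwise_le_shell_int) (use False Phi_add[OF assms(1)] in auto)
  have low: "ennreal (r powr (2 * a) / (4 powr a - 1)) * ?I \<le> ?E"
    using shell_energy_lower[OF measurable_Phi[OF assms(1)] Phi_double[OF assms(1)] s(2) r] by (simp add: a_def right_diff_distrib)
  have "?I = ennreal ((4 powr a - 1) / r powr (2 * a)) * (ennreal (r powr (2 * a) / (4 powr a - 1)) * ?I)"
  proof -
    have "ennreal ((4 powr a - 1) / r powr (2 * a)) * ennreal (r powr (2 * a) / (4 powr a - 1))
      = ennreal ((4 powr a - 1) / r powr (2 * a) * (r powr (2 * a) / (4 powr a - 1)))"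
      by (rule ennreal_mult[symmetric]) (use den in auto)
    also have "(4 powr a - 1) / r powr (2 * a) * (r powr (2 * a) / (4 powr a - 1)) = 1" using den r a(1) by simp
    finally show ?thesis by (simp only: mult.assoc[symmetric] ennreal_1 mult_1)
  qed
  also have "\<dots> \<le> ennreal ((4 powr a - 1) / r powr (2 * a)) * ?E" by (rule mult_left_mono[OF low]) simp
  also have "\<dots> \<le> ennreal (3 * a / r powr (2 * a)) * ?E"
    using four_powr_le[of a] a by (intro mult_right_mono ennreal_leI divide_right_mono) auto
  finally have "Phi U h \<le> ennreal (c * (norm h)\<^sup>2) * (ennreal (3 * a / r powr (2 * a)) * ?E)"
    using up by (meson mult_left_mono order_trans zero_le)
  also have "\<dots> = ennreal (c * (norm h)\<^sup>2 * (3 * a / r powr (2 * a))) * ?E"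
    using a c by (subst ennreal_mult) (auto simp: mult.assoc)
  also have "\<dots> \<le> ennreal ((12 * c * norm h powr (2 * s)) * a) * ?E"
  proof (intro mult_right_mono ennreal_leI)
    have "norm h = r * 2" by (simp add: r_def)
    then have "norm h powr (2 * a) = r powr (2 * a) * 2 powr (2 * a)"
      using r by (simp add: powr_mult)
    moreover have "2 powr (2 * a) \<le> (2::real) powr 2" using a by (intro powr_mono) auto
    ultimately have le: "norm h powr (2 * a) \<le> 4 * r powr (2 * a)" using mult_left_mono[of "2 powr (2 * a)" 4 "r powr (2 * a)"] by (simp add: mult.commute)
    have "(norm h)\<^sup>2 = norm h powr (2 * s) * norm h powr (2 * a)"
      using False by (simp add: powr_add[symmetric] a_def algebra_simps powr_numeral)
    also have "\<dots> \<le> norm h powr (2 * s) * (4 * r powr (2 * a))" by (rule mult_left_mono[OF le]) simp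
    finally have "(norm h)\<^sup>2 / r powr (2 * a) \<le> 4 * norm h powr (2 * s)" using r by (simp add: divide_le_eq mult_ac)
    then have "(c * 3 * a) * ((norm h)\<^sup>2 / r powr (2 * a)) \<le> (c * 3 * a) * (4 * norm h powr (2 * s))"
      using c a by (intro mult_left_mono) auto
    then show "c * (norm h)\<^sup>2 * (3 * a / r powr (2 * a)) \<le> 12 * c * norm h powr (2 * s) * a" by (simp add: mult_ac)
  qed simp
  also have "\<dots> = ennreal (12 * c * norm h powr (2 * s)) * (ennreal a * ?E)"
    using a c by (subst ennreal_mult) (auto simp: mult.assoc)
  finally show ?thesis by (simp add: c_def a_def)
qed

text \<open>On the ball carrying f, |t| <= 1 + t^2 stands in for Cauchy-Schwarz.\<close>

lemma integral_abs_le: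
  fixes f :: "'a::euclidean_space \<Rightarrow> real"
  assumes [measurable]: "f \<in> borel_measurable borel" and fin: "nsq f \<le> ennreal M" "M \<ge> 0"
    and supp: "\<And>x. norm x > R \<Longrightarrow> f x = 0"
  shows "(\<integral>x. \<bar>f x\<bar> \<partial>lborel) \<le> measure lborel (cball (0::'a) R) + M" "integrable lborel f"
proof -
  have nf: "nsq f < \<infinity>" using fin(1) by (rule le_less_trans) simp
  show int: "integrable lborel f"
    by (rule integrable_of_L2_bounded_support[OF assms(1) nf bounded_cball[of 0 R]]) (use supp in auto)
  have i1: "integrable lborel (\<lambda>x::'a. indicator (cball 0 R) x :: real)"
    using emeasure_lborel_cball_finite[of "0::'a" R] by (intro integrable_real_indicator) auto
  have i2: "integrable lborel (\<lambda>x. (norm (f x))\<^sup>2)" using nf integrable_iff_nsq[OF assms(1)] by simp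
  have "(\<integral>x. \<bar>f x\<bar> \<partial>lborel) \<le> (\<integral>x. indicator (cball 0 R) x + (norm (f x))\<^sup>2 \<partial>lborel)"
  proof (rule integral_mono)
    fix x
    have "\<bar>t\<bar> \<le> 1 + t\<^sup>2" for t :: real
    proof -
      have "0 \<le> (\<bar>t\<bar> - 1/2)\<^sup>2" by simp
      then show ?thesis by (simp add: power2_eq_square algebra_simps)
    qed
    then show "\<bar>f x\<bar> \<le> indicator (cball 0 R) x + (norm (f x))\<^sup>2"
      using supp[of x] by (cases "norm x \<le> R") auto
  qed (use int i1 i2 in auto)
  also have "\<dots> = measure lborel (cball (0::'a) R) + (\<integral>x. (norm (f x))\<^sup>2 \<partial>lborel)"
    using i1 i2 by simp
  also have "(\<integral>x. (norm (f x))\<^sup>2 \<partial>lborel) \<le> M"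
  proof -
    have "(\<integral>x. (norm (f x))\<^sup>2 \<partial>lborel) = enn2real (nsq f)"
      unfolding nsq_def by (rule integral_eq_nn_integral) auto
    also have "\<dots> \<le> M" using fin by (intro enn2real_leI) auto
    finally show ?thesis .
  qed
  finally show "(\<integral>x. \<bar>f x\<bar> \<partial>lborel) \<le> measure lborel (cball (0::'a) R) + M" by simp
qed

text \<open>At each scale \<open>e j\<close> the mollified functions are bounded and equi-Lipschitz.
  One diagonal subsequence converges for all j on a countable dense set, then everywhere by
  equicontinuity, and in L2 by dominated convergence on a ball. As \<open>equi\<close> makes the
  mollification error small uniformly in n, the subsequence itself is Cauchy in L2.\<close>

lemma frechet_kolmogorov:
  fixes U :: "nat \<Rightarrow> 'a::euclidean_space \<Rightarrow> real"
  assumes O: "open \<Omega>" "bounded \<Omega>" and Um [measurable]: "\<And>n. U n \<in> borel_measurable borel"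
    and supp: "\<And>n x. x \<notin> \<Omega> \<Longrightarrow> U n x = 0" and M: "M \<ge> 0" "\<And>n. nsq (U n) \<le> ennreal M"
    and equi: "\<And>e. e > 0 \<Longrightarrow> \<exists>d>0. \<forall>n h. norm h < d \<longrightarrow> Phi (U n) h \<le> ennreal e"
  shows "\<exists>r V. strict_mono r \<and> V \<in> borel_measurable borel \<and> (\<forall>x. x \<notin> \<Omega> \<longrightarrow> V x = 0)
     \<and> (\<lambda>n. nsq (\<lambda>x. U (r n) x - V x)) \<longlonglongrightarrow> 0"
proof -
  obtain R where R: "\<And>x. x \<in> \<Omega> \<Longrightarrow> norm x \<le> R" using O(2) unfolding bounded_iff by auto
  have UR: "U n x = 0" if "norm x > R" for n x using R[of x] that supp by force
  define M' where "M' = measure lborel (cball (0::'a) R) + M"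
  have M': "M' \<ge> 0" using M by (simp add: M'_def)
  have ia: "(\<integral>x. \<bar>U n x\<bar> \<partial>lborel) \<le> M'" and ii: "integrable lborel (U n)" for n
    unfolding M'_def using integral_abs_le[OF Um M(2,1) UR] by auto
  define e where "e j = inverse (real (Suc j))" for j
  have e0: "e j > 0" for j by (simp add: e_def)
  have e1: "e j \<le> 1" for j by (simp add: e_def inverse_le_1_iff)
  have elim: "e \<longlonglongrightarrow> 0" unfolding e_def[abs_def] by (rule LIMSEQ_inverse_real_of_nat)
  have "\<exists>\<rho> :: 'a \<Rightarrow> real. mollifier (e j) \<rho>" for j by (rule mollifier_exists[OF e0])
  then obtain \<rho> :: "nat \<Rightarrow> 'a \<Rightarrow> real" where rho: "\<And>j. mollifier (e j) (\<rho> j)" by metis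
  have sc: "smooth_compact (\<rho> j)" for j using rho[of j] by (simp add: mollifier_def)
  have [measurable]: "\<rho> j \<in> borel_measurable borel" for j by (rule mollifier_measurable[OF rho])
  have "\<forall>j. \<exists>B\<ge>0. \<forall>x. \<bar>\<rho> j x\<bar> \<le> B" using smooth_compact_bounded[OF sc] by blast
  then obtain B where B: "\<And>j. B j \<ge> 0" "\<And>j x. \<bar>\<rho> j x\<bar> \<le> B j" by metis
  have "\<forall>j. \<exists>L\<ge>0. \<forall>x y. \<bar>\<rho> j y - \<rho> j x\<bar> \<le> L * norm (y - x)" using smooth_compact_lipschitz[OF sc] by blast
  then obtain L where L: "\<And>j. L j \<ge> 0" "\<And>j x y. \<bar>\<rho> j y - \<rho> j x\<bar> \<le> L j * norm (y - x)" by metis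
  define f where "f n j = conv (\<rho> j) (U n)" for n j
  have ci: "integrable lborel (\<lambda>y. \<rho> j (x - y) * U n y)" for n j x by (rule conv_integrable[OF sc ii])
  have fm [measurable]: "f n j \<in> borel_measurable borel" for n j
    unfolding f_def by (rule smooth_measurable[OF smooth_conv[OF sc ii]])
  have fB: "\<bar>f n j x\<bar> \<le> B j * M'" for n j x
  proof -
    have "\<bar>f n j x\<bar> \<le> (\<integral>y. \<bar>\<rho> j (x - y) * U n y\<bar> \<partial>lborel)"
      unfolding f_def conv_def using integral_norm_bound[of lborel "\<lambda>y. \<rho> j (x - y) * U n y"] by simp
    also have "\<dots> \<le> (\<integral>y. B j * \<bar>U n y\<bar> \<partial>lborel)"
      by (rule integral_mono) (use integrable_abs[OF ci] ii B in \<open>auto simp: abs_mult intro!: mult_right_mono\<close>)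
    also have "\<dots> \<le> B j * M'" using ia[of n] B(1)[of j] by (simp add: mult_left_mono)
    finally show ?thesis .
  qed
  have fL: "\<bar>f n j x - f n j y\<bar> \<le> (L j * M') * norm (x - y)" for n j x y
  proof -
    have "f n j x - f n j y = (\<integral>z. (\<rho> j (x - z) - \<rho> j (y - z)) * U n z \<partial>lborel)"
      unfolding f_def conv_def using ci by (simp add: left_diff_distrib Bochner_Integration.integral_diff)
    also have "\<bar>\<dots>\<bar> \<le> (\<integral>z. \<bar>(\<rho> j (x - z) - \<rho> j (y - z)) * U n z\<bar> \<partial>lborel)"
      using integral_norm_bound[of lborel "\<lambda>z. (\<rho> j (x - z) - \<rho> j (y - z)) * U n z"] by simp
    also have "\<dots> \<le> (\<integral>z. (L j * norm (x - y)) * \<bar>U n z\<bar> \<partial>lborel)"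
    proof (rule integral_mono)
      show "integrable lborel (\<lambda>z. \<bar>(\<rho> j (x - z) - \<rho> j (y - z)) * U n z\<bar>)"
        using ci by (intro integrable_abs) (simp add: left_diff_distrib)
      show "integrable lborel (\<lambda>z. (L j * norm (x - y)) * \<bar>U n z\<bar>)" using ii by simp
      fix z
      show "\<bar>(\<rho> j (x - z) - \<rho> j (y - z)) * U n z\<bar> \<le> (L j * norm (x - y)) * \<bar>U n z\<bar>"
        using L(2)[where j = j and y = "x - z" and x = "y - z"] by (simp add: abs_mult mult_right_mono)
    qed
    also have "\<dots> \<le> (L j * norm (x - y)) * M'"
      using ia[of n] L(1)[of j] by (simp add: mult_left_mono)
    finally show ?thesis by (simp add: mult_ac)
  qed
  have fsupp: "f n j x = 0" if x: "norm x > R + 1" for n j x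
  proof -
    have "\<rho> j (x - y) * U n y = 0" for y
    proof (cases "norm y > R")
      case False
      have "norm x \<le> norm (x - y) + norm y" using norm_triangle_ineq[of "x - y" y] by simp
      then have "norm (x - y) \<ge> e j" using False x e1[of j] by linarith
      then show ?thesis using rho[of j] by (simp add: mollifier_def)
    qed (use UR in simp)
    then show ?thesis unfolding f_def conv_def by (simp only: integral_zero)
  qed
  obtain D :: "'a set" where D: "countable D" "\<And>X. open X \<Longrightarrow> X \<noteq> {} \<Longrightarrow> \<exists>d\<in>D. d \<in> X"
    by (rule countable_dense_setE) blast
  \<comment> \<open>The bound \<open>B j * M'\<close> depends on the scale; dividing by it yields
    one bound for all pairs (j, x), as a simultaneous extraction requires. The + 1 excludes a zero
    denominator.\<close>
  let ?g = "\<lambda>n (p :: nat \<times> 'a). f n (fst p) (snd p) / (B (fst p) * M' + 1)"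
  have Bp: "B j * M' + 1 > 0" for j using B(1)[of j] M' by (simp add: add_nonneg_pos)
  have gb: "norm (?g n p) \<le> 1" for n p
    using fB[of n "fst p" "snd p"] Bp[of "fst p"] by (simp add: divide_le_eq)
  obtain r where r: "strict_mono r" and conv: "\<And>p. p \<in> UNIV \<times> D \<Longrightarrow> \<exists>l. (\<lambda>n. ?g (r n) p) \<longlonglongrightarrow> l"
    by (rule function_convergent_subsequence[of "UNIV \<times> D" ?g 1]) (use D(1) gb in auto)
  have convD: "convergent (\<lambda>n. f (r n) j x)" if x: "x \<in> D" for j x
  proof -
    obtain l where "(\<lambda>n. ?g (r n) (j, x)) \<longlonglongrightarrow> l" using conv[of "(j, x)"] x by auto
    then have "(\<lambda>n. (B j * M' + 1) * ?g (r n) (j, x)) \<longlonglongrightarrow> (B j * M' + 1) * l" by (intro tendsto_mult tendsto_const)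
    moreover have "(B j * M' + 1) * ?g (r n) (j, x) = f (r n) j x" for n using Bp[of j] by simp
    ultimately show ?thesis by (auto simp: convergent_def)
  qed
  have convA: "convergent (\<lambda>n. f (r n) j x)" for j x
  proof -
    have "Cauchy (\<lambda>n. f (r n) j x)"
    proof (rule CauchyI)
      fix \<epsilon> :: real assume eps: "\<epsilon> > 0"
      define d where "d = \<epsilon> / (3 * (L j * M' + 1))"
      have LM: "L j * M' \<ge> 0" using L M' by simp
      then have d: "d > 0" using eps by (simp add: d_def add_nonneg_pos)
      obtain y where y: "y \<in> D" "y \<in> ball x d" using D(2)[of "ball x d"] d by auto
      have Ld: "(L j * M') * norm (x - y) \<le> \<epsilon> / 3"
      proof -
        have "(L j * M') * norm (x - y) \<le> (L j * M' + 1) * d"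
          using y(2) LM by (intro mult_mono) (auto simp: dist_norm)
        also have "\<dots> = \<epsilon> / 3" using LM unfolding d_def by (simp add: field_simps add_nonneg_pos)
        finally show ?thesis .
      qed
      obtain N where N: "\<And>m n. m \<ge> N \<Longrightarrow> n \<ge> N \<Longrightarrow> \<bar>f (r m) j y - f (r n) j y\<bar> < \<epsilon> / 3"
        using CauchyD[OF convergent_Cauchy[OF convD[OF y(1), of j]], of "\<epsilon>/3"] eps by auto
      show "\<exists>N. \<forall>m\<ge>N. \<forall>n\<ge>N. norm (f (r m) j x - f (r n) j x) < \<epsilon>"
      proof (intro exI[of _ N] allI impI)
        fix m n assume mn: "m \<ge> N" "n \<ge> N"
        have "\<bar>f (r m) j x - f (r m) j y\<bar> \<le> \<epsilon> / 3" "\<bar>f (r n) j x - f (r n) j y\<bar> \<le> \<epsilon> / 3"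
          using fL[where j = j and x = x and y = y] Ld order_trans by blast+
        then show "norm (f (r m) j x - f (r n) j x) < \<epsilon>" using N[OF mn] unfolding real_norm_def by linarith
      qed
    qed
    then show ?thesis by (simp add: Cauchy_convergent_iff)
  qed
  define F where "F j x = lim (\<lambda>n. f (r n) j x)" for j x
  have limF: "(\<lambda>n. f (r n) j x) \<longlonglongrightarrow> F j x" for j x
    using convA[of j x] by (simp add: F_def convergent_LIMSEQ_iff)
  have Fm [measurable]: "F j \<in> borel_measurable borel" for j
    by (rule borel_measurable_LIMSEQ_metric[OF _ limF]) measurable
  have F0: "F j x = 0" if "norm x > R + 1" for j x
    using LIMSEQ_unique[OF limF[of j x]] fsupp[OF that] by simp
  have FB: "\<bar>F j x\<bar> \<le> B j * M'" for j x
    by (rule LIMSEQ_le_const2[OF tendsto_rabs[OF limF]]) (use fB in auto)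
  have [measurable]: "cball (0::'a) (R + 1) \<in> sets borel" by (intro borel_closed closed_cball)
  have fF: "(\<lambda>n. nsq (\<lambda>x. f (r n) j x - F j x)) \<longlonglongrightarrow> 0" for j
  proof -
    have "(\<lambda>n. \<integral>\<^sup>+x. ennreal ((norm (f (r n) j x - F j x))\<^sup>2) \<partial>lborel) \<longlonglongrightarrow> (\<integral>\<^sup>+x. 0 \<partial>(lborel :: 'a measure))"
    proof (rule nn_integral_dominated_convergence[where w = "\<lambda>x. ennreal ((2 * (B j * M'))\<^sup>2) * indicator (cball 0 (R + 1)) x"])
      show "AE x in lborel. ennreal ((norm (f (r n) j x - F j x))\<^sup>2) \<le> ennreal ((2 * (B j * M'))\<^sup>2) * indicator (cball 0 (R + 1)) x" for n
      proof (rule AE_I2)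
        fix x :: 'a
        show "ennreal ((norm (f (r n) j x - F j x))\<^sup>2) \<le> ennreal ((2 * (B j * M'))\<^sup>2) * indicator (cball 0 (R + 1)) x"
        proof (cases "norm x \<le> R + 1")
          case True
          have "norm (f (r n) j x - F j x) \<le> 2 * (B j * M')" using fB[of "r n" j x] FB[of j x] unfolding real_norm_def by linarith
          then have "(norm (f (r n) j x - F j x))\<^sup>2 \<le> (2 * (B j * M'))\<^sup>2" by (intro power_mono) auto
          then show ?thesis using True by (simp add: ennreal_leI)
        next
          case False
          then show ?thesis using fsupp[of x] F0[of x] by simp
        qed
      qed
      show "(\<integral>\<^sup>+x. ennreal ((2 * (B j * M'))\<^sup>2) * indicator (cball (0::'a) (R + 1)) x \<partial>lborel) < \<infinity>"
        using emeasure_lborel_cball_finite[of "0::'a" "R + 1"]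
        by (simp add: nn_integral_cmult_indicator ennreal_mult_less_top)
      show "AE x in lborel. (\<lambda>n. ennreal ((norm (f (r n) j x - F j x))\<^sup>2)) \<longlonglongrightarrow> 0"
      proof (rule AE_I2)
        fix x
        have "(\<lambda>n. (norm (f (r n) j x - F j x))\<^sup>2) \<longlonglongrightarrow> (norm (F j x - F j x))\<^sup>2" by (intro tendsto_intros limF)
        then show "(\<lambda>n. ennreal ((norm (f (r n) j x - F j x))\<^sup>2)) \<longlonglongrightarrow> 0" using tendsto_ennrealI by fastforce
      qed
    qed measurable
    then show ?thesis by (simp add: nsq_def)
  qed
  have "\<exists>V. V \<in> borel_measurable borel \<and> (\<lambda>n. nsq (\<lambda>x. U (r n) x - V x)) \<longlonglongrightarrow> 0"
  proof (rule nsq_complete)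
    fix \<epsilon> :: real assume eps: "\<epsilon> > 0"
    \<comment> \<open>The factor 2 of \<open>nsq_diff_triangle\<close> compounds: 2 + 2 = 4, then 2
      * 4 + 2 = 10, then 2 + 2 * 10 = 22.\<close>
    define \<eta> where "\<eta> = \<epsilon> / 22"
    have eta: "\<eta> > 0" using eps by (simp add: \<eta>_def)
    obtain d where d: "d > 0" "\<And>n h. norm h < d \<Longrightarrow> Phi (U n) h \<le> ennreal \<eta>" using equi[OF eta] by blast
    obtain j where j: "e j < d"
      using order_tendstoD(2)[OF elim d(1)] by (auto simp: eventually_sequentially)
    have err: "nsq (\<lambda>x. f n j x - U n x) \<le> ennreal \<eta>" for n
      unfolding f_def by (rule mollify_error[OF rho ii]) (use d j in auto)
    have "eventually (\<lambda>n. nsq (\<lambda>x. f (r n) j x - F j x) < ennreal \<eta>) sequentially"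
      using order_tendstoD(2)[OF fF[of j], of "ennreal \<eta>"] eta by auto
    then obtain N where N: "\<And>n. n \<ge> N \<Longrightarrow> nsq (\<lambda>x. f (r n) j x - F j x) < ennreal \<eta>"
      by (auto simp: eventually_sequentially)
    show "\<exists>N. \<forall>m\<ge>N. \<forall>n\<ge>N. nsq (\<lambda>x. U (r m) x - U (r n) x) \<le> ennreal \<epsilon>"
    proof (intro exI[of _ N] allI impI)
      fix m n assume mn: "m \<ge> N" "n \<ge> N"
      have t1: "nsq (\<lambda>x. f (r m) j x - f (r n) j x) \<le> ennreal (4 * \<eta>)"
      proof -
        have "nsq (\<lambda>x. f (r m) j x - f (r n) j x) \<le> 2 * nsq (\<lambda>x. f (r m) j x - F j x) + 2 * nsq (\<lambda>x. F j x - f (r n) j x)"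
          by (rule nsq_diff_triangle) measurable
        also have "\<dots> \<le> 2 * ennreal \<eta> + 2 * ennreal \<eta>"
          using N[OF mn(1)] N[OF mn(2)] by (intro add_mono mult_left_mono) (auto simp: nsq_minus[of "F j"] less_imp_le)
        also have "\<dots> = ennreal (4 * \<eta>)" using eta by (simp add: numeral_mult_ennreal ennreal_plus[symmetric] del: ennreal_plus)
        finally show ?thesis .
      qed
      have t2: "nsq (\<lambda>x. f (r m) j x - U (r n) x) \<le> ennreal (10 * \<eta>)"
      proof -
        have "nsq (\<lambda>x. f (r m) j x - U (r n) x) \<le> 2 * nsq (\<lambda>x. f (r m) j x - f (r n) j x) + 2 * nsq (\<lambda>x. f (r n) j x - U (r n) x)"
          by (rule nsq_diff_triangle) measurable
        also have "\<dots> \<le> 2 * ennreal (4 * \<eta>) + 2 * ennreal \<eta>"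
          by (intro add_mono mult_left_mono t1 err) auto
        also have "\<dots> = ennreal (10 * \<eta>)" using eta by (simp add: numeral_mult_ennreal ennreal_plus[symmetric] del: ennreal_plus)
        finally show ?thesis .
      qed
      have "nsq (\<lambda>x. U (r m) x - U (r n) x) \<le> 2 * nsq (\<lambda>x. U (r m) x - f (r m) j x) + 2 * nsq (\<lambda>x. f (r m) j x - U (r n) x)"
        by (rule nsq_diff_triangle) measurable
      also have "\<dots> \<le> 2 * ennreal \<eta> + 2 * ennreal (10 * \<eta>)"
        using err[of "r m"] by (intro add_mono mult_left_mono t2) (auto simp: nsq_minus[of "U (r m)"])
      also have "\<dots> = ennreal \<epsilon>" using eta by (simp add: numeral_mult_ennreal ennreal_plus[symmetric] \<eta>_def del: ennreal_plus)
      finally show "nsq (\<lambda>x. U (r m) x - U (r n) x) \<le> ennreal \<epsilon>" .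
    qed
  qed measurable
  then obtain V where V [measurable]: "V \<in> borel_measurable borel" and lV: "(\<lambda>n. nsq (\<lambda>x. U (r n) x - V x)) \<longlonglongrightarrow> 0" by blast
  have [measurable]: "\<Omega> \<in> sets borel" using O by auto
  let ?V = "\<lambda>x. indicator \<Omega> x * V x"
  have "(\<lambda>n. nsq (\<lambda>x. U (r n) x - ?V x)) \<longlonglongrightarrow> 0"
  proof (rule tendsto_sandwich[OF _ _ tendsto_const lV]; rule always_eventually; rule allI)
    show "nsq (\<lambda>x. U (r n) x - ?V x) \<le> nsq (\<lambda>x. U (r n) x - V x)" for n
      by (rule nsq_mono) (auto simp: indicator_def supp)
  qed simp
  moreover have "?V \<in> borel_measurable borel" by measurable
  ultimately show ?thesis using r by (intro exI[of _ r] exI[of _ ?V]) auto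
qed

section \<open>Sharp energy bounds\<close>

text \<open>The derivative of 4^x at 0, which is where ln 4 enters the limits.\<close>

lemma four_powr_quotient_tendsto:
  assumes "a \<longlonglongrightarrow> 0" "\<And>n. a n > (0::real)"
  shows "(\<lambda>n. (4 powr a n - 1) / a n) \<longlonglongrightarrow> ln 4"
proof -
  have "DERIV (\<lambda>x. exp (x * ln 4)) 0 :> ln (4::real)"
    by (auto intro!: derivative_eq_intros)
  then have "((\<lambda>h. (exp ((0 + h) * ln 4) - exp (0 * ln 4)) / h) \<longlongrightarrow> ln (4::real)) (at 0)"
    by (simp only: DERIV_def)
  then have "((\<lambda>h. (4 powr h - 1) / h) \<longlongrightarrow> ln (4::real)) (at 0)"
    by (simp add: powr_def)
  moreover have "filterlim a (at 0) sequentially"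
    using assms by (intro filterlim_atI always_eventually) (auto simp: less_imp_neq[symmetric])
  ultimately show ?thesis by (rule filterlim_compose)
qed

lemma ln_four: "ln (4::real) = 2 * ln 2"
proof -
  show ?thesis using ln_realpow[of 2 2] by simp
qed

lemma nsq_inner_tendsto:
  fixes G :: "'a::euclidean_space \<Rightarrow> 'a"
  assumes [measurable]: "G \<in> borel_measurable borel" "\<And>n. H n \<in> borel_measurable borel"
    and lim: "(\<lambda>n. nsq (\<lambda>x. G x - H n x)) \<longlonglongrightarrow> 0"
  shows "(\<lambda>n. nsq (\<lambda>x. G x \<bullet> h - H n x \<bullet> h)) \<longlonglongrightarrow> 0"
proof -
  have "(\<lambda>n. ennreal ((norm h)\<^sup>2) * nsq (\<lambda>x. G x - H n x)) \<longlonglongrightarrow> ennreal ((norm h)\<^sup>2) * 0"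
    by (rule ennreal_tendsto_cmult[OF _ lim]) simp
  then have l: "(\<lambda>n. ennreal ((norm h)\<^sup>2) * nsq (\<lambda>x. G x - H n x)) \<longlonglongrightarrow> 0" by simp
  show ?thesis
  proof (rule tendsto_sandwich[OF _ _ tendsto_const l]; rule always_eventually; rule allI)
    show "nsq (\<lambda>x. G x \<bullet> h - H n x \<bullet> h) \<le> ennreal ((norm h)\<^sup>2) * nsq (\<lambda>x. G x - H n x)" for n
      using nsq_inner_le[of "\<lambda>x. G x - H n x" h] by (simp add: inner_diff_left)
  qed simp
qed

text \<open>By \<open>Phi_dyadic\<close>, \<open>Phi\<close> lies below each squared dyadic
  difference quotient, and these converge to the right-hand side. The constant 1 is what the sharp
  upper bound needs.\<close>

lemma Phi_smooth_le:
  assumes sc: "smooth_compact \<phi>"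
  shows "Phi \<phi> h \<le> nsq (\<lambda>x. grad \<phi> x \<bullet> h)"
proof -
  have [measurable]: "\<phi> \<in> borel_measurable borel" "grad \<phi> \<in> borel_measurable borel"
    using smooth_compact_measurable[OF sc] grad_measurable[OF sc] by auto
  have "nsq (\<lambda>x. grad \<phi> x \<bullet> h) \<le> ennreal ((norm h)\<^sup>2) * nsq (grad \<phi>)" by (rule nsq_inner_le) measurable
  also have "\<dots> < \<infinity>" using smooth_compact_grad_nsq_finite[OF sc] by (simp add: ennreal_mult_less_top)
  finally have "nsq (\<lambda>x. grad \<phi> x \<bullet> h) < \<infinity>" .
  then have lim: "(\<lambda>k. nsq (\<lambda>x. 2^k * (\<phi> (x + (1/2)^k *\<^sub>R h) - \<phi> x))) \<longlonglongrightarrow> nsq (\<lambda>x. grad \<phi> x \<bullet> h)"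
    by (intro nsq_tendsto nsq_difference_quotient_tendsto[OF sc]) measurable
  have "Phi \<phi> h \<le> nsq (\<lambda>x. 2^k * (\<phi> (x + (1/2)^k *\<^sub>R h) - \<phi> x))" for k
    using Phi_dyadic[of \<phi> h k] nsq_difference_quotient[of \<phi> k h] by simp
  then show ?thesis by (intro LIMSEQ_le_const[OF lim]) auto
qed

text \<open>Both sides pass to the limit along the approximating functions. It is stated for
  arbitrary smooth approximations so as to apply to differences V - \<phi> n as well.\<close>

lemma Phi_le_directional:
  fixes G :: "'a::euclidean_space \<Rightarrow> 'a" and V :: "'a::euclidean_space \<Rightarrow> real"
  assumes Vm [measurable]: "V \<in> borel_measurable borel" and Gm [measurable]: "G \<in> borel_measurable borel"
    and fin: "nsq V < \<infinity>" "nsq G < \<infinity>"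
    and sc: "\<And>n. smooth_compact (\<phi> n)" and lV: "(\<lambda>n. nsq (\<lambda>x. V x - \<phi> n x)) \<longlonglongrightarrow> 0"
    and lG: "(\<lambda>n. nsq (\<lambda>x. G x - grad (\<phi> n) x)) \<longlonglongrightarrow> 0"
  shows "Phi V h \<le> nsq (\<lambda>x. G x \<bullet> h)"
proof -
  have [measurable]: "\<phi> n \<in> borel_measurable borel" "grad (\<phi> n) \<in> borel_measurable borel" for n
    using smooth_compact_measurable[OF sc] grad_measurable[OF sc] by auto
  have "nsq (\<lambda>x. G x \<bullet> h) \<le> ennreal ((norm h)\<^sup>2) * nsq G" by (rule nsq_inner_le) measurable
  also have "\<dots> < \<infinity>" using fin by (simp add: ennreal_mult_less_top)
  finally have f: "nsq (\<lambda>x. G x \<bullet> h) < \<infinity>" .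
  have 1: "(\<lambda>n. Phi (\<phi> n) h) \<longlonglongrightarrow> Phi V h"
    by (rule Phi_tendsto[OF _ Vm fin(1)]) (use lV nsq_diff_comm_tendsto in auto)
  have "(\<lambda>n. nsq (\<lambda>x. grad (\<phi> n) x \<bullet> h - G x \<bullet> h)) \<longlonglongrightarrow> 0"
    by (rule iffD1[OF nsq_diff_comm_tendsto nsq_inner_tendsto[OF Gm _ lG]]) measurable
  then have 2: "(\<lambda>n. nsq (\<lambda>x. grad (\<phi> n) x \<bullet> h)) \<longlonglongrightarrow> nsq (\<lambda>x. G x \<bullet> h)"
    by (intro nsq_tendsto f) measurable
  show ?thesis by (rule LIMSEQ_le[OF 1 2]) (auto intro: Phi_smooth_le[OF sc])
qed

text \<open>Two limits are exchanged: k in the difference quotient and n in the approximation.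
  \<open>Phi_le_directional\<close>, applied to V - \<phi> n, bounds the error of the quotients by
  \<delta> n uniformly in k; for fixed n the smooth case applies.\<close>

lemma Phi_dyadic_tendsto:
  fixes G :: "'a::euclidean_space \<Rightarrow> 'a" and V :: "'a::euclidean_space \<Rightarrow> real"
  assumes Vm [measurable]: "V \<in> borel_measurable borel" and Gm [measurable]: "G \<in> borel_measurable borel"
    and fin: "nsq V < \<infinity>" "nsq G < \<infinity>"
    and phi: "\<And>n. \<phi> n \<in> test_functions \<Omega>" and lV: "(\<lambda>n. nsq (\<lambda>x. V x - \<phi> n x)) \<longlonglongrightarrow> 0"
    and lG: "(\<lambda>n. nsq (\<lambda>x. G x - grad (\<phi> n) x)) \<longlonglongrightarrow> 0"
  shows "(\<lambda>k. 4^k * Phi V ((1/2)^k *\<^sub>R h)) \<longlonglongrightarrow> nsq (\<lambda>x. G x \<bullet> h)"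
proof -
  have sc: "smooth_compact (\<phi> n)" for n by (rule test_smooth_compact[OF phi])
  have [measurable]: "\<phi> n \<in> borel_measurable borel" "grad (\<phi> n) \<in> borel_measurable borel" for n
    using smooth_compact_measurable[OF sc] grad_measurable[OF sc] by auto
  let ?D = "\<lambda>k V x. 2^k * (V (x + (1/2)^k *\<^sub>R h) - V x)"
  have "nsq (\<lambda>x. G x \<bullet> h) \<le> ennreal ((norm h)\<^sup>2) * nsq G" by (rule nsq_inner_le) measurable
  also have "\<dots> < \<infinity>" using fin by (simp add: ennreal_mult_less_top)
  finally have f: "nsq (\<lambda>x. G x \<bullet> h) < \<infinity>" .
  define \<delta> where "\<delta> n = nsq (\<lambda>x. G x \<bullet> h - grad (\<phi> n) x \<bullet> h)" for n
  have dl: "\<delta> \<longlonglongrightarrow> 0" unfolding \<delta>_def by (rule nsq_inner_tendsto[OF Gm _ lG]) measurable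
  have b1: "nsq (\<lambda>x. ?D k V x - ?D k (\<phi> n) x) \<le> \<delta> n" for k n
  proof -
    have m: "(\<lambda>x. V x - \<phi> n x) \<in> borel_measurable borel" "(\<lambda>x. G x - grad (\<phi> n) x) \<in> borel_measurable borel" by measurable
    have "Phi (\<lambda>x. V x - \<phi> n x) ((1/2)^k *\<^sub>R h) \<le> nsq (\<lambda>x. (G x - grad (\<phi> n) x) \<bullet> ((1/2)^k *\<^sub>R h))"
    \<comment> \<open>As m grows, \<phi> m - \<phi> n approximates V - \<phi> n, with gradients
      tending to G - grad (\<phi> n).\<close>
    proof (rule Phi_le_directional[OF m, where \<phi> = "\<lambda>m x. 1 * \<phi> m x + (-1) * \<phi> n x"])
      show "nsq (\<lambda>x. V x - \<phi> n x) < \<infinity>" "nsq (\<lambda>x. G x - grad (\<phi> n) x) < \<infinity>"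
      proof -
        have "nsq (\<lambda>x. V x - \<phi> n x) \<le> 2 * nsq V + 2 * nsq (\<phi> n)" by (rule nsq_diff) measurable
        also have "\<dots> < \<infinity>" using ennreal_numeral_mult_finite[OF fin(1)] ennreal_numeral_mult_finite[OF smooth_compact_nsq_finite[OF sc[of n]]] by simp
        finally show "nsq (\<lambda>x. V x - \<phi> n x) < \<infinity>" .
        have "nsq (\<lambda>x. G x - grad (\<phi> n) x) \<le> 2 * nsq G + 2 * nsq (grad (\<phi> n))" by (rule nsq_diff) measurable
        also have "\<dots> < \<infinity>" using ennreal_numeral_mult_finite[OF fin(2)] ennreal_numeral_mult_finite[OF smooth_compact_grad_nsq_finite[OF sc[of n]]] by simp
        finally show "nsq (\<lambda>x. G x - grad (\<phi> n) x) < \<infinity>" .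
      qed
      show "smooth_compact (\<lambda>x. 1 * \<phi> m x + (-1) * \<phi> n x)" for m
        by (rule test_smooth_compact[OF test_lincomb[OF phi phi]])
      show "(\<lambda>m. nsq (\<lambda>x. V x - \<phi> n x - (1 * \<phi> m x + - 1 * \<phi> n x))) \<longlonglongrightarrow> 0" using lV by simp
      have "G x - grad (\<phi> n) x - grad (\<lambda>x. 1 * \<phi> m x + - 1 * \<phi> n x) x = G x - grad (\<phi> m) x" for m x
        by (simp only: grad_lincomb[where a = 1 and b = "-1", OF sc[of m] sc[of n]]) simp
      then show "(\<lambda>m. nsq (\<lambda>x. G x - grad (\<phi> n) x - grad (\<lambda>x. 1 * \<phi> m x + - 1 * \<phi> n x) x)) \<longlonglongrightarrow> 0"
        using lG by (simp only:)
    qed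
    also have "\<dots> = nsq (\<lambda>x. (1/2)^k *\<^sub>R (G x \<bullet> h - grad (\<phi> n) x \<bullet> h))" by (simp add: inner_diff_left)
    also have "\<dots> = ennreal (((1/2)^k)\<^sup>2) * \<delta> n" unfolding \<delta>_def by (rule nsq_scaleR) measurable
    finally have le: "4^k * Phi (\<lambda>x. V x - \<phi> n x) ((1/2)^k *\<^sub>R h) \<le> 4^k * (ennreal (((1/2)^k)\<^sup>2) * \<delta> n)"
      by (rule mult_left_mono) simp
    have "4^k * ennreal (((1/2)^k)\<^sup>2) = ennreal (4^k * ((1/2)^k)\<^sup>2)"
      by (simp add: ennreal_mult ennreal_power[symmetric])
    also have "4^k * ((1/2)^k)\<^sup>2 = (1::real)" by (simp add: power2_eq_square power_mult_distrib[symmetric])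
    finally have one: "4^k * ennreal (((1/2)^k)\<^sup>2) = 1" by simp
    have "nsq (\<lambda>x. ?D k V x - ?D k (\<phi> n) x) = nsq (?D k (\<lambda>x. V x - \<phi> n x))"
      by (simp add: algebra_simps)
    also have "\<dots> = 4^k * Phi (\<lambda>x. V x - \<phi> n x) ((1/2)^k *\<^sub>R h)"
      by (rule nsq_difference_quotient) measurable
    also note le
    also have "4^k * (ennreal (((1/2)^k)\<^sup>2) * \<delta> n) = \<delta> n" by (simp only: mult.assoc[symmetric] one mult_1)
    finally show ?thesis .
  qed
  have "(\<lambda>k. nsq (\<lambda>x. ?D k V x - G x \<bullet> h)) \<longlonglongrightarrow> 0"
  proof (rule tendsto_zero_ennreal)
    fix e :: real assume e: "e > 0"
    \<comment> \<open>Two triangle inequalities with factor 2 follow: 2/12 + 2/12 = 1/3, then 2/12 +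
      2/3 = 5/6 < 1.\<close>
    have "eventually (\<lambda>n. \<delta> n < ennreal (e / 12)) sequentially" using order_tendstoD(2)[OF dl, of "ennreal (e/12)"] e by auto
    then obtain n where n: "\<delta> n < ennreal (e / 12)" by (auto simp: eventually_sequentially)
    have "eventually (\<lambda>k. nsq (\<lambda>x. ?D k (\<phi> n) x - grad (\<phi> n) x \<bullet> h) < ennreal (e / 12)) sequentially"
      using order_tendstoD(2)[OF nsq_difference_quotient_tendsto[OF sc[of n], of h], of "ennreal (e/12)"] e by auto
    then show "\<forall>\<^sub>F k in sequentially. nsq (\<lambda>x. ?D k V x - G x \<bullet> h) < ennreal e"
    proof eventually_elim
      case (elim k)
      have "nsq (\<lambda>x. ?D k (\<phi> n) x - G x \<bullet> h) \<le> 2 * nsq (\<lambda>x. ?D k (\<phi> n) x - grad (\<phi> n) x \<bullet> h) + 2 * nsq (\<lambda>x. grad (\<phi> n) x \<bullet> h - G x \<bullet> h)"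
        by (rule nsq_diff_triangle) measurable
      also have "\<dots> \<le> 2 * ennreal (e / 12) + 2 * ennreal (e / 12)"
      proof (intro add_mono mult_left_mono)
        have "nsq (\<lambda>x. grad (\<phi> n) x \<bullet> h - G x \<bullet> h) = \<delta> n" unfolding \<delta>_def by (rule nsq_minus)
        then show "nsq (\<lambda>x. grad (\<phi> n) x \<bullet> h - G x \<bullet> h) \<le> ennreal (e / 12)" using n by simp
      qed (use elim in auto)
      also have "\<dots> = ennreal (e / 3)" using e by (simp add: numeral_mult_ennreal ennreal_plus[symmetric] del: ennreal_plus)
      finally have s1: "nsq (\<lambda>x. ?D k (\<phi> n) x - G x \<bullet> h) \<le> ennreal (e / 3)" .
      have "nsq (\<lambda>x. ?D k V x - G x \<bullet> h) \<le> 2 * nsq (\<lambda>x. ?D k V x - ?D k (\<phi> n) x) + 2 * nsq (\<lambda>x. ?D k (\<phi> n) x - G x \<bullet> h)"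
        by (rule nsq_diff_triangle) measurable
      also have "\<dots> \<le> 2 * ennreal (e / 12) + 2 * ennreal (e / 3)"
        using b1[of k n] n by (intro add_mono mult_left_mono s1) auto
      also have "\<dots> = ennreal (5 * e / 6)" using e by (simp add: numeral_mult_ennreal ennreal_plus[symmetric] del: ennreal_plus)
      also have "\<dots> < ennreal e" using e by (simp add: ennreal_less_iff)
      finally show ?case .
    qed
  qed
  then have "(\<lambda>k. nsq (?D k V)) \<longlonglongrightarrow> nsq (\<lambda>x. G x \<bullet> h)"
    by (intro nsq_tendsto f) measurable
  then show ?thesis by (simp add: nsq_difference_quotient)
qed

text \<open>Tonelli: for fixed x the integral over the shell is the second moment of
  \<open>shell_quadratic_integral\<close>.\<close>

lemma shell_int_directional:
  fixes G :: "'a::euclidean_space \<Rightarrow> 'a"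
  assumes [measurable]: "G \<in> borel_measurable borel"
  shows "shell_int (\<lambda>h. nsq (\<lambda>x. G x \<bullet> h)) 1 = ennreal (unit_ball_vol DIM('a) * ln 2) * nsq G"
proof -
  let ?w = "\<lambda>h::'a. ennreal (norm h powr - (real DIM('a) + 2))"
  have "shell_int (\<lambda>h. nsq (\<lambda>x. G x \<bullet> h)) 1
    = (\<integral>\<^sup>+h. \<integral>\<^sup>+x. indicator (shell 1) h * (ennreal ((norm (G x \<bullet> h))\<^sup>2) * ?w h) \<partial>lborel \<partial>lborel)"
    unfolding shell_int_def nsq_def
    by (intro nn_integral_cong) (simp add: nn_integral_cmult nn_integral_multc)
  also have "\<dots> = (\<integral>\<^sup>+x. \<integral>\<^sup>+h. indicator (shell 1) h * (ennreal ((norm (G x \<bullet> h))\<^sup>2) * ?w h) \<partial>lborel \<partial>lborel)"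
    by (rule lborel_pair.Fubini') measurable
  also have "\<dots> = (\<integral>\<^sup>+x. ennreal (unit_ball_vol DIM('a) * ln 2 * (norm (G x))\<^sup>2) \<partial>lborel)"
    by (rule nn_integral_cong) (simp only: real_norm_def power2_abs shell_quadratic_integral)
  also have "\<dots> = (\<integral>\<^sup>+x. ennreal (unit_ball_vol DIM('a) * ln 2) * ennreal ((norm (G x))\<^sup>2) \<partial>lborel)"
    by (intro nn_integral_cong) (simp add: ennreal_mult)
  also have "\<dots> = ennreal (unit_ball_vol DIM('a) * ln 2) * nsq G"
    unfolding nsq_def by (rule nn_integral_cmult) measurable
  finally show ?thesis .
qed

text \<open>Inside the unit ball \<open>Phi V\<close> is replaced by the 2-homogeneous form, to
  which \<open>shell_energy_upper\<close> applies. Outside, \<open>Phi V\<close> is at most 4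
  \<open>nsq V\<close>, and s >= 1/2 puts the kernel below an integrable one independent of s;
  multiplied by 1 - s, this part will vanish.\<close>

lemma frac_energy_upper:
  fixes G :: "'a::euclidean_space \<Rightarrow> 'a" and V :: "'a::euclidean_space \<Rightarrow> real"
  assumes [measurable]: "V \<in> borel_measurable borel" "G \<in> borel_measurable borel"
    and dir: "\<And>h. Phi V h \<le> nsq (\<lambda>x. G x \<bullet> h)" and s: "1/2 \<le> s" "s < 1"
  shows "frac_energy s (Phi V) \<le> ennreal (4 powr (1 - s) / (4 powr (1 - s) - 1)) * (ennreal (unit_ball_vol DIM('a) * ln 2) * nsq G)
    + 4 * nsq V * (\<integral>\<^sup>+z. indicator {z. norm z > 1} z * ennreal (norm (z::'a) powr - (real DIM('a) + 1)) \<partial>lborel)"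
proof -
  let ?Q = "\<lambda>h. nsq (\<lambda>x. G x \<bullet> h)"
  let ?w = "\<lambda>h::'a. ennreal (norm h powr - (real DIM('a) + 2 * s))"
  let ?t = "\<lambda>h::'a. ennreal (norm h powr - (real DIM('a) + 1))"
  have Qm [measurable]: "?Q \<in> borel_measurable borel" unfolding nsq_def by measurable
  have hom: "?Q (c *\<^sub>R h) = ennreal (c\<^sup>2) * ?Q h" for c h
  proof -
    have "?Q (c *\<^sub>R h) = nsq (\<lambda>x. c *\<^sub>R (G x \<bullet> h))" by simp
    also have "\<dots> = ennreal (c\<^sup>2) * ?Q h" by (rule nsq_scaleR) measurable
    finally show ?thesis .
  qed
  have "frac_energy s (Phi V) \<le> (\<integral>\<^sup>+h. indicator {h. 0 < norm h \<and> norm h \<le> 1} h * (?Q h * ?w h)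
      + 4 * nsq V * (indicator {h. norm h > 1} h * ?t h) \<partial>lborel)"
    unfolding frac_energy_def
  proof (rule nn_integral_mono)
    fix h :: 'a
    consider "h = 0" | "0 < norm h" "norm h \<le> 1" | "norm h > 1" by (metis zero_less_norm_iff linorder_not_le)
    then show "Phi V h * ?w h \<le> indicator {h. 0 < norm h \<and> norm h \<le> 1} h * (?Q h * ?w h)
      + 4 * nsq V * (indicator {h. norm h > 1} h * ?t h)"
    proof cases
      case 1
      then show ?thesis by simp
    next
      case 2
      then show ?thesis using mult_right_mono[OF dir[of h], of "?w h"] by simp
    next
      case 3
      have "?w h \<le> ?t h" using 3 s by (intro ennreal_leI powr_mono) auto
      then have "Phi V h * ?w h \<le> 4 * nsq V * ?t h" using Phi_le_nsq[of V h] by (intro mult_mono) auto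
      then show ?thesis using 3 by simp
    qed
  qed
  also have "\<dots> = (\<integral>\<^sup>+h. indicator {h. 0 < norm h \<and> norm h \<le> 1} h * (?Q h * ?w h) \<partial>lborel)
      + 4 * nsq V * (\<integral>\<^sup>+h. indicator {h. norm h > 1} h * ?t h \<partial>lborel)"
    by (subst nn_integral_add; (subst nn_integral_cmult)?; measurable)
  also have "(\<integral>\<^sup>+h. indicator {h. 0 < norm h \<and> norm h \<le> 1} h * (?Q h * ?w h) \<partial>lborel)
      \<le> ennreal (4 powr (1 - s) / (4 powr (1 - s) - 1)) * shell_int ?Q 1"
    by (rule shell_energy_upper[OF Qm hom s(2)])
  also have "shell_int ?Q 1 = ennreal (unit_ball_vol DIM('a) * ln 2) * nsq G"
    by (rule shell_int_directional) measurable
  finally show ?thesis by (simp add: add_right_mono)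
qed

text \<open>With a = 1 - s the coefficient of the Dirichlet integral is (1/2) a 4^a / (4^a - 1)
  omega_d ln 2. Since a / (4^a - 1) tends to 1 / ln 4 = 1 / (2 ln 2), it tends to omega_d / 4; the
  far part carries a bare factor a.\<close>

lemma energy_limsup:
  fixes G :: "'a::euclidean_space \<Rightarrow> 'a" and V :: "'a::euclidean_space \<Rightarrow> real"
  assumes Vm: "V \<in> borel_measurable borel" and Gm: "G \<in> borel_measurable borel"
    and fin: "nsq V < \<infinity>" "nsq G < \<infinity>"
    and dir: "\<And>h. Phi V h \<le> nsq (\<lambda>x. G x \<bullet> h)"
    and s: "\<And>n. 0 < s n \<and> s n < 1" "s \<longlonglongrightarrow> 1"
  shows "limsup (\<lambda>n. ennreal (1 - s n) * (ennreal (1/2) * frac_energy (s n) (Phi V)))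
    \<le> ennreal (unit_ball_vol DIM('a) / 4) * nsq G"
proof -
  obtain g where g: "nsq G = ennreal g" "g \<ge> 0" using fin(2) by (cases "nsq G") auto
  obtain N where N: "nsq V = ennreal N" "N \<ge> 0" using fin(1) by (cases "nsq V") auto
  obtain T where T: "(\<integral>\<^sup>+z. indicator {z. norm z > 1} z * ennreal (norm (z::'a) powr - (real DIM('a) + 1)) \<partial>lborel) = ennreal T" "T \<ge> 0"
    using tail_radial_integral[where 'a='a]
    by (cases "\<integral>\<^sup>+z. indicator {z. norm z > 1} z * ennreal (norm (z::'a) powr - (real DIM('a) + 1)) \<partial>lborel") auto
  define a where "a n = 1 - s n" for n
  have a: "a n > 0" for n using s(1)[of n] by (simp add: a_def)
  have al: "a \<longlonglongrightarrow> 0" unfolding a_def using tendsto_diff[OF tendsto_const s(2), of 1] by simp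
  let ?W = "unit_ball_vol DIM('a) * ln 2"
  have W: "?W \<ge> 0" by simp
  define b where "b n = (1/2) * (4 powr a n * inverse ((4 powr a n - 1) / a n) * (?W * g)) + a n * (2 * N * T)" for n
  have "b \<longlonglongrightarrow> (1/2) * (4 powr 0 * inverse (ln 4) * (?W * g)) + 0 * (2 * N * T)"
    unfolding b_def
    by (intro tendsto_intros al four_powr_quotient_tendsto[OF al a]) auto
  moreover have "(1/2) * (4 powr 0 * inverse (ln 4) * (?W * g)) + 0 * (2 * N * T) = unit_ball_vol DIM('a) / 4 * g"
    by (simp add: ln_four field_simps)
  ultimately have "b \<longlonglongrightarrow> unit_ball_vol DIM('a) / 4 * g" by (simp only:)
  then have bl: "(\<lambda>n. ennreal (b n)) \<longlonglongrightarrow> ennreal (unit_ball_vol DIM('a) / 4 * g)"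
    by (rule tendsto_ennrealI)
  have "eventually (\<lambda>n. s n > 1/2) sequentially" using order_tendstoD(1)[OF s(2), of "1/2"] by simp
  then have ev: "eventually (\<lambda>n. ennreal (1 - s n) * (ennreal (1/2) * frac_energy (s n) (Phi V)) \<le> ennreal (b n)) sequentially"
  proof eventually_elim
    case (elim n)
    have d: "4 powr a n - 1 > 0" using a[of n] by simp
    let ?c = "4 powr a n / (4 powr a n - 1)"
    have "frac_energy (s n) (Phi V) \<le> ennreal ?c * (ennreal ?W * ennreal g) + 4 * ennreal N * ennreal T"
      using frac_energy_upper[OF Vm Gm dir, of "s n"] elim s(1)[of n] g N T by (simp add: a_def)
    also have "\<dots> = ennreal (?c * (?W * g) + 4 * N * T)"
    proof -
      have "ennreal ?c * (ennreal ?W * ennreal g) = ennreal (?c * (?W * g))"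
      proof -
        have "ennreal ?W * ennreal g = ennreal (?W * g)" by (rule ennreal_mult[symmetric]) (use W g in auto)
        moreover have "ennreal ?c * ennreal (?W * g) = ennreal (?c * (?W * g))"
          by (rule ennreal_mult''[symmetric]) (rule mult_nonneg_nonneg[OF W g(2)])
        ultimately show ?thesis by (simp only:)
      qed
      moreover have "4 * ennreal N * ennreal T = ennreal (4 * N * T)"
        by (simp only: numeral_mult_ennreal[OF N(2)] ennreal_mult''[OF T(2)])
      moreover have "0 \<le> ?c * (?W * g)" by (intro mult_nonneg_nonneg divide_nonneg_pos) (use W g d in auto)
      moreover have "0 \<le> 4 * N * T" using N T by simp
      ultimately show ?thesis by (metis ennreal_plus)
    qed
    finally have le: "frac_energy (s n) (Phi V) \<le> ennreal (?c * (?W * g) + 4 * N * T)" .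
    have "ennreal (1 - s n) * (ennreal (1/2) * frac_energy (s n) (Phi V))
      \<le> ennreal (a n) * (ennreal (1/2) * ennreal (?c * (?W * g) + 4 * N * T))"
      unfolding a_def[symmetric] by (intro mult_left_mono le) auto
    also have "\<dots> = ennreal (a n * ((1/2) * (?c * (?W * g) + 4 * N * T)))"
    proof -
      let ?y = "?c * (?W * g) + 4 * N * T"
      have y: "0 \<le> ?y" by (intro add_nonneg_nonneg mult_nonneg_nonneg divide_nonneg_pos) (use W g d N T in auto)
      have "ennreal (1/2) * ennreal ?y = ennreal ((1/2) * ?y)" by (rule ennreal_mult''[OF y, symmetric])
      moreover have "ennreal (a n) * ennreal ((1/2) * ?y) = ennreal (a n * ((1/2) * ?y))"
        by (rule ennreal_mult'[symmetric]) (use a[of n] in simp)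
      ultimately show ?thesis by (simp only:)
    qed
    also have "a n * ((1/2) * (?c * (?W * g) + 4 * N * T)) = b n"
      using a[of n] d by (simp add: b_def field_simps)
    finally show ?case .
  qed
  have "limsup (\<lambda>n. ennreal (1 - s n) * (ennreal (1/2) * frac_energy (s n) (Phi V))) \<le> limsup (\<lambda>n. ennreal (b n))"
    by (rule Limsup_mono[OF ev])
  also have "\<dots> = ennreal (unit_ball_vol DIM('a) / 4 * g)" by (rule lim_imp_Limsup[OF _ bl]) simp
  also have "\<dots> = ennreal (unit_ball_vol DIM('a) / 4) * nsq G" by (simp only: g(1) ennreal_mult''[OF g(2)])
  finally show ?thesis .
qed

text \<open>At a fixed radius \<open>shell_energy_lower\<close> bounds I(r) for \<open>U n\<close>
  by \<open>c n\<close> times the energy. The factor r^(2 - 2 s n) in \<open>c n\<close> tends to 1,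
  so the limit 2 ln 4 does not depend on r. Fatou's lemma on the shell passes to V.\<close>

lemma shell_int_le_energy_limit:
  fixes U :: "nat \<Rightarrow> 'a::euclidean_space \<Rightarrow> real"
  assumes Um [measurable]: "\<And>n. U n \<in> borel_measurable borel" and Vm [measurable]: "V \<in> borel_measurable borel"
    and fin: "nsq V < \<infinity>" and lim: "(\<lambda>n. nsq (\<lambda>x. U n x - V x)) \<longlonglongrightarrow> 0"
    and s: "\<And>n. 0 < s n \<and> s n < 1" "s \<longlonglongrightarrow> 1" and r: "r > 0"
    and E: "(\<lambda>n. ennreal (1 - s n) * (ennreal (1/2) * frac_energy (s n) (Phi (U n)))) \<longlonglongrightarrow> L" and L: "L < \<infinity>"
  shows "shell_int (Phi V) r \<le> ennreal (2 * ln 4) * L"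
proof -
  define a where "a n = 1 - s n" for n
  have a: "a n > 0" for n using s(1)[of n] by (simp add: a_def)
  have al: "a \<longlonglongrightarrow> 0" unfolding a_def using tendsto_diff[OF tendsto_const s(2), of 1] by simp
  let ?E = "\<lambda>n. ennreal (1 - s n) * (ennreal (1/2) * frac_energy (s n) (Phi (U n)))"
  define c where "c n = 2 * ((4 powr a n - 1) / a n) * inverse (r powr (2 * a n))" for n
  have "c \<longlonglongrightarrow> 2 * ln 4 * inverse (r powr (2 * 0))"
    unfolding c_def using r by (intro tendsto_intros al four_powr_quotient_tendsto[OF al a]) auto
  then have "(\<lambda>n. ennreal (c n)) \<longlonglongrightarrow> ennreal (2 * ln 4)" using r by (intro tendsto_ennrealI) simp
  then have cE: "(\<lambda>n. ennreal (c n) * ?E n) \<longlonglongrightarrow> ennreal (2 * ln 4) * L"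
    by (rule tendsto_mult_ennreal[OF _ E]) (use L in auto)
  have le: "shell_int (Phi (U n)) r \<le> ennreal (c n) * ?E n" for n
  proof -
    have d: "4 powr a n - 1 > 0" using a[of n] by simp
    let ?k = "r powr (2 * a n) / (4 powr a n - 1)"
    have k: "?k > 0" using d r by simp
    have low: "ennreal ?k * shell_int (Phi (U n)) r \<le> frac_energy (s n) (Phi (U n))"
      using shell_energy_lower[OF measurable_Phi[OF Um] Phi_double[OF Um], of "s n" r n] s(1)[of n] r
      by (simp add: a_def right_diff_distrib)
    have "ennreal (1 / ?k) * ennreal ?k = 1"
    proof -
      have "ennreal (1 / ?k) * ennreal ?k = ennreal (1 / ?k * ?k)" by (rule ennreal_mult''[symmetric, OF less_imp_le[OF k]])
      also have "1 / ?k * ?k = 1" using k by (metis less_numeral_extra(3) nonzero_eq_divide_eq)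
      finally show ?thesis by simp
    qed
    then have "shell_int (Phi (U n)) r = ennreal (1 / ?k) * (ennreal ?k * shell_int (Phi (U n)) r)"
      by (simp only: mult.assoc[symmetric] mult_1)
    also have "\<dots> \<le> ennreal (1 / ?k) * frac_energy (s n) (Phi (U n))" by (rule mult_left_mono[OF low]) simp
    also have "1 / ?k = c n * a n * (1/2)" using a[of n] r d by (simp add: c_def field_simps)
    also have "ennreal (c n * a n * (1/2)) = ennreal (c n) * ennreal (a n) * ennreal (1/2)"
    proof -
      have "ennreal (c n * a n * (1/2)) = ennreal (c n * a n) * ennreal (1/2)" by (rule ennreal_mult'') simp
      also have "ennreal (c n * a n) = ennreal (c n) * ennreal (a n)" by (rule ennreal_mult'') (use a[of n] in simp)
      finally show ?thesis .
    qed
    finally show ?thesis by (simp add: a_def mult.assoc)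
  qed
  have "shell_int (Phi V) r = (\<integral>\<^sup>+h. liminf (\<lambda>n. indicator (shell r) h * (Phi (U n) h * ennreal (norm h powr - (real DIM('a) + 2)))) \<partial>lborel)"
    unfolding shell_int_def
  proof (rule nn_integral_cong)
    fix h :: 'a
    have "(\<lambda>n. (indicator (shell r) h * ennreal (norm h powr - (real DIM('a) + 2))) * Phi (U n) h)
       \<longlonglongrightarrow> (indicator (shell r) h * ennreal (norm h powr - (real DIM('a) + 2))) * Phi V h"
      by (rule ennreal_tendsto_cmult[OF _ Phi_tendsto[OF Um Vm fin lim]]) (auto simp: indicator_def)
    then have "(\<lambda>n. indicator (shell r) h * (Phi (U n) h * ennreal (norm h powr - (real DIM('a) + 2))))
       \<longlonglongrightarrow> indicator (shell r) h * (Phi V h * ennreal (norm h powr - (real DIM('a) + 2)))"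
      by (simp only: mult_ac)
    from lim_imp_Liminf[OF _ this]
    show "indicator (shell r) h * (Phi V h * ennreal (norm h powr - (real DIM('a) + 2)))
      = liminf (\<lambda>n. indicator (shell r) h * (Phi (U n) h * ennreal (norm h powr - (real DIM('a) + 2))))" by simp
  qed
  also have "\<dots> \<le> liminf (\<lambda>n. shell_int (Phi (U n)) r)"
    unfolding shell_int_def by (rule nn_integral_liminf) measurable
  also have "\<dots> \<le> liminf (\<lambda>n. ennreal (c n) * ?E n)"
    by (rule Liminf_mono) (rule always_eventually, rule allI, rule le)
  also have "\<dots> = ennreal (2 * ln 4) * L" by (rule lim_imp_Liminf[OF _ cE]) simp
  finally show ?thesis .
qed

lemma F1_H10:
  assumes O: "open \<Omega>" and v: "v \<in> H10 \<Omega>" and G: "rep \<Omega> (weak_gradient \<Omega> v) G" "nsq G < \<infinity>"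
  shows "F1 \<Omega> (v :: 'a::euclidean_space \<Rightarrow> real) = ennreal (unit_ball_vol DIM('a) / 4) * nsq G"
proof -
  have m: "measure lebesgue (ball (0::'a) 1) = unit_ball_vol DIM('a)"
    using content_ball[of 1 "0::'a"] by simp
  let ?X = "\<integral>x. (norm (weak_gradient \<Omega> v x))\<^sup>2 \<partial>lebesgue_on \<Omega>"
  have "?X \<ge> 0" by (rule integral_nonneg_AE) auto
  moreover have "F1 \<Omega> v = ennreal (unit_ball_vol DIM('a) / 4 * ?X)" using v by (simp only: F1_def if_True m)
  ultimately have "F1 \<Omega> v = ennreal (unit_ball_vol DIM('a) / 4) * ennreal ?X" by (simp only:) (rule ennreal_mult, auto)
  then show ?thesis by (simp only: rep_integral_eq_nsq[OF O G])
qed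

section \<open>Gamma-convergence\<close>

lemma frac_compactness:
  fixes u :: "nat \<Rightarrow> 'a::euclidean_space \<Rightarrow> real"
  assumes O: "open \<Omega>" "bounded \<Omega>" "lipschitz_boundary \<Omega>"
    and s: "\<And>n. 0 < s n \<and> s n < 1" "s \<longlonglongrightarrow> 1"
    and u: "\<And>n. u n \<in> L2 \<Omega>" and M: "M < \<infinity>"
    and bd: "\<And>n. ennreal (1 - s n) * Fs \<Omega> (s n) (u n) + ennreal ((L2_norm \<Omega> (u n))\<^sup>2) \<le> M"
  shows "\<exists>r v. strict_mono (r :: nat \<Rightarrow> nat) \<and> v \<in> H10 \<Omega> \<and> (\<lambda>n. L2_norm \<Omega> (\<lambda>x. u (r n) x - v x)) \<longlonglongrightarrow> 0"
proof -
  obtain m where m: "M = ennreal m" "m \<ge> 0" using M by (cases M) auto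
  have "\<exists>U. rep \<Omega> (u n) U" for n using rep_exists[OF O(1)] u[of n] by (auto simp: L2_def)
  then obtain U where U: "\<And>n. rep \<Omega> (u n) (U n)" by metis
  have Um [measurable]: "U n \<in> borel_measurable borel" for n by (rule rep_measurable[OF U])
  have Ufin: "nsq (U n) < \<infinity>" for n using rep_L2_iff[OF O(1) U] u by simp
  have UM: "nsq (U n) \<le> ennreal m" for n
  proof -
    have "nsq (U n) \<le> ennreal (1 - s n) * Fs \<Omega> (s n) (u n) + ennreal ((L2_norm \<Omega> (u n))\<^sup>2)"
      using rep_L2_norm[OF O(1) U Ufin] by simp
    then show ?thesis using bd[of n] m by simp
  qed
  define k where "k = 96 * 4 ^ DIM('a) / unit_ball_vol DIM('a)"
  have k: "k > 0" by (simp add: k_def)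
  have PhiB: "Phi (U n) h \<le> ennreal (2 * k * m * norm h powr (2 * s n))" for n h
  proof -
    have e: "ennreal (1 - s n) * frac_energy (s n) (Phi (U n)) \<le> 2 * M"
    proof -
      have "frac_energy (s n) (Phi (U n)) = 2 * Fs \<Omega> (s n) (u n)"
      proof -
        have "2 * ennreal (1/2) = ennreal (2 * (1/2))" by (rule numeral_mult_ennreal) simp
        also have "\<dots> = 1" by simp
        finally have "2 * ennreal (1/2) = 1" .
        then show ?thesis by (simp only: Fs_eq_frac_energy[OF U] mult.assoc[symmetric] mult_1)
      qed
      then have "ennreal (1 - s n) * frac_energy (s n) (Phi (U n)) = 2 * (ennreal (1 - s n) * Fs \<Omega> (s n) (u n))"
        by (simp only: mult.left_commute)
      also have "\<dots> \<le> 2 * (ennreal (1 - s n) * Fs \<Omega> (s n) (u n) + ennreal ((L2_norm \<Omega> (u n))\<^sup>2))"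
        by (rule mult_left_mono) auto
      also have "\<dots> \<le> 2 * M" by (rule mult_left_mono[OF bd]) simp
      finally show ?thesis .
    qed
    have "Phi (U n) h \<le> ennreal (k * norm h powr (2 * s n)) * (ennreal (1 - s n) * frac_energy (s n) (Phi (U n)))"
      unfolding k_def by (rule Phi_le_frac_energy[OF Um]) (use s(1)[of n] in auto)
    also have "\<dots> \<le> ennreal (k * norm h powr (2 * s n)) * (2 * M)" by (rule mult_left_mono[OF e]) simp
    also have "\<dots> = ennreal (k * norm h powr (2 * s n)) * ennreal (2 * m)" by (simp only: m numeral_mult_ennreal[OF m(2)])
    also have "\<dots> = ennreal (k * norm h powr (2 * s n) * (2 * m))" by (rule ennreal_mult''[symmetric]) (use m in simp)
    finally show ?thesis by (simp add: mult_ac)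
  qed
  \<comment> \<open>From an index N on, 2 s n > 1 and so |h|^(2 s n) <= |h| for |h| < 1: a modulus
    common to all n. The sequence is therefore shifted by N.\<close>
  have "eventually (\<lambda>n. s n > 1/2) sequentially" using order_tendstoD(1)[OF s(2), of "1/2"] by simp
  then obtain N where N: "\<And>n. n \<ge> N \<Longrightarrow> s n > 1/2" by (auto simp: eventually_sequentially)
  let ?K = "2 * k * m + 1"
  have K: "?K > 0" using k m(2) by (simp add: add_nonneg_pos)
  have "\<exists>r V. strict_mono r \<and> V \<in> borel_measurable borel \<and> (\<forall>x. x \<notin> \<Omega> \<longrightarrow> V x = 0)
     \<and> (\<lambda>n. nsq (\<lambda>x. U (r n + N) x - V x)) \<longlonglongrightarrow> 0"
  proof (rule frechet_kolmogorov[OF O(1,2), of "\<lambda>n. U (n + N)" m])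
    fix e :: real assume e: "e > 0"
    show "\<exists>d>0. \<forall>n h. norm h < d \<longrightarrow> Phi (U (n + N)) h \<le> ennreal e"
    proof (intro exI[of _ "min 1 (e / ?K)"] conjI allI impI)
      show "0 < min 1 (e / ?K)" using e K by simp
      fix n and h :: 'a assume h: "norm h < min 1 (e / ?K)"
      have "norm h powr (2 * s (n + N)) \<le> norm h powr 1"
        using h N[of "n + N"] by (intro powr_mono') auto
      then have "2 * k * m * norm h powr (2 * s (n + N)) \<le> ?K * norm h"
        using k m(2) by (intro mult_mono) auto
      also have "\<dots> \<le> e" using h K by (simp add: less_divide_eq mult.commute)
      finally show "Phi (U (n + N)) h \<le> ennreal e" using PhiB ennreal_leI order_trans by blast
    qed
  qed (use rep_outside[OF U] m UM in auto)
  then obtain r V where r: "strict_mono r" and Vm [measurable]: "V \<in> borel_measurable borel"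
    and V0: "\<And>x. x \<notin> \<Omega> \<Longrightarrow> V x = 0" and lV: "(\<lambda>n. nsq (\<lambda>x. U (r n + N) x - V x)) \<longlonglongrightarrow> 0" by blast
  have rV: "rep \<Omega> V V" by (rule rep_self[OF Vm V0])
  have Vfin: "nsq V < \<infinity>" by (rule nsq_limit_finite[OF Um Vm Ufin lV])
  let ?r = "\<lambda>n. r n + N"
  have sm: "strict_mono ?r" using r by (simp add: strict_mono_def)
  \<comment> \<open>For fixed h the exponent 2 s tends to 2, so V inherits the quadratic bound that
    places it in H^1_0.\<close>
  have "Phi V h \<le> ennreal (2 * k * m * (norm h)\<^sup>2)" for h
  proof (cases "h = 0")
    case True
    then show ?thesis by (simp add: Phi_def)
  next
    case False
    have 1: "(\<lambda>n. Phi (U (?r n)) h) \<longlonglongrightarrow> Phi V h" by (rule Phi_tendsto[OF Um Vm Vfin lV])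
    have "(\<lambda>n. s (?r n)) \<longlonglongrightarrow> 1" using LIMSEQ_subseq_LIMSEQ[OF s(2) sm] by (simp add: o_def)
    then have "(\<lambda>n. 2 * k * m * norm h powr (2 * s (?r n))) \<longlonglongrightarrow> 2 * k * m * norm h powr (2 * 1)"
      using False by (intro tendsto_intros) auto
    then have 2: "(\<lambda>n. ennreal (2 * k * m * norm h powr (2 * s (?r n)))) \<longlonglongrightarrow> ennreal (2 * k * m * (norm h)\<^sup>2)"
      using False by (intro tendsto_ennrealI) (simp add: powr_numeral)
    show ?thesis by (rule LIMSEQ_le[OF 1 2]) (use PhiB in auto)
  qed
  then have "V \<in> H10 \<Omega>" by (rule H10_of_Phi_bound[OF O rV Vfin, of "2 * k * m", rotated]) (use k m(2) in auto)
  moreover have "(\<lambda>n. L2_norm \<Omega> (\<lambda>x. u (?r n) x - V x)) \<longlonglongrightarrow> 0"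
  proof (rule iffD2[OF rep_L2_norm_tendsto[OF O(1) rep_diff[OF U rV]] lV])
    show "nsq (\<lambda>x. U (?r n) x - V x) < \<infinity>" for n
      by (rule le_less_trans[OF nsq_diff[OF Um Vm]])
        (use ennreal_numeral_mult_finite[OF Ufin] ennreal_numeral_mult_finite[OF Vfin] in simp)
  qed
  ultimately show ?thesis using sm by blast
qed

text \<open>A finite liminf L is attained along a subsequence, and
  \<open>shell_int_le_energy_limit\<close> then bounds I(\<rho>) of the limit function by 2 ln 4
  times L for every \<rho>. The bound is used twice: at \<rho> = |h|/2 it forces v into H^1_0, and
  along \<rho> = 2^(-k) it controls the Dirichlet integral.\<close>

lemma frac_liminf:
  fixes v :: "'a::euclidean_space \<Rightarrow> real"
  assumes O: "open \<Omega>" "bounded \<Omega>" "lipschitz_boundary \<Omega>"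
    and s: "\<And>n. 0 < s n \<and> s n < 1" "s \<longlonglongrightarrow> 1"
    and v: "v \<in> L2 \<Omega>" and u: "\<And>n. u n \<in> L2 \<Omega>" and lim: "(\<lambda>n. L2_norm \<Omega> (\<lambda>x. u n x - v x)) \<longlonglongrightarrow> 0"
  shows "F1 \<Omega> v \<le> liminf (\<lambda>n. ennreal (1 - s n) * Fs \<Omega> (s n) (u n))"
proof (cases "liminf (\<lambda>n. ennreal (1 - s n) * Fs \<Omega> (s n) (u n)) < \<infinity>")
  case False
  then have "liminf (\<lambda>n. ennreal (1 - s n) * Fs \<Omega> (s n) (u n)) = \<infinity>" by (simp add: not_less top_unique)
  then show ?thesis by simp
next
  case True
  define L where "L = liminf (\<lambda>n. ennreal (1 - s n) * Fs \<Omega> (s n) (u n))"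
  have L: "L < \<infinity>" using True by (simp add: L_def)
  obtain r where r: "strict_mono r" and rl: "((\<lambda>n. ennreal (1 - s n) * Fs \<Omega> (s n) (u n)) \<circ> r) \<longlonglongrightarrow> L"
    unfolding L_def using liminf_subseq_lim by blast
  have "\<exists>U. rep \<Omega> (u n) U" for n using rep_exists[OF O(1)] u[of n] by (auto simp: L2_def)
  then obtain U where U: "\<And>n. rep \<Omega> (u n) (U n)" by metis
  obtain V where V: "rep \<Omega> v V" using rep_exists[OF O(1)] v by (auto simp: L2_def)
  have Um [measurable]: "U n \<in> borel_measurable borel" for n by (rule rep_measurable[OF U])
  have Vm [measurable]: "V \<in> borel_measurable borel" by (rule rep_measurable[OF V])
  have Ufin: "nsq (U n) < \<infinity>" for n using rep_L2_iff[OF O(1) U] u by simp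
  have Vfin: "nsq V < \<infinity>" using rep_L2_iff[OF O(1) V] v by simp
  have dfin: "nsq (\<lambda>x. U n x - V x) < \<infinity>" for n
    by (rule le_less_trans[OF nsq_diff[OF Um Vm]])
      (use ennreal_numeral_mult_finite[OF Ufin] ennreal_numeral_mult_finite[OF Vfin] in simp)
  have lV: "(\<lambda>n. nsq (\<lambda>x. U n x - V x)) \<longlonglongrightarrow> 0"
    by (rule iffD1[OF rep_L2_norm_tendsto[OF O(1) rep_diff[OF U V] dfin] lim])
  have lVr: "(\<lambda>n. nsq (\<lambda>x. U (r n) x - V x)) \<longlonglongrightarrow> 0"
    using LIMSEQ_subseq_LIMSEQ[OF lV r] by (simp add: o_def)
  have sr: "(\<lambda>n. s (r n)) \<longlonglongrightarrow> 1" using LIMSEQ_subseq_LIMSEQ[OF s(2) r] by (simp add: o_def)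
  have E: "(\<lambda>n. ennreal (1 - s (r n)) * (ennreal (1/2) * frac_energy (s (r n)) (Phi (U (r n))))) \<longlonglongrightarrow> L"
    using rl by (simp only: o_def Fs_eq_frac_energy[OF U])
  have I: "shell_int (Phi V) \<rho> \<le> ennreal (2 * ln 4) * L" if "\<rho> > 0" for \<rho>
    by (rule shell_int_le_energy_limit[OF Um Vm Vfin lVr s(1) sr that E L])
  obtain l where l: "L = ennreal l" "l \<ge> 0" using L by (cases L) auto
  define c where "c = 8 * 4 ^ DIM('a) / unit_ball_vol DIM('a)"
  have c: "c > 0" by (simp add: c_def)
  have l4: "(0::real) \<le> 2 * ln 4" by simp
  have "Phi V h \<le> ennreal ((c * (2 * ln 4 * l)) * (norm h)\<^sup>2)" for h
  proof (cases "h = 0")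
    case True
    then show ?thesis by (simp add: Phi_def)
  next
    case False
    have "Phi V h \<le> ennreal (c * (norm h)\<^sup>2) * shell_int (Phi V) (norm h / 2)"
      unfolding c_def by (rule pointwise_le_shell_int) (use False Phi_add[OF Vm] in auto)
    also have "\<dots> \<le> ennreal (c * (norm h)\<^sup>2) * (ennreal (2 * ln 4) * L)"
      by (rule mult_left_mono[OF I]) (use False in auto)
    also have "\<dots> = ennreal (c * (norm h)\<^sup>2) * ennreal (2 * ln 4 * l)" by (simp only: l(1) ennreal_mult''[OF l(2)])
    also have "\<dots> = ennreal (c * (norm h)\<^sup>2 * (2 * ln 4 * l))"
      by (rule ennreal_mult''[symmetric]) (rule mult_nonneg_nonneg[OF l4 l(2)])
    finally show ?thesis by (simp add: mult_ac)
  qed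
  then have vH: "v \<in> H10 \<Omega>"
    by (rule H10_of_Phi_bound[OF O V Vfin, of "c * (2 * ln 4 * l)", rotated]) (use c l4 l in auto)
  obtain G \<phi> where G: "rep \<Omega> (weak_gradient \<Omega> v) G" "nsq G < \<infinity>" and phi: "\<And>n. \<phi> n \<in> test_functions \<Omega>"
    and lp: "(\<lambda>n. nsq (\<lambda>x. V x - \<phi> n x)) \<longlonglongrightarrow> 0" and lG: "(\<lambda>n. nsq (\<lambda>x. G x - grad (\<phi> n) x)) \<longlonglongrightarrow> 0"
    using H10_approximation[OF O(1,2) vH V] by blast
  have Gm [measurable]: "G \<in> borel_measurable borel" by (rule rep_measurable[OF G(1)])
  \<comment> \<open>Rescaling the shell of radius 2^(-k) to the unit shell turns
    \<open>Phi V\<close> into 4^k Phi V (h/2^k), which converges to the squared directional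
    derivative; Fatou's lemma compares the integrals in the required direction.\<close>
  have "ennreal (unit_ball_vol DIM('a) * ln 2) * nsq G = shell_int (\<lambda>h. nsq (\<lambda>x. G x \<bullet> h)) 1"
    by (rule shell_int_directional[symmetric, OF Gm])
  also have "\<dots> = (\<integral>\<^sup>+h. liminf (\<lambda>k. indicator (shell 1) h * ((4^k * Phi V ((1/2)^k *\<^sub>R h)) * ennreal (norm h powr - (real DIM('a) + 2)))) \<partial>lborel)"
    unfolding shell_int_def
  proof (rule nn_integral_cong)
    fix h :: 'a
    have "(\<lambda>k. (indicator (shell 1) h * ennreal (norm h powr - (real DIM('a) + 2))) * (4^k * Phi V ((1/2)^k *\<^sub>R h)))
       \<longlonglongrightarrow> (indicator (shell 1) h * ennreal (norm h powr - (real DIM('a) + 2))) * nsq (\<lambda>x. G x \<bullet> h)"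
      by (rule ennreal_tendsto_cmult[OF _ Phi_dyadic_tendsto[OF Vm Gm Vfin G(2) phi lp lG]]) (auto simp: indicator_def)
    then have "(\<lambda>k. indicator (shell 1) h * ((4^k * Phi V ((1/2)^k *\<^sub>R h)) * ennreal (norm h powr - (real DIM('a) + 2))))
       \<longlonglongrightarrow> indicator (shell 1) h * (nsq (\<lambda>x. G x \<bullet> h) * ennreal (norm h powr - (real DIM('a) + 2)))"
      by (simp only: mult_ac)
    from lim_imp_Liminf[OF _ this]
    show "indicator (shell 1) h * (nsq (\<lambda>x. G x \<bullet> h) * ennreal (norm h powr - (real DIM('a) + 2)))
      = liminf (\<lambda>k. indicator (shell 1) h * ((4^k * Phi V ((1/2)^k *\<^sub>R h)) * ennreal (norm h powr - (real DIM('a) + 2))))" by simp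
  qed
  also have "\<dots> \<le> liminf (\<lambda>k. shell_int (\<lambda>h. 4^k * Phi V ((1/2)^k *\<^sub>R h)) 1)"
    unfolding shell_int_def by (rule nn_integral_liminf) measurable
  also have "\<dots> = liminf (\<lambda>k. shell_int (Phi V) ((1/2)^k))"
  proof -
    have "shell_int (Phi V) ((1/2)^k) = shell_int (\<lambda>h. 4^k * Phi V ((1/2)^k *\<^sub>R h)) 1" for k
    proof -
      have "ennreal (1 / ((1/2)^k)\<^sup>2) = 4^k"
        by (simp add: ennreal_power[symmetric] power_one_over power2_eq_square power_mult_distrib[symmetric])
      then show ?thesis using shell_int_scale[OF measurable_Phi[OF Vm], of "(1/2)^k" 1] by simp
    qed
    then show ?thesis by simp
  qed
  also have "\<dots> \<le> ennreal (2 * ln 4) * L"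
  proof -
    have "liminf (\<lambda>k. shell_int (Phi V) ((1/2)^k)) \<le> liminf (\<lambda>k::nat. ennreal (2 * ln 4) * L)"
      by (intro Liminf_mono always_eventually allI I) simp
    then show ?thesis by (simp add: Liminf_const)
  qed
  finally have main: "ennreal (unit_ball_vol DIM('a) * ln 2) * nsq G \<le> ennreal (2 * ln 4) * L" .
  obtain g where g: "nsq G = ennreal g" "g \<ge> 0" using G(2) by (cases "nsq G") auto
  have "ennreal (unit_ball_vol DIM('a) * ln 2 * g) \<le> ennreal (2 * ln 4 * l)"
    using main by (simp only: g(1) l(1) ennreal_mult''[OF g(2)] ennreal_mult''[OF l(2)])
  then have "unit_ball_vol DIM('a) * ln 2 * g \<le> 2 * ln 4 * l"
    by (subst (asm) ennreal_le_iff) (rule mult_nonneg_nonneg[OF l4 l(2)])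
  \<comment> \<open>Since ln 4 = 2 ln 2, the common factor ln 2 cancels and leaves the 4 in the
    denominator of F^1.\<close>
  then have "ln 2 * (unit_ball_vol DIM('a) * g) \<le> ln 2 * (4 * l)" by (simp add: ln_four mult_ac)
  then have "unit_ball_vol DIM('a) / 4 * g \<le> l" by (simp add: mult_le_cancel_left_pos)
  then have "ennreal (unit_ball_vol DIM('a) / 4 * g) \<le> L" unfolding l(1) by (rule ennreal_leI)
  then have "F1 \<Omega> v \<le> L" by (simp only: F1_H10[OF O(1) vH G] g(1) ennreal_mult''[OF g(2)])
  then show ?thesis by (simp add: L_def)
qed

lemma frac_recovery:
  fixes v :: "'a::euclidean_space \<Rightarrow> real"
  assumes O: "open \<Omega>" "bounded \<Omega>" "lipschitz_boundary \<Omega>"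
    and s: "\<And>n. 0 < s n \<and> s n < 1" "s \<longlonglongrightarrow> 1" and v: "v \<in> L2 \<Omega>"
  shows "(\<lambda>n. ennreal (1 - s n) * Fs \<Omega> (s n) v) \<longlonglongrightarrow> F1 \<Omega> v"
proof -
  let ?E = "\<lambda>n. ennreal (1 - s n) * Fs \<Omega> (s n) v"
  \<comment> \<open>The constant sequence is admissible in the liminf inequality.\<close>
  have low: "F1 \<Omega> v \<le> liminf ?E"
    by (rule frac_liminf[OF O s v v]) (simp add: L2_norm_def)
  \<comment> \<open>Outside H^1_0 the right-hand side is infinite, and the lower bound alone then
    drives the energies to infinity.\<close>
  have up: "limsup ?E \<le> F1 \<Omega> v"
  proof (cases "v \<in> H10 \<Omega>")
    case True
    obtain V where V: "rep \<Omega> v V" using rep_exists[OF O(1)] v by (auto simp: L2_def)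
    have Vm: "V \<in> borel_measurable borel" by (rule rep_measurable[OF V])
    have Vfin: "nsq V < \<infinity>" using rep_L2_iff[OF O(1) V] v by simp
    obtain G \<phi> where G: "rep \<Omega> (weak_gradient \<Omega> v) G" "nsq G < \<infinity>" and phi: "\<And>n. \<phi> n \<in> test_functions \<Omega>"
      and lp: "(\<lambda>n. nsq (\<lambda>x. V x - \<phi> n x)) \<longlonglongrightarrow> 0" and lG: "(\<lambda>n. nsq (\<lambda>x. G x - grad (\<phi> n) x)) \<longlonglongrightarrow> 0"
      using H10_approximation[OF O(1,2) True V] by blast
    have Gm: "G \<in> borel_measurable borel" by (rule rep_measurable[OF G(1)])
    have dir: "Phi V h \<le> nsq (\<lambda>x. G x \<bullet> h)" for h
      by (rule Phi_le_directional[OF Vm Gm Vfin G(2) test_smooth_compact[OF phi] lp lG])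
    show ?thesis unfolding F1_H10[OF O(1) True G] Fs_eq_frac_energy[OF V]
      by (rule energy_limsup[OF Vm Gm Vfin G(2) dir s])
  qed (simp add: F1_def)
  have "liminf ?E \<le> limsup ?E" by (rule Liminf_le_Limsup) simp
  then have "liminf ?E = F1 \<Omega> v" "limsup ?E = F1 \<Omega> v" using low up by (auto intro: antisym order_trans)
  then show ?thesis by (simp add: tendsto_iff_Liminf_eq_Limsup)
qed

theorem theorem2p1:
  fixes \<Omega> :: "'a::euclidean_space set" and s :: "nat \<Rightarrow> real"
  assumes "open \<Omega>" and "bounded \<Omega>" and "lipschitz_boundary \<Omega>"
    and "\<And>n. 0 < s n \<and> s n < 1" and "s \<longlonglongrightarrow> 1"
  shows
    "(\<forall>(u :: nat \<Rightarrow> 'a \<Rightarrow> real) (M :: ennreal).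
        (\<forall>n. u n \<in> L2 \<Omega>) \<and> M < \<infinity> \<and>
        (SUP n. ennreal (1 - s n) * Fs \<Omega> (s n) (u n) + ennreal ((L2_norm \<Omega> (u n))\<^sup>2)) \<le> M \<longrightarrow>
        (\<exists>(r :: nat \<Rightarrow> nat) v. strict_mono r \<and> v \<in> H10 \<Omega> \<and>
           (\<lambda>n. L2_norm \<Omega> (\<lambda>x. u (r n) x - v x)) \<longlonglongrightarrow> 0)) \<and>
     (\<forall>v \<in> L2 \<Omega>. \<forall>u :: nat \<Rightarrow> 'a \<Rightarrow> real.
        (\<forall>n. u n \<in> L2 \<Omega>) \<and> (\<lambda>n. L2_norm \<Omega> (\<lambda>x. u n x - v x)) \<longlonglongrightarrow> 0 \<longrightarrow>
        F1 \<Omega> v \<le> liminf (\<lambda>n. ennreal (1 - s n) * Fs \<Omega> (s n) (u n))) \<and>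
     (\<forall>v \<in> L2 \<Omega>. \<exists>u :: nat \<Rightarrow> 'a \<Rightarrow> real.
        (\<forall>n. u n \<in> L2 \<Omega>) \<and> (\<lambda>n. L2_norm \<Omega> (\<lambda>x. u n x - v x)) \<longlonglongrightarrow> 0 \<and>
        (\<lambda>n. ennreal (1 - s n) * Fs \<Omega> (s n) (u n)) \<longlonglongrightarrow> F1 \<Omega> v)"
proof (intro conjI ballI allI impI)
  fix u :: "nat \<Rightarrow> 'a \<Rightarrow> real" and M :: ennreal
  assume *: "(\<forall>n. u n \<in> L2 \<Omega>) \<and> M < \<infinity> \<and>
        (SUP n. ennreal (1 - s n) * Fs \<Omega> (s n) (u n) + ennreal ((L2_norm \<Omega> (u n))\<^sup>2)) \<le> M"
  then have "ennreal (1 - s n) * Fs \<Omega> (s n) (u n) + ennreal ((L2_norm \<Omega> (u n))\<^sup>2) \<le> M" for n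
    by (simp add: SUP_le_iff)
  with * show "\<exists>(r :: nat \<Rightarrow> nat) v. strict_mono r \<and> v \<in> H10 \<Omega> \<and>
           (\<lambda>n. L2_norm \<Omega> (\<lambda>x. u (r n) x - v x)) \<longlonglongrightarrow> 0"
    by (intro frac_compactness[OF assms]) auto
next
  fix v :: "'a \<Rightarrow> real" and u :: "nat \<Rightarrow> 'a \<Rightarrow> real"
  assume "v \<in> L2 \<Omega>" "(\<forall>n. u n \<in> L2 \<Omega>) \<and> (\<lambda>n. L2_norm \<Omega> (\<lambda>x. u n x - v x)) \<longlonglongrightarrow> 0"
  then show "F1 \<Omega> v \<le> liminf (\<lambda>n. ennreal (1 - s n) * Fs \<Omega> (s n) (u n))"
    by (intro frac_liminf[OF assms]) auto
next
  fix v :: "'a \<Rightarrow> real" assume v: "v \<in> L2 \<Omega>"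
  show "\<exists>u :: nat \<Rightarrow> 'a \<Rightarrow> real.
        (\<forall>n. u n \<in> L2 \<Omega>) \<and> (\<lambda>n. L2_norm \<Omega> (\<lambda>x. u n x - v x)) \<longlonglongrightarrow> 0 \<and>
        (\<lambda>n. ennreal (1 - s n) * Fs \<Omega> (s n) (u n)) \<longlonglongrightarrow> F1 \<Omega> v"
    using v frac_recovery[OF assms v] by (intro exI[of _ "\<lambda>n. v"]) (simp add: L2_norm_def)
qed

end
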